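(* Let $A$ be a finite abelian group, let $k$ be a field and $S=\operatorname{spec}(k)$. Then every $A$-equivariant formal group $(C,\phi)$ over $S$ is of product type.
   Context: All rings are commutative with unit. $S=\operatorname{spec}(k)$, $\mathcal{O}_S=k$. A formal ring is a complete Hausdorff linearly topologised ring $R$; $\operatorname{spf}(R)=\operatorname{colim}_J\operatorname{spec}(R/J)$ ($J$ running over open ideals), and $\mathcal{O}_X=R$ for $X=\operatorname{spf}(R)$. A closed subscheme $\operatorname{spf}(R/J)$ of $\operatorname{spf}(R)$ is a regular hypersurface if $J$ is generated by a single regular element. A formal multicurve over $S$ is a formal scheme $C=\operatorname{spf}(R)$ over $S$ such that (i) there is a regular element $y\in R$ such that for all $m\geq 0$ the ideal $Ry^m$ is open, $R/y^m$ is a finitely generated free $k$-module, and $R=\varprojlim_m R/y^m$; (ii) the diagonal in $C\times_SC$ is a regular hypersurface. A formal multicurve group is a formal multicurve over $S$ with a commutative group structure over $S$. A divisor on $C$ is a closed subscheme $\operatorname{spec}(\mathcal{O}_C/J)$ with $J$ an open ideal generated by one regular element and $\mathcal{O}_C/J$ finitely generated projective over $\mathcal{O}_S$; sums of divisors correspond to products of ideals; the image of a section $u\colon S\to C$ is a divisor $[u]$. Put $A^*=\operatorname{Hom}(A,\mathbb{Q}/\mathbb{Z})$. An $A$-equivariant formal group over $S$ is a formal multicurve group $C$ over $S$ with a homomorphism $\phi\colon A^*\times S\to C$ of group schemes over $S$ such that $C$ is the formal neighbourhood of the divisor $\sum_{\alpha\in A^*}[\phi(\alpha)]$, i.e. if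 $J$ is the ideal of this divisor then $\mathcal{O}_C=\varprojlim_m\mathcal{O}_C/J^m$ as topological rings. An $A$-equivariant formal group $(C,\phi)$ over $S$ is of product type if there are a subgroup $B\leq A$ and an ordinary (nonequivariant) one-dimensional commutative formal group $\widehat{C}$ over $S$ (so $\widehat{C}\cong\operatorname{spf}(k[[x]])$ as a formal scheme) such that $(C,\phi)$ is isomorphic to $B^*\times\widehat{C}=\coprod_{\beta\in B^*}\widehat{C}$ with $\phi$ the composite of the restriction $A^*\to B^*$ and the inclusion $B^*\to B^*\times\widehat{C}$, $\beta\mapsto(\beta,0)$. *)

theory Defs
  imports "HOL-Algebra.Algebra" "HOL-Analysis.Function_Topology" "HOL-Analysis.T1_Spaces"
begin

text \<open>
  Formal schemes \<open>spf(R)\<close> over \<open>S = spec(k)\<close> are represented by their coordinate rings: \<open>R\<close> is a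
  formal ring together with a structure map \<open>k \<rightarrow> R\<close>, where \<open>k\<close> is discrete.  Morphisms
  \<open>spf(R) \<rightarrow> spf(R')\<close> over \<open>S\<close> are continuous \<open>k\<close>-algebra homomorphisms \<open>R' \<rightarrow> R\<close>, and
  \<open>spf(R) \<times>\<^sub>S spf(R')\<close> is the formal spectrum of the completed tensor product of \<open>R\<close> and \<open>R'\<close> over \<open>k\<close>.
\<close>


section \<open>Formal rings and formal algebras\<close>

record ('k, 'r) formal_algebra = "'r ring" +
  struct_map :: "'k \<Rightarrow> 'r"
  topol :: "'r topology"

definition open_ideals :: "('k, 'r, 'm) formal_algebra_scheme \<Rightarrow> 'r set set" where
  "open_ideals R = {I. ideal I R \<and> openin (topol R) I}"

definition linearly_topologised :: "('k, 'r, 'm) formal_algebra_scheme \<Rightarrow> bool" where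
  "linearly_topologised R \<longleftrightarrow>
     topspace (topol R) = carrier R \<and>
     (\<forall>U. openin (topol R) U \<longleftrightarrow>
        U \<subseteq> carrier R \<and> (\<forall>x\<in>U. \<exists>I\<in>open_ideals R. I +>\<^bsub>R\<^esub> x \<subseteq> U))"

text \<open>
  Surjectivity of \<open>R \<rightarrow> lim R/I\<close>, with \<open>I\<close> running over the open ideals: a compatible family of
  cosets is given by representatives \<open>x I\<close>.
\<close>

definition complete_formal :: "('k, 'r, 'm) formal_algebra_scheme \<Rightarrow> bool" where
  "complete_formal R \<longleftrightarrow>
     (\<forall>x. (\<forall>I\<in>open_ideals R. x I \<in> carrier R) \<and>
          (\<forall>I\<in>open_ideals R. \<forall>J\<in>open_ideals R. I \<subseteq> J \<longrightarrow> x I \<ominus>\<^bsub>R\<^esub> x J \<in> J) \<longrightarrow>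
          (\<exists>z\<in>carrier R. \<forall>I\<in>open_ideals R. z \<ominus>\<^bsub>R\<^esub> x I \<in> I))"

definition formal_algebra :: "('k, 'c) ring_scheme \<Rightarrow> ('k, 'r, 'm) formal_algebra_scheme \<Rightarrow> bool" where
  "formal_algebra K R \<longleftrightarrow>
     cring K \<and> cring R \<and> struct_map R \<in> ring_hom K R \<and>
     linearly_topologised R \<and> Hausdorff_space (topol R) \<and> complete_formal R"

definition formal_hom ::
    "('k, 'c) ring_scheme \<Rightarrow> ('k, 'r, 'm) formal_algebra_scheme \<Rightarrow> ('k, 's, 'n) formal_algebra_scheme
      \<Rightarrow> ('r \<Rightarrow> 's) \<Rightarrow> bool" where
  "formal_hom K R T f \<longleftrightarrow>
     f \<in> ring_hom R T \<and> continuous_map (topol R) (topol T) f \<and>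
     (\<forall>c\<in>carrier K. f (struct_map R c) = struct_map T c)"

definition base_algebra :: "('k, 'c) ring_scheme \<Rightarrow> ('k, 'k) formal_algebra" where
  "base_algebra K =
     \<lparr>carrier = carrier K, monoid.mult = monoid.mult K, one = one K, ring.zero = ring.zero K, ring.add = ring.add K,
      struct_map = (\<lambda>c. c), topol = discrete_topology (carrier K)\<rparr>"


section \<open>Completed tensor products\<close>

text \<open>The monoid algebra \<open>K[M]\<close>: finitely supported functions on \<open>M\<close>, with convolution.\<close>

definition monoid_algebra :: "('k, 'c) ring_scheme \<Rightarrow> ('a, 'd) monoid_scheme \<Rightarrow> ('a \<Rightarrow> 'k) ring" where
  "monoid_algebra K M =
     \<lparr>carrier = {p. range p \<subseteq> carrier K \<and> {m. p m \<noteq> \<zero>\<^bsub>K\<^esub>} \<subseteq> carrier M \<and> finite {m. p m \<noteq> \<zero>\<^bsub>K\<^esub>}},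
      monoid.mult = (\<lambda>p q m. finsum K (\<lambda>(a, b). p a \<otimes>\<^bsub>K\<^esub> q b)
                {(a, b). p a \<noteq> \<zero>\<^bsub>K\<^esub> \<and> q b \<noteq> \<zero>\<^bsub>K\<^esub> \<and> a \<otimes>\<^bsub>M\<^esub> b = m}),
      one = (\<lambda>m. if m = \<one>\<^bsub>M\<^esub> then \<one>\<^bsub>K\<^esub> else \<zero>\<^bsub>K\<^esub>),
      ring.zero = (\<lambda>m. \<zero>\<^bsub>K\<^esub>),
      ring.add = (\<lambda>p q m. p m \<oplus>\<^bsub>K\<^esub> q m)\<rparr>"

definition single :: "('k, 'c) ring_scheme \<Rightarrow> 'a \<Rightarrow> 'k \<Rightarrow> 'a \<Rightarrow> 'k" where
  "single K m c = (\<lambda>m'. if m' = m then c else \<zero>\<^bsub>K\<^esub>)"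

text \<open>
  \<open>U \<otimes>\<^sub>K V\<close> is the quotient of the free \<open>K\<close>-module on the set \<open>U \<times> V\<close> by the submodule of bilinearity
  relations.  With respect to the product \<open>(x, y)(x', y') = (x x', y y')\<close> this submodule is an ideal,
  so it agrees with the ideal generated by the relations.
  Adding the generators \<open>i \<otimes> y\<close> and \<open>x \<otimes> j\<close> with \<open>i \<in> I\<close> and \<open>j \<in> J\<close>
  one obtains \<open>U/I \<otimes>\<^sub>K V/J\<close> as the quotient.
\<close>

abbreviation free_prod ::
    "('k, 'c) ring_scheme \<Rightarrow> ('x, 'm) monoid_scheme \<Rightarrow> ('y, 'n) monoid_scheme \<Rightarrow> ('x \<times> 'y \<Rightarrow> 'k) ring" where
  "free_prod K U V \<equiv> monoid_algebra K (U \<times>\<times> V)"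

definition tensor_relations ::
    "('k, 'c) ring_scheme \<Rightarrow> ('k, 'x, 'm) formal_algebra_scheme \<Rightarrow> ('k, 'y, 'n) formal_algebra_scheme
      \<Rightarrow> ('x \<times> 'y \<Rightarrow> 'k) set" where
  "tensor_relations K U V =
     (let e = (\<lambda>x y. single K (x, y) \<one>\<^bsub>K\<^esub>); P = free_prod K U V in
      {e (x \<oplus>\<^bsub>U\<^esub> x') y \<ominus>\<^bsub>P\<^esub> (e x y \<oplus>\<^bsub>P\<^esub> e x' y) | x x' y.
          x \<in> carrier U \<and> x' \<in> carrier U \<and> y \<in> carrier V} \<union>
      {e x (y \<oplus>\<^bsub>V\<^esub> y') \<ominus>\<^bsub>P\<^esub> (e x y \<oplus>\<^bsub>P\<^esub> e x y') | x y y'.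
          x \<in> carrier U \<and> y \<in> carrier V \<and> y' \<in> carrier V} \<union>
      {e (struct_map U c \<otimes>\<^bsub>U\<^esub> x) y \<ominus>\<^bsub>P\<^esub> single K (x, y) c | c x y.
          c \<in> carrier K \<and> x \<in> carrier U \<and> y \<in> carrier V} \<union>
      {e x (struct_map V c \<otimes>\<^bsub>V\<^esub> y) \<ominus>\<^bsub>P\<^esub> single K (x, y) c | c x y.
          c \<in> carrier K \<and> x \<in> carrier U \<and> y \<in> carrier V})"

definition tensor_ideal ::
    "('k, 'c) ring_scheme \<Rightarrow> ('k, 'x, 'm) formal_algebra_scheme \<Rightarrow> ('k, 'y, 'n) formal_algebra_scheme
      \<Rightarrow> 'x set \<Rightarrow> 'y set \<Rightarrow> ('x \<times> 'y \<Rightarrow> 'k) set" where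
  "tensor_ideal K U V I J =
     Idl\<^bsub>free_prod K U V\<^esub>
       (tensor_relations K U V \<union>
        {single K (x, y) \<one>\<^bsub>K\<^esub> | x y. x \<in> carrier U \<and> y \<in> carrier V \<and> (x \<in> I \<or> y \<in> J)})"

definition tensor_ideals ::
    "('k, 'c) ring_scheme \<Rightarrow> ('k, 'x, 'm) formal_algebra_scheme \<Rightarrow> ('k, 'y, 'n) formal_algebra_scheme
      \<Rightarrow> ('x \<times> 'y \<Rightarrow> 'k) set set" where
  "tensor_ideals K U V = {tensor_ideal K U V I J | I J. I \<in> open_ideals U \<and> J \<in> open_ideals V}"

text \<open>
  The completed tensor product is the limit of the discrete rings \<open>U/I \<otimes>\<^sub>K V/J\<close>.  Its elements are
  compatible families of cosets, indexed by the directed set of the ideals \<open>N\<close> above: for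
  \<open>N \<subseteq> N'\<close> the transition map sends a coset of \<open>N\<close> to the coset of \<open>N'\<close> that contains it.
\<close>

type_synonym ('k, 'x, 'y) ctensor = "('x \<times> 'y \<Rightarrow> 'k) set \<Rightarrow> ('x \<times> 'y \<Rightarrow> 'k) set"

definition ctensor_carrier ::
    "('k, 'c) ring_scheme \<Rightarrow> ('k, 'x, 'm) formal_algebra_scheme \<Rightarrow> ('k, 'y, 'n) formal_algebra_scheme
      \<Rightarrow> ('k, 'x, 'y) ctensor set" where
  "ctensor_carrier K U V =
     {w \<in> (\<Pi>\<^sub>E N\<in>tensor_ideals K U V. carrier (free_prod K U V Quot N)).
        \<forall>N\<in>tensor_ideals K U V. \<forall>N'\<in>tensor_ideals K U V. N \<subseteq> N' \<longrightarrow> w N \<subseteq> w N'}"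

definition ctensor ::
    "('k, 'c) ring_scheme \<Rightarrow> ('k, 'x, 'm) formal_algebra_scheme \<Rightarrow> ('k, 'y, 'n) formal_algebra_scheme
      \<Rightarrow> ('k, ('k, 'x, 'y) ctensor) formal_algebra" where
  "ctensor K U V =
     (let D = tensor_ideals K U V; P = free_prod K U V in
      \<lparr>carrier = ctensor_carrier K U V,
       monoid.mult = (\<lambda>v w. \<lambda>N\<in>D. v N \<otimes>\<^bsub>P Quot N\<^esub> w N),
       one = (\<lambda>N\<in>D. \<one>\<^bsub>P Quot N\<^esub>),
       ring.zero = (\<lambda>N\<in>D. \<zero>\<^bsub>P Quot N\<^esub>),
       ring.add = (\<lambda>v w. \<lambda>N\<in>D. v N \<oplus>\<^bsub>P Quot N\<^esub> w N),
       struct_map = (\<lambda>c. \<lambda>N\<in>D. N +>\<^bsub>P\<^esub> single K (\<one>\<^bsub>U\<^esub>, \<one>\<^bsub>V\<^esub>) c),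
       topol = subtopology (product_topology (\<lambda>N. discrete_topology (carrier (P Quot N))) D)
                 (ctensor_carrier K U V)\<rparr>)"

definition incl1 ::
    "('k, 'c) ring_scheme \<Rightarrow> ('k, 'x, 'm) formal_algebra_scheme \<Rightarrow> ('k, 'y, 'n) formal_algebra_scheme
      \<Rightarrow> 'x \<Rightarrow> ('k, 'x, 'y) ctensor" where
  "incl1 K U V x =
     (\<lambda>N\<in>tensor_ideals K U V. N +>\<^bsub>free_prod K U V\<^esub> single K (x, \<one>\<^bsub>V\<^esub>) \<one>\<^bsub>K\<^esub>)"

definition incl2 ::
    "('k, 'c) ring_scheme \<Rightarrow> ('k, 'x, 'm) formal_algebra_scheme \<Rightarrow> ('k, 'y, 'n) formal_algebra_scheme
      \<Rightarrow> 'y \<Rightarrow> ('k, 'x, 'y) ctensor" where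
  "incl2 K U V y =
     (\<lambda>N\<in>tensor_ideals K U V. N +>\<^bsub>free_prod K U V\<^esub> single K (\<one>\<^bsub>U\<^esub>, y) \<one>\<^bsub>K\<^esub>)"

text \<open>
  For continuous \<open>K\<close>-algebra maps \<open>f : U \<rightarrow> T\<close> and \<open>g : V \<rightarrow> T\<close> into a formal algebra \<open>T\<close>, \<open>copair\<close> is
  the unique continuous \<open>K\<close>-algebra map on the completed tensor product with
  \<open>x \<otimes> y \<mapsto> f x \<cdot> g y\<close>: it exists because \<open>T\<close> is complete, and is unique because \<open>T\<close> is Hausdorff and
  the sums of elements \<open>x \<otimes> y\<close> are dense.  Geometrically this is the morphism
  \<open>(f, g) : spf(T) \<rightarrow> spf(U) \<times>\<^sub>S spf(V)\<close>.
\<close>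

definition copair ::
    "('k, 'c) ring_scheme \<Rightarrow> ('k, 'x, 'm) formal_algebra_scheme \<Rightarrow> ('k, 'y, 'n) formal_algebra_scheme
      \<Rightarrow> ('k, 't, 'p) formal_algebra_scheme \<Rightarrow> ('x \<Rightarrow> 't) \<Rightarrow> ('y \<Rightarrow> 't)
      \<Rightarrow> ('k, 'x, 'y) ctensor \<Rightarrow> 't" where
  "copair K U V T f g =
     (THE h. h \<in> extensional (carrier (ctensor K U V)) \<and> formal_hom K (ctensor K U V) T h \<and>
        (\<forall>x\<in>carrier U. h (incl1 K U V x) = f x) \<and>
        (\<forall>y\<in>carrier V. h (incl2 K U V y) = g y))"


section \<open>Commutative group structures over the base\<close>

text \<open>
  A group structure on \<open>G = spf(R)\<close>: the addition \<open>G \<times>\<^sub>S G \<rightarrow> G\<close>, the zero section \<open>S \<rightarrow> G\<close> and the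
  inversion \<open>G \<rightarrow> G\<close>, all given by the corresponding maps of coordinate rings.
\<close>

record ('k, 'r) formal_group = "('k, 'r) formal_algebra" +
  comult :: "'r \<Rightarrow> ('k, 'r, 'r) ctensor"
  counit :: "'r \<Rightarrow> 'k"
  antipode :: "'r \<Rightarrow> 'r"

text \<open>The sum of two points \<open>f, g : spf(T) \<rightarrow> G\<close>, and the zero point of \<open>G\<close> over \<open>spf(T)\<close>.\<close>

definition point_add ::
    "('k, 'c) ring_scheme \<Rightarrow> ('k, 'r, 'm) formal_group_scheme \<Rightarrow> ('k, 't, 'n) formal_algebra_scheme
      \<Rightarrow> ('r \<Rightarrow> 't) \<Rightarrow> ('r \<Rightarrow> 't) \<Rightarrow> 'r \<Rightarrow> 't" where
  "point_add K G T f g = (\<lambda>r. copair K G G T f g (comult G r))"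

definition point_zero ::
    "('k, 'r, 'm) formal_group_scheme \<Rightarrow> ('k, 't, 'n) formal_algebra_scheme \<Rightarrow> 'r \<Rightarrow> 't" where
  "point_zero G T = (\<lambda>r. struct_map T (counit G r))"

text \<open>
  Associativity and commutativity are stated for the tautological points of \<open>G\<close> over
  \<open>G \<times>\<^sub>S (G \<times>\<^sub>S G)\<close> and \<open>G \<times>\<^sub>S G\<close> (the projections), the unit and inverse laws for the tautological
  point of \<open>G\<close> over \<open>G\<close>; so these are the usual commutative diagrams.
\<close>

definition comm_formal_group :: "('k, 'c) ring_scheme \<Rightarrow> ('k, 'r, 'm) formal_group_scheme \<Rightarrow> bool" where
  "comm_formal_group K G \<longleftrightarrow>
     formal_algebra K G \<and>
     formal_hom K G (ctensor K G G) (comult G) \<and>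
     formal_hom K G (base_algebra K) (counit G) \<and>
     formal_hom K G G (antipode G) \<and>
     (let W2 = ctensor K G G; W3 = ctensor K G W2;
          p1 = incl1 K G G; p2 = incl2 K G G;
          q1 = incl1 K G W2; q2 = incl2 K G W2 \<circ> p1; q3 = incl2 K G W2 \<circ> p2 in
      (\<forall>r\<in>carrier G.
         point_add K G W3 (point_add K G W3 q1 q2) q3 r =
         point_add K G W3 q1 (point_add K G W3 q2 q3) r) \<and>
      (\<forall>r\<in>carrier G. point_add K G W2 p1 p2 r = point_add K G W2 p2 p1 r)) \<and>
     (\<forall>r\<in>carrier G. point_add K G G (point_zero G G) (\<lambda>s. s) r = r) \<and>
     (\<forall>r\<in>carrier G. point_add K G G (antipode G) (\<lambda>s. s) r = point_zero G G r)"

text \<open>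
  \<open>f\<close> is the map \<open>\<O>\<^sub>H \<rightarrow> \<O>\<^sub>G\<close> of coordinate rings of a homomorphism \<open>G \<rightarrow> H\<close>; the last condition is
  \<open>\<Delta>\<^sub>G \<circ> f = (f \<otimes> f) \<circ> \<Delta>\<^sub>H\<close>.
\<close>

definition formal_group_hom ::
    "('k, 'c) ring_scheme \<Rightarrow> ('k, 'r, 'm) formal_group_scheme \<Rightarrow> ('k, 's, 'n) formal_group_scheme
      \<Rightarrow> ('s \<Rightarrow> 'r) \<Rightarrow> bool" where
  "formal_group_hom K G H f \<longleftrightarrow>
     formal_hom K H G f \<and>
     (\<forall>s\<in>carrier H.
        comult G (f s) = point_add K H (ctensor K G G) (incl1 K G G \<circ> f) (incl2 K G G \<circ> f) s)"

definition formal_group_iso ::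
    "('k, 'c) ring_scheme \<Rightarrow> ('k, 'r, 'm) formal_group_scheme \<Rightarrow> ('k, 's, 'n) formal_group_scheme
      \<Rightarrow> ('s \<Rightarrow> 'r) \<Rightarrow> bool" where
  "formal_group_iso K G H f \<longleftrightarrow>
     formal_group_hom K G H f \<and> homeomorphic_map (topol H) (topol G) f"

definition prod_group ::
    "('k, 'c) ring_scheme \<Rightarrow> ('k, 'r, 'm) formal_group_scheme \<Rightarrow> ('k, 's, 'n) formal_group_scheme
      \<Rightarrow> ('k, ('k, 'r, 's) ctensor) formal_group" where
  "prod_group K G H =
     (let W = ctensor K G H; WW = ctensor K W W; i1 = incl1 K G H; i2 = incl2 K G H in
      formal_algebra.extend W
        (formal_group.fields
          (copair K G H WW
             (point_add K G WW (incl1 K W W \<circ> i1) (incl2 K W W \<circ> i1))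
             (point_add K H WW (incl1 K W W \<circ> i2) (incl2 K W W \<circ> i2)))
          (copair K G H (base_algebra K) (counit G) (counit H))
          (copair K G H W (i1 \<circ> antipode G) (i2 \<circ> antipode H))))"


subsection \<open>Constant groups\<close>

text \<open>
  The constant group scheme \<open>M \<times> S\<close> of a finite commutative group \<open>M\<close>.  Its coordinate ring is the ring
  of functions \<open>M \<rightarrow> K\<close>; with \<open>\<delta>\<^sub>a\<close> the indicator functions, the addition on \<open>M \<times> S\<close> is given by
  \<open>f \<mapsto> \<Sum>\<^sub>a\<^sub>,\<^sub>b f(a + b) \<cdot> \<delta>\<^sub>a \<otimes> \<delta>\<^sub>b\<close>.
\<close>

definition fun_algebra :: "('k, 'c) ring_scheme \<Rightarrow> 'a set \<Rightarrow> ('k, 'a \<Rightarrow> 'k) formal_algebra" where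
  "fun_algebra K M =
     \<lparr>carrier = M \<rightarrow>\<^sub>E carrier K,
      monoid.mult = (\<lambda>f g. \<lambda>a\<in>M. f a \<otimes>\<^bsub>K\<^esub> g a),
      one = (\<lambda>a\<in>M. \<one>\<^bsub>K\<^esub>),
      ring.zero = (\<lambda>a\<in>M. \<zero>\<^bsub>K\<^esub>),
      ring.add = (\<lambda>f g. \<lambda>a\<in>M. f a \<oplus>\<^bsub>K\<^esub> g a),
      struct_map = (\<lambda>c. \<lambda>a\<in>M. c),
      topol = discrete_topology (M \<rightarrow>\<^sub>E carrier K)\<rparr>"

definition const_group :: "('k, 'c) ring_scheme \<Rightarrow> ('a, 'd) monoid_scheme \<Rightarrow> ('k, 'a \<Rightarrow> 'k) formal_group" where
  "const_group K M =
     (let F = fun_algebra K (carrier M); W = ctensor K F F;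
          \<delta> = (\<lambda>a. \<lambda>b\<in>carrier M. if b = a then \<one>\<^bsub>K\<^esub> else \<zero>\<^bsub>K\<^esub>) in
      formal_algebra.extend F
        (formal_group.fields
          (\<lambda>f. finsum W
             (\<lambda>(a, b). struct_map W (f (a \<otimes>\<^bsub>M\<^esub> b)) \<otimes>\<^bsub>W\<^esub> (incl1 K F F (\<delta> a) \<otimes>\<^bsub>W\<^esub> incl2 K F F (\<delta> b)))
             (carrier M \<times> carrier M))
          (\<lambda>f. f \<one>\<^bsub>M\<^esub>)
          (\<lambda>f. \<lambda>a\<in>carrier M. f (inv\<^bsub>M\<^esub> a))))"


subsection \<open>Ordinary one-dimensional formal groups\<close>

text \<open>The \<open>x\<close>-adic topology on \<open>K[[x]]\<close> is the product topology of the discrete coefficient rings.\<close>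

definition powser_algebra :: "('k, 'c) ring_scheme \<Rightarrow> ('k, nat \<Rightarrow> 'k) formal_algebra" where
  "powser_algebra K =
     \<lparr>carrier = UNIV \<rightarrow> carrier K,
      monoid.mult = (\<lambda>p q n. \<Oplus>\<^bsub>K\<^esub>i\<in>{..n}. p i \<otimes>\<^bsub>K\<^esub> q (n - i)),
      one = (\<lambda>n. if n = 0 then \<one>\<^bsub>K\<^esub> else \<zero>\<^bsub>K\<^esub>),
      ring.zero = (\<lambda>n. \<zero>\<^bsub>K\<^esub>),
      ring.add = (\<lambda>p q n. p n \<oplus>\<^bsub>K\<^esub> q n),
      struct_map = (\<lambda>c n. if n = 0 then c else \<zero>\<^bsub>K\<^esub>),
      topol = product_topology (\<lambda>n. discrete_topology (carrier K)) UNIV\<rparr>"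

text \<open>Up to isomorphism, the coordinate ring of an ordinary formal group is equal to \<open>K[[x]]\<close>.\<close>

definition ordinary_formal_group :: "('k, 'c) ring_scheme \<Rightarrow> ('k, nat \<Rightarrow> 'k) formal_group \<Rightarrow> bool" where
  "ordinary_formal_group K G \<longleftrightarrow>
     formal_algebra.truncate G = powser_algebra K \<and> comm_formal_group K G"


section \<open>Formal multicurves\<close>

definition regular_element :: "('r, 'm) ring_scheme \<Rightarrow> 'r \<Rightarrow> bool" where
  "regular_element R a \<longleftrightarrow>
     a \<in> carrier R \<and> (\<forall>b\<in>carrier R. a \<otimes>\<^bsub>R\<^esub> b = \<zero>\<^bsub>R\<^esub> \<longrightarrow> b = \<zero>\<^bsub>R\<^esub>)"

definition regular_hypersurface_ideal :: "('r, 'm) ring_scheme \<Rightarrow> 'r set \<Rightarrow> bool" where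
  "regular_hypersurface_ideal R J \<longleftrightarrow> (\<exists>d. regular_element R d \<and> J = PIdl\<^bsub>R\<^esub> d)"

text \<open>\<open>R/I\<close> is a finitely generated free \<open>K\<close>-module: the classes of the \<open>b i\<close> form a basis.\<close>

definition fg_free_quotient ::
    "('k, 'c) ring_scheme \<Rightarrow> ('k, 'r, 'm) formal_algebra_scheme \<Rightarrow> 'r set \<Rightarrow> bool" where
  "fg_free_quotient K R I \<longleftrightarrow>
     (\<exists>(n::nat) b. b \<in> {..<n} \<rightarrow> carrier R \<and>
        (\<forall>r\<in>carrier R. \<exists>!c. c \<in> {..<n} \<rightarrow>\<^sub>E carrier K \<and>
           r \<ominus>\<^bsub>R\<^esub> (\<Oplus>\<^bsub>R\<^esub>i\<in>{..<n}. struct_map R (c i) \<otimes>\<^bsub>R\<^esub> b i) \<in> I))"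

text \<open>
  For a decreasing sequence of ideals \<open>F m\<close>: \<open>R = lim R/F m\<close> as topological rings, with \<open>R/F m\<close>
  discrete.  The first two conditions say that \<open>R \<rightarrow> lim R/F m\<close> is continuous and open onto its
  image, the last two that it is injective and surjective.
\<close>

definition is_limit_of_quotients ::
    "('k, 'r, 'm) formal_algebra_scheme \<Rightarrow> (nat \<Rightarrow> 'r set) \<Rightarrow> bool" where
  "is_limit_of_quotients R F \<longleftrightarrow>
     (\<forall>m. openin (topol R) (F m)) \<and>
     (\<forall>U. openin (topol R) U \<and> \<zero>\<^bsub>R\<^esub> \<in> U \<longrightarrow> (\<exists>m. F m \<subseteq> U)) \<and>
     (\<Inter>m. F m) = {\<zero>\<^bsub>R\<^esub>} \<and>
     (\<forall>x. (\<forall>m. x m \<in> carrier R) \<and> (\<forall>m. x (Suc m) \<ominus>\<^bsub>R\<^esub> x m \<in> F m) \<longrightarrow>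
          (\<exists>z\<in>carrier R. \<forall>m. z \<ominus>\<^bsub>R\<^esub> x m \<in> F m))"

text \<open>The ideal of the diagonal is the kernel of the multiplication map of the completed tensor square.\<close>

definition diagonal_ideal ::
    "('k, 'c) ring_scheme \<Rightarrow> ('k, 'r, 'm) formal_algebra_scheme \<Rightarrow> ('k, 'r, 'r) ctensor set" where
  "diagonal_ideal K R =
     a_kernel (ctensor K R R) R (copair K R R R (\<lambda>r. r) (\<lambda>r. r))"

definition formal_multicurve :: "('k, 'c) ring_scheme \<Rightarrow> ('k, 'r, 'm) formal_algebra_scheme \<Rightarrow> bool" where
  "formal_multicurve K R \<longleftrightarrow>
     formal_algebra K R \<and>
     (\<exists>y. regular_element R y \<and>
        (\<forall>m::nat. openin (topol R) (PIdl\<^bsub>R\<^esub> (y [^]\<^bsub>R\<^esub> m)) \<and>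
                  fg_free_quotient K R (PIdl\<^bsub>R\<^esub> (y [^]\<^bsub>R\<^esub> m))) \<and>
        is_limit_of_quotients R (\<lambda>m. PIdl\<^bsub>R\<^esub> (y [^]\<^bsub>R\<^esub> m))) \<and>
     regular_hypersurface_ideal (ctensor K R R) (diagonal_ideal K R)"

definition formal_multicurve_group :: "('k, 'c) ring_scheme \<Rightarrow> ('k, 'r, 'm) formal_group_scheme \<Rightarrow> bool" where
  "formal_multicurve_group K C \<longleftrightarrow> formal_multicurve K C \<and> comm_formal_group K C"


section \<open>Equivariant formal groups\<close>

definition rat_mod_int :: "rat set monoid" where
  "rat_mod_int = \<lparr>carrier = UNIV, monoid.mult = (+), one = (0::rat)\<rparr> Mod \<int>"

definition dual_group :: "('a, 'd) monoid_scheme \<Rightarrow> ('a \<Rightarrow> rat set) monoid" where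
  "dual_group A =
     \<lparr>carrier = hom A rat_mod_int \<inter> extensional (carrier A),
      monoid.mult = (\<lambda>\<alpha> \<beta>. \<lambda>a\<in>carrier A. \<alpha> a \<otimes>\<^bsub>rat_mod_int\<^esub> \<beta> a),
      one = (\<lambda>a\<in>carrier A. \<one>\<^bsub>rat_mod_int\<^esub>)\<rparr>"

text \<open>
  A homomorphism \<open>A\<^sup>* \<times> S \<rightarrow> C\<close> is given by a map \<open>\<phi>\<close> from \<open>\<O>\<^sub>C\<close> to the ring of functions on \<open>A\<^sup>*\<close>; so
  \<open>r \<mapsto> \<phi> r \<alpha>\<close> is the section \<open>\<phi>(\<alpha>) : S \<rightarrow> C\<close>, and its kernel is the ideal of the divisor \<open>[\<phi>(\<alpha>)]\<close>.
\<close>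

definition section_ideal ::
    "('k, 'c) ring_scheme \<Rightarrow> ('k, 'r, 'm) formal_algebra_scheme \<Rightarrow> ('r \<Rightarrow> 'k) \<Rightarrow> 'r set" where
  "section_ideal K R u = a_kernel R K u"

definition euler_ideal ::
    "('k, 'c) ring_scheme \<Rightarrow> ('a, 'd) monoid_scheme \<Rightarrow> ('k, 'r, 'm) formal_algebra_scheme
      \<Rightarrow> ('r \<Rightarrow> ('a \<Rightarrow> rat set) \<Rightarrow> 'k) \<Rightarrow> 'r set" where
  "euler_ideal K A R \<phi> =
     (\<Otimes>\<^bsub>ideals_set R\<^esub>\<alpha>\<in>carrier (dual_group A). section_ideal K R (\<lambda>r. \<phi> r \<alpha>))"

definition equivariant_formal_group ::
    "('k, 'c) ring_scheme \<Rightarrow> ('a, 'd) monoid_scheme \<Rightarrow> ('k, 'r, 'm) formal_group_scheme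
      \<Rightarrow> ('r \<Rightarrow> ('a \<Rightarrow> rat set) \<Rightarrow> 'k) \<Rightarrow> bool" where
  "equivariant_formal_group K A C \<phi> \<longleftrightarrow>
     formal_multicurve_group K C \<and>
     formal_group_hom K (const_group K (dual_group A)) C \<phi> \<and>
     is_limit_of_quotients C (\<lambda>m. euler_ideal K A C \<phi> [^]\<^bsub>ideals_set C\<^esub> (m::nat))"

text \<open>The maps of coordinate rings of the restriction \<open>A\<^sup>* \<rightarrow> B\<^sup>*\<close> and of \<open>G \<rightarrow> G \<times>\<^sub>S H\<close>, \<open>g \<mapsto> (g, 0)\<close>.\<close>

definition dual_restriction ::
    "('a, 'd) monoid_scheme \<Rightarrow> 'a set \<Rightarrow> (('a \<Rightarrow> rat set) \<Rightarrow> 'k) \<Rightarrow> ('a \<Rightarrow> rat set) \<Rightarrow> 'k" where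
  "dual_restriction A B h = (\<lambda>\<alpha>\<in>carrier (dual_group A). h (restrict \<alpha> B))"

definition first_factor ::
    "('k, 'c) ring_scheme \<Rightarrow> ('k, 'r, 'm) formal_group_scheme \<Rightarrow> ('k, 's, 'n) formal_group_scheme
      \<Rightarrow> ('k, 'r, 's) ctensor \<Rightarrow> 'r" where
  "first_factor K G H = copair K G H G (\<lambda>r. r) (point_zero H G)"

definition product_type ::
    "('k, 'c) ring_scheme \<Rightarrow> ('a, 'd) monoid_scheme \<Rightarrow> ('k, 'r, 'm) formal_group_scheme
      \<Rightarrow> ('r \<Rightarrow> ('a \<Rightarrow> rat set) \<Rightarrow> 'k) \<Rightarrow> bool" where
  "product_type K A C \<phi> \<longleftrightarrow>
     (\<exists>B H f.
        subgroup B A \<and> ordinary_formal_group K H \<and>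
        (let D = const_group K (dual_group (A\<lparr>carrier := B\<rparr>)); P = prod_group K D H in
         formal_group_iso K C P f \<and>
         (\<forall>w\<in>carrier P. \<phi> (f w) = dual_restriction A B (first_factor K D H w))))"

end

theory Submission
  imports Defs
begin

text \<open>
  Pulling the diagonal back along a section shows that each \<open>\<phi>(\<alpha>)\<close> is cut out by one element, which is regular
  because a power of \<open>y\<close> lies in the ideal of \<open>\<Sum>[\<phi>(\<alpha>)]\<close>.  Let \<open>N\<close> be the kernel of \<open>\<alpha> \<mapsto> \<phi>(\<alpha>)\<close> and \<open>B \<le> A\<close> its
  annihilator; by duality \<open>B\<^sup>* = A\<^sup>*/N\<close>, so there are distinct sections \<open>u\<^sub>\<beta>\<close> with \<open>\<beta> \<in> B\<^sup>*\<close>.  Over a field, distinct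
  sections are coprime.  So every function has a Taylor expansion in \<open>k[[x]]\<close> at the origin, hence by translation
  at each \<open>u\<^sub>\<beta>\<close>, and the Chinese remainder theorem and completeness identify \<open>\<O>\<^sub>C\<close> with the product of copies of
  \<open>k[[x]]\<close> indexed by \<open>B\<^sup>*\<close>.  A point of \<open>C\<close> lies in the component of the origin if and only if its coordinate \<open>x\<close> is
  topologically nilpotent; hence this component is a subgroup \<open>G\<close>, and \<open>(\<beta>, g) \<mapsto> u\<^sub>\<beta> + g\<close> is an isomorphism
  \<open>B\<^sup>* \<times> G \<rightarrow> C\<close> of groups.
\<close>


section \<open>Linearly topologised algebras\<close>

text \<open>Group axioms are checked on points rather than on elements of completed tensor products.
  A continuous map out of such a product is determined by its values on the two factors, so the
  points of a formal group over any formal algebra \<open>T\<close> form an abelian group under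
  \<open>point_add\<close>, naturally in \<open>T\<close>, and every diagram becomes an identity
  between points of \<open>C\<close>. No formal group law is written down. The Taylor map at the
  origin is onto \<open>K[[x]]\<close>, so an operation of \<open>C\<close> descends to
  \<open>K[[x]]\<close> as soon as it factors, and the axioms descend with it. It factors because
  topologically nilpotent elements are closed under sums and the span of the elements
  \<open>r \<otimes> s\<close> is dense. The isomorphism is built as a map from the coordinate ring
  of \<open>C\<close> to that of the product, where it is given by the sum of two points, and
  inverted afterwards. For this sum to be read off from expansions, the coordinate at each section
  has to be the translate of the one at the origin, although every section has an equation of its
  own. That \<open>K\<close> is a field enters through values at sections: nonzero ones are inverted
  in \<open>separating_element\<close> and cancelled in \<open>xid_mult_cancel\<close>.\<close>

lemma (in ideal) mem_coset_iff:
  assumes "x \<in> carrier R"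
  shows "y \<in> I +> x \<longleftrightarrow> y \<in> carrier R \<and> y \<ominus> x \<in> I"
proof
  assume "y \<in> I +> x"
  then obtain h where h: "h \<in> I" "y = h \<oplus> x" by (auto simp: a_r_coset_def')
  then have "y \<ominus> x = h" using assms Icarr by (simp add: a_minus_def a_assoc r_neg)
  then show "y \<in> carrier R \<and> y \<ominus> x \<in> I" using h assms Icarr by simp
next
  assume y: "y \<in> carrier R \<and> y \<ominus> x \<in> I"
  have "y = (y \<ominus> x) \<oplus> x" using y assms by (simp add: a_minus_def a_assoc l_neg)
  then show "y \<in> I +> x" using y by (auto simp: a_r_coset_def')
qed

lemma (in ideal) sub_closed: "a \<in> I \<Longrightarrow> b \<in> I \<Longrightarrow> a \<ominus> b \<in> I"
  by (simp add: a_minus_def)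

lemma (in ideal) finsum_mem: "(\<And>i. i \<in> S \<Longrightarrow> g i \<in> I) \<Longrightarrow> finsum R g S \<in> I"
proof (induction S rule: infinite_finite_induct)
  case (insert x F)
  then have "g \<in> F \<rightarrow> carrier R" "g x \<in> carrier R" using Icarr by auto
  with insert show ?case by (simp add: finsum_insert)
qed (simp_all add: finsum_infinite)

locale formal_alg =
  fixes K :: "('k, 'c) ring_scheme" and R :: "('k, 'r, 'm) formal_algebra_scheme" (structure)
  assumes formal: "formal_algebra K R"
begin

sublocale K: cring K using formal by (simp add: formal_algebra_def)
sublocale cring R using formal by (simp add: formal_algebra_def)
sublocale str: ring_hom_cring K R "struct_map R"
  using formal by unfold_locales (simp add: formal_algebra_def)

lemma topspace: "topspace (topol R) = carrier R"
  using formal by (simp add: formal_algebra_def linearly_topologised_def)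

lemma openin_iff:
  "openin (topol R) U \<longleftrightarrow> U \<subseteq> carrier R \<and> (\<forall>x\<in>U. \<exists>I\<in>open_ideals R. I +> x \<subseteq> U)"
  using formal unfolding formal_algebra_def linearly_topologised_def by blast

lemma open_idealD: "I \<in> open_ideals R \<Longrightarrow> ideal I R"
  by (simp add: open_ideals_def)

lemma open_ideal_mono:
  assumes "I \<in> open_ideals R" "ideal J R" "I \<subseteq> J"
  shows "J \<in> open_ideals R"
proof -
  interpret J: ideal J R by fact
  have "I +> x \<subseteq> J" if "x \<in> J" for x
    using that assms(3) J.a_closed by (auto simp: a_r_coset_def')
  then show ?thesis
    using assms J.Icarr by (auto simp: open_ideals_def openin_iff[of J])
qed

lemma carrier_open_ideal: "carrier R \<in> open_ideals R"
  by (metis (no_types, lifting) mem_Collect_eq oneideal open_ideals_def openin_topspace topspace)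

lemma Int_open_ideal:
  "I \<in> open_ideals R \<Longrightarrow> J \<in> open_ideals R \<Longrightarrow> I \<inter> J \<in> open_ideals R"
  by (auto simp: open_ideals_def i_intersect)

lemma open_ideal_within:
  assumes "openin (topol R) U" "\<zero> \<in> U"
  obtains I where "I \<in> open_ideals R" "I \<subseteq> U"
proof -
  obtain I where I: "I \<in> open_ideals R" "I +> \<zero> \<subseteq> U"
    using assms by (auto simp: openin_iff)
  moreover have "x \<in> I +> \<zero>" if "x \<in> I" for x
    using that ideal.Icarr[OF open_idealD[OF I(1)] that] by (force simp: a_r_coset_def')
  ultimately show thesis using that by blast
qed

lemma Inter_open_ideals:
  assumes "x \<in> carrier R" "\<And>I. I \<in> open_ideals R \<Longrightarrow> x \<in> I"
  shows "x = \<zero>"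
proof (rule ccontr)
  assume "x \<noteq> \<zero>"
  moreover have "Hausdorff_space (topol R)" using formal by (simp add: formal_algebra_def)
  ultimately obtain U V where "openin (topol R) U" "openin (topol R) V" "\<zero> \<in> U" "x \<in> V" "disjnt U V"
    using assms(1) unfolding Hausdorff_space_def by (metis topspace zero_closed)
  then show False using assms(2) open_ideal_within by (metis disjnt_iff subsetD)
qed

lemma separated:
  assumes "x \<in> carrier R" "y \<in> carrier R" "\<And>I. I \<in> open_ideals R \<Longrightarrow> x \<ominus> y \<in> I"
  shows "x = y"
  using Inter_open_ideals[of "x \<ominus> y"] assms by simp

lemma complete:
  assumes "\<And>I. I \<in> open_ideals R \<Longrightarrow> x I \<in> carrier R"
    and "\<And>I J. \<lbrakk>I \<in> open_ideals R; J \<in> open_ideals R; I \<subseteq> J\<rbrakk> \<Longrightarrow> x I \<ominus> x J \<in> J"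
  shows "\<exists>z\<in>carrier R. \<forall>I\<in>open_ideals R. z \<ominus> x I \<in> I"
  proof -
  have "complete_formal R" using formal by (simp add: formal_algebra_def)
  then show ?thesis unfolding complete_formal_def using assms by (elim allE[of _ x]) blast
qed

end

text \<open>Separatedness and completeness are defined through all open ideals, while a concrete
  algebra comes with a basis \<open>\<B>\<close> of neighbourhoods of zero. Such a basis is cofinal
  among the open ideals, so both conditions can be tested on it. The last two conclusions let later
  proofs return from arbitrary open ideals to the basis.\<close>

lemma formal_algebraI:
  assumes "cring K" "cring R" "struct_map R \<in> ring_hom K R"
    and top: "topspace (topol R) = carrier R"
    and ideals: "\<And>I. I \<in> \<B> \<Longrightarrow> ideal I R"
    and basis: "\<And>U. openin (topol R) U \<longleftrightarrow> U \<subseteq> carrier R \<and> (\<forall>x\<in>U. \<exists>I\<in>\<B>. I +>\<^bsub>R\<^esub> x \<subseteq> U)"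
    and sep: "\<And>x. x \<in> carrier R \<Longrightarrow> (\<And>I. I \<in> \<B> \<Longrightarrow> x \<in> I) \<Longrightarrow> x = \<zero>\<^bsub>R\<^esub>"
    and compl: "\<And>x. \<lbrakk>\<And>I. I \<in> \<B> \<Longrightarrow> x I \<in> carrier R;
        \<And>I J. I \<in> \<B> \<Longrightarrow> J \<in> \<B> \<Longrightarrow> I \<subseteq> J \<Longrightarrow> x I \<ominus>\<^bsub>R\<^esub> x J \<in> J\<rbrakk>
        \<Longrightarrow> \<exists>z\<in>carrier R. \<forall>I\<in>\<B>. z \<ominus>\<^bsub>R\<^esub> x I \<in> I"
  shows "formal_algebra K R" and "\<B> \<subseteq> open_ideals R"
    and "\<And>J. J \<in> open_ideals R \<Longrightarrow> \<exists>I\<in>\<B>. I \<subseteq> J"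
proof -
  interpret K: cring K by fact
  interpret cring R by fact
  have coset0: "I +>\<^bsub>R\<^esub> \<zero>\<^bsub>R\<^esub> = I" if "ideal I R" for I
    using that ideal.Icarr[OF that] by (force simp: a_r_coset_def')
  have self: "I +>\<^bsub>R\<^esub> x \<subseteq> I" if "ideal I R" "x \<in> I" for I x
    using that additive_subgroup.a_closed[OF ideal.axioms(1)] by (fastforce simp: a_r_coset_def')
  show sub: "\<B> \<subseteq> open_ideals R"
  proof
    fix I assume I: "I \<in> \<B>"
    then have "I \<subseteq> carrier R" using ideal.Icarr[OF ideals[OF I]] by blast
    moreover have "\<forall>x\<in>I. \<exists>I'\<in>\<B>. I' +>\<^bsub>R\<^esub> x \<subseteq> I" using I self[OF ideals[OF I]] by metis
    ultimately have "openin (topol R) I" unfolding basis[of I] by simp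
    then show "I \<in> open_ideals R" using ideals[OF I] by (simp add: open_ideals_def)
  qed
  show below: "\<exists>I\<in>\<B>. I \<subseteq> J" if "J \<in> open_ideals R" for J
  proof -
    have J: "ideal J R" "openin (topol R) J" using that by (simp_all add: open_ideals_def)
    have "\<zero>\<^bsub>R\<^esub> \<in> J" using J by (simp add: additive_subgroup.zero_closed ideal.axioms(1))
    then obtain I where "I \<in> \<B>" "I +>\<^bsub>R\<^esub> \<zero>\<^bsub>R\<^esub> \<subseteq> J" using J(2) unfolding basis[of J] by blast
    then show ?thesis using coset0[OF ideals] by auto
  qed
  have lt: "linearly_topologised R"
    unfolding linearly_topologised_def
  proof (intro conjI top allI)
    fix U
    show "openin (topol R) U \<longleftrightarrow> U \<subseteq> carrier R \<and> (\<forall>x\<in>U. \<exists>I\<in>open_ideals R. I +>\<^bsub>R\<^esub> x \<subseteq> U)"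
    proof (intro iffI conjI ballI; (elim conjE)?)
      assume "openin (topol R) U"
      then show "U \<subseteq> carrier R" by (simp add: basis)
    next
      fix x assume "openin (topol R) U" "x \<in> U"
      then show "\<exists>I\<in>open_ideals R. I +>\<^bsub>R\<^esub> x \<subseteq> U" using basis sub by blast
    next
      assume U: "U \<subseteq> carrier R" "\<forall>x\<in>U. \<exists>I\<in>open_ideals R. I +>\<^bsub>R\<^esub> x \<subseteq> U"
      have "\<exists>I\<in>\<B>. I +>\<^bsub>R\<^esub> x \<subseteq> U" if x: "x \<in> U" for x
      proof -
        obtain J where J: "J \<in> open_ideals R" "J +>\<^bsub>R\<^esub> x \<subseteq> U" using U x by blast
        obtain I where "I \<in> \<B>" "I \<subseteq> J" using below J by blast
        moreover from this have "I +>\<^bsub>R\<^esub> x \<subseteq> J +>\<^bsub>R\<^esub> x" by (auto simp: a_r_coset_def')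
        ultimately show ?thesis using J by (meson subset_trans)
      qed
      then show "openin (topol R) U" using U basis by blast
    qed
  qed
  have sep2: "x \<ominus>\<^bsub>R\<^esub> y \<in> I" if I: "ideal I R" and z: "z \<in> I +>\<^bsub>R\<^esub> x" "z \<in> I +>\<^bsub>R\<^esub> y"
    and xy: "x \<in> carrier R" "y \<in> carrier R" for I x y z
  proof -
    interpret I: ideal I R by fact
    have "z \<in> carrier R" "z \<ominus>\<^bsub>R\<^esub> x \<in> I" "z \<ominus>\<^bsub>R\<^esub> y \<in> I" using z xy I.mem_coset_iff by auto
    moreover from this have "x \<ominus>\<^bsub>R\<^esub> y = (z \<ominus>\<^bsub>R\<^esub> y) \<ominus>\<^bsub>R\<^esub> (z \<ominus>\<^bsub>R\<^esub> x)" using xy by algebra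
    ultimately show ?thesis using I.sub_closed by simp
  qed
  have opn: "openin (topol R) (I +>\<^bsub>R\<^esub> x) \<and> x \<in> I +>\<^bsub>R\<^esub> x" if I: "I \<in> \<B>" and x: "x \<in> carrier R" for I x
  proof -
    interpret I: ideal I R using I ideals by blast
    have "I +>\<^bsub>R\<^esub> y \<subseteq> I +>\<^bsub>R\<^esub> x" if y: "y \<in> I +>\<^bsub>R\<^esub> x" for y
    proof -
      obtain k where "k \<in> I" "y = k \<oplus>\<^bsub>R\<^esub> x" using y by (auto simp: a_r_coset_def')
      then have "h \<oplus>\<^bsub>R\<^esub> y = (h \<oplus>\<^bsub>R\<^esub> k) \<oplus>\<^bsub>R\<^esub> x" "h \<oplus>\<^bsub>R\<^esub> k \<in> I" if "h \<in> I" for h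
        using that x I.Icarr by (simp_all add: a_assoc)
      then show ?thesis unfolding a_r_coset_def' by blast
    qed
    moreover have "I +>\<^bsub>R\<^esub> x \<subseteq> carrier R" using I.mem_coset_iff x by auto
    ultimately show ?thesis using I I.a_rcos_self x by (auto simp: basis[of "I +>\<^bsub>R\<^esub> x"])
  qed
  have hs: "Hausdorff_space (topol R)"
    unfolding Hausdorff_space_def
  proof (intro allI impI, elim conjE)
    fix x y assume xy: "x \<in> topspace (topol R)" "y \<in> topspace (topol R)" "x \<noteq> y"
    then have xy': "x \<in> carrier R" "y \<in> carrier R" by (simp_all add: top)
    have "x \<ominus>\<^bsub>R\<^esub> y \<noteq> \<zero>\<^bsub>R\<^esub>" using xy xy' by simp
    then obtain I where I: "I \<in> \<B>" "x \<ominus>\<^bsub>R\<^esub> y \<notin> I" using sep[of "x \<ominus>\<^bsub>R\<^esub> y"] xy' by auto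
    have "disjnt (I +>\<^bsub>R\<^esub> x) (I +>\<^bsub>R\<^esub> y)"
      using sep2[OF ideals[OF I(1)]] I xy' by (auto simp: disjnt_iff)
    then show "\<exists>U V. openin (topol R) U \<and> openin (topol R) V \<and> x \<in> U \<and> y \<in> V \<and> disjnt U V"
      using opn[OF I(1)] xy' by blast
  qed
  have "complete_formal R"
    unfolding complete_formal_def
  proof (intro allI impI, elim conjE)
    fix x assume x: "\<forall>I\<in>open_ideals R. x I \<in> carrier R"
      "\<forall>I\<in>open_ideals R. \<forall>J\<in>open_ideals R. I \<subseteq> J \<longrightarrow> x I \<ominus>\<^bsub>R\<^esub> x J \<in> J"
    have "\<exists>z\<in>carrier R. \<forall>I\<in>\<B>. z \<ominus>\<^bsub>R\<^esub> x I \<in> I"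
      using compl[of x] x sub by blast
    then obtain z where z: "z \<in> carrier R" "\<And>I. I \<in> \<B> \<Longrightarrow> z \<ominus>\<^bsub>R\<^esub> x I \<in> I" by blast
    have "z \<ominus>\<^bsub>R\<^esub> x J \<in> J" if J: "J \<in> open_ideals R" for J
    proof -
      interpret J: ideal J R using J by (simp add: open_ideals_def)
      obtain I where I: "I \<in> \<B>" "I \<subseteq> J" using below J by blast
      then have "z \<ominus>\<^bsub>R\<^esub> x I \<in> J" "x I \<ominus>\<^bsub>R\<^esub> x J \<in> J" using z x sub J by blast+
      moreover have "z \<ominus>\<^bsub>R\<^esub> x J = (z \<ominus>\<^bsub>R\<^esub> x I) \<oplus>\<^bsub>R\<^esub> (x I \<ominus>\<^bsub>R\<^esub> x J)"
      proof -
        have "x I \<in> carrier R" "x J \<in> carrier R" using x I J sub by blast+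
        then show ?thesis using z(1) by algebra
      qed
      ultimately show ?thesis by simp
    qed
    then show "\<exists>z\<in>carrier R. \<forall>I\<in>open_ideals R. z \<ominus>\<^bsub>R\<^esub> x I \<in> I" using z by blast
  qed
  then show "formal_algebra K R"
    using assms(1-3) lt hs by (simp add: formal_algebra_def)
qed

lemma formal_hom_comp:
  "formal_hom K R S f \<Longrightarrow> formal_hom K S T g \<Longrightarrow> formal_hom K R T (g \<circ> f)"
  unfolding formal_hom_def using ring_hom_trans continuous_map_compose by fastforce

text \<open>Additivity spreads continuity at zero, tested on open ideals, to all points.\<close>

lemma formal_homI:
  assumes "formal_algebra K R" "formal_algebra K T" "f \<in> ring_hom R T"
    and "\<And>c. c \<in> carrier K \<Longrightarrow> f (struct_map R c) = struct_map T c"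
    and cont: "\<And>J. J \<in> open_ideals T \<Longrightarrow> \<exists>I\<in>open_ideals R. \<forall>r\<in>I. f r \<in> J"
  shows "formal_hom K R T f"
proof -
  interpret R: formal_alg K R by unfold_locales fact
  interpret T: formal_alg K T by unfold_locales fact
  interpret f: ring_hom_cring R T f by unfold_locales fact
  have "openin (topol R) {x \<in> carrier R. f x \<in> U}" if U: "openin (topol T) U" for U
  proof -
    have "\<exists>I\<in>open_ideals R. I +>\<^bsub>R\<^esub> x \<subseteq> {x \<in> carrier R. f x \<in> U}" if x: "x \<in> carrier R" "f x \<in> U" for x
    proof -
      obtain J where J: "J \<in> open_ideals T" "J +>\<^bsub>T\<^esub> f x \<subseteq> U" using U x by (auto simp: T.openin_iff)
      obtain I where I: "I \<in> open_ideals R" "\<forall>r\<in>I. f r \<in> J" using cont J by blast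
      interpret I: ideal I R using I R.open_idealD by blast
      have "f (h \<oplus>\<^bsub>R\<^esub> x) \<in> U" if "h \<in> I" for h
        using that x I J I.Icarr by (force simp: a_r_coset_def')
      then have "I +>\<^bsub>R\<^esub> x \<subseteq> {x \<in> carrier R. f x \<in> U}"
        using x I.Icarr by (auto simp: a_r_coset_def')
      with I(1) show ?thesis by blast
    qed
    then show ?thesis by (auto simp: R.openin_iff)
  qed
  then have "continuous_map (topol R) (topol T) f"
    by (auto simp: continuous_map_def R.topspace T.topspace)
  then show ?thesis using assms by (simp add: formal_hom_def)
qed

locale formal_map = R: formal_alg K R + T: formal_alg K T
  for K :: "('k, 'c) ring_scheme" and R :: "('k, 'r, 'm) formal_algebra_scheme"
    and T :: "('k, 't, 'n) formal_algebra_scheme" +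
  fixes f :: "'r \<Rightarrow> 't"
  assumes formal_hom: "formal_hom K R T f"
begin

sublocale ring_hom_cring R T f
  using formal_hom by unfold_locales (simp add: formal_hom_def)

lemma hom_sub: "x \<in> carrier R \<Longrightarrow> y \<in> carrier R \<Longrightarrow> f (x \<ominus>\<^bsub>R\<^esub> y) = f x \<ominus>\<^bsub>T\<^esub> f y"
  by (simp add: a_minus_def)

lemma hom_struct: "c \<in> carrier K \<Longrightarrow> f (struct_map R c) = struct_map T c"
  using formal_hom by (simp add: formal_hom_def)

lemma vimage_open_ideal:
  assumes J: "J \<in> open_ideals T"
  shows "{r \<in> carrier R. f r \<in> J} \<in> open_ideals R"
proof -
  interpret J: ideal J T using J T.open_idealD by blast
  have "ideal {r \<in> carrier R. f r \<in> J} R"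
    by (rule ring_hom_ring.ideal_vimage[OF ring_hom_ringI2[OF R.ring_axioms T.ring_axioms homh] J.ideal_axioms])
  moreover have "openin (topol R) {r \<in> carrier R. f r \<in> J}"
    using formal_hom J by (simp add: formal_hom_def continuous_map_def R.topspace open_ideals_def)
  ultimately show ?thesis by (simp add: open_ideals_def)
qed

end

lemma formal_mapI:
  "formal_algebra K R \<Longrightarrow> formal_algebra K T \<Longrightarrow> formal_hom K R T f \<Longrightarrow> formal_map K R T f"
  by (simp add: formal_map_def formal_alg_def formal_map_axioms_def)

lemma (in formal_map) formal_hom_cong:
  assumes "\<And>r. r \<in> carrier R \<Longrightarrow> g r = f r"
  shows "formal_hom K R T g"
proof (rule formal_homI)
  show "formal_algebra K R" "formal_algebra K T" by (rule R.formal T.formal)+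
  show "g \<in> ring_hom R T"
    by (rule ring_hom_memI) (simp_all add: assms)
  show "g (struct_map R c) = struct_map T c" if "c \<in> carrier K" for c
    using that by (simp add: assms hom_struct)
  show "\<exists>I\<in>open_ideals R. \<forall>r\<in>I. g r \<in> J" if "J \<in> open_ideals T" for J
    by (rule bexI[OF _ vimage_open_ideal[OF that]]) (simp add: assms)
qed


section \<open>Monoid algebras\<close>

locale monoid_alg = K: cring K + M: comm_monoid M
  for K :: "('k, 'c) ring_scheme" and M :: "('a, 'd) monoid_scheme"
begin

abbreviation "P \<equiv> monoid_algebra K M"
abbreviation supp :: "('a \<Rightarrow> 'k) \<Rightarrow> 'a set" where "supp p \<equiv> {m. p m \<noteq> \<zero>\<^bsub>K\<^esub>}"

lemma mem_carrier:
  "p \<in> carrier P \<longleftrightarrow> (\<forall>m. p m \<in> carrier K) \<and> supp p \<subseteq> carrier M \<and> finite (supp p)"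
  by (auto simp: monoid_algebra_def)

lemma add_eq: "p \<oplus>\<^bsub>P\<^esub> q = (\<lambda>m. p m \<oplus>\<^bsub>K\<^esub> q m)" and zero_eq: "\<zero>\<^bsub>P\<^esub> = (\<lambda>m. \<zero>\<^bsub>K\<^esub>)"
  and one_eq: "\<one>\<^bsub>P\<^esub> = single K \<one>\<^bsub>M\<^esub> \<one>\<^bsub>K\<^esub>"
  by (simp_all add: monoid_algebra_def single_def)

lemma add_carrier: "p \<in> carrier P \<Longrightarrow> q \<in> carrier P \<Longrightarrow> p \<oplus>\<^bsub>P\<^esub> q \<in> carrier P"
proof -
  assume pq: "p \<in> carrier P" "q \<in> carrier P"
  have "supp (p \<oplus>\<^bsub>P\<^esub> q) \<subseteq> supp p \<union> supp q" by (auto simp: add_eq)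
  then have "finite (supp (p \<oplus>\<^bsub>P\<^esub> q))" "supp (p \<oplus>\<^bsub>P\<^esub> q) \<subseteq> carrier M"
    using pq by (auto simp: mem_carrier elim!: finite_subset)
  then show ?thesis using pq by (simp add: mem_carrier) (simp add: add_eq)
qed

lemma single_carrier: "m \<in> carrier M \<Longrightarrow> c \<in> carrier K \<Longrightarrow> single K m c \<in> carrier P"
proof -
  assume "m \<in> carrier M" "c \<in> carrier K"
  moreover have "supp (single K m c) \<subseteq> {m}" by (auto simp: single_def)
  ultimately show ?thesis unfolding mem_carrier using finite_subset by (fastforce simp: single_def)
qed

text \<open>The convolution in \<open>monoid_algebra\<close> runs over the exact supports, which
  change under addition. Over a fixed finite rectangle containing them, distributivity and
  commutativity become termwise identities.\<close>

lemma mult_eq: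
  assumes "p \<in> carrier P" "q \<in> carrier P" "finite A" "finite B" "supp p \<subseteq> A" "supp q \<subseteq> B"
  shows "(p \<otimes>\<^bsub>P\<^esub> q) m = (\<Oplus>\<^bsub>K\<^esub>z\<in>A \<times> B.
           if fst z \<otimes>\<^bsub>M\<^esub> snd z = m then p (fst z) \<otimes>\<^bsub>K\<^esub> q (snd z) else \<zero>\<^bsub>K\<^esub>)"
proof -
  let ?h = "\<lambda>z. if fst z \<otimes>\<^bsub>M\<^esub> snd z = m then p (fst z) \<otimes>\<^bsub>K\<^esub> q (snd z) else \<zero>\<^bsub>K\<^esub>"
  have pq: "\<And>a. p a \<in> carrier K" "\<And>a. q a \<in> carrier K" using assms by (simp_all add: mem_carrier)
  have "(p \<otimes>\<^bsub>P\<^esub> q) m = finsum K (\<lambda>(a, b). p a \<otimes>\<^bsub>K\<^esub> q b)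
      {(a, b). p a \<noteq> \<zero>\<^bsub>K\<^esub> \<and> q b \<noteq> \<zero>\<^bsub>K\<^esub> \<and> a \<otimes>\<^bsub>M\<^esub> b = m}"
    by (simp add: monoid_algebra_def)
  also have "\<dots> = finsum K ?h (A \<times> B)"
  proof (rule K.add.finprod_mono_neutral_cong_left)
    show "finite (A \<times> B)" using assms by simp
    show "{(a, b). p a \<noteq> \<zero>\<^bsub>K\<^esub> \<and> q b \<noteq> \<zero>\<^bsub>K\<^esub> \<and> a \<otimes>\<^bsub>M\<^esub> b = m} \<subseteq> A \<times> B" using assms by auto
    show "?h z = \<zero>\<^bsub>K\<^esub>" if "z \<in> A \<times> B - {(a, b). p a \<noteq> \<zero>\<^bsub>K\<^esub> \<and> q b \<noteq> \<zero>\<^bsub>K\<^esub> \<and> a \<otimes>\<^bsub>M\<^esub> b = m}" for z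
      using that pq by (cases z) auto
  qed (use pq in auto)
  finally show ?thesis .
qed

lemma mult_carrier:
  assumes p: "p \<in> carrier P" and q: "q \<in> carrier P"
  shows "p \<otimes>\<^bsub>P\<^esub> q \<in> carrier P"
proof -
  have fin: "finite (supp p)" "finite (supp q)" and sub: "supp p \<subseteq> carrier M" "supp q \<subseteq> carrier M"
    and c: "\<And>a. p a \<in> carrier K" "\<And>a. q a \<in> carrier K" using p q by (auto simp: mem_carrier)
  note eq = mult_eq[OF p q fin subset_refl subset_refl]
  let ?S = "(\<lambda>z. fst z \<otimes>\<^bsub>M\<^esub> snd z) ` (supp p \<times> supp q)"
  have "m \<in> ?S" if "(p \<otimes>\<^bsub>P\<^esub> q) m \<noteq> \<zero>\<^bsub>K\<^esub>" for m
  proof (rule ccontr)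
    assume "m \<notin> ?S"
    then have "(p \<otimes>\<^bsub>P\<^esub> q) m = \<zero>\<^bsub>K\<^esub>"
      unfolding eq by (intro K.add.finprod_one_eqI) force
    with that show False by simp
  qed
  then have "supp (p \<otimes>\<^bsub>P\<^esub> q) \<subseteq> ?S" by auto
  moreover have "finite ?S" "?S \<subseteq> carrier M" using fin sub by force+
  moreover have "(p \<otimes>\<^bsub>P\<^esub> q) m \<in> carrier K" for m
    unfolding eq by (rule K.finsum_closed) (use c in auto)
  ultimately show ?thesis unfolding mem_carrier using finite_subset by (metis (no_types, lifting) subset_trans)
qed

text \<open>Associativity, the unit law and multiplicativity of \<open>lin_ext\<close> are additive
  in each argument, so this induction on the size of the support reduces them to monomials.\<close>

lemma induct_single [consumes 1, case_names single add]:
  assumes p: "p \<in> carrier P"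
    and single: "\<And>m c. m \<in> carrier M \<Longrightarrow> c \<in> carrier K \<Longrightarrow> Q (single K m c)"
    and add: "\<And>p q. p \<in> carrier P \<Longrightarrow> q \<in> carrier P \<Longrightarrow> Q p \<Longrightarrow> Q q \<Longrightarrow> Q (p \<oplus>\<^bsub>P\<^esub> q)"
  shows "Q p"
  using p
proof (induction "card (supp p)" arbitrary: p)
  case 0
  then have "p = single K \<one>\<^bsub>M\<^esub> \<zero>\<^bsub>K\<^esub>" by (auto simp: mem_carrier single_def fun_eq_iff)
  then show ?case using single[of "\<one>\<^bsub>M\<^esub>" "\<zero>\<^bsub>K\<^esub>"] by simp
next
  case (Suc n)
  have fin: "finite (supp p)" and c: "\<And>m. p m \<in> carrier K" and sub: "supp p \<subseteq> carrier M"
    using Suc by (auto simp: mem_carrier)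
  obtain m where m: "m \<in> supp p" using Suc by (metis card.empty equals0I nat.distinct(1))
  let ?p = "p(m := \<zero>\<^bsub>K\<^esub>)"
  have supp: "supp ?p = supp p - {m}" by auto
  have p': "?p \<in> carrier P" using Suc c sub fin unfolding mem_carrier supp by auto
  have s: "single K m (p m) \<in> carrier P" using m c sub by (intro single_carrier) auto
  have "Q ?p" using Suc supp m fin p' by (intro Suc(1)) auto
  moreover have "p = ?p \<oplus>\<^bsub>P\<^esub> single K m (p m)" using c by (auto simp: add_eq single_def fun_eq_iff)
  ultimately show ?case using add[OF p' s] single[of m "p m"] m c sub by auto
qed

lemma l_distr: 
  assumes "p \<in> carrier P" "q \<in> carrier P" "r \<in> carrier P"
  shows "(p \<oplus>\<^bsub>P\<^esub> q) \<otimes>\<^bsub>P\<^esub> r = p \<otimes>\<^bsub>P\<^esub> r \<oplus>\<^bsub>P\<^esub> q \<otimes>\<^bsub>P\<^esub> r"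
proof
  fix m
  have fin: "finite (supp p \<union> supp q)" "finite (supp r)" and c: "\<And>a. p a \<in> carrier K"
    "\<And>a. q a \<in> carrier K" "\<And>a. r a \<in> carrier K" using assms by (auto simp: mem_carrier)
  have supp: "supp (p \<oplus>\<^bsub>P\<^esub> q) \<subseteq> supp p \<union> supp q" by (auto simp: add_eq)
  have "((p \<oplus>\<^bsub>P\<^esub> q) \<otimes>\<^bsub>P\<^esub> r) m = (\<Oplus>\<^bsub>K\<^esub>z\<in>(supp p \<union> supp q) \<times> supp r.
      (if fst z \<otimes>\<^bsub>M\<^esub> snd z = m then p (fst z) \<otimes>\<^bsub>K\<^esub> r (snd z) else \<zero>\<^bsub>K\<^esub>) \<oplus>\<^bsub>K\<^esub>
      (if fst z \<otimes>\<^bsub>M\<^esub> snd z = m then q (fst z) \<otimes>\<^bsub>K\<^esub> r (snd z) else \<zero>\<^bsub>K\<^esub>))"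
    unfolding mult_eq[OF add_carrier[OF assms(1,2)] assms(3) fin supp subset_refl]
    by (rule K.add.finprod_cong') (use c in \<open>auto simp: add_eq K.l_distr\<close>)
  also have "\<dots> = (p \<otimes>\<^bsub>P\<^esub> r \<oplus>\<^bsub>P\<^esub> q \<otimes>\<^bsub>P\<^esub> r) m"
    unfolding add_eq[of "p \<otimes>\<^bsub>P\<^esub> r"] mult_eq[OF assms(1,3) fin Un_upper1 subset_refl] mult_eq[OF assms(2,3) fin Un_upper2 subset_refl]
    by (rule K.finsum_addf) (use c in auto)
  finally show "((p \<oplus>\<^bsub>P\<^esub> q) \<otimes>\<^bsub>P\<^esub> r) m = (p \<otimes>\<^bsub>P\<^esub> r \<oplus>\<^bsub>P\<^esub> q \<otimes>\<^bsub>P\<^esub> r) m" .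
qed

lemma m_comm: 
  assumes "p \<in> carrier P" "q \<in> carrier P"
  shows "p \<otimes>\<^bsub>P\<^esub> q = q \<otimes>\<^bsub>P\<^esub> p"
proof
  fix m
  have fin: "finite (supp p)" "finite (supp q)" and c: "\<And>a. p a \<in> carrier K" "\<And>a. q a \<in> carrier K"
    and sub: "supp p \<subseteq> carrier M" "supp q \<subseteq> carrier M" using assms by (auto simp: mem_carrier)
  have swap: "supp p \<times> supp q = prod.swap ` (supp q \<times> supp p)" by auto
  show "(p \<otimes>\<^bsub>P\<^esub> q) m = (q \<otimes>\<^bsub>P\<^esub> p) m"
    unfolding mult_eq[OF assms fin subset_refl subset_refl] mult_eq[OF assms(2,1) fin(2,1) subset_refl subset_refl]
    unfolding swap using c sub
    by (subst K.add.finprod_reindex) (auto intro!: K.add.finprod_cong' simp: K.m_comm M.m_comm subset_eq)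
qed

lemma r_distr: 
  assumes "p \<in> carrier P" "q \<in> carrier P" "r \<in> carrier P"
  shows "r \<otimes>\<^bsub>P\<^esub> (p \<oplus>\<^bsub>P\<^esub> q) = r \<otimes>\<^bsub>P\<^esub> p \<oplus>\<^bsub>P\<^esub> r \<otimes>\<^bsub>P\<^esub> q"
  using assms by (simp add: m_comm[of r] add_carrier l_distr)

lemma single_mult:
  assumes "a \<in> carrier M" "b \<in> carrier M" "c \<in> carrier K" "d \<in> carrier K"
  shows "single K a c \<otimes>\<^bsub>P\<^esub> single K b d = single K (a \<otimes>\<^bsub>M\<^esub> b) (c \<otimes>\<^bsub>K\<^esub> d)"
proof
  fix m
  have "supp (single K a c) \<subseteq> {a}" "supp (single K b d) \<subseteq> {b}" by (auto simp: single_def)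
  from mult_eq[OF single_carrier single_carrier _ _ this] 
  show "(single K a c \<otimes>\<^bsub>P\<^esub> single K b d) m = single K (a \<otimes>\<^bsub>M\<^esub> b) (c \<otimes>\<^bsub>K\<^esub> d) m"
    using assms by (auto simp: single_def)
qed

lemma single_add:
  "c \<in> carrier K \<Longrightarrow> d \<in> carrier K \<Longrightarrow> single K m c \<oplus>\<^bsub>P\<^esub> single K m d = single K m (c \<oplus>\<^bsub>K\<^esub> d)"
  by (auto simp: add_eq single_def)

lemma m_assoc:
  assumes "p \<in> carrier P" "q \<in> carrier P" "r \<in> carrier P"
  shows "(p \<otimes>\<^bsub>P\<^esub> q) \<otimes>\<^bsub>P\<^esub> r = p \<otimes>\<^bsub>P\<^esub> (q \<otimes>\<^bsub>P\<^esub> r)"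
  using assms(1)
proof (induction p rule: induct_single)
  case (single a c)
  from assms(2) show ?case
  proof (induction q rule: induct_single)
    case b: (single b d)
    from assms(3) show ?case
    proof (induction r rule: induct_single)
      case (single e f)
      then show ?case using b \<open>a \<in> carrier M\<close> \<open>c \<in> carrier K\<close>
        by (simp add: single_mult M.m_assoc K.m_assoc)
    qed (use b single in \<open>simp add: r_distr single_carrier mult_carrier single_mult\<close>)
  qed (use assms(3) single in \<open>simp add: l_distr r_distr single_carrier mult_carrier\<close>)
qed (use assms in \<open>simp add: l_distr mult_carrier\<close>)

lemma cring: "cring P"
proof (rule cringI)
  show "abelian_group P"
  proof (rule abelian_groupI)
    fix p assume p: "p \<in> carrier P"
    have supp: "supp (\<lambda>m. \<ominus>\<^bsub>K\<^esub> p m) = supp p"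
      using p K.add.inv_eq_1_iff by (auto simp: mem_carrier a_inv_def)
    have "(\<lambda>m. \<ominus>\<^bsub>K\<^esub> p m) \<in> carrier P" using p unfolding mem_carrier supp by simp
    moreover have "(\<lambda>m. \<ominus>\<^bsub>K\<^esub> p m) \<oplus>\<^bsub>P\<^esub> p = \<zero>\<^bsub>P\<^esub>" using p by (simp add: mem_carrier add_eq zero_eq K.l_neg)
    ultimately show "\<exists>q\<in>carrier P. q \<oplus>\<^bsub>P\<^esub> p = \<zero>\<^bsub>P\<^esub>" by blast
  next
    fix p q assume "p \<in> carrier P" "q \<in> carrier P"
    then show "p \<oplus>\<^bsub>P\<^esub> q = q \<oplus>\<^bsub>P\<^esub> p" by (auto simp: mem_carrier add_eq intro: K.a_comm)
  qed (auto simp: add_carrier, auto simp: mem_carrier zero_eq add_eq K.a_assoc)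
  show "Group.comm_monoid P"
  proof (rule comm_monoidI)
    fix p assume "p \<in> carrier P"
    then show "\<one>\<^bsub>P\<^esub> \<otimes>\<^bsub>P\<^esub> p = p"
    proof (induction p rule: induct_single)
      case (add p q)
      then show ?case by (simp add: one_eq r_distr single_carrier)
    qed (simp add: one_eq single_mult)
  qed (simp_all add: mult_carrier m_assoc one_eq single_carrier, rule m_comm)
qed (rule l_distr)

sublocale cring P by (rule cring)

text \<open>The map that the universal property of the monoid algebra attaches to a ring map
  \<open>s\<close> on scalars and a multiplicative map \<open>\<chi>\<close> on the monoid.\<close>

definition lin_ext :: "('b, 'e) ring_scheme \<Rightarrow> ('k \<Rightarrow> 'b) \<Rightarrow> ('a \<Rightarrow> 'b) \<Rightarrow> ('a \<Rightarrow> 'k) \<Rightarrow> 'b" where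
  "lin_ext T s \<chi> p = (\<Oplus>\<^bsub>T\<^esub>m\<in>supp p. s (p m) \<otimes>\<^bsub>T\<^esub> \<chi> m)"

context
  fixes T :: "('b, 'e) ring_scheme" and s \<chi>
  assumes T: "cring T" and s: "s \<in> ring_hom K T"
    and \<chi>: "\<And>a. a \<in> carrier M \<Longrightarrow> \<chi> a \<in> carrier T" "\<chi> \<one>\<^bsub>M\<^esub> = \<one>\<^bsub>T\<^esub>"
      "\<And>a b. a \<in> carrier M \<Longrightarrow> b \<in> carrier M \<Longrightarrow> \<chi> (a \<otimes>\<^bsub>M\<^esub> b) = \<chi> a \<otimes>\<^bsub>T\<^esub> \<chi> b"
begin

interpretation T: cring T by (rule T)
interpretation s: ring_hom_cring K T s by unfold_locales (rule s)

lemma lin_ext_superset: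
  assumes "p \<in> carrier P" "finite A" "supp p \<subseteq> A" "A \<subseteq> carrier M"
  shows "lin_ext T s \<chi> p = (\<Oplus>\<^bsub>T\<^esub>m\<in>A. s (p m) \<otimes>\<^bsub>T\<^esub> \<chi> m)"
  unfolding lin_ext_def using assms \<chi>
  by (intro T.add.finprod_mono_neutral_cong_left) (auto simp: mem_carrier subset_eq)

lemma lin_ext_closed: "p \<in> carrier P \<Longrightarrow> lin_ext T s \<chi> p \<in> carrier T"
  unfolding lin_ext_def using \<chi> by (intro T.finsum_closed) (auto simp: mem_carrier)

lemma lin_ext_add:
  assumes "p \<in> carrier P" "q \<in> carrier P"
  shows "lin_ext T s \<chi> (p \<oplus>\<^bsub>P\<^esub> q) = lin_ext T s \<chi> p \<oplus>\<^bsub>T\<^esub> lin_ext T s \<chi> q"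
proof -
  let ?A = "supp p \<union> supp q"
  have supp: "supp (p \<oplus>\<^bsub>P\<^esub> q) \<subseteq> ?A" by (auto simp: add_eq)
  have A: "finite ?A" "?A \<subseteq> carrier M" using assms by (auto simp: mem_carrier)
  have "lin_ext T s \<chi> (p \<oplus>\<^bsub>P\<^esub> q) = (\<Oplus>\<^bsub>T\<^esub>m\<in>?A. s (p m) \<otimes>\<^bsub>T\<^esub> \<chi> m \<oplus>\<^bsub>T\<^esub> s (q m) \<otimes>\<^bsub>T\<^esub> \<chi> m)"
    unfolding lin_ext_superset[OF add_carrier[OF assms] A(1) supp A(2)]
    by (intro T.add.finprod_cong') (use assms \<chi> in \<open>auto simp: mem_carrier add_eq T.l_distr\<close>)
  also have "\<dots> = lin_ext T s \<chi> p \<oplus>\<^bsub>T\<^esub> lin_ext T s \<chi> q"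
    unfolding lin_ext_superset[OF assms(1) A(1) Un_upper1 A(2)] lin_ext_superset[OF assms(2) A(1) Un_upper2 A(2)]
    by (rule T.finsum_addf) (use assms \<chi> in \<open>auto simp: mem_carrier\<close>)
  finally show ?thesis .
qed

lemma lin_ext_single:
  assumes "m \<in> carrier M" "c \<in> carrier K"
  shows "lin_ext T s \<chi> (single K m c) = s c \<otimes>\<^bsub>T\<^esub> \<chi> m"
proof -
  have "supp (single K m c) \<subseteq> {m}" by (auto simp: single_def)
  from lin_ext_superset[OF single_carrier[OF assms] _ this]
  show ?thesis using assms \<chi> by (simp add: single_def)
qed

lemma lin_ext_ring_hom: "lin_ext T s \<chi> \<in> ring_hom P T"
proof (rule ring_hom_memI)
  fix p q assume p: "p \<in> carrier P" and q: "q \<in> carrier P"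
  from p show "lin_ext T s \<chi> (p \<otimes>\<^bsub>P\<^esub> q) = lin_ext T s \<chi> p \<otimes>\<^bsub>T\<^esub> lin_ext T s \<chi> q"
  proof (induction p rule: induct_single)
    case a: (single a c)
    from q show ?case
    proof (induction q rule: induct_single)
      case (single b d)
      then have "s c \<in> carrier T" "s d \<in> carrier T" "\<chi> a \<in> carrier T" "\<chi> b \<in> carrier T"
        using a \<chi> by auto
      then have "s c \<otimes>\<^bsub>T\<^esub> s d \<otimes>\<^bsub>T\<^esub> (\<chi> a \<otimes>\<^bsub>T\<^esub> \<chi> b) = s c \<otimes>\<^bsub>T\<^esub> \<chi> a \<otimes>\<^bsub>T\<^esub> (s d \<otimes>\<^bsub>T\<^esub> \<chi> b)"
        by (simp add: T.m_ac)
      then show ?case using a single by (simp add: single_mult lin_ext_single \<chi>)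
    qed (use a in \<open>simp add: r_distr single_carrier mult_carrier lin_ext_add lin_ext_closed T.r_distr\<close>)
  qed (use q in \<open>simp add: l_distr mult_carrier lin_ext_add lin_ext_closed T.l_distr\<close>)
qed (simp_all add: lin_ext_add lin_ext_closed one_eq lin_ext_single \<chi>)

end

end

section \<open>Completed tensor products\<close>

lemma (in ring) sub_self: "a \<in> carrier R \<Longrightarrow> a \<ominus> a = \<zero>"
  by (simp add: a_minus_def r_neg)

lemma (in ring) add_sub_cancel: "a \<in> carrier R \<Longrightarrow> b \<in> carrier R \<Longrightarrow> (a \<oplus> b) \<ominus> b = a"
  by (simp add: a_minus_def r_neg a_assoc)

locale tensor = U: formal_alg K U + V: formal_alg K V
  for K :: "('k, 'c) ring_scheme" and U :: "('k, 'x, 'm) formal_algebra_scheme"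
    and V :: "('k, 'y, 'n) formal_algebra_scheme"
begin

sublocale P: monoid_alg K "U \<times>\<times> V"
proof (intro monoid_alg.intro U.K.cring_axioms)
  show "Group.comm_monoid (U \<times>\<times> V)"
    by (rule Group.comm_monoidI) (auto simp: DirProd_def U.m_assoc V.m_assoc intro: U.m_comm V.m_comm)
qed

abbreviation "F \<equiv> free_prod K U V"
abbreviation "D \<equiv> tensor_ideals K U V"
abbreviation "W \<equiv> ctensor K U V"
abbreviation "i1 \<equiv> incl1 K U V"
abbreviation "i2 \<equiv> incl2 K U V"

lemma prod_simps [simp]: "carrier (U \<times>\<times> V) = carrier U \<times> carrier V" "\<one>\<^bsub>U \<times>\<times> V\<^esub> = (\<one>\<^bsub>U\<^esub>, \<one>\<^bsub>V\<^esub>)"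
  "(x, y) \<otimes>\<^bsub>U \<times>\<times> V\<^esub> (x', y') = (x \<otimes>\<^bsub>U\<^esub> x', y \<otimes>\<^bsub>V\<^esub> y')"
  by (simp_all add: DirProd_def)

lemma e_closed [simp]:
  "x \<in> carrier U \<Longrightarrow> y \<in> carrier V \<Longrightarrow> c \<in> carrier K \<Longrightarrow> single K (x, y) c \<in> carrier F"
  by (rule P.single_carrier) simp_all

lemma relations_carrier: "tensor_relations K U V \<subseteq> carrier F"
  unfolding tensor_relations_def Let_def by auto

lemma gens_carrier:
  "tensor_relations K U V \<union> {single K (x, y) \<one>\<^bsub>K\<^esub> | x y. x \<in> carrier U \<and> y \<in> carrier V \<and> (x \<in> I \<or> y \<in> J)}
    \<subseteq> carrier F"
  using relations_carrier by auto

lemma tensor_ideal_gen: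
  "tensor_relations K U V \<subseteq> tensor_ideal K U V I J"
  "\<lbrakk>x \<in> carrier U; y \<in> carrier V; x \<in> I \<or> y \<in> J\<rbrakk> \<Longrightarrow> single K (x, y) \<one>\<^bsub>K\<^esub> \<in> tensor_ideal K U V I J"
  using P.genideal_self[OF gens_carrier, of I J] unfolding tensor_ideal_def by blast+

lemma ideal_tensor_ideal: "ideal (tensor_ideal K U V I J) F"
  unfolding tensor_ideal_def by (rule P.genideal_ideal[OF gens_carrier])

lemma tensor_ideal_minimal:
  assumes "ideal N F" "tensor_relations K U V \<subseteq> N"
    and "\<And>x y. \<lbrakk>x \<in> carrier U; y \<in> carrier V; x \<in> I \<or> y \<in> J\<rbrakk> \<Longrightarrow> single K (x, y) \<one>\<^bsub>K\<^esub> \<in> N"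
  shows "tensor_ideal K U V I J \<subseteq> N"
  unfolding tensor_ideal_def using assms by (intro P.genideal_minimal) auto

lemma tensor_ideal_mono:
  "I \<subseteq> I' \<Longrightarrow> J \<subseteq> J' \<Longrightarrow> tensor_ideal K U V I J \<subseteq> tensor_ideal K U V I' J'"
  by (rule tensor_ideal_minimal) (auto simp: ideal_tensor_ideal tensor_ideal_gen(1) intro!: tensor_ideal_gen(2))

lemma D_ideal: "N \<in> D \<Longrightarrow> ideal N F"
  by (auto simp: tensor_ideals_def ideal_tensor_ideal)

lemma D_relations: "N \<in> D \<Longrightarrow> tensor_relations K U V \<subseteq> N"
  using tensor_ideal_gen(1) by (auto simp: tensor_ideals_def)

lemma D_directed: 
  assumes "N \<in> D" "N' \<in> D"
  shows "\<exists>M\<in>D. M \<subseteq> N \<and> M \<subseteq> N'"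
proof -
  obtain I J I' J' where "N = tensor_ideal K U V I J" "N' = tensor_ideal K U V I' J'"
    and IJ: "I \<in> open_ideals U" "I' \<in> open_ideals U" "J \<in> open_ideals V" "J' \<in> open_ideals V"
    using assms by (auto simp: tensor_ideals_def)
  moreover have "tensor_ideal K U V (I \<inter> I') (J \<inter> J') \<in> D"
    unfolding tensor_ideals_def using U.Int_open_ideal[OF IJ(1,2)] V.Int_open_ideal[OF IJ(3,4)] by blast
  ultimately show ?thesis
    using tensor_ideal_mono[of "I \<inter> I'" I "J \<inter> J'" J] tensor_ideal_mono[of "I \<inter> I'" I' "J \<inter> J'" J'] by blast
qed

lemma D_nonempty: "D \<noteq> {}"
  using U.carrier_open_ideal V.carrier_open_ideal by (auto simp: tensor_ideals_def)

text \<open>A basic open set of the product topology restricts finitely many coordinates. Below a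
  common lower bound in \<open>D\<close> these restrictions amount to one on a single coordinate,
  which is why the limit is linearly topologised.\<close>

lemma D_lower_bound:
  "finite S \<Longrightarrow> S \<subseteq> D \<Longrightarrow> N \<in> D \<Longrightarrow> \<exists>M\<in>D. M \<subseteq> N \<and> (\<forall>N'\<in>S. M \<subseteq> N')"
proof (induction S rule: finite_induct)
  case (insert N' S)
  then obtain M where M: "M \<in> D" "M \<subseteq> N" "\<forall>N'\<in>S. M \<subseteq> N'" by blast
  moreover obtain M' where "M' \<in> D" "M' \<subseteq> M" "M' \<subseteq> N'" using D_directed[of M N'] M insert by auto
  ultimately show ?case by (intro bexI[of _ M']) auto
qed auto

text \<open>Compatible families of representatives; \<open>cls p\<close> is the element of the limit they define.\<close>

definition rep :: "(('x \<times> 'y \<Rightarrow> 'k) set \<Rightarrow> 'x \<times> 'y \<Rightarrow> 'k) \<Rightarrow> bool" where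
  "rep p \<longleftrightarrow> (\<forall>N\<in>D. p N \<in> carrier F) \<and> (\<forall>N\<in>D. \<forall>N'\<in>D. N \<subseteq> N' \<longrightarrow> p N \<ominus>\<^bsub>F\<^esub> p N' \<in> N')"

definition cls :: "(('x \<times> 'y \<Rightarrow> 'k) set \<Rightarrow> 'x \<times> 'y \<Rightarrow> 'k) \<Rightarrow> ('k, 'x, 'y) ctensor" where
  "cls p = (\<lambda>N\<in>D. N +>\<^bsub>F\<^esub> p N)"

lemma repD: "rep p \<Longrightarrow> N \<in> D \<Longrightarrow> p N \<in> carrier F"
  by (simp add: rep_def)

lemma coset_eq_iff:
  "N \<in> D \<Longrightarrow> p \<in> carrier F \<Longrightarrow> q \<in> carrier F \<Longrightarrow> N +>\<^bsub>F\<^esub> p = N +>\<^bsub>F\<^esub> q \<longleftrightarrow> p \<ominus>\<^bsub>F\<^esub> q \<in> N"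
  using P.quotient_eq_iff_same_a_r_cos[OF D_ideal] by blast

lemma coset_subset_iff:
  assumes "N \<in> D" "N' \<in> D" "N \<subseteq> N'" "p \<in> carrier F" "q \<in> carrier F"
  shows "N +>\<^bsub>F\<^esub> p \<subseteq> N' +>\<^bsub>F\<^esub> q \<longleftrightarrow> p \<ominus>\<^bsub>F\<^esub> q \<in> N'"
proof -
  interpret N: ideal N F by (rule D_ideal) fact
  interpret N': ideal N' F by (rule D_ideal) fact
  have "p \<in> N +>\<^bsub>F\<^esub> p" using assms by (rule_tac N.a_rcos_self)
  moreover have "N +>\<^bsub>F\<^esub> p \<subseteq> N' +>\<^bsub>F\<^esub> p" using assms(3) by (auto simp: a_r_coset_def')
  ultimately show ?thesis
    using coset_eq_iff[OF assms(2,4,5)] N'.mem_coset_iff[OF assms(5), of p] by blast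
qed

lemma carrier_W: "carrier W = ctensor_carrier K U V"
  by (simp add: ctensor_def Let_def)

lemma cls_carrier: "rep p \<Longrightarrow> cls p \<in> carrier W"
  unfolding carrier_W ctensor_carrier_def rep_def
  by (auto simp: cls_def FactRing_def A_RCOSETS_def' coset_subset_iff)

text \<open>Choosing a representative in each coset. All computations in the limit are then carried
  out in the free ring \<open>F\<close>, coordinate by coordinate.\<close>

lemma W_cases:
  assumes w: "w \<in> carrier W"
  obtains p where "rep p" "w = cls p"
proof -
  have *: "\<exists>p\<in>carrier F. w N = N +>\<^bsub>F\<^esub> p" if "N \<in> D" for N
  proof -
    have "w N \<in> a_rcosets\<^bsub>F\<^esub> N"
      using w that by (auto simp: carrier_W ctensor_carrier_def FactRing_def)
    then show ?thesis by (auto simp: A_RCOSETS_def')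
  qed
  then obtain p where p: "\<And>N. N \<in> D \<Longrightarrow> p N \<in> carrier F \<and> w N = N +>\<^bsub>F\<^esub> p N" by metis
  have ext: "w = cls p"
    using w p by (auto simp: carrier_W ctensor_carrier_def cls_def PiE_iff extensional_def fun_eq_iff)
  moreover have "rep p" unfolding rep_def
  proof (intro conjI ballI impI)
    fix N N' assume N: "N \<in> D" "N' \<in> D" "N \<subseteq> N'"
    then have "w N \<subseteq> w N'" using w by (auto simp: carrier_W ctensor_carrier_def)
    then show "p N \<ominus>\<^bsub>F\<^esub> p N' \<in> N'" using p N coset_subset_iff by simp
  qed (use p in simp)
  ultimately show thesis using that by blast
qed

lemma cls_eq_iff: "rep p \<Longrightarrow> rep q \<Longrightarrow> cls p = cls q \<longleftrightarrow> (\<forall>N\<in>D. p N \<ominus>\<^bsub>F\<^esub> q N \<in> N)"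
  unfolding cls_def fun_eq_iff by (auto simp: coset_eq_iff repD restrict_def)

lemma cls_cong: "(\<And>N. N \<in> D \<Longrightarrow> p N = q N) \<Longrightarrow> cls p = cls q"
  unfolding cls_def by (rule restrict_ext) simp

lemma rep_const: "p \<in> carrier F \<Longrightarrow> rep (\<lambda>N. p)"
  unfolding rep_def using additive_subgroup.zero_closed[OF ideal.axioms(1)[OF D_ideal]]
  by (simp add: a_minus_def P.r_neg)

lemma rep_add:
  assumes "rep p" "rep q" shows "rep (\<lambda>N. p N \<oplus>\<^bsub>F\<^esub> q N)"
  unfolding rep_def
proof (intro conjI ballI impI)
  fix N N' assume N: "N \<in> D" "N' \<in> D" "N \<subseteq> N'"
  interpret N': ideal N' F by (rule D_ideal) fact
  have c: "p N \<in> carrier F" "q N \<in> carrier F" "p N' \<in> carrier F" "q N' \<in> carrier F" using assms N repD by auto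
  have "p N \<ominus>\<^bsub>F\<^esub> p N' \<in> N'" "q N \<ominus>\<^bsub>F\<^esub> q N' \<in> N'" using assms N by (auto simp: rep_def)
  moreover have "p N \<oplus>\<^bsub>F\<^esub> q N \<ominus>\<^bsub>F\<^esub> (p N' \<oplus>\<^bsub>F\<^esub> q N') = (p N \<ominus>\<^bsub>F\<^esub> p N') \<oplus>\<^bsub>F\<^esub> (q N \<ominus>\<^bsub>F\<^esub> q N')"
    using c by algebra
  ultimately show "p N \<oplus>\<^bsub>F\<^esub> q N \<ominus>\<^bsub>F\<^esub> (p N' \<oplus>\<^bsub>F\<^esub> q N') \<in> N'" by simp
qed (use assms repD in simp)

lemma rep_mult:
  assumes "rep p" "rep q" shows "rep (\<lambda>N. p N \<otimes>\<^bsub>F\<^esub> q N)"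
  unfolding rep_def
proof (intro conjI ballI impI)
  fix N N' assume N: "N \<in> D" "N' \<in> D" "N \<subseteq> N'"
  interpret N': ideal N' F by (rule D_ideal) fact
  have c: "p N \<in> carrier F" "q N \<in> carrier F" "p N' \<in> carrier F" "q N' \<in> carrier F" using assms N repD by auto
  have "p N \<ominus>\<^bsub>F\<^esub> p N' \<in> N'" "q N \<ominus>\<^bsub>F\<^esub> q N' \<in> N'" using assms N by (auto simp: rep_def)
  then have "(p N \<ominus>\<^bsub>F\<^esub> p N') \<otimes>\<^bsub>F\<^esub> q N \<oplus>\<^bsub>F\<^esub> p N' \<otimes>\<^bsub>F\<^esub> (q N \<ominus>\<^bsub>F\<^esub> q N') \<in> N'"
    using c by (simp add: N'.I_l_closed N'.I_r_closed)
  moreover have "p N \<otimes>\<^bsub>F\<^esub> q N \<ominus>\<^bsub>F\<^esub> (p N' \<otimes>\<^bsub>F\<^esub> q N')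
      = (p N \<ominus>\<^bsub>F\<^esub> p N') \<otimes>\<^bsub>F\<^esub> q N \<oplus>\<^bsub>F\<^esub> p N' \<otimes>\<^bsub>F\<^esub> (q N \<ominus>\<^bsub>F\<^esub> q N')"
    using c by algebra
  ultimately show "p N \<otimes>\<^bsub>F\<^esub> q N \<ominus>\<^bsub>F\<^esub> (p N' \<otimes>\<^bsub>F\<^esub> q N') \<in> N'" by simp
qed (use assms repD in simp)

lemma cls_add: "rep p \<Longrightarrow> rep q \<Longrightarrow> cls p \<oplus>\<^bsub>W\<^esub> cls q = cls (\<lambda>N. p N \<oplus>\<^bsub>F\<^esub> q N)"
  by (auto simp: ctensor_def Let_def cls_def FactRing_def repD fun_eq_iff
      abelian_subgroup.a_rcos_sum[OF abelian_subgroupI3[OF ideal.axioms(1)[OF D_ideal] P.abelian_group_axioms]])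

lemma cls_mult: "rep p \<Longrightarrow> rep q \<Longrightarrow> cls p \<otimes>\<^bsub>W\<^esub> cls q = cls (\<lambda>N. p N \<otimes>\<^bsub>F\<^esub> q N)"
  by (auto simp: ctensor_def Let_def cls_def FactRing_def repD fun_eq_iff ideal.rcoset_mult_add[OF D_ideal])

lemma one_W: "\<one>\<^bsub>W\<^esub> = cls (\<lambda>N. \<one>\<^bsub>F\<^esub>)"
  by (simp add: ctensor_def Let_def cls_def FactRing_def)

lemma coset_zero: "N \<in> D \<Longrightarrow> N +>\<^bsub>F\<^esub> \<zero>\<^bsub>F\<^esub> = N"
  using ideal.Icarr[OF D_ideal] by (force simp: a_r_coset_def')

lemma zero_W: "\<zero>\<^bsub>W\<^esub> = cls (\<lambda>N. \<zero>\<^bsub>F\<^esub>)"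
  by (auto simp: ctensor_def Let_def cls_def FactRing_def fun_eq_iff coset_zero)

lemma zero_W_apply: "N \<in> D \<Longrightarrow> \<zero>\<^bsub>W\<^esub> N = N"
  by (simp add: ctensor_def Let_def FactRing_def)

lemma struct_W: "struct_map W c = cls (\<lambda>N. single K (\<one>\<^bsub>U\<^esub>, \<one>\<^bsub>V\<^esub>) c)"
  and i1_eq: "i1 x = cls (\<lambda>N. single K (x, \<one>\<^bsub>V\<^esub>) \<one>\<^bsub>K\<^esub>)"
  and i2_eq: "i2 y = cls (\<lambda>N. single K (\<one>\<^bsub>U\<^esub>, y) \<one>\<^bsub>K\<^esub>)"
  by (simp_all add: ctensor_def Let_def cls_def incl1_def incl2_def)

lemmas rep_intros = rep_const rep_add rep_mult

section \<open>The ring structure of the limit\<close>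

lemma W_cring: "cring W"
proof (rule cringI)
  show "abelian_group W"
  proof (rule abelian_groupI)
    fix x y assume "x \<in> carrier W" "y \<in> carrier W"
    then obtain p q where "rep p" "x = cls p" "rep q" "y = cls q" by (metis W_cases)
    then show "x \<oplus>\<^bsub>W\<^esub> y \<in> carrier W" "x \<oplus>\<^bsub>W\<^esub> y = y \<oplus>\<^bsub>W\<^esub> x"
      by (auto simp: cls_add rep_add P.a_comm repD intro!: cls_carrier cls_cong)
  next
    fix x y z assume "x \<in> carrier W" "y \<in> carrier W" "z \<in> carrier W"
    then obtain p q r where "rep p" "x = cls p" "rep q" "y = cls q" "rep r" "z = cls r" by (metis W_cases)
    then show "x \<oplus>\<^bsub>W\<^esub> y \<oplus>\<^bsub>W\<^esub> z = x \<oplus>\<^bsub>W\<^esub> (y \<oplus>\<^bsub>W\<^esub> z)"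
      by (auto simp: cls_add rep_add P.a_assoc repD intro!: cls_cong)
  next
    fix x assume "x \<in> carrier W"
    then obtain p where p: "rep p" "x = cls p" by (metis W_cases)
    then show "\<zero>\<^bsub>W\<^esub> \<oplus>\<^bsub>W\<^esub> x = x"
      by (auto simp: cls_add zero_W rep_const repD intro!: cls_cong)
    \<comment> \<open>The negative is written as a product with the constant \<open>-1\<close>, so
      that its compatibility follows from \<open>rep_const\<close> and
      \<open>rep_mult\<close>.\<close>
    have m: "rep (\<lambda>N. \<ominus>\<^bsub>F\<^esub> \<one>\<^bsub>F\<^esub> \<otimes>\<^bsub>F\<^esub> p N)" using p by (intro rep_intros) simp_all
    then show "\<exists>y\<in>carrier W. y \<oplus>\<^bsub>W\<^esub> x = \<zero>\<^bsub>W\<^esub>"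
      using p by (intro bexI[of _ "cls (\<lambda>N. \<ominus>\<^bsub>F\<^esub> \<one>\<^bsub>F\<^esub> \<otimes>\<^bsub>F\<^esub> p N)"])
        (auto simp: cls_add zero_W repD P.l_minus P.l_neg intro!: cls_cong cls_carrier)
  qed (simp add: zero_W cls_carrier rep_const)
  show "Group.comm_monoid W"
  proof (rule Group.comm_monoidI)
    fix x y assume "x \<in> carrier W" "y \<in> carrier W"
    then obtain p q where "rep p" "x = cls p" "rep q" "y = cls q" by (metis W_cases)
    then show "x \<otimes>\<^bsub>W\<^esub> y \<in> carrier W" "x \<otimes>\<^bsub>W\<^esub> y = y \<otimes>\<^bsub>W\<^esub> x"
      by (auto simp: cls_mult rep_mult P.m_comm repD intro!: cls_carrier cls_cong)
  next
    fix x y z assume "x \<in> carrier W" "y \<in> carrier W" "z \<in> carrier W"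
    then obtain p q r where "rep p" "x = cls p" "rep q" "y = cls q" "rep r" "z = cls r" by (metis W_cases)
    then show "x \<otimes>\<^bsub>W\<^esub> y \<otimes>\<^bsub>W\<^esub> z = x \<otimes>\<^bsub>W\<^esub> (y \<otimes>\<^bsub>W\<^esub> z)"
      by (auto simp: cls_mult rep_mult P.m_assoc repD intro!: cls_cong)
  next
    fix x assume "x \<in> carrier W"
    then obtain p where "rep p" "x = cls p" by (metis W_cases)
    then show "\<one>\<^bsub>W\<^esub> \<otimes>\<^bsub>W\<^esub> x = x"
      by (auto simp: cls_mult one_W rep_const repD intro!: cls_cong)
  qed (simp add: one_W cls_carrier rep_const)
  fix x y z assume "x \<in> carrier W" "y \<in> carrier W" "z \<in> carrier W"
  then obtain p q r where "rep p" "x = cls p" "rep q" "y = cls q" "rep r" "z = cls r" by (metis W_cases)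
  then show "(x \<oplus>\<^bsub>W\<^esub> y) \<otimes>\<^bsub>W\<^esub> z = x \<otimes>\<^bsub>W\<^esub> z \<oplus>\<^bsub>W\<^esub> y \<otimes>\<^bsub>W\<^esub> z"
    by (auto simp: cls_mult cls_add rep_mult rep_add P.l_distr repD intro!: cls_cong)
qed

sublocale W: cring W by (rule W_cring)

lemma cls_minus:
  assumes "rep p" "rep q"
  shows "rep (\<lambda>N. p N \<ominus>\<^bsub>F\<^esub> q N)" "cls p \<ominus>\<^bsub>W\<^esub> cls q = cls (\<lambda>N. p N \<ominus>\<^bsub>F\<^esub> q N)"
proof -
  have m: "rep (\<lambda>N. \<ominus>\<^bsub>F\<^esub> \<one>\<^bsub>F\<^esub> \<otimes>\<^bsub>F\<^esub> q N)" using assms by (intro rep_intros) simp_all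
  have "rep (\<lambda>N. p N \<oplus>\<^bsub>F\<^esub> (\<ominus>\<^bsub>F\<^esub> \<one>\<^bsub>F\<^esub> \<otimes>\<^bsub>F\<^esub> q N))" by (rule rep_add[OF assms(1) m])
  then show r: "rep (\<lambda>N. p N \<ominus>\<^bsub>F\<^esub> q N)"
    using repD[OF assms(1)] repD[OF assms(2)] by (simp add: rep_def a_minus_def P.l_minus)
  have "cls (\<lambda>N. p N \<ominus>\<^bsub>F\<^esub> q N) \<oplus>\<^bsub>W\<^esub> cls q = cls (\<lambda>N. (p N \<ominus>\<^bsub>F\<^esub> q N) \<oplus>\<^bsub>F\<^esub> q N)"
    by (rule cls_add[OF r assms(2)])
  also have "\<dots> = cls p"
    using repD[OF assms(1)] repD[OF assms(2)] by (intro cls_cong) (simp add: P.minus_eq P.a_assoc P.l_neg)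
  finally have "cls (\<lambda>N. p N \<ominus>\<^bsub>F\<^esub> q N) \<oplus>\<^bsub>W\<^esub> cls q = cls p" .
  then show "cls p \<ominus>\<^bsub>W\<^esub> cls q = cls (\<lambda>N. p N \<ominus>\<^bsub>F\<^esub> q N)"
    using W.add_sub_cancel[OF cls_carrier[OF r] cls_carrier[OF assms(2)]] by simp
qed

text \<open>The zero of the quotient by \<open>N\<close> is the coset \<open>N\<close> itself, so
  this is the kernel of the projection to coordinate \<open>N\<close>. These kernels serve as the
  basis of open ideals of the limit.\<close>

definition kern :: "('x \<times> 'y \<Rightarrow> 'k) set \<Rightarrow> ('k, 'x, 'y) ctensor set" where
  "kern N = {w \<in> carrier W. w N = N}"

lemma cls_kern_iff:
  assumes "rep p" "N \<in> D"
  shows "cls p \<in> kern N \<longleftrightarrow> p N \<in> N"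
proof -
  have "cls p \<in> kern N \<longleftrightarrow> N +>\<^bsub>F\<^esub> p N = N +>\<^bsub>F\<^esub> \<zero>\<^bsub>F\<^esub>"
    using assms cls_carrier unfolding coset_zero[OF assms(2)] by (simp add: kern_def cls_def)
  also have "\<dots> \<longleftrightarrow> p N \<in> N"
    using assms repD by (subst coset_eq_iff) (simp_all add: P.minus_eq)
  finally show ?thesis .
qed

lemma kern_ideal: 
  assumes N: "N \<in> D" shows "ideal (kern N) W"
proof (rule idealI)
  interpret N: ideal N F by (rule D_ideal) fact
  show "subgroup (kern N) (add_monoid W)"
  proof (rule W.add.subgroupI)
    show "kern N \<subseteq> carrier W" by (auto simp: kern_def)
    show "kern N \<noteq> {}" using zero_W_apply[OF N] by (auto simp: kern_def)
    fix x assume x: "x \<in> kern N"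
    then have xc: "x \<in> carrier W" by (simp add: kern_def)
    then obtain p where p: "rep p" "x = cls p" by (rule W_cases)
    have "\<zero>\<^bsub>W\<^esub> \<ominus>\<^bsub>W\<^esub> x \<in> kern N"
      using p x N cls_minus[OF rep_const p(1), of "\<zero>\<^bsub>F\<^esub>"] cls_kern_iff[OF p(1) N]
      by (simp add: zero_W cls_kern_iff N.sub_closed)
    then show "\<ominus>\<^bsub>W\<^esub> x \<in> kern N" using xc by (simp add: W.minus_eq)
  next
    fix x y assume "x \<in> kern N" "y \<in> kern N"
    moreover from this obtain p q where "rep p" "x = cls p" "rep q" "y = cls q"
      by (metis (no_types, lifting) W_cases kern_def mem_Collect_eq)
    ultimately show "x \<oplus>\<^bsub>W\<^esub> y \<in> kern N" using N
      by (simp add: cls_add cls_kern_iff rep_add)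
  qed
  fix a x assume "a \<in> kern N" "x \<in> carrier W"
  moreover from this obtain p q where "rep p" "a = cls p" "rep q" "x = cls q"
    by (metis (no_types, lifting) W_cases kern_def mem_Collect_eq)
  ultimately show "x \<otimes>\<^bsub>W\<^esub> a \<in> kern N" "a \<otimes>\<^bsub>W\<^esub> x \<in> kern N" using N
    by (simp_all add: cls_mult cls_kern_iff rep_mult N.I_l_closed N.I_r_closed repD)
qed (rule W.ring_axioms)

lemma kern_mono: 
  assumes "N \<in> D" "N' \<in> D" "N \<subseteq> N'" shows "kern N \<subseteq> kern N'"
proof
  fix w assume w: "w \<in> kern N"
  then obtain p where p: "rep p" "w = cls p" by (metis (no_types, lifting) W_cases kern_def mem_Collect_eq)
  interpret N': ideal N' F by (rule D_ideal) fact
  have c: "p N \<in> carrier F" "p N' \<in> carrier F" using p assms repD by auto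
  have "p N \<in> N'" "p N \<ominus>\<^bsub>F\<^esub> p N' \<in> N'" using w p assms by (auto simp: cls_kern_iff rep_def)
  then have "p N \<ominus>\<^bsub>F\<^esub> (p N \<ominus>\<^bsub>F\<^esub> p N') \<in> N'" by (rule N'.sub_closed)
  moreover have "p N \<ominus>\<^bsub>F\<^esub> (p N \<ominus>\<^bsub>F\<^esub> p N') = p N'" using c by algebra
  ultimately show "w \<in> kern N'" using p assms by (simp add: cls_kern_iff)
qed

lemma kern_coset:
  assumes N: "N \<in> D" and w: "w \<in> carrier W"
  shows "kern N +>\<^bsub>W\<^esub> w = {w' \<in> carrier W. w' N = w N}"
proof -
  obtain p where p: "rep p" "w = cls p" using w by (rule W_cases)
  interpret k: ideal "kern N" W by (rule kern_ideal) fact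
  have "w' \<ominus>\<^bsub>W\<^esub> w \<in> kern N \<longleftrightarrow> w' N = w N" if w': "w' \<in> carrier W" for w'
  proof -
    obtain q where q: "rep q" "w' = cls q" using w' by (rule W_cases)
    have "w' \<ominus>\<^bsub>W\<^esub> w \<in> kern N \<longleftrightarrow> q N \<ominus>\<^bsub>F\<^esub> p N \<in> N"
      using p q N by (simp add: cls_minus cls_kern_iff)
    also have "\<dots> \<longleftrightarrow> w' N = w N"
      using p q N repD by (simp add: cls_def coset_eq_iff)
    finally show ?thesis .
  qed
  then show ?thesis using k.mem_coset_iff[OF w] by blast
qed

section \<open>The topology of the limit\<close>

lemma W_topspace: "topspace (topol W) = carrier W"
  by (auto simp: ctensor_def Let_def ctensor_carrier_def)

lemma W_openin: "openin (topol W) Y \<longleftrightarrow> Y \<subseteq> carrier W \<and> (\<forall>w\<in>Y. \<exists>I\<in>kern ` D. I +>\<^bsub>W\<^esub> w \<subseteq> Y)"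
proof -
  define PT where "PT = product_topology (\<lambda>N. discrete_topology (carrier (F Quot N))) D"
  have top: "topol W = subtopology PT (carrier W)" by (simp add: ctensor_def Let_def PT_def)
  have sub: "carrier W \<subseteq> topspace PT" by (auto simp: PT_def ctensor_def Let_def ctensor_carrier_def)
  show ?thesis
  proof (intro iffI conjI ballI)
    assume "openin (topol W) Y"
    then show "Y \<subseteq> carrier W" using W_topspace openin_subset by blast
  next
    fix w assume Y: "openin (topol W) Y" and w: "w \<in> Y"
    then obtain T where T: "openin PT T" "Y = T \<inter> carrier W" by (auto simp: top openin_subtopology)
    then obtain S where S: "finite {N \<in> D. S N \<noteq> carrier (F Quot N)}" "w \<in> Pi\<^sub>E D S" "Pi\<^sub>E D S \<subseteq> T"
      using w by (auto simp: PT_def openin_product_topology_alt)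
    obtain N0 where "N0 \<in> D" using D_nonempty by blast
    then obtain N where N: "N \<in> D" "\<And>N'. N' \<in> D \<Longrightarrow> S N' \<noteq> carrier (F Quot N') \<Longrightarrow> N \<subseteq> N'"
      using D_lower_bound[OF S(1), of N0] by blast
    have wc: "w \<in> carrier W" using w T by simp
    have "w' \<in> Y" if w': "w' \<in> carrier W" "w' N = w N" for w'
    proof -
      have "w' N' \<in> S N'" if N': "N' \<in> D" for N'
      proof (cases "S N' = carrier (F Quot N')")
        case True
        then show ?thesis using w' N' sub by (auto simp: PT_def)
      next
        case False
        then have "N \<subseteq> N'" using N N' by blast
        then have "w' \<ominus>\<^bsub>W\<^esub> w \<in> kern N'"
          using kern_coset[OF N(1) wc] w' wc kern_mono[OF N(1) N'] ideal.mem_coset_iff[OF kern_ideal[OF N(1)] wc]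
          by blast
        then have "w' N' = w N'"
          using kern_coset[OF N' wc] w' wc ideal.mem_coset_iff[OF kern_ideal[OF N'] wc] by blast
        then show ?thesis using S N' by auto
      qed
      moreover have "w' \<in> extensional D" using w' sub by (auto simp: PT_def PiE_def)
      ultimately show ?thesis using S T w' by (auto simp: PiE_def)
    qed
    then show "\<exists>I\<in>kern ` D. I +>\<^bsub>W\<^esub> w \<subseteq> Y" using kern_coset[OF N(1) wc] N(1) by auto
  next
    assume Y: "Y \<subseteq> carrier W \<and> (\<forall>w\<in>Y. \<exists>I\<in>kern ` D. I +>\<^bsub>W\<^esub> w \<subseteq> Y)"
    show "openin (topol W) Y"
    proof (subst openin_subopen, intro ballI)
      fix w assume w: "w \<in> Y"
      then obtain N where N: "N \<in> D" "kern N +>\<^bsub>W\<^esub> w \<subseteq> Y" using Y by blast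
      have wc: "w \<in> carrier W" using Y w by blast
      have "w N \<in> carrier (F Quot N)" using wc sub N by (auto simp: PT_def)
      then have "openin PT {f \<in> topspace PT. f N \<in> {w N}}"
        unfolding PT_def using N
        by (intro openin_continuous_map_preimage[OF continuous_map_product_projection]) auto
      then have "openin (topol W) ({f \<in> topspace PT. f N \<in> {w N}} \<inter> carrier W)"
        unfolding top by (rule openin_subtopology_Int)
      moreover have "{f \<in> topspace PT. f N \<in> {w N}} \<inter> carrier W = kern N +>\<^bsub>W\<^esub> w"
        using kern_coset[OF N(1) wc] sub by auto
      ultimately show "\<exists>T. openin (topol W) T \<and> w \<in> T \<and> T \<subseteq> Y"
        using N wc kern_coset by (metis (mono_tags, lifting) mem_Collect_eq)
    qed
  qed
qed

lemma struct_W_hom: "struct_map W \<in> ring_hom K W"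
  by (rule ring_hom_memI)
    (auto simp: struct_W cls_carrier rep_const cls_mult cls_add P.single_mult P.single_add one_W P.one_eq)

lemma W_separated:
  assumes "w \<in> carrier W" "\<And>N. N \<in> D \<Longrightarrow> w \<in> kern N"
  shows "w = \<zero>\<^bsub>W\<^esub>"
proof -
  obtain p where p: "rep p" "w = cls p" using assms by (metis W_cases)
  then show ?thesis
    using assms(2) repD[OF p(1)] by (auto simp: zero_W cls_eq_iff rep_const cls_kern_iff P.minus_eq)
qed

lemma W_complete:
  assumes x: "\<And>I. I \<in> kern ` D \<Longrightarrow> x I \<in> carrier W"
    and compat: "\<And>I J. I \<in> kern ` D \<Longrightarrow> J \<in> kern ` D \<Longrightarrow> I \<subseteq> J \<Longrightarrow> x I \<ominus>\<^bsub>W\<^esub> x J \<in> J"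
  shows "\<exists>z\<in>carrier W. \<forall>I\<in>kern ` D. z \<ominus>\<^bsub>W\<^esub> x I \<in> I"
proof -
  have "\<exists>p. rep p \<and> x (kern N) = cls p" if "N \<in> D" for N using x that by (metis W_cases imageI)
  then obtain p where p: "\<And>N. N \<in> D \<Longrightarrow> rep (p N)" "\<And>N. N \<in> D \<Longrightarrow> x (kern N) = cls (p N)" by metis
  have c: "p N N' \<in> carrier F" if "N \<in> D" "N' \<in> D" for N N' using p that repD by blast
  \<comment> \<open>The diagonal family is the limit: its coordinate \<open>N\<close> is taken from
    the element prescribed modulo \<open>kern N\<close>.\<close>
  have r: "rep (\<lambda>N. p N N)"
    unfolding rep_def
  proof (intro conjI ballI impI)
    fix N N' assume N: "N \<in> D" "N' \<in> D" "N \<subseteq> N'"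
    interpret N': ideal N' F by (rule D_ideal) fact
    have "cls (p N) \<ominus>\<^bsub>W\<^esub> cls (p N') \<in> kern N'" using compat[of "kern N" "kern N'"] kern_mono N p by auto
    then have "p N N' \<ominus>\<^bsub>F\<^esub> p N' N' \<in> N'" using N p by (simp add: cls_minus cls_kern_iff)
    moreover have "p N N \<ominus>\<^bsub>F\<^esub> p N N' \<in> N'" using p(1)[OF N(1)] N by (simp add: rep_def)
    moreover have "p N N \<ominus>\<^bsub>F\<^esub> p N' N' = (p N N \<ominus>\<^bsub>F\<^esub> p N N') \<oplus>\<^bsub>F\<^esub> (p N N' \<ominus>\<^bsub>F\<^esub> p N' N')"
      using c N by algebra
    ultimately show "p N N \<ominus>\<^bsub>F\<^esub> p N' N' \<in> N'" by simp
  qed (use c in simp)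
  have "cls (\<lambda>N. p N N) \<ominus>\<^bsub>W\<^esub> x (kern N) \<in> kern N" if N: "N \<in> D" for N
    using additive_subgroup.zero_closed[OF ideal.axioms(1)[OF D_ideal[OF N]]]
    by (simp add: p N cls_minus[OF r] cls_kern_iff cls_minus(1)[OF r] c P.sub_self)
  then show ?thesis using cls_carrier[OF r] by blast
qed

lemma formal_W: "formal_algebra K W"
  and kern_open: "N \<in> D \<Longrightarrow> kern N \<in> open_ideals W"
  and kern_within: "I \<in> open_ideals W \<Longrightarrow> \<exists>N\<in>D. kern N \<subseteq> I"
proof -
  have i: "\<And>I. I \<in> kern ` D \<Longrightarrow> ideal I W" using kern_ideal by blast
  have s: "\<And>w. w \<in> carrier W \<Longrightarrow> (\<And>I. I \<in> kern ` D \<Longrightarrow> w \<in> I) \<Longrightarrow> w = \<zero>\<^bsub>W\<^esub>" using W_separated by blast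
  note * = formal_algebraI[OF U.K.cring_axioms W_cring struct_W_hom W_topspace i W_openin s W_complete]
  show "formal_algebra K W" by (rule *(1))
  show "N \<in> D \<Longrightarrow> kern N \<in> open_ideals W" using *(2) by blast
  show "I \<in> open_ideals W \<Longrightarrow> \<exists>N\<in>D. kern N \<subseteq> I" using *(3) by blast
qed

end

lemma (in cring) add_diff_add:
  assumes "a \<in> carrier R" "b \<in> carrier R" "c \<in> carrier R" "d \<in> carrier R"
  shows "(a \<oplus> b) \<ominus> (c \<oplus> d) = (a \<ominus> c) \<oplus> (b \<ominus> d)"
  using assms by algebra

section \<open>The universal property of the completed tensor product\<close>

context tensor begin

sublocale W: formal_alg K W by (simp add: formal_alg_def formal_W)

lemma D_relation:
  assumes N: "N \<in> D"
  shows "\<lbrakk>x \<in> carrier U; x' \<in> carrier U; y \<in> carrier V\<rbrakk> \<Longrightarrow>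
      single K (x \<oplus>\<^bsub>U\<^esub> x', y) \<one>\<^bsub>K\<^esub> \<ominus>\<^bsub>F\<^esub> (single K (x, y) \<one>\<^bsub>K\<^esub> \<oplus>\<^bsub>F\<^esub> single K (x', y) \<one>\<^bsub>K\<^esub>) \<in> N"
    and "\<lbrakk>x \<in> carrier U; y \<in> carrier V; y' \<in> carrier V\<rbrakk> \<Longrightarrow>
      single K (x, y \<oplus>\<^bsub>V\<^esub> y') \<one>\<^bsub>K\<^esub> \<ominus>\<^bsub>F\<^esub> (single K (x, y) \<one>\<^bsub>K\<^esub> \<oplus>\<^bsub>F\<^esub> single K (x, y') \<one>\<^bsub>K\<^esub>) \<in> N"
    and "\<lbrakk>x \<in> carrier U; y \<in> carrier V; c \<in> carrier K\<rbrakk> \<Longrightarrow>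
      single K (struct_map U c \<otimes>\<^bsub>U\<^esub> x, y) \<one>\<^bsub>K\<^esub> \<ominus>\<^bsub>F\<^esub> single K (x, y) c \<in> N"
    and "\<lbrakk>x \<in> carrier U; y \<in> carrier V; c \<in> carrier K\<rbrakk> \<Longrightarrow>
      single K (x, struct_map V c \<otimes>\<^bsub>V\<^esub> y) \<one>\<^bsub>K\<^esub> \<ominus>\<^bsub>F\<^esub> single K (x, y) c \<in> N"
  by (rule subsetD[OF D_relations[OF N]], unfold tensor_relations_def Let_def, blast)+

lemma i1_hom: "formal_hom K U W i1"
proof (rule formal_homI[OF U.formal formal_W])
  show "i1 \<in> ring_hom U W"
    by (rule ring_hom_memI)
      (auto simp: i1_eq cls_carrier rep_const cls_mult P.single_mult cls_add cls_eq_iff rep_add D_relation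
        one_W P.one_eq)
  show "i1 (struct_map U c) = struct_map W c" if "c \<in> carrier K" for c
    using that D_relation(3)[of _ "\<one>\<^bsub>U\<^esub>" "\<one>\<^bsub>V\<^esub>" c]
    by (auto simp: i1_eq struct_W cls_eq_iff rep_const)
  fix J assume "J \<in> open_ideals W"
  then obtain N where N: "N \<in> D" "kern N \<subseteq> J" using kern_within by blast
  then obtain I I' where I: "N = tensor_ideal K U V I I'" "I \<in> open_ideals U" by (auto simp: tensor_ideals_def)
  have "i1 r \<in> J" if r: "r \<in> I" for r
  proof -
    have "r \<in> carrier U" using r I U.open_idealD ideal.Icarr by metis
    then have "i1 r \<in> kern N" using r N(1) tensor_ideal_gen(2)[of r "\<one>\<^bsub>V\<^esub>" I I']
      by (simp add: i1_eq cls_kern_iff rep_const) (simp add: I)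
    then show ?thesis using N by blast
  qed
  then show "\<exists>I\<in>open_ideals U. \<forall>r\<in>I. i1 r \<in> J" using I by blast
qed

lemma i2_hom: "formal_hom K V W i2"
proof (rule formal_homI[OF V.formal formal_W])
  show "i2 \<in> ring_hom V W"
    by (rule ring_hom_memI)
      (auto simp: i2_eq cls_carrier rep_const cls_mult P.single_mult cls_add cls_eq_iff rep_add D_relation
        one_W P.one_eq)
  show "i2 (struct_map V c) = struct_map W c" if "c \<in> carrier K" for c
    using that D_relation(4)[of _ "\<one>\<^bsub>U\<^esub>" "\<one>\<^bsub>V\<^esub>" c]
    by (auto simp: i2_eq struct_W cls_eq_iff rep_const)
  fix J assume "J \<in> open_ideals W"
  then obtain N where N: "N \<in> D" "kern N \<subseteq> J" using kern_within by blast
  then obtain I I' where I: "N = tensor_ideal K U V I' I" "I \<in> open_ideals V" by (auto simp: tensor_ideals_def)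
  have "i2 r \<in> J" if r: "r \<in> I" for r
  proof -
    have "r \<in> carrier V" using r I V.open_idealD ideal.Icarr by metis
    then have "i2 r \<in> kern N" using r N(1) tensor_ideal_gen(2)[of "\<one>\<^bsub>U\<^esub>" r I' I]
      by (simp add: i2_eq cls_kern_iff rep_const) (simp add: I)
    then show ?thesis using N by blast
  qed
  then show "\<exists>I\<in>open_ideals V. \<forall>r\<in>I. i2 r \<in> J" using I by blast
qed

sublocale i1: formal_map K U W i1
  by (rule formal_mapI[OF U.formal formal_W i1_hom])
sublocale i2: formal_map K V W i2
  by (rule formal_mapI[OF V.formal formal_W i2_hom])

lemma cls_single:
  assumes "x \<in> carrier U" "y \<in> carrier V" "c \<in> carrier K"
  shows "cls (\<lambda>N. single K (x, y) c) = i1 (struct_map U c \<otimes>\<^bsub>U\<^esub> x) \<otimes>\<^bsub>W\<^esub> i2 y"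
proof -
  have "struct_map W c \<otimes>\<^bsub>W\<^esub> (i1 x \<otimes>\<^bsub>W\<^esub> i2 y) = cls (\<lambda>N. single K (x, y) c)"
    using assms by (simp add: i1_eq i2_eq struct_W cls_mult rep_const P.single_mult)
  then show ?thesis using assms by (simp add: i1.hom_struct W.m_assoc)
qed

text \<open>Modulo \<open>kern N\<close> an element of the limit agrees with a constant family, and
  that is a finite sum of monomials whose scalars are absorbed into the first factor.
  \<open>M\<close> is an arbitrary additively closed set so that the density can be applied to
  properties as well as to spans.\<close>

lemma dense:
  assumes w: "w \<in> carrier W" and Q: "Q \<in> open_ideals W"
    and gen: "\<And>x y. x \<in> carrier U \<Longrightarrow> y \<in> carrier V \<Longrightarrow> i1 x \<otimes>\<^bsub>W\<^esub> i2 y \<in> M"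
    and add: "\<And>a b. a \<in> M \<Longrightarrow> b \<in> M \<Longrightarrow> a \<oplus>\<^bsub>W\<^esub> b \<in> M"
  shows "\<exists>a\<in>M. a \<in> carrier W \<and> w \<ominus>\<^bsub>W\<^esub> a \<in> Q"
proof -
  have M: "cls (\<lambda>N. p) \<in> M" if "p \<in> carrier F" for p
    using that
  proof (induction p rule: P.induct_single)
    case (single m c)
    then obtain x y where m: "m = (x, y)" "x \<in> carrier U" "y \<in> carrier V" by auto
    then have "i1 (struct_map U c \<otimes>\<^bsub>U\<^esub> x) \<otimes>\<^bsub>W\<^esub> i2 y \<in> M" using single by (intro gen) simp_all
    then show ?case using single m by (simp only: cls_single)
  next
    case (add p q)
    then show ?case using assms(4)[of "cls (\<lambda>N. p)" "cls (\<lambda>N. q)"] by (simp add: cls_add rep_const)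
  qed
  obtain N where N: "N \<in> D" "kern N \<subseteq> Q" using kern_within Q by blast
  obtain p where p: "rep p" "w = cls p" using w by (rule W_cases)
  then have "p N \<in> carrier F" using N repD by blast
  moreover from this have "w \<ominus>\<^bsub>W\<^esub> cls (\<lambda>_. p N) \<in> kern N"
    using p N additive_subgroup.zero_closed[OF ideal.axioms(1)[OF D_ideal[OF N(1)]]]
    by (simp add: cls_minus rep_const cls_kern_iff P.sub_self)
  ultimately show ?thesis using M N cls_carrier rep_const by blast
qed

text \<open>The map \<open>h\<close> is merely additive because it will be a difference of ring
  homomorphisms or a multiple of one. With \<open>Z\<close> equal to zero this gives uniqueness
  statements; with \<open>Z\<close> the topologically nilpotent elements it gives
  \<open>copair_nilpotent\<close>.\<close>

lemma additive_dense:
  assumes T: "formal_algebra K T" and h: "\<And>w. w \<in> carrier W \<Longrightarrow> h w \<in> carrier T"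
    and h_add: "\<And>v w. v \<in> carrier W \<Longrightarrow> w \<in> carrier W \<Longrightarrow> h (v \<oplus>\<^bsub>W\<^esub> w) = h v \<oplus>\<^bsub>T\<^esub> h w"
    and cont: "\<And>J. J \<in> open_ideals T \<Longrightarrow> \<exists>Q\<in>open_ideals W. \<forall>w\<in>Q. h w \<in> J"
    and gen: "\<And>x y. x \<in> carrier U \<Longrightarrow> y \<in> carrier V \<Longrightarrow> h (i1 x \<otimes>\<^bsub>W\<^esub> i2 y) \<in> Z"
    and Z: "\<And>a b. a \<in> Z \<Longrightarrow> b \<in> Z \<Longrightarrow> a \<oplus>\<^bsub>T\<^esub> b \<in> Z"
    and w: "w \<in> carrier W" and J: "J \<in> open_ideals T"
  shows "\<exists>z\<in>Z. z \<in> carrier T \<and> h w \<ominus>\<^bsub>T\<^esub> z \<in> J"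
proof -
  interpret T: formal_alg K T by unfold_locales fact
  obtain Q where Q: "Q \<in> open_ideals W" "\<forall>w\<in>Q. h w \<in> J" using cont J by blast
  have "\<exists>a\<in>{a \<in> carrier W. h a \<in> Z}. a \<in> carrier W \<and> w \<ominus>\<^bsub>W\<^esub> a \<in> Q"
    by (rule dense[OF w Q(1)]) (use gen Z h_add in auto)
  then obtain a where a: "a \<in> carrier W" "h a \<in> Z" "w \<ominus>\<^bsub>W\<^esub> a \<in> Q" by blast
  have "w = (w \<ominus>\<^bsub>W\<^esub> a) \<oplus>\<^bsub>W\<^esub> a" using w a by (simp add: W.minus_eq W.a_assoc W.l_neg)
  then have "h w = h (w \<ominus>\<^bsub>W\<^esub> a) \<oplus>\<^bsub>T\<^esub> h a" using h_add w a by (metis W.minus_closed)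
  then have "h w \<ominus>\<^bsub>T\<^esub> h a = h (w \<ominus>\<^bsub>W\<^esub> a)"
    using h w a by (simp add: T.minus_eq T.a_assoc T.r_neg)
  then show ?thesis using a Q h by (intro bexI[of _ "h a"]) auto
qed

lemma additive_zero:
  assumes T: "formal_algebra K T" and h: "\<And>w. w \<in> carrier W \<Longrightarrow> h w \<in> carrier T"
    and h_add: "\<And>v w. v \<in> carrier W \<Longrightarrow> w \<in> carrier W \<Longrightarrow> h (v \<oplus>\<^bsub>W\<^esub> w) = h v \<oplus>\<^bsub>T\<^esub> h w"
    and cont: "\<And>J. J \<in> open_ideals T \<Longrightarrow> \<exists>Q\<in>open_ideals W. \<forall>w\<in>Q. h w \<in> J"
    and gen: "\<And>x y. x \<in> carrier U \<Longrightarrow> y \<in> carrier V \<Longrightarrow> h (i1 x \<otimes>\<^bsub>W\<^esub> i2 y) = \<zero>\<^bsub>T\<^esub>"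
    and w: "w \<in> carrier W"
  shows "h w = \<zero>\<^bsub>T\<^esub>"
proof (rule formal_alg.Inter_open_ideals)
  interpret T: formal_alg K T by unfold_locales fact
  show "formal_alg K T" ..
  show "h w \<in> carrier T" using h w .
  fix J assume J: "J \<in> open_ideals T"
  have "\<exists>z\<in>{\<zero>\<^bsub>T\<^esub>}. z \<in> carrier T \<and> h w \<ominus>\<^bsub>T\<^esub> z \<in> J"
    by (rule additive_dense[OF assms(1-4) _ _ w J]) (simp_all add: gen)
  then show "h w \<in> J" using h w by (simp add: T.minus_eq)
qed

lemma hom_ext:
  assumes T: "formal_algebra K T" and h: "formal_hom K W T h" and h': "formal_hom K W T h'"
    and "\<And>x. x \<in> carrier U \<Longrightarrow> h (i1 x) = h' (i1 x)"
    and "\<And>y. y \<in> carrier V \<Longrightarrow> h (i2 y) = h' (i2 y)"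
    and w: "w \<in> carrier W"
  shows "h w = h' w"
proof -
  interpret T: formal_alg K T by unfold_locales fact
  interpret h: formal_map K W T h by (rule formal_mapI[OF formal_W T h])
  interpret h': formal_map K W T h' by (rule formal_mapI[OF formal_W T h'])
  have "h w \<ominus>\<^bsub>T\<^esub> h' w = \<zero>\<^bsub>T\<^esub>"
  proof (rule additive_zero[OF T _ _ _ _ w, where h = "\<lambda>w. h w \<ominus>\<^bsub>T\<^esub> h' w"])
    fix v w assume vw: "v \<in> carrier W" "w \<in> carrier W"
    then show "h (v \<oplus>\<^bsub>W\<^esub> w) \<ominus>\<^bsub>T\<^esub> h' (v \<oplus>\<^bsub>W\<^esub> w) = (h v \<ominus>\<^bsub>T\<^esub> h' v) \<oplus>\<^bsub>T\<^esub> (h w \<ominus>\<^bsub>T\<^esub> h' w)"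
      using vw by (simp add: T.add_diff_add)
  next
    fix J assume J: "J \<in> open_ideals T"
    let ?Q = "{w \<in> carrier W. h w \<in> J} \<inter> {w \<in> carrier W. h' w \<in> J}"
    have "?Q \<in> open_ideals W" using J by (intro W.Int_open_ideal h.vimage_open_ideal h'.vimage_open_ideal)
    moreover have "\<forall>w\<in>?Q. h w \<ominus>\<^bsub>T\<^esub> h' w \<in> J" using ideal.sub_closed[OF T.open_idealD[OF J]] by blast
    ultimately show "\<exists>Q\<in>open_ideals W. \<forall>w\<in>Q. h w \<ominus>\<^bsub>T\<^esub> h' w \<in> J" by blast
  qed (use assms in \<open>simp_all add: T.minus_eq T.r_neg\<close>)
  then show ?thesis using w by simp
qed

text \<open>The map \<open>L\<close> on the free ring induced by \<open>f\<close> and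
  \<open>g\<close> kills the tensor relations and sends \<open>NN J\<close> into \<open>J\<close>. A
  compatible family \<open>p\<close> therefore yields the compatible family
  \<open>L (p (NN J))\<close> in \<open>T\<close>, whose limit exists because \<open>T\<close> is
  complete and is unique because \<open>T\<close> is Hausdorff. Uniqueness also makes the limit
  independent of the representatives and multiplicative.\<close>

lemma copair_exists:
  assumes T: "formal_algebra K T" and f: "formal_hom K U T f" and g: "formal_hom K V T g"
  shows "\<exists>h. formal_hom K W T h \<and> (\<forall>x\<in>carrier U. h (i1 x) = f x) \<and> (\<forall>y\<in>carrier V. h (i2 y) = g y)"
proof -
  interpret T: formal_alg K T by unfold_locales fact
  interpret f: formal_map K U T f by (rule formal_mapI[OF U.formal T f])
  interpret g: formal_map K V T g by (rule formal_mapI[OF V.formal T g])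
  define \<chi> where "\<chi> z = f (fst z) \<otimes>\<^bsub>T\<^esub> g (snd z)" for z
  define L where "L = P.lin_ext T (struct_map T) \<chi>"
  have s: "struct_map T \<in> ring_hom K T" by (rule T.str.homh)
  have \<chi>: "\<And>z. z \<in> carrier (U \<times>\<times> V) \<Longrightarrow> \<chi> z \<in> carrier T" "\<chi> \<one>\<^bsub>U \<times>\<times> V\<^esub> = \<one>\<^bsub>T\<^esub>"
    "\<And>z z'. z \<in> carrier (U \<times>\<times> V) \<Longrightarrow> z' \<in> carrier (U \<times>\<times> V) \<Longrightarrow> \<chi> (z \<otimes>\<^bsub>U \<times>\<times> V\<^esub> z') = \<chi> z \<otimes>\<^bsub>T\<^esub> \<chi> z'"
    by (auto simp: \<chi>_def) (simp add: DirProd_def T.m_ac)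
  have Lh: "L \<in> ring_hom F T" unfolding L_def by (rule P.lin_ext_ring_hom[OF T.cring_axioms s \<chi>])
  interpret L: ring_hom_cring F T L by unfold_locales (rule Lh)
  have L_sub: "L (p \<ominus>\<^bsub>F\<^esub> q) = L p \<ominus>\<^bsub>T\<^esub> L q" if "p \<in> carrier F" "q \<in> carrier F" for p q
    using that by (simp add: P.minus_eq T.minus_eq)
  have L_single: "L (single K (x, y) c) = struct_map T c \<otimes>\<^bsub>T\<^esub> (f x \<otimes>\<^bsub>T\<^esub> g y)"
    if "x \<in> carrier U" "y \<in> carrier V" "c \<in> carrier K" for x y c
    using P.lin_ext_single[OF T.cring_axioms s \<chi>, of "(x, y)" c] that by (simp add: L_def) (simp add: \<chi>_def)
  have L_rel: "L p = \<zero>\<^bsub>T\<^esub>" if "p \<in> tensor_relations K U V" for p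
    using that unfolding tensor_relations_def Let_def
    by (auto simp: L_sub L_single T.l_distr T.r_distr f.hom_struct g.hom_struct T.m_ac T.minus_eq T.r_neg)
  define NN where "NN J = tensor_ideal K U V {x \<in> carrier U. f x \<in> J} {y \<in> carrier V. g y \<in> J}" for J
  have NN_D: "NN J \<in> D" if "J \<in> open_ideals T" for J
    using f.vimage_open_ideal[OF that] g.vimage_open_ideal[OF that] by (auto simp: NN_def tensor_ideals_def)
  have NN_L: "L p \<in> J" if J: "J \<in> open_ideals T" and p: "p \<in> NN J" for J p
  proof -
    interpret J: ideal J T by (rule T.open_idealD[OF J])
    have "ideal {p \<in> carrier F. L p \<in> J} F"
      by (rule ring_hom_ring.ideal_vimage[OF ring_hom_ringI2[OF P.ring_axioms T.ring_axioms Lh] J.ideal_axioms])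
    then have "NN J \<subseteq> {p \<in> carrier F. L p \<in> J}"
      unfolding NN_def using relations_carrier
      by (rule_tac tensor_ideal_minimal) (auto simp: L_rel L_single J.I_l_closed J.I_r_closed)
    then show ?thesis using p by blast
  qed
  have NN_mono: "NN J \<subseteq> NN J'" if "J \<subseteq> J'" for J J'
    unfolding NN_def using that by (intro tensor_ideal_mono) auto
  \<comment> \<open>That is, \<open>z\<close> is the limit in \<open>T\<close> of the images of the
    coordinates of \<open>p\<close>.\<close>
  define good where "good p z \<longleftrightarrow> z \<in> carrier T \<and> (\<forall>J\<in>open_ideals T. z \<ominus>\<^bsub>T\<^esub> L (p (NN J)) \<in> J)" for p z
  have good_ex: "\<exists>z. good p z" if p: "rep p" for p
  proof -
    have "\<exists>z\<in>carrier T. \<forall>J\<in>open_ideals T. z \<ominus>\<^bsub>T\<^esub> L (p (NN J)) \<in> J"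
    proof (rule T.complete)
      show "L (p (NN J)) \<in> carrier T" if "J \<in> open_ideals T" for J
        using repD[OF p NN_D[OF that]] by simp
      fix J J' assume J: "J \<in> open_ideals T" "J' \<in> open_ideals T" "J \<subseteq> J'"
      then have "p (NN J) \<ominus>\<^bsub>F\<^esub> p (NN J') \<in> NN J'" using p NN_D NN_mono by (simp add: rep_def)
      then show "L (p (NN J)) \<ominus>\<^bsub>T\<^esub> L (p (NN J')) \<in> J'"
        using NN_L[OF J(2)] by (metis L_sub repD[OF p NN_D] J(1,2))
    qed
    then show ?thesis unfolding good_def by blast
  qed
  have good_unique: "z = z'" if p: "rep p" "rep q" "cls p = cls q" and z: "good p z" "good q z'" for p q z z'
  proof (rule T.separated)
    fix J assume J: "J \<in> open_ideals T"
    interpret J: ideal J T by (rule T.open_idealD[OF J])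
    have c: "p (NN J) \<in> carrier F" "q (NN J) \<in> carrier F" using repD p NN_D[OF J] by auto
    have "p (NN J) \<ominus>\<^bsub>F\<^esub> q (NN J) \<in> NN J" using p NN_D[OF J] by (simp add: cls_eq_iff)
    then have "L (p (NN J)) \<ominus>\<^bsub>T\<^esub> L (q (NN J)) \<in> J" using NN_L[OF J] by (metis L_sub c)
    moreover have "z \<ominus>\<^bsub>T\<^esub> L (p (NN J)) \<in> J" "z' \<ominus>\<^bsub>T\<^esub> L (q (NN J)) \<in> J" using z J by (auto simp: good_def)
    ultimately have "((z \<ominus>\<^bsub>T\<^esub> L (p (NN J))) \<oplus>\<^bsub>T\<^esub> (L (p (NN J)) \<ominus>\<^bsub>T\<^esub> L (q (NN J)))) \<ominus>\<^bsub>T\<^esub> (z' \<ominus>\<^bsub>T\<^esub> L (q (NN J))) \<in> J"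
      using J.sub_closed J.a_closed by blast
    moreover have "((z \<ominus>\<^bsub>T\<^esub> L (p (NN J))) \<oplus>\<^bsub>T\<^esub> (L (p (NN J)) \<ominus>\<^bsub>T\<^esub> L (q (NN J)))) \<ominus>\<^bsub>T\<^esub> (z' \<ominus>\<^bsub>T\<^esub> L (q (NN J))) = z \<ominus>\<^bsub>T\<^esub> z'"
    proof -
      have "L (p (NN J)) \<in> carrier T" "L (q (NN J)) \<in> carrier T" using c by auto
      moreover have "z \<in> carrier T" "z' \<in> carrier T" using z by (auto simp: good_def)
      ultimately show ?thesis by algebra
    qed
    ultimately show "z \<ominus>\<^bsub>T\<^esub> z' \<in> J" by simp
  qed (use z in \<open>auto simp: good_def\<close>)
  \<comment> \<open>The representative and its limit are chosen together; \<open>good_unique\<close>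
    shows that the value does not depend on either choice.\<close>
  define h where "h w = (SOME z. \<exists>p. rep p \<and> w = cls p \<and> good p z)" for w
  have h_good: "good p (h (cls p))" if p: "rep p" for p
  proof -
    have "\<exists>z q. rep q \<and> cls p = cls q \<and> good q z" using good_ex[OF p] p by blast
    then have "\<exists>q. rep q \<and> cls p = cls q \<and> good q (h (cls p))" unfolding h_def by (rule someI_ex)
    then obtain q where q: "rep q" "cls p = cls q" "good q (h (cls p))" by blast
    obtain z where "good p z" using good_ex[OF p] by blast
    with good_unique[OF p q(1,2)] q show ?thesis by metis
  qed
  have h_eq: "h (cls p) = z" if "rep p" "good p z" for p z
    using good_unique[OF that(1) that(1) refl h_good[OF that(1)] that(2)] .
  have zero: "L p \<ominus>\<^bsub>T\<^esub> L p \<in> J" if "J \<in> open_ideals T" "p \<in> carrier F" for J p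
    using that additive_subgroup.zero_closed[OF ideal.axioms(1)[OF T.open_idealD]] by (simp add: T.minus_eq T.r_neg)
  have good_const: "good (\<lambda>N. p) (L p)" if "p \<in> carrier F" for p
    using that zero by (simp add: good_def)
  have const: "h (cls (\<lambda>N. p)) = L p" if "p \<in> carrier F" for p
    by (rule h_eq[OF rep_const[OF that] good_const[OF that]])
  have mult: "h (cls p \<otimes>\<^bsub>W\<^esub> cls q) = h (cls p) \<otimes>\<^bsub>T\<^esub> h (cls q)"
    and add: "h (cls p \<oplus>\<^bsub>W\<^esub> cls q) = h (cls p) \<oplus>\<^bsub>T\<^esub> h (cls q)" if p: "rep p" and q: "rep q" for p q
  proof -
    let ?a = "h (cls p)" and ?b = "h (cls q)"
    have ab: "?a \<in> carrier T" "?b \<in> carrier T" "\<And>J. J \<in> open_ideals T \<Longrightarrow> ?a \<ominus>\<^bsub>T\<^esub> L (p (NN J)) \<in> J"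
      "\<And>J. J \<in> open_ideals T \<Longrightarrow> ?b \<ominus>\<^bsub>T\<^esub> L (q (NN J)) \<in> J"
      using h_good p q by (auto simp: good_def)
    have 1: "?a \<otimes>\<^bsub>T\<^esub> ?b \<ominus>\<^bsub>T\<^esub> L (p (NN J) \<otimes>\<^bsub>F\<^esub> q (NN J)) \<in> J \<and> ?a \<oplus>\<^bsub>T\<^esub> ?b \<ominus>\<^bsub>T\<^esub> L (p (NN J) \<oplus>\<^bsub>F\<^esub> q (NN J)) \<in> J"
      if J: "J \<in> open_ideals T" for J
    proof -
      interpret J: ideal J T by (rule T.open_idealD[OF J])
      have c: "p (NN J) \<in> carrier F" "q (NN J) \<in> carrier F" using repD p q NN_D[OF J] by auto
      then have Lc: "L (p (NN J)) \<in> carrier T" "L (q (NN J)) \<in> carrier T" by auto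
      have "?a \<otimes>\<^bsub>T\<^esub> ?b \<ominus>\<^bsub>T\<^esub> L (p (NN J)) \<otimes>\<^bsub>T\<^esub> L (q (NN J))
        = ?a \<otimes>\<^bsub>T\<^esub> (?b \<ominus>\<^bsub>T\<^esub> L (q (NN J))) \<oplus>\<^bsub>T\<^esub> (?a \<ominus>\<^bsub>T\<^esub> L (p (NN J))) \<otimes>\<^bsub>T\<^esub> L (q (NN J))"
        "?a \<oplus>\<^bsub>T\<^esub> ?b \<ominus>\<^bsub>T\<^esub> (L (p (NN J)) \<oplus>\<^bsub>T\<^esub> L (q (NN J)))
        = (?a \<ominus>\<^bsub>T\<^esub> L (p (NN J))) \<oplus>\<^bsub>T\<^esub> (?b \<ominus>\<^bsub>T\<^esub> L (q (NN J)))"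
        using ab(1,2) Lc by algebra+
      then show ?thesis using c ab Lc J by (simp add: J.I_l_closed J.I_r_closed)
    qed
    show "h (cls p \<otimes>\<^bsub>W\<^esub> cls q) = ?a \<otimes>\<^bsub>T\<^esub> ?b"
      unfolding cls_mult[OF p q] by (rule h_eq) (use 1 ab rep_mult[OF p q] in \<open>simp_all add: good_def\<close>)
    show "h (cls p \<oplus>\<^bsub>W\<^esub> cls q) = ?a \<oplus>\<^bsub>T\<^esub> ?b"
      unfolding cls_add[OF p q] by (rule h_eq) (use 1 ab rep_add[OF p q] in \<open>simp_all add: good_def\<close>)
  qed
  have "formal_hom K W T h"
  proof (rule formal_homI[OF formal_W T])
    show "h \<in> ring_hom W T"
    proof (rule ring_hom_memI)
      fix v w assume vw: "v \<in> carrier W" "w \<in> carrier W"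
      then obtain p q where pq: "rep p" "v = cls p" "rep q" "w = cls q" by (metis W_cases)
      then show "h (v \<otimes>\<^bsub>W\<^esub> w) = h v \<otimes>\<^bsub>T\<^esub> h w" "h (v \<oplus>\<^bsub>W\<^esub> w) = h v \<oplus>\<^bsub>T\<^esub> h w" "h v \<in> carrier T"
        using mult add h_good by (auto simp: good_def)
    qed (simp add: one_W const)
    show "h (struct_map W c) = struct_map T c" if "c \<in> carrier K" for c
      using that by (simp add: struct_W const L_single)
    fix J assume J: "J \<in> open_ideals T"
    interpret J: ideal J T by (rule T.open_idealD[OF J])
    have "h w \<in> J" if w: "w \<in> kern (NN J)" for w
    proof -
      obtain p where p: "rep p" "w = cls p" using w by (metis (no_types, lifting) W_cases kern_def mem_Collect_eq)
      then have "p (NN J) \<in> NN J" using w NN_D[OF J] by (simp add: cls_kern_iff)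
      then have "L (p (NN J)) \<in> J" using NN_L J by blast
      moreover have "h w \<ominus>\<^bsub>T\<^esub> L (p (NN J)) \<in> J" "h w \<in> carrier T" using h_good p J by (auto simp: good_def)
      ultimately have "(h w \<ominus>\<^bsub>T\<^esub> L (p (NN J))) \<oplus>\<^bsub>T\<^esub> L (p (NN J)) \<in> J" "L (p (NN J)) \<in> carrier T"
        using J.Icarr by auto
      then show ?thesis using \<open>h w \<in> carrier T\<close> by (simp add: T.minus_eq T.a_assoc T.l_neg)
    qed
    then show "\<exists>I\<in>open_ideals W. \<forall>w\<in>I. h w \<in> J" using kern_open[OF NN_D[OF J]] by blast
  qed
  moreover have "h (i1 x) = f x" if "x \<in> carrier U" for x using that by (simp add: i1_eq const L_single)
  moreover have "h (i2 y) = g y" if "y \<in> carrier V" for y using that by (simp add: i2_eq const L_single)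
  ultimately show ?thesis by blast
qed

lemma copair:
  assumes T: "formal_algebra K T" and f: "formal_hom K U T f" and g: "formal_hom K V T g"
  shows copair_hom: "formal_hom K W T (copair K U V T f g)"
    and copair_i1: "\<And>x. x \<in> carrier U \<Longrightarrow> copair K U V T f g (i1 x) = f x"
    and copair_i2: "\<And>y. y \<in> carrier V \<Longrightarrow> copair K U V T f g (i2 y) = g y"
proof -
  let ?Q = "\<lambda>h. h \<in> extensional (carrier W) \<and> formal_hom K W T h \<and>
        (\<forall>x\<in>carrier U. h (i1 x) = f x) \<and> (\<forall>y\<in>carrier V. h (i2 y) = g y)"
  obtain h where h: "formal_hom K W T h" "\<forall>x\<in>carrier U. h (i1 x) = f x" "\<forall>y\<in>carrier V. h (i2 y) = g y"
    using copair_exists[OF assms] by blast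
  interpret h: formal_map K W T h by (rule formal_mapI[OF formal_W T h(1)])
  have ex1: "\<exists>!h. ?Q h"
  proof (rule ex1I)
    show "?Q (restrict h (carrier W))" using h by (simp add: h.formal_hom_cong)
    fix h' assume "?Q h'"
    then show "h' = restrict h (carrier W)"
      using hom_ext[OF T, of h' h] h by (intro extensionalityI[of _ "carrier W"]) auto
  qed
  have "?Q (copair K U V T f g)" unfolding copair_def by (rule theI'[OF ex1])
  then show "formal_hom K W T (copair K U V T f g)"
    "\<And>x. x \<in> carrier U \<Longrightarrow> copair K U V T f g (i1 x) = f x"
    "\<And>y. y \<in> carrier V \<Longrightarrow> copair K U V T f g (i2 y) = g y" by blast+
qed

end

lemma tensorI: "formal_algebra K U \<Longrightarrow> formal_algebra K V \<Longrightarrow> tensor K U V"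
  by (simp add: tensor_def formal_alg_def)

section \<open>Groups of points\<close>

lemma copair_cong:
  assumes "\<And>x. x \<in> carrier U \<Longrightarrow> f x = f' x" "\<And>y. y \<in> carrier V \<Longrightarrow> g y = g' y"
  shows "copair K U V T f g = copair K U V T f' g'"
  unfolding copair_def using assms by simp

lemma (in tensor) comp_copair:
  assumes T: "formal_algebra K T" "formal_algebra K T'" and f: "formal_hom K U T f" and g: "formal_hom K V T g"
    and t: "formal_hom K T T' t" and w: "w \<in> carrier W"
  shows "t (copair K U V T f g w) = copair K U V T' (t \<circ> f) (t \<circ> g) w"
proof -
  note tf = formal_hom_comp[OF f t] and tg = formal_hom_comp[OF g t]
  have "(t \<circ> copair K U V T f g) w = copair K U V T' (t \<circ> f) (t \<circ> g) w"
  proof (rule hom_ext[OF T(2) _ _ _ _ w])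
    show "formal_hom K W T' (t \<circ> copair K U V T f g)"
      by (rule formal_hom_comp[OF copair_hom[OF T(1) f g] t])
    show "formal_hom K W T' (copair K U V T' (t \<circ> f) (t \<circ> g))"
      by (rule copair_hom[OF T(2) tf tg])
    show "(t \<circ> copair K U V T f g) (i1 x) = copair K U V T' (t \<circ> f) (t \<circ> g) (i1 x)" if x: "x \<in> carrier U" for x
      using copair_i1[OF T(1) f g x] copair_i1[OF T(2) tf tg x] by simp
    show "(t \<circ> copair K U V T f g) (i2 y) = copair K U V T' (t \<circ> f) (t \<circ> g) (i2 y)" if y: "y \<in> carrier V" for y
      using copair_i2[OF T(1) f g y] copair_i2[OF T(2) tf tg y] by simp
  qed
  then show ?thesis by simp
qed

text \<open>Applied to \<open>comult\<close>, this identifies the comultiplication with the sum of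
  the two tautological points, which is the form in which homomorphisms of formal groups are
  recognised.\<close>

lemma (in tensor) copair_i1_i2: "w \<in> carrier W \<Longrightarrow> copair K U V W i1 i2 w = w"
  using hom_ext[OF formal_W copair_hom[OF formal_W i1_hom i2_hom], of "\<lambda>w. w"]
  by (simp add: copair_i1 copair_i2 formal_W i1_hom i2_hom)
    (simp add: formal_hom_def ring_hom_def continuous_map_id[unfolded id_def])

lemmas ctensor_formal = tensor.formal_W[OF tensorI]
  and incl1_hom = tensor.i1_hom[OF tensorI]
  and incl2_hom = tensor.i2_hom[OF tensorI]
  and copair_formal_hom = tensor.copair_hom[OF tensorI]
  and copair_incl1 = tensor.copair_i1[OF tensorI]
  and copair_incl2 = tensor.copair_i2[OF tensorI]
  and copair_incl1_incl2 = tensor.copair_i1_i2[OF tensorI]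
  and comp_copair = tensor.comp_copair[OF tensorI]
  and ctensor_hom_ext = tensor.hom_ext[OF tensorI]

lemma formal_hom_closed: "formal_hom K R T f \<Longrightarrow> r \<in> carrier R \<Longrightarrow> f r \<in> carrier T"
  by (auto simp: formal_hom_def ring_hom_def)

lemma formal_hom_id: "formal_hom K R R (\<lambda>r. r)"
  by (simp add: formal_hom_def ring_hom_def continuous_map_id[unfolded id_def])

lemma discrete_formal_algebra:
  assumes K: "cring K" and R: "cring R" and s: "struct_map R \<in> ring_hom K R"
    and top: "topol R = discrete_topology (carrier R)"
  shows "formal_algebra K R" and "{\<zero>\<^bsub>R\<^esub>} \<in> open_ideals R"
proof -
  interpret R: cring R by fact
  have coset: "{\<zero>\<^bsub>R\<^esub>} +>\<^bsub>R\<^esub> x = {x}" if "x \<in> carrier R" for x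
    using that by (auto simp: a_r_coset_def')
  have 1: "\<And>I. I \<in> {{\<zero>\<^bsub>R\<^esub>}} \<Longrightarrow> ideal I R" by (simp add: R.zeroideal)
  have 2: "openin (topol R) Y \<longleftrightarrow> Y \<subseteq> carrier R \<and> (\<forall>x\<in>Y. \<exists>I\<in>{{\<zero>\<^bsub>R\<^esub>}}. I +>\<^bsub>R\<^esub> x \<subseteq> Y)" for Y
    using coset by (auto simp: top)
  have 3: "\<And>x. x \<in> carrier R \<Longrightarrow> (\<And>I. I \<in> {{\<zero>\<^bsub>R\<^esub>}} \<Longrightarrow> x \<in> I) \<Longrightarrow> x = \<zero>\<^bsub>R\<^esub>" by simp
  have 4: "\<exists>z\<in>carrier R. \<forall>I\<in>{{\<zero>\<^bsub>R\<^esub>}}. z \<ominus>\<^bsub>R\<^esub> x I \<in> I"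
    if "\<And>I. I \<in> {{\<zero>\<^bsub>R\<^esub>}} \<Longrightarrow> x I \<in> carrier R" for x
    using that[of "{\<zero>\<^bsub>R\<^esub>}"] by (auto simp: R.sub_self)
  have t: "topspace (topol R) = carrier R" by (simp add: top)
  note * = formal_algebraI[OF K R s t 1 2 3 4]
  show "formal_algebra K R" by (rule *(1))
  show "{\<zero>\<^bsub>R\<^esub>} \<in> open_ideals R" using *(2) by blast
qed

lemma base_simps [simp]: "carrier (base_algebra K) = carrier K" "monoid.mult (base_algebra K) = monoid.mult K"
  "one (base_algebra K) = one K" "ring.zero (base_algebra K) = ring.zero K" "ring.add (base_algebra K) = ring.add K"
  "struct_map (base_algebra K) = (\<lambda>c. c)" "topol (base_algebra K) = discrete_topology (carrier K)"
  by (simp_all add: base_algebra_def)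

text \<open>Different extensions of the ring record are unrelated types, so ring axioms are carried
  over along equality of the fields.\<close>

lemma cring_transfer:
  fixes R :: "('a, 'b) ring_scheme" and S :: "('a, 'e) ring_scheme"
  assumes "cring R" and eq: "carrier S = carrier R" "monoid.mult S = monoid.mult R" "one S = one R"
    "ring.zero S = ring.zero R" "ring.add S = ring.add R"
  shows "cring S"
proof -
  interpret R: cring R by fact
  show ?thesis
  proof (rule cringI)
    show "abelian_group S"
      by (rule abelian_groupI) (auto simp: eq R.a_assoc intro: R.a_comm R.add.l_inv_ex)
    show "Group.comm_monoid S"
      by (rule Group.comm_monoidI) (auto simp: eq R.m_assoc intro: R.m_comm)
  qed (simp add: eq R.l_distr)
qed

lemma base_cring: "cring K \<Longrightarrow> cring (base_algebra K)"
  by (rule cring_transfer) simp_all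

lemma base_formal:
  assumes "cring K"
  shows "formal_algebra K (base_algebra K)" and "{\<zero>\<^bsub>K\<^esub>} \<in> open_ideals (base_algebra K)"
  using discrete_formal_algebra[OF assms base_cring[OF assms]] by (simp_all add: ring_hom_def)

lemma (in formal_alg) struct_hom: "formal_hom K (base_algebra K) R (struct_map R)"
proof (rule formal_homI[OF base_formal(1)[OF K.cring_axioms] formal])
  show "struct_map R \<in> ring_hom (base_algebra K) R"
    using str.homh by (simp add: ring_hom_def)
  show "\<exists>I\<in>open_ideals (base_algebra K). \<forall>r\<in>I. struct_map R r \<in> J" if "J \<in> open_ideals R" for J
    using base_formal(2)[OF K.cring_axioms] additive_subgroup.zero_closed[OF ideal.axioms(1)[OF open_idealD[OF that]]]
    by (intro bexI) auto
qed simp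

locale formal_grp =
  fixes K :: "('k, 'c) ring_scheme" and G :: "('k, 'r, 'm) formal_group_scheme"
  assumes group: "comm_formal_group K G"
begin

sublocale formal_alg K G
  using group by unfold_locales (simp add: comm_formal_group_def)

abbreviation "W2 \<equiv> ctensor K G G"
abbreviation "W3 \<equiv> ctensor K G W2"

lemmas W2_formal = ctensor_formal[OF formal formal]
  and W3_formal = ctensor_formal[OF formal ctensor_formal[OF formal formal]]
  and p_hom = incl1_hom[OF formal formal] incl2_hom[OF formal formal]
  and q_hom = incl1_hom[OF formal ctensor_formal[OF formal formal]] incl2_hom[OF formal ctensor_formal[OF formal formal]]

lemma comult_hom: "formal_hom K G (ctensor K G G) (comult G)"
  and counit_hom: "formal_hom K G (base_algebra K) (counit G)"
  and antipode_hom: "formal_hom K G G (antipode G)"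
  using group by (simp_all add: comm_formal_group_def)

lemma comult_closed: "r \<in> carrier G \<Longrightarrow> comult G r \<in> carrier (ctensor K G G)"
  using comult_hom by (auto simp: formal_hom_def ring_hom_def)

abbreviation "padd \<equiv> point_add K G"

lemma padd_hom:
  assumes "formal_algebra K T" "formal_hom K G T f" "formal_hom K G T g"
  shows "formal_hom K G T (padd T f g)"
  using formal_hom_comp[OF comult_hom copair_formal_hom[OF formal formal assms]] by (simp add: point_add_def comp_def)

lemma padd_cong:
  assumes "\<And>x. x \<in> carrier G \<Longrightarrow> f x = f' x" "\<And>x. x \<in> carrier G \<Longrightarrow> g x = g' x"
  shows "padd T f g = padd T f' g'"
  unfolding point_add_def using copair_cong[of G f f' G g g' K T] assms by simp

text \<open>This is what allows an identity between tautological points to be specialised to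
  arbitrary points.\<close>

lemma padd_natural:
  assumes "formal_algebra K T" "formal_algebra K T'" "formal_hom K G T f" "formal_hom K G T g"
    and "formal_hom K T T' t" "r \<in> carrier G"
  shows "t (padd T f g r) = padd T' (t \<circ> f) (t \<circ> g) r"
  unfolding point_add_def by (rule comp_copair[OF formal formal assms(1-5) comult_closed[OF assms(6)]])

lemma pzero_hom: "formal_algebra K T \<Longrightarrow> formal_hom K G T (point_zero G T)"
  using formal_hom_comp[OF counit_hom formal_alg.struct_hom[of K T]]
  by (simp add: formal_alg_def point_zero_def comp_def)

context
  fixes T :: "('k, 't, 'n) formal_algebra_scheme"
  assumes T: "formal_algebra K T"
begin

interpretation T: formal_alg K T by (simp add: formal_alg_def T)

text \<open>A Yoneda argument: the axiom concerns the two projections over \<open>W2\<close>, and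
  applying the map classified by \<open>f\<close> and \<open>g\<close> turns them into
  \<open>f\<close> and \<open>g\<close>. The other group laws for points are obtained in the same
  manner.\<close>

lemma padd_comm:
  assumes f: "formal_hom K G T f" and g: "formal_hom K G T g" and r: "r \<in> carrier G"
  shows "padd T f g r = padd T g f r"
proof -
  let ?t = "copair K G G T f g"
  note h = W2_formal p_hom(1) p_hom(2) copair_formal_hom[OF formal formal T f g]
  have "padd W2 (incl1 K G G) (incl2 K G G) r = padd W2 (incl2 K G G) (incl1 K G G) r"
    using group r unfolding comm_formal_group_def Let_def by blast
  then have "?t (padd W2 (incl1 K G G) (incl2 K G G) r) = ?t (padd W2 (incl2 K G G) (incl1 K G G) r)" by simp
  moreover have "?t (padd W2 (incl1 K G G) (incl2 K G G) r) = padd T f g r"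
    using padd_natural[OF h(1) T h(2,3,4) r] padd_cong[of "?t \<circ> incl1 K G G" f "?t \<circ> incl2 K G G" g T]
    by (simp add: copair_incl1[OF formal formal T f g] copair_incl2[OF formal formal T f g])
  moreover have "?t (padd W2 (incl2 K G G) (incl1 K G G) r) = padd T g f r"
    using padd_natural[OF h(1) T h(3,2,4) r] padd_cong[of "?t \<circ> incl2 K G G" g "?t \<circ> incl1 K G G" f T]
    by (simp add: copair_incl1[OF formal formal T f g] copair_incl2[OF formal formal T f g])
  ultimately show ?thesis by simp
qed

lemma padd_assoc:
  assumes f: "formal_hom K G T f" and g: "formal_hom K G T g" and h: "formal_hom K G T h" and r: "r \<in> carrier G"
  shows "padd T (padd T f g) h r = padd T f (padd T g h) r"
proof -
  note gh = copair_formal_hom[OF formal formal T g h] and co = copair_incl1[OF formal formal T g h] copair_incl2[OF formal formal T g h]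
  let ?t = "copair K G W2 T f (copair K G G T g h)"
  have t: "formal_hom K W3 T ?t" by (rule copair_formal_hom[OF formal W2_formal T f gh])
  define q1 q2 q3 where "q1 = incl1 K G W2" and "q2 = incl2 K G W2 \<circ> incl1 K G G" and "q3 = incl2 K G W2 \<circ> incl2 K G G"
  have q: "formal_hom K G W3 q1" "formal_hom K G W3 q2" "formal_hom K G W3 q3"
    unfolding q1_def q2_def q3_def by (auto intro: formal_hom_comp q_hom(1) q_hom(2) p_hom(1) p_hom(2))
  have tq: "x \<in> carrier G \<Longrightarrow> ?t (q1 x) = f x" "x \<in> carrier G \<Longrightarrow> ?t (q2 x) = g x" "x \<in> carrier G \<Longrightarrow> ?t (q3 x) = h x" for x
    by (simp_all add: q1_def q2_def q3_def copair_incl1[OF formal W2_formal T f gh] copair_incl2[OF formal W2_formal T f gh] co formal_hom_closed[OF p_hom(1)] formal_hom_closed[OF p_hom(2)])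
  note p = padd_natural[OF W3_formal T _ _ t]
  have "padd W3 (padd W3 q1 q2) q3 r = padd W3 q1 (padd W3 q2 q3) r"
    using group r unfolding comm_formal_group_def Let_def q1_def q2_def q3_def by blast
  then have "?t (padd W3 (padd W3 q1 q2) q3 r) = ?t (padd W3 q1 (padd W3 q2 q3) r)" by simp
  moreover have "?t (padd W3 (padd W3 q1 q2) q3 r) = padd T (?t \<circ> padd W3 q1 q2) (?t \<circ> q3) r"
    using q r by (intro p padd_hom W3_formal)
  moreover have "padd T (?t \<circ> q1) (?t \<circ> q2) = padd T f g" "padd T (?t \<circ> q2) (?t \<circ> q3) = padd T g h"
    by (rule padd_cong; simp add: tq)+
  then have "\<And>x. x \<in> carrier G \<Longrightarrow> ?t (padd W3 q1 q2 x) = padd T f g x"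
    "\<And>x. x \<in> carrier G \<Longrightarrow> ?t (padd W3 q2 q3 x) = padd T g h x"
    using p q by metis+
  then have "padd T (?t \<circ> padd W3 q1 q2) (?t \<circ> q3) = padd T (padd T f g) h"
    "padd T (?t \<circ> q1) (?t \<circ> padd W3 q2 q3) = padd T f (padd T g h)"
    by (intro padd_cong; simp add: tq)+
  moreover have "?t (padd W3 q1 (padd W3 q2 q3) r) = padd T (?t \<circ> q1) (?t \<circ> padd W3 q2 q3) r"
    using q r by (intro p padd_hom W3_formal)
  ultimately show ?thesis by simp
qed

lemma padd_zero:
  assumes f: "formal_hom K G T f" and r: "r \<in> carrier G"
  shows "padd T (point_zero G T) f r = f r"
proof -
  have "f (padd G (point_zero G G) (\<lambda>s. s) r) = f r"
    using group r unfolding comm_formal_group_def by simp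
  moreover have "f (padd G (point_zero G G) (\<lambda>s. s) r) = padd T (f \<circ> point_zero G G) (f \<circ> (\<lambda>s. s)) r"
    by (rule padd_natural[OF formal T pzero_hom[OF formal] formal_hom_id f r])
  moreover have "f (point_zero G G x) = point_zero G T x" if "x \<in> carrier G" for x
    using f counit_hom that by (auto simp: formal_hom_def point_zero_def ring_hom_def)
  then have "padd T (f \<circ> point_zero G G) (f \<circ> (\<lambda>s. s)) = padd T (point_zero G T) f"
    by (intro padd_cong) simp_all
  ultimately show ?thesis by simp
qed

lemma padd_antipode:
  assumes f: "formal_hom K G T f" and r: "r \<in> carrier G"
  shows "padd T (f \<circ> antipode G) f r = point_zero G T r"
proof -
  have "f (padd G (antipode G) (\<lambda>s. s) r) = f (point_zero G G r)"
    using group r unfolding comm_formal_group_def by simp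
  moreover have "f (padd G (antipode G) (\<lambda>s. s) r) = padd T (f \<circ> antipode G) (f \<circ> (\<lambda>s. s)) r"
    by (rule padd_natural[OF formal T antipode_hom formal_hom_id f r])
  moreover have "f (point_zero G G r) = point_zero G T r"
    using f counit_hom r by (auto simp: formal_hom_def point_zero_def ring_hom_def)
  moreover have "padd T (f \<circ> antipode G) (f \<circ> (\<lambda>s. s)) = padd T (f \<circ> antipode G) f"
    by (intro padd_cong) simp_all
  ultimately show ?thesis by simp
qed

lemma padd_interchange:
  assumes a: "formal_hom K G T a" and b: "formal_hom K G T b" and c: "formal_hom K G T c"
    and d: "formal_hom K G T d" and r: "r \<in> carrier G"
  shows "padd T (padd T a b) (padd T c d) r = padd T (padd T a c) (padd T b d) r"
proof -
  have "padd T b (padd T c d) x = padd T c (padd T b d) x" if x: "x \<in> carrier G" for x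
  proof -
    have "padd T b (padd T c d) x = padd T (padd T b c) d x" using padd_assoc[OF b c d x] by simp
    also have "padd T (padd T b c) d = padd T (padd T c b) d"
      by (rule padd_cong) (simp_all add: padd_comm[OF b c])
    also have "padd T (padd T c b) d x = padd T c (padd T b d) x" by (rule padd_assoc[OF c b d x])
    finally show ?thesis .
  qed
  then have "padd T a (padd T b (padd T c d)) = padd T a (padd T c (padd T b d))"
    by (intro padd_cong) simp_all
  then show ?thesis
    using padd_assoc[OF a b padd_hom[OF T c d] r] padd_assoc[OF a c padd_hom[OF T b d] r] by simp
qed

lemma padd_cancel:
  assumes f: "formal_hom K G T f" and g: "formal_hom K G T g" and r: "r \<in> carrier G"
  shows "padd T (f \<circ> antipode G) (padd T f g) r = g r"
proof -
  note fS = formal_hom_comp[OF antipode_hom f]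
  have "padd T (padd T (f \<circ> antipode G) f) g = padd T (point_zero G T) g"
    by (rule padd_cong) (simp_all add: padd_antipode[OF f])
  then show ?thesis using padd_assoc[OF fS f g r] padd_zero[OF g r] by simp
qed

end

text \<open>\<open>formal_group_hom\<close> only asks for compatibility with addition. That zero
  goes to zero is recovered by cancelling \<open>f\<close> in \<open>f + f = f\<close>.\<close>

lemma idempotent_point:
  assumes T: "formal_algebra K T" and f: "formal_hom K G T f"
    and idem: "\<And>r. r \<in> carrier G \<Longrightarrow> padd T f f r = f r" and r: "r \<in> carrier G"
  shows "f r = point_zero G T r"
proof -
  have "padd T (f \<circ> antipode G) (padd T f f) = padd T (f \<circ> antipode G) f"
    by (rule padd_cong) (simp_all add: idem)
  then show ?thesis using padd_cancel[OF T f f r] padd_antipode[OF T f r] by simp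
qed

text \<open>Since \<open>-0 = 0\<close>, inversion fixes the origin; this is why it preserves the
  component of the origin.\<close>

lemma counit_antipode:
  assumes r: "r \<in> carrier G"
  shows "counit G (antipode G r) = counit G r"
proof -
  note B = base_formal(1)[OF K.cring_axioms]
  have z: "point_zero G (base_algebra K) = counit G" by (simp add: point_zero_def)
  note cS = formal_hom_comp[OF antipode_hom counit_hom]
  have "padd (base_algebra K) (counit G \<circ> antipode G) (counit G) r = counit G r"
    using padd_antipode[OF B counit_hom r] by (simp add: z)
  moreover have "padd (base_algebra K) (counit G \<circ> antipode G) (counit G) r = (counit G \<circ> antipode G) r"
    using padd_comm[OF B cS counit_hom r] padd_zero[OF B cS r] by (simp add: z)
  ultimately show ?thesis by simp
qed

end

section \<open>Forgetting the group structure\<close>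

lemma truncate_simps [simp]:
  fixes R :: "('k, 'r, 'm) formal_algebra_scheme"
  shows "carrier (formal_algebra.truncate R) = carrier R" "monoid.mult (formal_algebra.truncate R) = monoid.mult R"
  "one (formal_algebra.truncate R) = one R" "ring.zero (formal_algebra.truncate R) = ring.zero R"
  "ring.add (formal_algebra.truncate R) = ring.add R" "struct_map (formal_algebra.truncate R) = struct_map R"
  "topol (formal_algebra.truncate R) = topol R"
  by (simp_all add: formal_algebra.truncate_def)

lemma cring_truncate: "cring (formal_algebra.truncate R) \<longleftrightarrow> cring R"
  using cring_transfer[of R "formal_algebra.truncate R"] cring_transfer[of "formal_algebra.truncate R" R] by auto

lemma a_inv_truncate: "\<ominus>\<^bsub>formal_algebra.truncate R\<^esub> x = \<ominus>\<^bsub>R\<^esub> x"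
  by (simp add: a_inv_def m_inv_def)

lemma ideal_transfer:
  fixes R :: "('a, 'b) ring_scheme" and S :: "('a, 'e) ring_scheme"
  assumes "ideal I R" and eq: "carrier S = carrier R" "monoid.mult S = monoid.mult R" "one S = one R"
    "ring.zero S = ring.zero R" "ring.add S = ring.add R"
  shows "ideal I S"
proof -
  interpret I: ideal I R by fact
  show ?thesis
  proof (rule idealI)
    have "abelian_group S"
      by (rule abelian_groupI) (auto simp: eq I.a_assoc intro: I.a_comm I.add.l_inv_ex)
    moreover have "Group.monoid S"
      by (rule Group.monoidI) (auto simp: eq I.m_assoc)
    ultimately show "ring S"
      by (rule ringI) (simp_all add: eq I.l_distr I.r_distr)
    show "subgroup I (add_monoid S)" using I.a_subgroup by (simp add: subgroup_def m_inv_def eq)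
  qed (auto simp: eq I.I_l_closed I.I_r_closed)
qed

lemma ideal_truncate: "ideal I (formal_algebra.truncate R) \<longleftrightarrow> ideal I R"
  using ideal_transfer[of I R "formal_algebra.truncate R"] ideal_transfer[of I "formal_algebra.truncate R" R] by auto

lemma open_ideals_truncate: "open_ideals (formal_algebra.truncate R) = open_ideals R"
  by (simp add: open_ideals_def ideal_truncate)

lemma ring_hom_truncate:
  "ring_hom (formal_algebra.truncate R) T = ring_hom R T"
  "ring_hom S (formal_algebra.truncate R) = ring_hom S R"
  by (simp_all add: ring_hom_def)

lemma formal_hom_truncate_source: "formal_hom K (formal_algebra.truncate R) T f \<longleftrightarrow> formal_hom K R T f"
  by (simp add: formal_hom_def ring_hom_truncate)

lemma formal_hom_truncate_target: "formal_hom K S (formal_algebra.truncate R) f \<longleftrightarrow> formal_hom K S R f"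
  by (simp add: formal_hom_def ring_hom_truncate)

lemma formal_algebra_truncate: "formal_algebra K (formal_algebra.truncate R) \<longleftrightarrow> formal_algebra K R"
  by (simp add: formal_algebra_def cring_truncate ring_hom_truncate linearly_topologised_def complete_formal_def
      open_ideals_truncate a_r_coset_def' a_minus_def a_inv_truncate)

lemma DirProd_truncate:
  "formal_algebra.truncate U \<times>\<times> V = U \<times>\<times> V" "U \<times>\<times> formal_algebra.truncate V = U \<times>\<times> V"
  by (simp_all add: DirProd_def)

lemma tensor_ideals_truncate:
  "tensor_ideals K (formal_algebra.truncate U) V = tensor_ideals K U V"
  "tensor_ideals K U (formal_algebra.truncate V) = tensor_ideals K U V"
  by (simp_all add: tensor_ideals_def tensor_ideal_def tensor_relations_def DirProd_truncate open_ideals_truncate)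

lemma ctensor_truncate:
  "ctensor K (formal_algebra.truncate U) V = ctensor K U V"
  "ctensor K U (formal_algebra.truncate V) = ctensor K U V"
  by (simp_all add: ctensor_def ctensor_carrier_def tensor_ideals_truncate DirProd_truncate)

lemma incl_truncate:
  "incl1 K (formal_algebra.truncate U) V = incl1 K U V" "incl2 K (formal_algebra.truncate U) V = incl2 K U V"
  "incl1 K U (formal_algebra.truncate V) = incl1 K U V" "incl2 K U (formal_algebra.truncate V) = incl2 K U V"
  by (simp_all add: incl1_def incl2_def tensor_ideals_truncate DirProd_truncate fun_eq_iff)

lemma copair_truncate:
  "copair K (formal_algebra.truncate U) V T f g = copair K U V T f g"
  "copair K U (formal_algebra.truncate V) T f g = copair K U V T f g"
  by (simp_all add: copair_def ctensor_truncate incl_truncate)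

lemma formal_algebra_cong:
  "formal_algebra.truncate R = formal_algebra.truncate S \<Longrightarrow> formal_algebra K R \<longleftrightarrow> formal_algebra K S"
  by (metis formal_algebra_truncate)

lemma formal_hom_cong_source:
  "formal_algebra.truncate R = formal_algebra.truncate S \<Longrightarrow> formal_hom K R T f \<longleftrightarrow> formal_hom K S T f"
  by (metis formal_hom_truncate_source)

lemma formal_hom_cong_target:
  "formal_algebra.truncate R = formal_algebra.truncate S \<Longrightarrow> formal_hom K T R f \<longleftrightarrow> formal_hom K T S f"
  by (metis formal_hom_truncate_target)

text \<open>A formal group and its coordinate ring are records of different types, but the tensor
  constructions only see the truncated record. Equality of truncations thus exchanges
  \<open>const_group\<close> for \<open>fun_algebra\<close>, an ordinary formal group for
  \<open>powser_algebra\<close>, and a product group for its tensor product.\<close>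

lemma ctensor_cong:
  assumes "formal_algebra.truncate U = formal_algebra.truncate U'" "formal_algebra.truncate V = formal_algebra.truncate V'"
  shows "ctensor K U V = ctensor K U' V'" "incl1 K U V = incl1 K U' V'" "incl2 K U V = incl2 K U' V'"
    "copair K U V T f g = copair K U' V' T f g"
  by (metis assms ctensor_truncate incl_truncate copair_truncate)+

section \<open>Power series\<close>

lemma powser_simps [simp]:
  "carrier (powser_algebra R) = UNIV \<rightarrow> carrier R"
  "p \<otimes>\<^bsub>powser_algebra R\<^esub> q = (\<lambda>n. \<Oplus>\<^bsub>R\<^esub>i\<in>{..n}. p i \<otimes>\<^bsub>R\<^esub> q (n - i))"
  "p \<oplus>\<^bsub>powser_algebra R\<^esub> q = (\<lambda>n. p n \<oplus>\<^bsub>R\<^esub> q n)"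
  "\<one>\<^bsub>powser_algebra R\<^esub> = (\<lambda>n. if n = 0 then \<one>\<^bsub>R\<^esub> else \<zero>\<^bsub>R\<^esub>)"
  "\<zero>\<^bsub>powser_algebra R\<^esub> = (\<lambda>n. \<zero>\<^bsub>R\<^esub>)"
  "struct_map (powser_algebra R) c = (\<lambda>n. if n = 0 then c else \<zero>\<^bsub>R\<^esub>)"
  by (simp_all add: powser_algebra_def)

context cring
begin

abbreviation "PS \<equiv> powser_algebra R"

text \<open>Coefficient \<open>n\<close> of a product depends only on coefficients up to
  \<open>n\<close>, and truncated series are polynomials. The commutative, associative and unit laws
  of power series are therefore inherited from \<open>UP R\<close>, one coefficient at a
  time.\<close>

definition cut :: "nat \<Rightarrow> (nat \<Rightarrow> 'a) \<Rightarrow> nat \<Rightarrow> 'a" where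
  "cut m p = (\<lambda>i. if i \<le> m then p i else \<zero>)"

lemma cut_up: "p \<in> carrier PS \<Longrightarrow> cut m p \<in> up R"
  by (auto simp: up_def cut_def Pi_iff intro!: exI[of _ m])

lemma UP_mult_eq: "p \<in> up R \<Longrightarrow> q \<in> up R \<Longrightarrow> p \<otimes>\<^bsub>UP R\<^esub> q = p \<otimes>\<^bsub>PS\<^esub> q"
  by (simp add: UP_def)

lemma PS_mult_closed: "p \<in> carrier PS \<Longrightarrow> q \<in> carrier PS \<Longrightarrow> p \<otimes>\<^bsub>PS\<^esub> q \<in> carrier PS"
  by (auto intro!: finsum_closed simp: Pi_iff)

lemma PS_mult_cong:
  assumes "\<And>i. i \<le> n \<Longrightarrow> p i = p' i" "\<And>i. i \<le> n \<Longrightarrow> q i = q' i" "p' \<in> carrier PS" "q' \<in> carrier PS"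
  shows "(p \<otimes>\<^bsub>PS\<^esub> q) n = (p' \<otimes>\<^bsub>PS\<^esub> q') n"
  unfolding powser_simps by (rule add.finprod_cong') (use assms in \<open>auto simp: Pi_iff\<close>)

lemma PS_cring: "cring PS"
proof -
  interpret UP: UP_cring R "UP R" by unfold_locales auto
  have up: "carrier (UP R) = up R" by (simp add: UP_def)
  have up_PS: "p \<in> carrier PS" if "p \<in> up R" for p using that by (simp add: up_def)
  have cut: "(p \<otimes>\<^bsub>PS\<^esub> q) n = (cut m p \<otimes>\<^bsub>UP R\<^esub> cut m q) n"
    if "n \<le> m" "p \<in> carrier PS" "q \<in> carrier PS" for n m p q
    unfolding UP_mult_eq[OF cut_up[OF that(2)] cut_up[OF that(3)]]
    by (rule PS_mult_cong) (use that cut_up up_PS in \<open>auto simp: cut_def simp del: powser_simps\<close>)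
  have up_mult: "p \<otimes>\<^bsub>UP R\<^esub> q \<in> up R" if "p \<in> up R" "q \<in> up R" for p q
    using UP.P.m_closed[of p q] that by (simp add: up)
  show ?thesis
  proof (rule cringI)
    show "abelian_group PS"
    proof (rule abelian_groupI)
      fix p assume p: "p \<in> carrier PS"
      show "\<exists>q\<in>carrier PS. q \<oplus>\<^bsub>PS\<^esub> p = \<zero>\<^bsub>PS\<^esub>"
        using p by (intro bexI[of _ "\<lambda>n. \<ominus> p n"]) (auto simp: Pi_iff l_neg)
    qed (auto simp: Pi_iff a_assoc fun_eq_iff intro: a_comm)
    show "Group.comm_monoid PS"
    proof (rule Group.comm_monoidI)
      fix p q assume pq: "p \<in> carrier PS" "q \<in> carrier PS"
      show "p \<otimes>\<^bsub>PS\<^esub> q \<in> carrier PS" using pq by (rule PS_mult_closed)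
      show "p \<otimes>\<^bsub>PS\<^esub> q = q \<otimes>\<^bsub>PS\<^esub> p"
      proof
        fix n
        have "cut n p \<otimes>\<^bsub>UP R\<^esub> cut n q = cut n q \<otimes>\<^bsub>UP R\<^esub> cut n p"
          using pq cut_up up by (intro UP.P.m_comm) auto
        then show "(p \<otimes>\<^bsub>PS\<^esub> q) n = (q \<otimes>\<^bsub>PS\<^esub> p) n"
          unfolding cut[OF order_refl pq] cut[OF order_refl pq(2,1)] by simp
      qed
    next
      fix p q r assume p: "p \<in> carrier PS" and q: "q \<in> carrier PS" and r: "r \<in> carrier PS"
      note u = cut_up[OF p] cut_up[OF q] cut_up[OF r]
      show "p \<otimes>\<^bsub>PS\<^esub> q \<otimes>\<^bsub>PS\<^esub> r = p \<otimes>\<^bsub>PS\<^esub> (q \<otimes>\<^bsub>PS\<^esub> r)"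
      proof
        fix n
        have "(p \<otimes>\<^bsub>PS\<^esub> q \<otimes>\<^bsub>PS\<^esub> r) n = ((cut n p \<otimes>\<^bsub>UP R\<^esub> cut n q) \<otimes>\<^bsub>PS\<^esub> cut n r) n"
          by (rule PS_mult_cong) (use cut p q u up_mult up_PS in \<open>auto simp: cut_def simp del: powser_simps\<close>)
        also have "\<dots> = ((cut n p \<otimes>\<^bsub>UP R\<^esub> cut n q) \<otimes>\<^bsub>UP R\<^esub> cut n r) n"
          using UP_mult_eq up_mult u by simp
        also have "\<dots> = (cut n p \<otimes>\<^bsub>UP R\<^esub> (cut n q \<otimes>\<^bsub>UP R\<^esub> cut n r)) n"
          using u UP.P.m_assoc up by simp
        also have "\<dots> = (cut n p \<otimes>\<^bsub>PS\<^esub> (cut n q \<otimes>\<^bsub>UP R\<^esub> cut n r)) n"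
          using UP_mult_eq up_mult u by simp
        also have "\<dots> = (p \<otimes>\<^bsub>PS\<^esub> (q \<otimes>\<^bsub>PS\<^esub> r)) n"
        proof (rule PS_mult_cong)
          show "cut n p i = p i" "(cut n q \<otimes>\<^bsub>UP R\<^esub> cut n r) i = (q \<otimes>\<^bsub>PS\<^esub> r) i" if "i \<le> n" for i
            using that cut[OF that q r] by (auto simp: cut_def simp del: powser_simps)
        qed (use p q r PS_mult_closed in auto)
        finally show "(p \<otimes>\<^bsub>PS\<^esub> q \<otimes>\<^bsub>PS\<^esub> r) n = (p \<otimes>\<^bsub>PS\<^esub> (q \<otimes>\<^bsub>PS\<^esub> r)) n" .
      qed
    next
      fix p assume p: "p \<in> carrier PS"
      show "\<one>\<^bsub>PS\<^esub> \<otimes>\<^bsub>PS\<^esub> p = p"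
      proof
        fix n
        have "cut n \<one>\<^bsub>PS\<^esub> = \<one>\<^bsub>UP R\<^esub>" by (auto simp: cut_def UP_def)
        then have "(\<one>\<^bsub>PS\<^esub> \<otimes>\<^bsub>PS\<^esub> p) n = (\<one>\<^bsub>UP R\<^esub> \<otimes>\<^bsub>UP R\<^esub> cut n p) n"
          using cut[OF order_refl _ p, of "\<one>\<^bsub>PS\<^esub>" n] by auto
        also have "\<dots> = p n" using cut_up[OF p] up by (subst UP.P.l_one) (auto simp: cut_def)
        finally show "(\<one>\<^bsub>PS\<^esub> \<otimes>\<^bsub>PS\<^esub> p) n = p n" .
      qed
    qed auto
    fix p q r assume pqr: "p \<in> carrier PS" "q \<in> carrier PS" "r \<in> carrier PS"
    show "(p \<oplus>\<^bsub>PS\<^esub> q) \<otimes>\<^bsub>PS\<^esub> r = p \<otimes>\<^bsub>PS\<^esub> r \<oplus>\<^bsub>PS\<^esub> q \<otimes>\<^bsub>PS\<^esub> r"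
    proof
      fix n
      have "((p \<oplus>\<^bsub>PS\<^esub> q) \<otimes>\<^bsub>PS\<^esub> r) n = (\<Oplus>i\<in>{..n}. p i \<otimes> r (n - i) \<oplus> q i \<otimes> r (n - i))"
        unfolding powser_simps by (rule add.finprod_cong') (use pqr in \<open>auto simp: Pi_iff l_distr\<close>)
      also have "\<dots> = (p \<otimes>\<^bsub>PS\<^esub> r \<oplus>\<^bsub>PS\<^esub> q \<otimes>\<^bsub>PS\<^esub> r) n"
        unfolding powser_simps by (rule finsum_addf) (use pqr in \<open>auto simp: Pi_iff\<close>)
      finally show "((p \<oplus>\<^bsub>PS\<^esub> q) \<otimes>\<^bsub>PS\<^esub> r) n = (p \<otimes>\<^bsub>PS\<^esub> r \<oplus>\<^bsub>PS\<^esub> q \<otimes>\<^bsub>PS\<^esub> r) n" .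
    qed
  qed
qed

definition xpow_ideal :: "nat \<Rightarrow> (nat \<Rightarrow> 'a) set" where
  "xpow_ideal m = {p \<in> carrier PS. \<forall>i<m. p i = \<zero>}"

lemma mem_xpow: "p \<in> xpow_ideal m \<longleftrightarrow> p \<in> carrier PS \<and> (\<forall>i<m. p i = \<zero>)"
  by (simp add: xpow_ideal_def)

lemma PS_uminus: "p \<in> carrier PS \<Longrightarrow> \<ominus>\<^bsub>PS\<^esub> p = (\<lambda>n. \<ominus> p n)"
proof -
  interpret PS: cring PS by (rule PS_cring)
  assume "p \<in> carrier PS"
  then show ?thesis by (intro PS.minus_equality) (auto simp: Pi_iff l_neg)
qed

lemma PS_minus: "p \<in> carrier PS \<Longrightarrow> q \<in> carrier PS \<Longrightarrow> p \<ominus>\<^bsub>PS\<^esub> q = (\<lambda>n. p n \<ominus> q n)"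
  by (simp only: a_minus_def PS_uminus) simp

lemma xpow_ideal: "ideal (xpow_ideal m) PS"
proof (rule idealI)
  interpret PS: cring PS by (rule PS_cring)
  show "ring PS" ..
  show "subgroup (xpow_ideal m) (add_monoid PS)"
  proof (rule PS.add.subgroupI)
    show "xpow_ideal m \<noteq> {}" by (auto simp: xpow_ideal_def intro!: exI[of _ "\<zero>\<^bsub>PS\<^esub>"])
    show "\<ominus>\<^bsub>PS\<^esub> p \<in> xpow_ideal m" if "p \<in> xpow_ideal m" for p
    proof -
      have "p \<in> carrier PS" using that by (simp add: xpow_ideal_def)
      then show ?thesis using that PS.a_inv_closed[of p] PS_uminus[of p]
        by (simp add: xpow_ideal_def del: powser_simps)
    qed
  qed (auto simp: xpow_ideal_def)
  fix p q assume pq: "p \<in> xpow_ideal m" "q \<in> carrier PS"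
  then have p: "p \<in> carrier PS" by (simp add: xpow_ideal_def)
  have "(p \<otimes>\<^bsub>PS\<^esub> q) n = \<zero>" if "n < m" for n
    unfolding powser_simps by (rule add.finprod_one_eqI) (use pq that in \<open>auto simp: xpow_ideal_def Pi_iff\<close>)
  then show *: "p \<otimes>\<^bsub>PS\<^esub> q \<in> xpow_ideal m"
    using PS_mult_closed[OF p pq(2)] unfolding xpow_ideal_def by blast
  show "q \<otimes>\<^bsub>PS\<^esub> p \<in> xpow_ideal m"
    using * PS.m_comm[OF p pq(2)] by metis
qed

lemma xpow_coset:
  assumes p: "p \<in> carrier PS"
  shows "xpow_ideal m +>\<^bsub>PS\<^esub> p = {q \<in> carrier PS. \<forall>i<m. q i = p i}"
proof -
  interpret I: ideal "xpow_ideal m" PS by (rule xpow_ideal)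
  have "q \<ominus>\<^bsub>PS\<^esub> p \<in> xpow_ideal m \<longleftrightarrow> (\<forall>i<m. q i = p i)" if q: "q \<in> carrier PS" for q
    using I.minus_closed[OF q p] p q unfolding xpow_ideal_def PS_minus[OF q p]
    by (auto simp: Pi_iff)
  then show ?thesis using I.mem_coset_iff[OF p] by blast
qed

lemma powser_formal: "formal_algebra R PS" and xpow_open: "xpow_ideal m \<in> open_ideals PS"
  and xpow_within: "J \<in> open_ideals PS \<Longrightarrow> \<exists>m. xpow_ideal m \<subseteq> J"
proof -
  let ?B = "range xpow_ideal"
  interpret PS: cring PS by (rule PS_cring)
  have top: "topol PS = product_topology (\<lambda>n. discrete_topology (carrier R)) UNIV"
    by (simp add: powser_algebra_def)
  have ts: "topspace (topol PS) = carrier PS" by (auto simp: top)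
  have i: "\<And>I. I \<in> ?B \<Longrightarrow> ideal I PS" using xpow_ideal by blast
  have op: "openin (topol PS) Y \<longleftrightarrow> Y \<subseteq> carrier PS \<and> (\<forall>p\<in>Y. \<exists>I\<in>?B. I +>\<^bsub>PS\<^esub> p \<subseteq> Y)" for Y
  proof (intro iffI conjI ballI)
    assume "openin (topol PS) Y"
    then show "Y \<subseteq> carrier PS" using ts openin_subset by blast
  next
    fix p assume Y: "openin (topol PS) Y" and p: "p \<in> Y"
    then obtain S where S: "finite {n \<in> UNIV. S n \<noteq> carrier R}" "p \<in> Pi\<^sub>E UNIV S" "Pi\<^sub>E UNIV S \<subseteq> Y"
      by (auto simp: top openin_product_topology_alt)
    then obtain m where m: "\<And>n. S n \<noteq> carrier R \<Longrightarrow> n < m"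
      using finite_nat_set_iff_bounded by auto
    have pc: "p \<in> carrier PS" using Y p ts openin_subset by blast
    have "q \<in> Y" if q: "q \<in> carrier PS" "\<forall>i<m. q i = p i" for q
    proof -
      have "q n \<in> S n" for n using m[of n] q S(2) by (cases "S n = carrier R") (auto simp: Pi_iff)
      then show ?thesis using S(3) by auto
    qed
    then show "\<exists>I\<in>?B. I +>\<^bsub>PS\<^esub> p \<subseteq> Y" using xpow_coset[OF pc, of m] by blast
  next
    assume Y: "Y \<subseteq> carrier PS \<and> (\<forall>p\<in>Y. \<exists>I\<in>?B. I +>\<^bsub>PS\<^esub> p \<subseteq> Y)"
    show "openin (topol PS) Y"
      unfolding top openin_product_topology_alt
    proof
      fix p assume p: "p \<in> Y"
      then obtain m where m: "xpow_ideal m +>\<^bsub>PS\<^esub> p \<subseteq> Y" using Y by blast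
      have pc: "p \<in> carrier PS" using Y p by blast
      let ?S = "\<lambda>n. if n < m then {p n} else carrier R"
      have "finite {n \<in> UNIV. ?S n \<noteq> topspace (discrete_topology (carrier R))}"
        by (rule finite_subset[of _ "{..<m}"]) auto
      moreover have "Pi\<^sub>E UNIV ?S \<subseteq> Y"
      proof
        fix q assume q: "q \<in> Pi\<^sub>E UNIV ?S"
        have "q n = p n" if "n < m" for n using PiE_mem[OF q, of n] that by simp
        moreover have "q n \<in> carrier R" for n using PiE_mem[OF q, of n] pc by (auto split: if_splits)
        ultimately show "q \<in> Y" using m xpow_coset[OF pc, of m] by auto
      qed
      ultimately show "\<exists>S. finite {n \<in> UNIV. S n \<noteq> topspace (discrete_topology (carrier R))} \<and>
          (\<forall>n\<in>UNIV. openin (discrete_topology (carrier R)) (S n)) \<and> p \<in> Pi\<^sub>E UNIV S \<and> Pi\<^sub>E UNIV S \<subseteq> Y"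
        using pc by (intro exI[of _ ?S]) (auto simp: Pi_iff)
    qed
  qed
  have sep: "\<And>p. p \<in> carrier PS \<Longrightarrow> (\<And>I. I \<in> ?B \<Longrightarrow> p \<in> I) \<Longrightarrow> p = \<zero>\<^bsub>PS\<^esub>"
  proof -
    fix p assume "\<And>I. I \<in> ?B \<Longrightarrow> p \<in> I"
    then have "p \<in> xpow_ideal (Suc n)" for n by blast
    then show "p = \<zero>\<^bsub>PS\<^esub>" by (auto simp: xpow_ideal_def)
  qed
  have compl: "\<exists>z\<in>carrier PS. \<forall>I\<in>?B. z \<ominus>\<^bsub>PS\<^esub> x I \<in> I"
    if x: "\<And>I. I \<in> ?B \<Longrightarrow> x I \<in> carrier PS"
      and compat: "\<And>I J. I \<in> ?B \<Longrightarrow> J \<in> ?B \<Longrightarrow> I \<subseteq> J \<Longrightarrow> x I \<ominus>\<^bsub>PS\<^esub> x J \<in> J" for x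
  proof -
    \<comment> \<open>Coefficient \<open>n\<close> is determined modulo the power
      \<open>n + 1\<close> of the variable, hence the \<open>Suc\<close>.\<close>
    let ?z = "\<lambda>n. x (xpow_ideal (Suc n)) n"
    have xc: "x (xpow_ideal m) \<in> carrier PS" for m using x by blast
    then have xn: "x (xpow_ideal m) n \<in> carrier R" for m n by auto
    then have zc: "?z \<in> carrier PS" by auto
    have "?z \<ominus>\<^bsub>PS\<^esub> x (xpow_ideal m) \<in> xpow_ideal m" for m
    proof -
      have "?z i = x (xpow_ideal m) i" if "i < m" for i
      proof -
        have "xpow_ideal m \<subseteq> xpow_ideal (Suc i)" using that by (auto simp: xpow_ideal_def)
        then have "x (xpow_ideal m) \<ominus>\<^bsub>PS\<^esub> x (xpow_ideal (Suc i)) \<in> xpow_ideal (Suc i)"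
          using compat by blast
        then have "x (xpow_ideal m) i \<ominus> x (xpow_ideal (Suc i)) i = \<zero>"
          unfolding PS_minus[OF xc xc] by (simp add: xpow_ideal_def)
        then show ?thesis using xn by simp
      qed
      then show ?thesis by (subst PS_minus[OF zc xc], subst mem_xpow) (use xn in simp)
    qed
    then show ?thesis using zc by blast
  qed
  have s: "struct_map PS \<in> ring_hom R PS"
  proof (rule ring_hom_memI)
    fix a b assume ab: "a \<in> carrier R" "b \<in> carrier R"
    show "struct_map PS (a \<otimes> b) = struct_map PS a \<otimes>\<^bsub>PS\<^esub> struct_map PS b"
    proof
      fix n
      have "(struct_map PS a \<otimes>\<^bsub>PS\<^esub> struct_map PS b) n
          = (\<Oplus>i\<in>{..n}. if 0 = i then a \<otimes> struct_map PS b (n - i) else \<zero>)"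
        unfolding powser_simps(2) by (rule add.finprod_cong') (use ab in auto)
      also have "\<dots> = a \<otimes> struct_map PS b (n - 0)"
        by (rule add.finprod_singleton) (use ab in auto)
      finally show "struct_map PS (a \<otimes> b) n = (struct_map PS a \<otimes>\<^bsub>PS\<^esub> struct_map PS b) n" using ab by auto
    qed
  qed auto
  note * = formal_algebraI[OF cring_axioms PS_cring s ts i op sep compl]
  show "formal_algebra R PS" by (rule *(1))
  show "xpow_ideal m \<in> open_ideals PS" using *(2) by blast
  show "J \<in> open_ideals PS \<Longrightarrow> \<exists>m. xpow_ideal m \<subseteq> J" using *(3) by blast
qed

end

section \<open>Constant groups\<close>

lemma fun_algebra_simps [simp]:
  "carrier (fun_algebra K M) = M \<rightarrow>\<^sub>E carrier K"
  "f \<otimes>\<^bsub>fun_algebra K M\<^esub> g = (\<lambda>a\<in>M. f a \<otimes>\<^bsub>K\<^esub> g a)"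
  "f \<oplus>\<^bsub>fun_algebra K M\<^esub> g = (\<lambda>a\<in>M. f a \<oplus>\<^bsub>K\<^esub> g a)"
  "\<one>\<^bsub>fun_algebra K M\<^esub> = (\<lambda>a\<in>M. \<one>\<^bsub>K\<^esub>)" "\<zero>\<^bsub>fun_algebra K M\<^esub> = (\<lambda>a\<in>M. \<zero>\<^bsub>K\<^esub>)"
  "struct_map (fun_algebra K M) c = (\<lambda>a\<in>M. c)"
  "topol (fun_algebra K M) = discrete_topology (M \<rightarrow>\<^sub>E carrier K)"
  by (simp_all add: fun_algebra_def)

context cring
begin

lemma fun_cring: "cring (fun_algebra R M)"
proof (rule cringI)
  show "abelian_group (fun_algebra R M)"
  proof (rule abelian_groupI)
    fix f assume f: "f \<in> carrier (fun_algebra R M)"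
    show "\<exists>g\<in>carrier (fun_algebra R M). g \<oplus>\<^bsub>fun_algebra R M\<^esub> f = \<zero>\<^bsub>fun_algebra R M\<^esub>"
      using f by (intro bexI[of _ "\<lambda>a\<in>M. \<ominus> f a"]) (auto simp: PiE_iff l_neg)
  qed (auto simp: PiE_iff a_assoc extensional_def fun_eq_iff intro: a_comm)
  show "Group.comm_monoid (fun_algebra R M)"
    by (rule Group.comm_monoidI) (auto simp: PiE_iff m_assoc extensional_def fun_eq_iff intro: m_comm)
qed (auto simp: PiE_iff l_distr extensional_def fun_eq_iff)

lemma fun_formal: "formal_algebra R (fun_algebra R M)" 
  and fun_zero_open: "{\<zero>\<^bsub>fun_algebra R M\<^esub>} \<in> open_ideals (fun_algebra R M)"
proof -
  have "struct_map (fun_algebra R M) \<in> ring_hom R (fun_algebra R M)"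
    by (rule ring_hom_memI) (auto simp: fun_eq_iff)
  from discrete_formal_algebra[OF cring_axioms fun_cring this]
  show "formal_algebra R (fun_algebra R M)" "{\<zero>\<^bsub>fun_algebra R M\<^esub>} \<in> open_ideals (fun_algebra R M)" by simp_all
qed

lemma eval_hom:
  assumes "b \<in> M"
  shows "formal_hom R (fun_algebra R M) (base_algebra R) (\<lambda>f. f b)"
proof (rule formal_homI[OF fun_formal base_formal(1)[OF cring_axioms]])
  show "(\<lambda>f. f b) \<in> ring_hom (fun_algebra R M) (base_algebra R)"
    using assms by (intro ring_hom_memI) auto
  show "\<exists>I\<in>open_ideals (fun_algebra R M). \<forall>r\<in>I. r b \<in> J" if "J \<in> open_ideals (base_algebra R)" for J
    using assms that fun_zero_open[of M] additive_subgroup.zero_closed[OF ideal.axioms(1), of J "base_algebra R"]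
    by (intro bexI[of _ "{\<zero>\<^bsub>fun_algebra R M\<^esub>}"]) (auto simp: open_ideals_def)
qed (use assms in simp)

end

locale fun_tensor =
  fixes K :: "('k, 'c) ring_scheme" and M :: "'a set" and V :: "('k, 'y, 'n) formal_algebra_scheme"
  assumes V_formal: "formal_algebra K V" and fin: "finite M"
begin

sublocale V: formal_alg K V by (simp add: formal_alg_def V_formal)

abbreviation "A \<equiv> fun_algebra K M"

sublocale tensor K A V by (rule tensorI[OF V.K.fun_formal V_formal])

text \<open>Geometrically, restriction of functions to the copy of \<open>spf(V)\<close> with index
  \<open>b\<close> in the disjoint union \<open>M \<times> spf(V)\<close>.\<close>

definition ev :: "'a \<Rightarrow> ('k, 'a \<Rightarrow> 'k, 'y) ctensor \<Rightarrow> 'y" where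
  "ev b = copair K A V V (\<lambda>h. struct_map V (h b)) (\<lambda>v. v)"

definition \<delta> :: "'a \<Rightarrow> 'a \<Rightarrow> 'k" where
  "\<delta> b = (\<lambda>a\<in>M. if a = b then \<one>\<^bsub>K\<^esub> else \<zero>\<^bsub>K\<^esub>)"

lemma \<delta>_closed [simp]: "\<delta> b \<in> M \<rightarrow>\<^sub>E carrier K" and \<delta>_carrier: "\<delta> b \<in> carrier A"
  by (auto simp: \<delta>_def)

lemma
  assumes b: "b \<in> M"
  shows ev_hom: "formal_hom K W V (ev b)"
    and ev_i1: "h \<in> carrier A \<Longrightarrow> ev b (i1 h) = struct_map V (h b)"
    and ev_i2: "v \<in> carrier V \<Longrightarrow> ev b (i2 v) = v"
proof -
  have "formal_hom K A V (\<lambda>h. struct_map V (h b))"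
    using formal_hom_comp[OF V.K.eval_hom[OF b] V.struct_hom] by (simp add: comp_def)
  from copair[OF V_formal this formal_hom_id]
  show "formal_hom K W V (ev b)" "h \<in> carrier A \<Longrightarrow> ev b (i1 h) = struct_map V (h b)"
    "v \<in> carrier V \<Longrightarrow> ev b (i2 v) = v" unfolding ev_def by blast+
qed

lemma \<delta>_mult: 
  assumes "h \<in> carrier A" "b \<in> M"
  shows "\<delta> b \<otimes>\<^bsub>A\<^esub> h = struct_map A (h b) \<otimes>\<^bsub>A\<^esub> \<delta> b"
  using assms by (auto simp: \<delta>_def fun_eq_iff PiE_iff)

text \<open>The idempotent \<open>\<delta> b\<close> cuts out the copy with index \<open>b\<close>.
  Both sides are additive and continuous in \<open>w\<close>, so only elements
  \<open>h \<otimes> v\<close> have to be compared, and there the reason is that multiplying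
  \<open>h\<close> by \<open>\<delta> b\<close> replaces it by the scalar
  \<open>h b\<close>.\<close>

lemma ev_proj:
  assumes b: "b \<in> M" and w: "w \<in> carrier W"
  shows "i1 (\<delta> b) \<otimes>\<^bsub>W\<^esub> w = i1 (\<delta> b) \<otimes>\<^bsub>W\<^esub> i2 (ev b w)"
proof -
  interpret e: formal_map K W V "ev b" by (rule formal_mapI[OF formal_W V_formal ev_hom[OF b]])
  let ?h = "\<lambda>w. i1 (\<delta> b) \<otimes>\<^bsub>W\<^esub> (w \<ominus>\<^bsub>W\<^esub> i2 (ev b w))"
  have d: "i1 (\<delta> b) \<in> carrier W" by simp
  have "?h w = \<zero>\<^bsub>W\<^esub>"
  proof (rule additive_zero[OF formal_W _ _ _ _ w])
    fix v w assume "v \<in> carrier W" "w \<in> carrier W"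
    then show "?h (v \<oplus>\<^bsub>W\<^esub> w) = ?h v \<oplus>\<^bsub>W\<^esub> ?h w"
      using d by (simp add: W.r_distr[symmetric] W.add_diff_add)
  next
    fix J assume J: "J \<in> open_ideals W"
    interpret J: ideal J W by (rule W.open_idealD[OF J])
    let ?Q = "J \<inter> {w \<in> carrier W. ev b w \<in> {v \<in> carrier V. i2 v \<in> J}}"
    have "?Q \<in> open_ideals W"
      using J by (intro W.Int_open_ideal e.vimage_open_ideal i2.vimage_open_ideal)
    moreover have "?h w \<in> J" if "w \<in> ?Q" for w
      using that d by (intro J.I_l_closed J.sub_closed) auto
    ultimately show "\<exists>Q\<in>open_ideals W. \<forall>w\<in>Q. ?h w \<in> J" by blast
  next
    fix h v assume h: "h \<in> carrier A" and v: "v \<in> carrier V"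
    have hb: "h b \<in> carrier K" using h b by auto
    have "i1 (\<delta> b) \<otimes>\<^bsub>W\<^esub> (i1 h \<otimes>\<^bsub>W\<^esub> i2 v) = i1 (\<delta> b \<otimes>\<^bsub>A\<^esub> h) \<otimes>\<^bsub>W\<^esub> i2 v"
      using h v d by (simp del: fun_algebra_simps add: \<delta>_carrier W.m_assoc)
    also have "\<dots> = struct_map W (h b) \<otimes>\<^bsub>W\<^esub> i1 (\<delta> b) \<otimes>\<^bsub>W\<^esub> i2 v"
      unfolding \<delta>_mult[OF h b] using hb by (simp del: fun_algebra_simps add: \<delta>_carrier i1.hom_struct)
    also have "\<dots> = i1 (\<delta> b) \<otimes>\<^bsub>W\<^esub> i2 (struct_map V (h b) \<otimes>\<^bsub>V\<^esub> v)"
      using hb d v by (simp add: i2.hom_struct W.m_ac)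
    also have "struct_map V (h b) \<otimes>\<^bsub>V\<^esub> v = ev b (i1 h \<otimes>\<^bsub>W\<^esub> i2 v)"
      using h v b by (simp add: ev_i1 ev_i2 \<delta>_carrier del: fun_algebra_simps)
    finally show "?h (i1 h \<otimes>\<^bsub>W\<^esub> i2 v) = \<zero>\<^bsub>W\<^esub>"
      using h v d by (simp add: W.minus_eq W.r_distr W.r_minus W.r_neg \<delta>_carrier del: fun_algebra_simps)
  qed (use d in simp)
  then have "i1 (\<delta> b) \<otimes>\<^bsub>W\<^esub> w \<ominus>\<^bsub>W\<^esub> i1 (\<delta> b) \<otimes>\<^bsub>W\<^esub> i2 (ev b w) = \<zero>\<^bsub>W\<^esub>"
    using d w by (simp add: W.minus_eq W.r_distr W.r_minus)
  then show ?thesis using d w by simp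
qed

lemma sum_\<delta>: "(\<Oplus>\<^bsub>A\<^esub>b\<in>M. \<delta> b) = \<one>\<^bsub>A\<^esub>"
proof
  fix a
  show "(\<Oplus>\<^bsub>A\<^esub>b\<in>M. \<delta> b) a = \<one>\<^bsub>A\<^esub> a"
  proof (cases "a \<in> M")
    case True
    interpret e: formal_map K A "base_algebra K" "\<lambda>f. f a"
      by (rule formal_mapI[OF V.K.fun_formal base_formal(1)[OF V.K.cring_axioms] V.K.eval_hom[OF True]])
    have "(\<Oplus>\<^bsub>A\<^esub>b\<in>M. \<delta> b) a = (\<Oplus>\<^bsub>base_algebra K\<^esub>b\<in>M. \<delta> b a)"
      using e.hom_finsum[of \<delta> M] by (simp add: comp_def \<delta>_carrier del: fun_algebra_simps)
    also have "\<dots> = (\<Oplus>\<^bsub>base_algebra K\<^esub>b\<in>M. if a = b then \<one>\<^bsub>K\<^esub> else \<zero>\<^bsub>base_algebra K\<^esub>)"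
      using True by (intro e.T.add.finprod_cong') (auto simp: \<delta>_def)
    also have "\<dots> = \<one>\<^bsub>K\<^esub>" using True fin by (intro e.T.add.finprod_singleton) auto
    finally show ?thesis using True by simp
  next
    case False
    have "(\<Oplus>\<^bsub>A\<^esub>b\<in>M. \<delta> b) \<in> carrier A" by (rule U.finsum_closed) simp
    then show ?thesis using False by (auto simp: PiE_iff extensional_def)
  qed
qed

text \<open>As the idempotents \<open>\<delta> b\<close> sum to one, \<open>ev_proj\<close>
  reconstructs an element from its components.\<close>

lemma ev_inject:
  assumes w: "w \<in> carrier W" "w' \<in> carrier W" and eq: "\<And>b. b \<in> M \<Longrightarrow> ev b w = ev b w'"
  shows "w = w'"
proof -
  have "w = (\<Oplus>\<^bsub>W\<^esub>b\<in>M. i1 (\<delta> b) \<otimes>\<^bsub>W\<^esub> i2 (ev b w))" if w: "w \<in> carrier W" for w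
  proof -
    have "w = i1 (\<Oplus>\<^bsub>A\<^esub>b\<in>M. \<delta> b) \<otimes>\<^bsub>W\<^esub> w" using w unfolding sum_\<delta> by (simp add: \<delta>_carrier del: fun_algebra_simps)
    also have "\<dots> = (\<Oplus>\<^bsub>W\<^esub>b\<in>M. i1 (\<delta> b)) \<otimes>\<^bsub>W\<^esub> w"
      using i1.hom_finsum[of \<delta> M] by (simp add: comp_def \<delta>_carrier del: fun_algebra_simps)
    also have "\<dots> = (\<Oplus>\<^bsub>W\<^esub>b\<in>M. i1 (\<delta> b) \<otimes>\<^bsub>W\<^esub> w)"
      using w fin by (intro W.finsum_ldistr) auto
    also have "\<dots> = (\<Oplus>\<^bsub>W\<^esub>b\<in>M. i1 (\<delta> b) \<otimes>\<^bsub>W\<^esub> i2 (ev b w))"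
      using w by (intro W.add.finprod_cong') (auto simp: ev_proj[symmetric])
    finally show ?thesis .
  qed
  note * = this
  have "(\<Oplus>\<^bsub>W\<^esub>b\<in>M. i1 (\<delta> b) \<otimes>\<^bsub>W\<^esub> i2 (ev b w)) = (\<Oplus>\<^bsub>W\<^esub>b\<in>M. i1 (\<delta> b) \<otimes>\<^bsub>W\<^esub> i2 (ev b w'))"
  proof (rule W.add.finprod_cong')
    show "(\<lambda>b. i1 (\<delta> b) \<otimes>\<^bsub>W\<^esub> i2 (ev b w')) \<in> M \<rightarrow> carrier W"
      using w(2) by (auto simp: ev_proj[symmetric])
  qed (simp_all add: eq)
  then show ?thesis using *[OF w(1)] *[OF w(2)] by simp
qed

end

section \<open>Duality for finite abelian groups\<close>

abbreviation (input) "rat_add \<equiv> \<lparr>carrier = UNIV, monoid.mult = (+), one = (0::rat)\<rparr>"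

section \<open>The group of rationals modulo the integers and its characters\<close>

definition rat_class :: "rat \<Rightarrow> rat set" where
  "rat_class r = \<int> #>\<^bsub>rat_add\<^esub> r"

lemma rat_add_group: "comm_group rat_add"
  by (rule comm_groupI) (auto intro: exI[of _ "- x" for x])

lemma Ints_normal: "\<int> \<lhd> rat_add"
proof -
  interpret comm_group rat_add by (rule rat_add_group)
  have inv: "inv\<^bsub>rat_add\<^esub> r = - r" for r by (rule inv_equality) auto
  have "subgroup \<int> rat_add" by (rule subgroupI) (auto simp: inv)
  then show ?thesis by (rule subgroup_imp_normal)
qed

lemma rmi_carrier: "carrier rat_mod_int = range rat_class"
  by (auto simp: rat_mod_int_def FactGroup_def RCOSETS_def rat_class_def)

lemma rat_class_closed [simp]: "rat_class r \<in> carrier rat_mod_int"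
  by (simp add: rmi_carrier)

lemma rmi_mult: "rat_class r \<otimes>\<^bsub>rat_mod_int\<^esub> rat_class s = rat_class (r + s)"
  unfolding rat_mod_int_def FactGroup_def rat_class_def using normal.rcos_sum[OF Ints_normal, of r s] by simp

lemma rat_class_mem: "s \<in> rat_class r \<longleftrightarrow> s - r \<in> \<int>"
  by (auto simp: rat_class_def r_coset_def intro!: bexI[of _ "s - r"])

lemma rat_class_eq_iff: "rat_class r = rat_class s \<longleftrightarrow> r - s \<in> \<int>"
proof
  assume "rat_class r = rat_class s"
  moreover have "r \<in> rat_class r" by (simp add: rat_class_mem)
  ultimately show "r - s \<in> \<int>" by (simp add: rat_class_mem)
next
  assume rs: "r - s \<in> \<int>"
  have "t - r \<in> \<int> \<longleftrightarrow> t - s \<in> \<int>" for t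
    using Ints_add[OF _ rs, of "t - r"] Ints_diff[OF _ rs, of "t - s"] by auto
  then show "rat_class r = rat_class s" by (auto simp: rat_class_mem)
qed

lemma rmi_one: "\<one>\<^bsub>rat_mod_int\<^esub> = rat_class 0"
  by (auto simp: rat_mod_int_def FactGroup_def rat_class_mem)

lemma rmi_group: "comm_group rat_mod_int"
proof -
  have "rat_class r \<otimes>\<^bsub>rat_mod_int\<^esub> rat_class s = rat_class s \<otimes>\<^bsub>rat_mod_int\<^esub> rat_class r" for r s
    by (simp add: rmi_mult add.commute)
  moreover have "group rat_mod_int"
    unfolding rat_mod_int_def by (rule normal.factorgroup_is_group[OF Ints_normal])
  ultimately show ?thesis by (intro group.group_comm_groupI) (auto simp: rmi_carrier)
qed

interpretation rmi: comm_group rat_mod_int by (rule rmi_group)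

lemma rat_class_pow: "rat_class r [^]\<^bsub>rat_mod_int\<^esub> (n::nat) = rat_class (of_nat n * r)"
  by (induction n) (simp_all add: rmi_one rmi_mult algebra_simps)

lemma rmi_divisible:
  assumes "z \<in> carrier rat_mod_int" "n > 0"
  shows "\<exists>q\<in>carrier rat_mod_int. q [^]\<^bsub>rat_mod_int\<^esub> (n::nat) = z"
proof -
  obtain r where "z = rat_class r" using assms by (auto simp: rmi_carrier)
  then show ?thesis using assms by (intro bexI[of _ "rat_class (r / of_nat n)"]) (simp_all add: rat_class_pow)
qed

text \<open>The embedding of rationals modulo integers into the unit circle. It turns characters
  into complex functions, to which orthogonality applies.\<close>

definition rmi_cis :: "rat set \<Rightarrow> complex" where
  "rmi_cis S = cis (2 * pi * of_rat (SOME r. S = rat_class r))"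

lemma cis_eq_iff_Ints: "cis (2 * pi * of_rat r) = cis (2 * pi * of_rat s) \<longleftrightarrow> r - s \<in> \<int>"
proof -
  have "cis (2 * pi * of_rat r) = cis (2 * pi * of_rat s) \<longleftrightarrow> cis (2 * pi * (of_rat r - of_rat s)) = 1"
    using cis_divide[of "2 * pi * of_rat r" "2 * pi * of_rat s"] cis_neq_zero by (auto simp: right_diff_distrib)
  also have "\<dots> \<longleftrightarrow> (\<exists>n::int. of_rat r - of_rat s = (of_int n :: real))"
  proof -
    have "cis (2 * pi * x) = 1 \<longleftrightarrow> (\<exists>n::int. x = of_int n)" for x :: real
      using cos_one_2pi_int[of "2 * pi * x"] sin_cos_eq_iff[of "2 * pi * x" 0]
      by (auto simp: complex_eq_iff sin_times_pi_eq_0 mult.commute)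
    then show ?thesis by simp
  qed
  also have "\<dots> \<longleftrightarrow> (\<exists>n::int. of_rat (r - s) = (of_rat (of_int n) :: real))" by (simp add: of_rat_diff)
  also have "\<dots> \<longleftrightarrow> r - s \<in> \<int>" by (simp only: of_rat_eq_iff) (auto elim: Ints_cases)
  finally show ?thesis .
qed

lemma rmi_cis_class: "rmi_cis (rat_class r) = cis (2 * pi * of_rat r)"
proof -
  have "rat_class r = rat_class (SOME s. rat_class r = rat_class s)" by (rule someI[of _ r]) simp
  then show ?thesis unfolding rmi_cis_def by (simp add: cis_eq_iff_Ints rat_class_eq_iff) (metis minus_diff_eq Ints_minus)
qed

lemma rmi_cis_mult:
  "x \<in> carrier rat_mod_int \<Longrightarrow> y \<in> carrier rat_mod_int \<Longrightarrow> rmi_cis (x \<otimes>\<^bsub>rat_mod_int\<^esub> y) = rmi_cis x * rmi_cis y"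
  by (auto simp: rmi_carrier rmi_mult rmi_cis_class cis_mult of_rat_add algebra_simps)

lemma rmi_cis_one: "rmi_cis \<one>\<^bsub>rat_mod_int\<^esub> = 1"
  by (simp add: rmi_one rmi_cis_class)

lemma rmi_cis_norm: "rmi_cis x * cnj (rmi_cis x) = 1"
  by (simp add: rmi_cis_def cis_cnj cis_mult)

lemma rmi_cis_inj:
  "x \<in> carrier rat_mod_int \<Longrightarrow> y \<in> carrier rat_mod_int \<Longrightarrow> rmi_cis x = rmi_cis y \<Longrightarrow> x = y"
  unfolding rmi_carrier by (elim imageE) (simp add: rmi_cis_class cis_eq_iff_Ints rat_class_eq_iff)

text \<open>Translating the summation by an element \<open>h\<close> where the characters differ
  multiplies the sum by a constant other than one.\<close>

lemma character_orthogonality: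
  assumes "group G" and fin: "finite (carrier G)"
    and \<chi>: "\<chi> \<in> hom G rat_mod_int" and \<psi>: "\<psi> \<in> hom G rat_mod_int"
    and ne: "\<exists>g\<in>carrier G. \<chi> g \<noteq> \<psi> g"
  shows "(\<Sum>g\<in>carrier G. rmi_cis (\<chi> g) * cnj (rmi_cis (\<psi> g))) = 0"
proof -
  interpret group G by fact
  let ?f = "\<lambda>g. rmi_cis (\<chi> g) * cnj (rmi_cis (\<psi> g))"
  obtain h where h: "h \<in> carrier G" "\<chi> h \<noteq> \<psi> h" using ne by blast
  have c: "\<chi> g \<in> carrier rat_mod_int" "\<psi> g \<in> carrier rat_mod_int" if "g \<in> carrier G" for g
    using \<chi> \<psi> that by (auto simp: hom_def)
  have "?f h \<noteq> 1"
  proof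
    assume "?f h = 1"
    then have "rmi_cis (\<psi> h) * ?f h = rmi_cis (\<psi> h)" by simp
    then have "rmi_cis (\<chi> h) = rmi_cis (\<psi> h)" using rmi_cis_norm[of "\<psi> h"] by (simp add: algebra_simps)
    then show False using rmi_cis_inj c h by blast
  qed
  have mul: "?f (h \<otimes>\<^bsub>G\<^esub> g) = ?f h * ?f g" if "g \<in> carrier G" for g
    using that h c \<chi> \<psi> by (simp add: hom_mult rmi_cis_mult)
  have "(\<Sum>g\<in>carrier G. ?f g) = (\<Sum>g\<in>carrier G. ?f (h \<otimes>\<^bsub>G\<^esub> g))"
    by (rule sum.reindex_bij_witness[of _ "\<lambda>g. h \<otimes>\<^bsub>G\<^esub> g" "\<lambda>g. inv\<^bsub>G\<^esub> h \<otimes>\<^bsub>G\<^esub> g"])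
      (use h in \<open>auto simp: m_assoc[symmetric]\<close>)
  also have "\<dots> = (\<Sum>g\<in>carrier G. ?f h * ?f g)" by (rule sum.cong[OF refl mul])
  also have "\<dots> = ?f h * (\<Sum>g\<in>carrier G. ?f g)" by (simp only: sum_distrib_left)
  finally have "(\<Sum>g\<in>carrier G. ?f g) = ?f h * (\<Sum>g\<in>carrier G. ?f g)" .
  moreover have "s = 0" if "s = c * s" "c \<noteq> 1" for s c :: complex using that by simp
  ultimately show ?thesis using \<open>?f h \<noteq> 1\<close> by blast
qed

text \<open>Sum \<open>|\<Sum>\<chi>(g)|\<^sup>2\<close> over the group by orthogonality, and bound it below by its terms in \<open>S\<close>.\<close>

lemma card_characters_le:
  assumes G: "group G" and fin: "finite (carrier G)" and "finite Y"
    and Y: "Y \<subseteq> hom G rat_mod_int \<inter> extensional (carrier G)"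
    and S: "S \<subseteq> carrier G" "\<And>\<chi> s. \<chi> \<in> Y \<Longrightarrow> s \<in> S \<Longrightarrow> \<chi> s = \<one>\<^bsub>rat_mod_int\<^esub>"
  shows "card Y * card S \<le> card (carrier G)"
proof (cases "Y = {}")
  case False
  define F where "F g = (\<Sum>\<chi>\<in>Y. rmi_cis (\<chi> g))" for g
  have "(\<Sum>g\<in>carrier G. rmi_cis (\<chi> g) * cnj (rmi_cis (\<psi> g))) = (if \<psi> = \<chi> then of_nat (card (carrier G)) else 0)"
    if "\<chi> \<in> Y" "\<psi> \<in> Y" for \<chi> \<psi>
  proof (cases "\<psi> = \<chi>")
    case True
    then show ?thesis by (simp add: rmi_cis_norm)
  next
    case False
    then have "\<exists>g\<in>carrier G. \<chi> g \<noteq> \<psi> g"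
      using that Y extensionalityI[of \<psi> "carrier G" \<chi>] by (metis Int_iff subsetD)
    then show ?thesis using that Y False by (subst character_orthogonality[OF G fin]) auto
  qed
  then have "(\<Sum>\<chi>\<in>Y. \<Sum>\<psi>\<in>Y. \<Sum>g\<in>carrier G. rmi_cis (\<chi> g) * cnj (rmi_cis (\<psi> g)))
      = (\<Sum>\<chi>\<in>Y. \<Sum>\<psi>\<in>Y. if \<psi> = \<chi> then of_nat (card (carrier G)) else 0)"
    by (intro sum.cong) auto
  also have "\<dots> = of_nat (card Y * card (carrier G))" using \<open>finite Y\<close> by simp
  also have "(\<Sum>\<chi>\<in>Y. \<Sum>\<psi>\<in>Y. \<Sum>g\<in>carrier G. rmi_cis (\<chi> g) * cnj (rmi_cis (\<psi> g))) = (\<Sum>g\<in>carrier G. F g * cnj (F g))"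
  proof -
    have "(\<Sum>g\<in>carrier G. F g * cnj (F g)) = (\<Sum>g\<in>carrier G. \<Sum>\<chi>\<in>Y. \<Sum>\<psi>\<in>Y. rmi_cis (\<chi> g) * cnj (rmi_cis (\<psi> g)))"
      by (simp add: F_def sum_product)
    also have "\<dots> = (\<Sum>\<chi>\<in>Y. \<Sum>g\<in>carrier G. \<Sum>\<psi>\<in>Y. rmi_cis (\<chi> g) * cnj (rmi_cis (\<psi> g)))" by (rule sum.swap)
    also have "\<dots> = (\<Sum>\<chi>\<in>Y. \<Sum>\<psi>\<in>Y. \<Sum>g\<in>carrier G. rmi_cis (\<chi> g) * cnj (rmi_cis (\<psi> g)))"
      by (intro sum.cong refl sum.swap)
    finally show ?thesis by simp
  qed
  also have "\<dots> = complex_of_real (\<Sum>g\<in>carrier G. (cmod (F g))\<^sup>2)"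
    by (simp only: of_real_sum complex_norm_square)
  finally have "(\<Sum>g\<in>carrier G. (cmod (F g))\<^sup>2) = real (card Y * card (carrier G))"
    by (metis of_real_eq_iff of_real_of_nat_eq)
  moreover have "(\<Sum>g\<in>S. (cmod (F g))\<^sup>2) \<le> (\<Sum>g\<in>carrier G. (cmod (F g))\<^sup>2)"
    by (rule sum_mono2) (use fin S in auto)
  moreover have "F s = of_nat (card Y)" if "s \<in> S" for s
  proof -
    have "F s = (\<Sum>\<chi>\<in>Y. 1)" unfolding F_def by (rule sum.cong) (simp_all add: S(2)[OF _ that] rmi_cis_one)
    then show ?thesis by simp
  qed
  ultimately have "real (card S) * (real (card Y))\<^sup>2 \<le> real (card Y * card (carrier G))" by simp
  then have "card S * (card Y * card Y) \<le> card Y * card (carrier G)"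
    by (simp add: power2_eq_square flip: of_nat_mult)
  then have "card Y * (card Y * card S) \<le> card Y * card (carrier G)" by (simp add: ac_simps)
  then show ?thesis using False \<open>finite Y\<close> by (simp add: card_gt_0_iff)
qed simp

text \<open>With \<open>S\<close> consisting of the identity, the preceding bound says that a finite
  set of characters has at most as many elements as \<open>G\<close>; an infinite set would contain
  larger finite ones.\<close>

lemma finite_characters:
  assumes "group G" "finite (carrier G)"
  shows "finite (hom G rat_mod_int \<inter> extensional (carrier G))"
proof (rule ccontr)
  assume "infinite (hom G rat_mod_int \<inter> extensional (carrier G))"
  then obtain Y where Y: "finite Y" "card Y = Suc (card (carrier G))" "Y \<subseteq> hom G rat_mod_int \<inter> extensional (carrier G)"
    using infinite_arbitrarily_large by blast
  have "card Y * card {\<one>\<^bsub>G\<^esub>} \<le> card (carrier G)"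
  proof (rule card_characters_le[OF assms Y(1,3)])
    show "\<chi> s = \<one>\<^bsub>rat_mod_int\<^esub>" if "\<chi> \<in> Y" "s \<in> {\<one>\<^bsub>G\<^esub>}" for \<chi> s
      using that Y assms(1) hom_one[of \<chi> G rat_mod_int] rmi.is_group by auto
  qed (use assms group.is_monoid monoid.one_closed in auto)
  with Y show False by simp
qed

text \<open>The target is divisible. If \<open>n\<close> is the least positive exponent for which
  the power of \<open>a\<close> lies in \<open>H\<close>, then \<open>\<beta>\<close> extends to the
  subgroup generated by \<open>H\<close> and \<open>a\<close> by sending \<open>a\<close> to an
  \<open>n\<close>-th root \<open>q\<close> of the value of \<open>\<beta>\<close> at that
  power.\<close>

lemma extend_character_step:
  assumes A: "comm_group A" and fin: "finite (carrier A)" and H: "subgroup H A"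
    and a: "a \<in> carrier A" "a \<notin> H" and \<beta>: "\<beta> \<in> hom (A\<lparr>carrier := H\<rparr>) rat_mod_int"
  shows "\<exists>H' \<gamma>. subgroup H' A \<and> H \<subset> H' \<and> \<gamma> \<in> hom (A\<lparr>carrier := H'\<rparr>) rat_mod_int \<and> (\<forall>h\<in>H. \<gamma> h = \<beta> h)"
proof -
  interpret A: comm_group A by fact
  interpret H: subgroup H A by fact
  have Hc: "h \<in> carrier A" if "h \<in> H" for h using that H.subset by blast
  have \<beta>c: "\<beta> h \<in> carrier rat_mod_int" if "h \<in> H" for h using \<beta> that by (auto simp: hom_def)
  have \<beta>m: "\<beta> (h \<otimes>\<^bsub>A\<^esub> h') = \<beta> h \<otimes>\<^bsub>rat_mod_int\<^esub> \<beta> h'" if "h \<in> H" "h' \<in> H" for h h'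
    using \<beta> that by (auto simp: hom_def)
  have \<beta>1: "\<beta> \<one>\<^bsub>A\<^esub> = \<one>\<^bsub>rat_mod_int\<^esub>"
    using \<beta>m[of "\<one>\<^bsub>A\<^esub>" "\<one>\<^bsub>A\<^esub>"] \<beta>c[of "\<one>\<^bsub>A\<^esub>"] rmi.l_cancel_one by auto
  define n where "n = (LEAST n. n > 0 \<and> a [^]\<^bsub>A\<^esub> (n::nat) \<in> H)"
  have "order A > 0 \<and> a [^]\<^bsub>A\<^esub> order A \<in> H"
    using fin a A.pow_order_eq_1 A.order_gt_0_iff_finite by simp
  then have n: "n > 0" "a [^]\<^bsub>A\<^esub> n \<in> H" unfolding n_def by (metis (mono_tags, lifting) LeastI)+
  have n_least: "\<not> (m > 0 \<and> a [^]\<^bsub>A\<^esub> m \<in> H)" if "m < n" for m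
    using that not_less_Least unfolding n_def by blast
  obtain q where q: "q \<in> carrier rat_mod_int" "q [^]\<^bsub>rat_mod_int\<^esub> n = \<beta> (a [^]\<^bsub>A\<^esub> n)"
    using rmi_divisible \<beta>c n by blast
  have nk: "a [^]\<^bsub>A\<^esub> (n * k) \<in> H \<and> \<beta> (a [^]\<^bsub>A\<^esub> (n * k)) = q [^]\<^bsub>rat_mod_int\<^esub> (n * k)" for k :: nat
  proof (induction k)
    case (Suc k)
    have "a [^]\<^bsub>A\<^esub> (n * Suc k) = a [^]\<^bsub>A\<^esub> n \<otimes>\<^bsub>A\<^esub> a [^]\<^bsub>A\<^esub> (n * k)" using a by (simp add: A.nat_pow_mult)
    then show ?case using Suc n q by (simp add: \<beta>m rmi.nat_pow_mult[symmetric] q(2)[symmetric])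
  qed (simp add: \<beta>1)
  \<comment> \<open>By minimality of \<open>n\<close>, an exponent \<open>k\<close> with the power
    of \<open>a\<close> in \<open>H\<close> is a multiple of \<open>n\<close>. So \<open>q\<close>
    and \<open>\<beta>\<close> agree wherever they could conflict.\<close>
  have pw: "q [^]\<^bsub>rat_mod_int\<^esub> k = \<beta> (a [^]\<^bsub>A\<^esub> k)" if k: "a [^]\<^bsub>A\<^esub> k \<in> H" for k :: nat
  proof -
    have "a [^]\<^bsub>A\<^esub> k = a [^]\<^bsub>A\<^esub> (k mod n) \<otimes>\<^bsub>A\<^esub> a [^]\<^bsub>A\<^esub> (n * (k div n))" using a by (simp add: A.nat_pow_mult)
    then have "a [^]\<^bsub>A\<^esub> (k mod n) = a [^]\<^bsub>A\<^esub> k \<otimes>\<^bsub>A\<^esub> inv\<^bsub>A\<^esub> (a [^]\<^bsub>A\<^esub> (n * (k div n)))"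
      using a by (simp add: A.m_assoc)
    then have "a [^]\<^bsub>A\<^esub> (k mod n) \<in> H" using k nk by simp
    then have "k mod n = 0" using n_least[of "k mod n"] n by auto
    then show ?thesis using nk[of "k div n"] by (metis add.right_neutral mult_div_mod_eq)
  qed
  \<comment> \<open>Natural exponents are enough because \<open>A\<close> is finite: inverses are
    positive powers or the identity.\<close>
  define H' where "H' = {h \<otimes>\<^bsub>A\<^esub> a [^]\<^bsub>A\<^esub> (i::nat) | h i. h \<in> H}"
  define \<gamma> where "\<gamma> x = (THE z. \<exists>h i. h \<in> H \<and> x = h \<otimes>\<^bsub>A\<^esub> a [^]\<^bsub>A\<^esub> (i::nat) \<and> z = \<beta> h \<otimes>\<^bsub>rat_mod_int\<^esub> q [^]\<^bsub>rat_mod_int\<^esub> i)" for x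
  have le: "\<beta> h \<otimes>\<^bsub>rat_mod_int\<^esub> q [^]\<^bsub>rat_mod_int\<^esub> i = \<beta> h' \<otimes>\<^bsub>rat_mod_int\<^esub> q [^]\<^bsub>rat_mod_int\<^esub> j"
    if h: "h \<in> H" "h' \<in> H" and eq: "h \<otimes>\<^bsub>A\<^esub> a [^]\<^bsub>A\<^esub> i = h' \<otimes>\<^bsub>A\<^esub> a [^]\<^bsub>A\<^esub> j" and ij: "i \<le> j" for h h' and i j :: nat
  proof -
    have c: "h \<in> carrier A" "h' \<in> carrier A" using h Hc by auto
    have "h \<otimes>\<^bsub>A\<^esub> a [^]\<^bsub>A\<^esub> i = (h' \<otimes>\<^bsub>A\<^esub> a [^]\<^bsub>A\<^esub> (j - i)) \<otimes>\<^bsub>A\<^esub> a [^]\<^bsub>A\<^esub> i"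
      using eq a c ij by (simp add: A.m_assoc A.nat_pow_mult)
    then have h_eq: "h = h' \<otimes>\<^bsub>A\<^esub> a [^]\<^bsub>A\<^esub> (j - i)" using a c by simp
    then have "a [^]\<^bsub>A\<^esub> (j - i) = inv\<^bsub>A\<^esub> h' \<otimes>\<^bsub>A\<^esub> h" using a c by (simp add: A.m_assoc[symmetric])
    then have k: "a [^]\<^bsub>A\<^esub> (j - i) \<in> H" using h by simp
    have "\<beta> h = \<beta> h' \<otimes>\<^bsub>rat_mod_int\<^esub> q [^]\<^bsub>rat_mod_int\<^esub> (j - i)" using h_eq \<beta>m[OF h(2) k] pw[OF k] by simp
    then show ?thesis using ij q \<beta>c h by (simp add: rmi.m_assoc rmi.nat_pow_mult)
  qed
  have \<gamma>: "\<gamma> (h \<otimes>\<^bsub>A\<^esub> a [^]\<^bsub>A\<^esub> i) = \<beta> h \<otimes>\<^bsub>rat_mod_int\<^esub> q [^]\<^bsub>rat_mod_int\<^esub> i" if h: "h \<in> H" for h and i :: nat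
    unfolding \<gamma>_def
  proof (rule the_equality)
    fix z assume "\<exists>h' j. h' \<in> H \<and> h \<otimes>\<^bsub>A\<^esub> a [^]\<^bsub>A\<^esub> i = h' \<otimes>\<^bsub>A\<^esub> a [^]\<^bsub>A\<^esub> (j::nat) \<and> z = \<beta> h' \<otimes>\<^bsub>rat_mod_int\<^esub> q [^]\<^bsub>rat_mod_int\<^esub> j"
    then obtain h' j where "h' \<in> H" "h \<otimes>\<^bsub>A\<^esub> a [^]\<^bsub>A\<^esub> i = h' \<otimes>\<^bsub>A\<^esub> a [^]\<^bsub>A\<^esub> (j::nat)" "z = \<beta> h' \<otimes>\<^bsub>rat_mod_int\<^esub> q [^]\<^bsub>rat_mod_int\<^esub> j"
      by blast
    then show "z = \<beta> h \<otimes>\<^bsub>rat_mod_int\<^esub> q [^]\<^bsub>rat_mod_int\<^esub> i"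
      using le[of h h' i j] le[of h' h j i] h by (cases "i \<le> j") auto
  qed (use h in blast)
  have mul: "(h \<otimes>\<^bsub>A\<^esub> a [^]\<^bsub>A\<^esub> i) \<otimes>\<^bsub>A\<^esub> (h' \<otimes>\<^bsub>A\<^esub> a [^]\<^bsub>A\<^esub> j) = (h \<otimes>\<^bsub>A\<^esub> h') \<otimes>\<^bsub>A\<^esub> a [^]\<^bsub>A\<^esub> (i + j)"
    if "h \<in> H" "h' \<in> H" for h h' and i j :: nat
    using that a Hc by (simp add: A.nat_pow_mult[symmetric] A.m_ac)
  have H'_iff: "x \<in> H' \<longleftrightarrow> (\<exists>h i. h \<in> H \<and> x = h \<otimes>\<^bsub>A\<^esub> a [^]\<^bsub>A\<^esub> (i::nat))" for x by (auto simp: H'_def)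
  have H'c: "H' \<subseteq> carrier A" using a Hc by (auto simp: H'_def)
  have H'm: "x \<otimes>\<^bsub>A\<^esub> y \<in> H'" if "x \<in> H'" "y \<in> H'" for x y
    using that mul unfolding H'_iff by (metis H.m_closed)
  have HH': "H \<subseteq> H'"
  proof
    fix h assume "h \<in> H"
    then show "h \<in> H'" using Hc unfolding H'_iff by (intro exI[of _ h] exI[of _ 0]) simp
  qed
  have aH': "a \<in> H'" using a unfolding H'_iff by (intro exI[of _ "\<one>\<^bsub>A\<^esub>"] exI[of _ 1]) simp
  have "subgroup H' A"
  proof (rule A.subgroupI)
    show "inv\<^bsub>A\<^esub> x \<in> H'" if x: "x \<in> H'" for x
    proof -
      have xc: "x \<in> carrier A" using x H'c by blast
      have pos: "order A > 0" using fin A.order_gt_0_iff_finite by simp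
      have "x [^]\<^bsub>A\<^esub> k \<in> H'" for k :: nat
        by (induction k) (use x H'm HH' in auto)
      moreover have "x [^]\<^bsub>A\<^esub> (order A - 1) \<otimes>\<^bsub>A\<^esub> x = \<one>\<^bsub>A\<^esub>"
        using xc pos A.pow_order_eq_1[OF xc] by (metis A.nat_pow_Suc Suc_diff_1)
      then have "inv\<^bsub>A\<^esub> x = x [^]\<^bsub>A\<^esub> (order A - 1)" using xc by (intro A.inv_equality) auto
      ultimately show ?thesis by simp
    qed
  qed (use H'c H'm aH' in auto)
  moreover have "H \<subset> H'" using HH' aH' a by blast
  moreover have "\<gamma> \<in> hom (A\<lparr>carrier := H'\<rparr>) rat_mod_int"
  proof (rule homI)
    fix x assume "x \<in> carrier (A\<lparr>carrier := H'\<rparr>)"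
    then obtain h i where "h \<in> H" "x = h \<otimes>\<^bsub>A\<^esub> a [^]\<^bsub>A\<^esub> (i::nat)" by (auto simp: H'_def)
    then show "\<gamma> x \<in> carrier rat_mod_int" using \<beta>c q by (simp add: \<gamma>)
  next
    fix x y assume "x \<in> carrier (A\<lparr>carrier := H'\<rparr>)" "y \<in> carrier (A\<lparr>carrier := H'\<rparr>)"
    then obtain h i h' j where h: "h \<in> H" "x = h \<otimes>\<^bsub>A\<^esub> a [^]\<^bsub>A\<^esub> (i::nat)" "h' \<in> H" "y = h' \<otimes>\<^bsub>A\<^esub> a [^]\<^bsub>A\<^esub> (j::nat)"
      by (auto simp: H'_def)
    then show "\<gamma> (x \<otimes>\<^bsub>A\<lparr>carrier := H'\<rparr>\<^esub> y) = \<gamma> x \<otimes>\<^bsub>rat_mod_int\<^esub> \<gamma> y"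
      using \<beta>c q by (simp add: mul \<gamma> \<beta>m rmi.nat_pow_mult[symmetric] rmi.m_ac)
  qed
  moreover have "\<gamma> h = \<beta> h" if "h \<in> H" for h
    using \<gamma>[OF that, of 0] Hc[OF that] \<beta>c[OF that] by simp
  ultimately show ?thesis by blast
qed

lemma extend_character:
  assumes A: "comm_group A" and fin: "finite (carrier A)" and "subgroup H A"
    and "\<beta> \<in> hom (A\<lparr>carrier := H\<rparr>) rat_mod_int"
  shows "\<exists>\<alpha>\<in>hom A rat_mod_int. \<forall>h\<in>H. \<alpha> h = \<beta> h"
  using assms(3,4)
proof (induction "card (carrier A) - card H" arbitrary: H \<beta> rule: less_induct)
  case less
  interpret H: subgroup H A by fact
  show ?case
  proof (cases "H = carrier A")
    case True
    then show ?thesis using less.prems by (intro bexI[of _ \<beta>]) (auto simp: hom_def)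
  next
    case False
    then obtain a where "a \<in> carrier A" "a \<notin> H" using H.subset by blast
    from extend_character_step[OF A fin less.prems(1) this less.prems(2)]
    obtain H' \<gamma> where H': "subgroup H' A" "H \<subset> H'" "\<gamma> \<in> hom (A\<lparr>carrier := H'\<rparr>) rat_mod_int" "\<forall>h\<in>H. \<gamma> h = \<beta> h"
      by blast
    have "H' \<subseteq> carrier A" using H'(1) subgroup.subset by blast
    then have "card H < card H'" "card H' \<le> card (carrier A)"
      using H'(2) fin by (auto intro: psubset_card_mono card_mono finite_subset)
    then obtain \<alpha> where "\<alpha> \<in> hom A rat_mod_int" "\<forall>h\<in>H'. \<alpha> h = \<gamma> h"
      using less.hyps[OF _ H'(1,3)] by (meson diff_less_mono2 order_less_le_trans)
    then show ?thesis using H' by (intro bexI[of _ \<alpha>]) auto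
  qed
qed

section \<open>Dual groups and annihilators\<close>

lemma dual_simps: 
  "carrier (dual_group A) = hom A rat_mod_int \<inter> extensional (carrier A)"
  "\<alpha> \<otimes>\<^bsub>dual_group A\<^esub> \<beta> = (\<lambda>a\<in>carrier A. \<alpha> a \<otimes>\<^bsub>rat_mod_int\<^esub> \<beta> a)"
  "\<one>\<^bsub>dual_group A\<^esub> = (\<lambda>a\<in>carrier A. \<one>\<^bsub>rat_mod_int\<^esub>)"
  by (simp_all add: dual_group_def)

lemma dual_comm_group:
  assumes A: "group A"
  shows "comm_group (dual_group A)"
proof (rule comm_groupI)
  interpret A: group A by fact
  show "\<one>\<^bsub>dual_group A\<^esub> \<in> carrier (dual_group A)" by (auto simp: dual_simps intro!: homI)
  fix \<alpha> \<beta> assume \<alpha>: "\<alpha> \<in> carrier (dual_group A)" and \<beta>: "\<beta> \<in> carrier (dual_group A)"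
  have c: "\<alpha> a \<in> carrier rat_mod_int" "\<beta> a \<in> carrier rat_mod_int" if "a \<in> carrier A" for a
    using \<alpha> \<beta> that by (auto simp: dual_simps hom_def)
  show "\<alpha> \<otimes>\<^bsub>dual_group A\<^esub> \<beta> \<in> carrier (dual_group A)"
    using \<alpha> \<beta> c unfolding dual_simps by (auto simp: hom_mult rmi.m_ac intro!: homI)
  show "\<alpha> \<otimes>\<^bsub>dual_group A\<^esub> \<beta> = \<beta> \<otimes>\<^bsub>dual_group A\<^esub> \<alpha>"
    using c by (auto simp: dual_simps rmi.m_comm intro!: restrict_ext)
  show "\<one>\<^bsub>dual_group A\<^esub> \<otimes>\<^bsub>dual_group A\<^esub> \<alpha> = \<alpha>"
    using \<alpha> c by (auto simp: dual_simps fun_eq_iff extensional_def)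
  have "(\<lambda>a\<in>carrier A. inv\<^bsub>rat_mod_int\<^esub> \<alpha> a) \<in> carrier (dual_group A)"
    using \<alpha> c by (auto simp: dual_simps hom_mult rmi.inv_mult intro!: homI)
  moreover have "(\<lambda>a\<in>carrier A. inv\<^bsub>rat_mod_int\<^esub> \<alpha> a) \<otimes>\<^bsub>dual_group A\<^esub> \<alpha> = \<one>\<^bsub>dual_group A\<^esub>"
    using c by (auto simp: dual_simps fun_eq_iff)
  ultimately show "\<exists>\<beta>\<in>carrier (dual_group A). \<beta> \<otimes>\<^bsub>dual_group A\<^esub> \<alpha> = \<one>\<^bsub>dual_group A\<^esub>" by blast
  fix \<gamma> assume \<gamma>: "\<gamma> \<in> carrier (dual_group A)"
  then show "\<alpha> \<otimes>\<^bsub>dual_group A\<^esub> \<beta> \<otimes>\<^bsub>dual_group A\<^esub> \<gamma> = \<alpha> \<otimes>\<^bsub>dual_group A\<^esub> (\<beta> \<otimes>\<^bsub>dual_group A\<^esub> \<gamma>)"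
    using c by (auto simp: dual_simps hom_def Pi_iff rmi.m_assoc intro!: restrict_ext)
qed

text \<open>A count in place of the structure theorem. Let \<open>Y\<close> be the set of characters
  that vanish on \<open>B\<close>, so \<open>N\<close> lies in \<open>Y\<close>. The bound
  \<open>card_characters_le\<close> gives \<open>|Y| |B| \<le> |A|\<close>. Conversely, evaluation
  sends \<open>A\<close> to characters of \<open>N\<close>, of which at most \<open>|N|\<close>
  occur by the same bound, and elements with equal evaluation differ by elements of
  \<open>B\<close>; hence \<open>|A| \<le> |N| |B|\<close>. Together
  \<open>|Y| \<le> |N|\<close>.\<close>

lemma annihilator_duality:
  assumes A: "comm_group A" and fin: "finite (carrier A)" and N: "subgroup N (dual_group A)"
  defines "B \<equiv> {a \<in> carrier A. \<forall>\<alpha>\<in>N. \<alpha> a = \<one>\<^bsub>rat_mod_int\<^esub>}"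
  shows annihilator_subgroup: "subgroup B A"
    and annihilator_annihilator:
      "{\<alpha> \<in> carrier (dual_group A). \<forall>b\<in>B. \<alpha> b = \<one>\<^bsub>rat_mod_int\<^esub>} = N"
proof -
  interpret A: comm_group A by fact
  interpret D: comm_group "dual_group A" by (rule dual_comm_group) (rule A.group_axioms)
  interpret N: subgroup N "dual_group A" by fact
  have hom: "\<alpha> \<in> hom A rat_mod_int" if "\<alpha> \<in> N" for \<alpha> using N.subset that by (auto simp: dual_simps)
  have hm: "group_hom A rat_mod_int \<alpha>" if "\<alpha> \<in> N" for \<alpha>
    using hom[OF that] by (simp add: group_hom_def group_hom_axioms_def A.group_axioms rmi.group_axioms)
  show B: "subgroup B A"
  proof (rule A.subgroupI)
    show "B \<noteq> {}" using group_hom.hom_one[OF hm] by (auto simp: B_def)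
    show "inv\<^bsub>A\<^esub> a \<in> B" if "a \<in> B" for a
      using that by (simp add: B_def group_hom.hom_inv[OF hm]) (metis rmi.inv_one)
    show "a \<otimes>\<^bsub>A\<^esub> b \<in> B" if "a \<in> B" "b \<in> B" for a b
      using that by (simp add: B_def hom_mult[OF hom]) (metis rmi.r_one rmi.one_closed)
  qed (simp add: B_def subset_eq)
  let ?Y = "{\<alpha> \<in> carrier (dual_group A). \<forall>b\<in>B. \<alpha> b = \<one>\<^bsub>rat_mod_int\<^esub>}"
  have finD: "finite (carrier (dual_group A))"
    using finite_characters[OF A.group_axioms fin] by (simp add: dual_simps)
  have finB: "finite B" using fin by (simp add: B_def)
  have NY: "N \<subseteq> ?Y" using N.subset by (auto simp: B_def)
  have 1: "card ?Y * card B \<le> card (carrier A)"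
  proof (rule card_characters_le[OF A.group_axioms fin])
    show "finite ?Y" using finD by simp
    show "?Y \<subseteq> hom A rat_mod_int \<inter> extensional (carrier A)" by (auto simp: dual_simps)
    show "B \<subseteq> carrier A" by (auto simp: B_def)
  qed blast
  define E where "E a = (\<lambda>\<alpha>\<in>N. \<alpha> a)" for a
  interpret NG: group "(dual_group A)\<lparr>carrier := N\<rparr>" by (rule D.subgroup_imp_group) (rule N)
  have finN: "finite N" using finD N.subset finite_subset by blast
  have "E a \<in> hom ((dual_group A)\<lparr>carrier := N\<rparr>) rat_mod_int" if "a \<in> carrier A" for a
    using that hom N.m_closed by (auto simp: E_def dual_simps hom_def Pi_iff)
  then have 2: "card (E ` carrier A) * card {\<one>\<^bsub>dual_group A\<^esub>} \<le> card (carrier ((dual_group A)\<lparr>carrier := N\<rparr>))"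
  proof (intro card_characters_le[OF NG.group_axioms])
    show "\<chi> s = \<one>\<^bsub>rat_mod_int\<^esub>" if cs: "\<chi> \<in> E ` carrier A" "s \<in> {\<one>\<^bsub>dual_group A\<^esub>}" for \<chi> s
    proof -
      obtain a where "\<chi> = E a" "a \<in> carrier A" using cs(1) by (rule imageE)
      then show ?thesis using cs(2) N.one_closed by (simp add: E_def) (simp add: dual_simps)
    qed
  qed (use fin finN in \<open>auto simp: E_def\<close>)
  have fib: "card {x \<in> carrier A. E x = y} \<le> card B" if y: "y \<in> E ` carrier A" for y
  proof -
    obtain a where a: "a \<in> carrier A" "y = E a" using y by blast
    have "inj_on (\<lambda>x. x \<otimes>\<^bsub>A\<^esub> inv\<^bsub>A\<^esub> a) {x \<in> carrier A. E x = y}"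
      using a by (auto simp: inj_on_def)
    moreover have "x \<otimes>\<^bsub>A\<^esub> inv\<^bsub>A\<^esub> a \<in> B" if x: "x \<in> carrier A" "E x = E a" for x
    proof -
      have "\<alpha> (x \<otimes>\<^bsub>A\<^esub> inv\<^bsub>A\<^esub> a) = \<one>\<^bsub>rat_mod_int\<^esub>" if \<alpha>: "\<alpha> \<in> N" for \<alpha>
      proof -
        interpret \<alpha>: group_hom A rat_mod_int \<alpha> by (rule hm) fact
        have "\<alpha> x = \<alpha> a" using x(2) \<alpha> by (metis E_def restrict_apply')
        then show ?thesis using x(1) a(1) by simp
      qed
      then show ?thesis using x a by (simp add: B_def)
    qed
    ultimately show ?thesis using a finB by (intro card_inj_on_le) auto
  qed
  have "carrier A = (\<Union>y\<in>E ` carrier A. {x \<in> carrier A. E x = y})" by auto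
  then have "card (carrier A) \<le> (\<Sum>y\<in>E ` carrier A. card {x \<in> carrier A. E x = y})"
    using card_UN_le[of "E ` carrier A" "\<lambda>y. {x \<in> carrier A. E x = y}"] fin by simp
  also have "\<dots> \<le> card (E ` carrier A) * card B"
    using sum_bounded_above[of "E ` carrier A" "\<lambda>y. card {x \<in> carrier A. E x = y}" "card B"] fib by simp
  also have "\<dots> \<le> card N * card B" using 2 by simp
  finally have "card ?Y * card B \<le> card N * card B" by (rule le_trans[OF 1])
  moreover have "card B > 0" using subgroup.one_closed[OF B] finB by (auto simp: card_gt_0_iff)
  ultimately have "card ?Y \<le> card N" by simp
  then show "?Y = N" using NY finD by (metis (no_types, lifting) card_seteq finite_subset mem_Collect_eq subsetI)
qed

section \<open>Homomorphisms into constant groups\<close>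

lemma truncate_extend:
  fixes R :: "('k, 'r) formal_algebra"
  shows "formal_algebra.truncate (formal_algebra.extend R m) = R"
  by (simp add: formal_algebra.truncate_def formal_algebra.extend_def)

lemma group_fields_simps:
  fixes R :: "('k, 'r) formal_algebra"
  shows "comult (formal_algebra.extend R (formal_group.fields a b c)) = a"
    "counit (formal_algebra.extend R (formal_group.fields a b c)) = b"
    "antipode (formal_algebra.extend R (formal_group.fields a b c)) = c"
  by (simp_all add: formal_algebra.extend_def formal_group.fields_def)

lemma truncate_trivial: "formal_algebra.truncate (R :: ('k, 'r) formal_algebra) = R"
  by (simp add: formal_algebra.truncate_def)

lemma truncate_const_group: "formal_algebra.truncate (const_group K M) = fun_algebra K (carrier M)"
  by (simp add: const_group_def Let_def truncate_extend)

locale const_grp =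
  fixes K :: "('k, 'c) ring_scheme" and M :: "('a, 'd) monoid_scheme"
  assumes K: "cring K" and M: "comm_group M" and fin_M: "finite (carrier M)"
begin

sublocale M: comm_group M by (rule M)
sublocale fun_tensor K "carrier M" "fun_algebra K (carrier M)"
  by unfold_locales (use cring.fun_formal[OF K] fin_M in auto)

abbreviation "G \<equiv> const_group K M"
abbreviation "B \<equiv> base_algebra K"

lemma trunc: "formal_algebra.truncate G = formal_algebra.truncate A"
  unfolding truncate_const_group truncate_trivial ..

lemma G_formal: "formal_algebra K G"
  using formal_algebra_cong[OF trunc, of K] V_formal by blast

lemmas G_ctensor = ctensor_cong[OF trunc trunc, of K]

lemma ev_closed: "b \<in> carrier M \<Longrightarrow> w \<in> carrier W \<Longrightarrow> ev b w \<in> carrier A"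
  using formal_hom_closed[OF ev_hom] by blast

lemma eval_ev_hom:
  assumes "b \<in> carrier M" "c \<in> carrier M"
  shows "formal_hom K W B (\<lambda>w. ev b w c)"
  using formal_hom_comp[OF ev_hom[OF assms(1)] V.K.eval_hom[OF assms(2)]] by (simp add: comp_def)

lemma eval_inject:
  assumes w: "w \<in> carrier W" "w' \<in> carrier W"
    and eq: "\<And>b c. b \<in> carrier M \<Longrightarrow> c \<in> carrier M \<Longrightarrow> ev b w c = ev b w' c"
  shows "w = w'"
proof (rule ev_inject[OF w])
  fix b assume b: "b \<in> carrier M"
  show "ev b w = ev b w'"
    using ev_closed[OF b w(1)] ev_closed[OF b w(2)] eq[OF b]
    by (intro extensionalityI[of _ "carrier M"]) (auto simp: PiE_iff)
qed

lemma comult_eq: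
  "comult G h = finsum W
     (\<lambda>z. struct_map W (h (fst z \<otimes>\<^bsub>M\<^esub> snd z)) \<otimes>\<^bsub>W\<^esub> (i1 (\<delta> (fst z)) \<otimes>\<^bsub>W\<^esub> i2 (\<delta> (snd z))))
     (carrier M \<times> carrier M)"
  by (simp add: const_group_def Let_def group_fields_simps \<delta>_def case_prod_unfold)

lemma comult_term_closed:
  assumes h: "h \<in> carrier A" and z: "z \<in> carrier M \<times> carrier M"
  shows "h (fst z \<otimes>\<^bsub>M\<^esub> snd z) \<in> carrier K"
    and "struct_map W (h (fst z \<otimes>\<^bsub>M\<^esub> snd z)) \<in> carrier W"
    and "struct_map W (h (fst z \<otimes>\<^bsub>M\<^esub> snd z)) \<otimes>\<^bsub>W\<^esub> (i1 (\<delta> (fst z)) \<otimes>\<^bsub>W\<^esub> i2 (\<delta> (snd z))) \<in> carrier W"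
proof -
  show 1: "h (fst z \<otimes>\<^bsub>M\<^esub> snd z) \<in> carrier K"
    by (rule PiE_mem[OF h[unfolded fun_algebra_simps(1)]]) (use z in \<open>simp add: mem_Times_iff\<close>)
  then show "struct_map W (h (fst z \<otimes>\<^bsub>M\<^esub> snd z)) \<in> carrier W" by simp
  then show "struct_map W (h (fst z \<otimes>\<^bsub>M\<^esub> snd z)) \<otimes>\<^bsub>W\<^esub> (i1 (\<delta> (fst z)) \<otimes>\<^bsub>W\<^esub> i2 (\<delta> (snd z))) \<in> carrier W"
    by (intro W.m_closed i1.hom_closed i2.hom_closed \<delta>_carrier)
qed

lemma comult_closed: "h \<in> carrier A \<Longrightarrow> comult G h \<in> carrier W"
  unfolding comult_eq by (intro W.finsum_closed Pi_I comult_term_closed(3))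

text \<open>Only the summand with index \<open>(b, c)\<close> survives evaluation there. Since these
  evaluations separate elements, every property of this comultiplication is reduced to values of
  \<open>h\<close> on products.\<close>

lemma eval_comult:
  assumes h: "h \<in> carrier A" and b: "b \<in> carrier M" "c \<in> carrier M"
  shows "ev b (comult G h) c = h (b \<otimes>\<^bsub>M\<^esub> c)"
proof -
  interpret e: formal_map K W B "\<lambda>w. ev b w c"
    by (rule formal_mapI[OF formal_W base_formal(1)[OF K] eval_ev_hom[OF b]])
  let ?t = "\<lambda>z. struct_map W (h (fst z \<otimes>\<^bsub>M\<^esub> snd z)) \<otimes>\<^bsub>W\<^esub> (i1 (\<delta> (fst z)) \<otimes>\<^bsub>W\<^esub> i2 (\<delta> (snd z)))"
  note hc = comult_term_closed(1)[OF h]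
  have t: "?t \<in> carrier M \<times> carrier M \<rightarrow> carrier W" using comult_term_closed(3)[OF h] by (rule Pi_I)
  have "ev b (comult G h) c = finsum B (\<lambda>z. ev b (?t z) c) (carrier M \<times> carrier M)"
    unfolding comult_eq using e.hom_finsum[OF t] by (simp add: comp_def)
  also have "\<dots> = finsum B (\<lambda>z. if (b, c) = z then h (fst z \<otimes>\<^bsub>M\<^esub> snd z) else \<zero>\<^bsub>B\<^esub>) (carrier M \<times> carrier M)"
  proof (rule e.T.add.finprod_cong')
    fix z assume z: "z \<in> carrier M \<times> carrier M"
    have d: "i1 (\<delta> (fst z)) \<in> carrier W" "i2 (\<delta> (snd z)) \<in> carrier W"
      by (rule i1.hom_closed[OF \<delta>_carrier] i2.hom_closed[OF \<delta>_carrier])+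
    have "ev b (?t z) c = h (fst z \<otimes>\<^bsub>M\<^esub> snd z) \<otimes>\<^bsub>K\<^esub> (\<delta> (fst z) b \<otimes>\<^bsub>K\<^esub> \<delta> (snd z) c)"
      using e.hom_mult[OF comult_term_closed(2)[OF h z] W.m_closed[OF d]] e.hom_mult[OF d] e.hom_struct[OF hc[OF z]]
        ev_i1[OF b(1) \<delta>_carrier, of "fst z"] ev_i2[OF b(1) \<delta>_carrier, of "snd z"] b by simp
    then show "ev b (?t z) c = (if (b, c) = z then h (fst z \<otimes>\<^bsub>M\<^esub> snd z) else \<zero>\<^bsub>B\<^esub>)"
      using b z hc[OF z] by (cases z) (auto simp: \<delta>_def)
  qed (use hc in auto)
  also have "\<dots> = h (b \<otimes>\<^bsub>M\<^esub> c)"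
    using e.T.add.finprod_singleton[of "(b, c)" "carrier M \<times> carrier M" "\<lambda>z. h (fst z \<otimes>\<^bsub>M\<^esub> snd z)"] hc b fin_M
    by auto
  finally show ?thesis .
qed

lemma comult_hom: "formal_hom K A W (comult G)"
proof (rule formal_homI[OF V_formal formal_W])
  have e: "ev b (v \<otimes>\<^bsub>W\<^esub> w) c = ev b v c \<otimes>\<^bsub>K\<^esub> ev b w c \<and> ev b (v \<oplus>\<^bsub>W\<^esub> w) c = ev b v c \<oplus>\<^bsub>K\<^esub> ev b w c
    \<and> ev b \<one>\<^bsub>W\<^esub> c = \<one>\<^bsub>K\<^esub>" if "b \<in> carrier M" "c \<in> carrier M" "v \<in> carrier W" "w \<in> carrier W" for b c v w
    using eval_ev_hom[OF that(1,2)] that(3,4) by (simp add: formal_hom_def ring_hom_def)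
  show "comult G \<in> ring_hom A W"
  proof (rule ring_hom_memI)
    fix f g assume f: "f \<in> carrier A" and g: "g \<in> carrier A"
    have fg: "f \<otimes>\<^bsub>A\<^esub> g \<in> carrier A" "f \<oplus>\<^bsub>A\<^esub> g \<in> carrier A" using f g by (rule V.m_closed V.a_closed)+
    note cc = comult_closed[OF f] comult_closed[OF g]
    show "comult G f \<in> carrier W" by (rule cc(1))
    show "comult G (f \<otimes>\<^bsub>A\<^esub> g) = comult G f \<otimes>\<^bsub>W\<^esub> comult G g"
    proof (rule eval_inject)
      fix b c assume bc: "b \<in> carrier M" "c \<in> carrier M"
      show "ev b (comult G (f \<otimes>\<^bsub>A\<^esub> g)) c = ev b (comult G f \<otimes>\<^bsub>W\<^esub> comult G g) c"
        using e[OF bc cc] eval_comult[OF f bc] eval_comult[OF g bc] eval_comult[OF fg(1) bc] bc by simp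
    qed (use cc comult_closed[OF fg(1)] in simp_all)
    show "comult G (f \<oplus>\<^bsub>A\<^esub> g) = comult G f \<oplus>\<^bsub>W\<^esub> comult G g"
    proof (rule eval_inject)
      fix b c assume bc: "b \<in> carrier M" "c \<in> carrier M"
      show "ev b (comult G (f \<oplus>\<^bsub>A\<^esub> g)) c = ev b (comult G f \<oplus>\<^bsub>W\<^esub> comult G g) c"
        using e[OF bc cc] eval_comult[OF f bc] eval_comult[OF g bc] eval_comult[OF fg(2) bc] bc by simp
    qed (use cc comult_closed[OF fg(2)] in simp_all)
  next
    show "comult G \<one>\<^bsub>A\<^esub> = \<one>\<^bsub>W\<^esub>"
    proof (rule eval_inject)
      fix b c assume bc: "b \<in> carrier M" "c \<in> carrier M"
      show "ev b (comult G \<one>\<^bsub>A\<^esub>) c = ev b \<one>\<^bsub>W\<^esub> c"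
        using e[OF bc W.one_closed W.one_closed] eval_comult[OF V.one_closed bc] bc by simp
    qed (use comult_closed[OF V.one_closed] in simp_all)
  qed
  show "comult G (struct_map A k) = struct_map W k" if k: "k \<in> carrier K" for k
  proof (rule eval_inject)
    have s: "struct_map A k \<in> carrier A" using k by simp
    show "comult G (struct_map A k) \<in> carrier W" by (rule comult_closed[OF s])
    fix b c assume bc: "b \<in> carrier M" "c \<in> carrier M"
    then have "ev b (struct_map W k) c = k" using eval_ev_hom[OF bc] k by (simp add: formal_hom_def)
    then show "ev b (comult G (struct_map A k)) c = ev b (struct_map W k) c"
      using bc eval_comult[OF s bc] by simp
  qed (use k in simp)
  show "\<exists>I\<in>open_ideals A. \<forall>r\<in>I. comult G r \<in> J" if J: "J \<in> open_ideals W" for J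
  proof (intro bexI[OF _ cring.fun_zero_open[OF K]] ballI)
    fix r assume "r \<in> {\<zero>\<^bsub>A\<^esub>}"
    moreover have "comult G \<zero>\<^bsub>A\<^esub> = \<zero>\<^bsub>W\<^esub>"
    proof (rule eval_inject)
      fix b c assume bc: "b \<in> carrier M" "c \<in> carrier M"
      interpret e: formal_map K W B "\<lambda>w. ev b w c"
        by (rule formal_mapI[OF formal_W base_formal(1)[OF K] eval_ev_hom[OF bc]])
      show "ev b (comult G \<zero>\<^bsub>A\<^esub>) c = ev b \<zero>\<^bsub>W\<^esub> c"
        using eval_comult[OF V.zero_closed bc] e.hom_zero bc by simp
    qed (use comult_closed[OF V.zero_closed] in simp_all)
    ultimately show "comult G r \<in> J"
      using additive_subgroup.zero_closed[OF ideal.axioms(1)[OF W.open_idealD[OF J]]] by simp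
  qed
qed

lemma const_padd_eq: "point_add K G T f g h = copair K A A T f g (comult G h)"
  by (simp add: point_add_def G_ctensor)

lemma const_padd_hom:
  assumes "formal_algebra K T" "formal_hom K A T f" "formal_hom K A T g"
  shows "formal_hom K A T (point_add K G T f g)"
  unfolding const_padd_eq using formal_hom_comp[OF comult_hom copair_formal_hom[OF V_formal V_formal assms]]
  by (simp add: comp_def)

text \<open>A map from the coordinate ring of \<open>C\<close> to functions on \<open>M\<close> is a
  family of points of \<open>C\<close> over the base, and evaluation at all pairs
  \<open>(b, c)\<close> turns compatibility with comultiplications into additivity of this family.
  One direction makes \<open>\<phi>\<close> additive in the character; the other produces the
  homomorphism from the constant group into \<open>C\<close> given by the sections.\<close>

lemma const_group_hom_iff:
  assumes C: "formal_grp K C" and \<upsilon>: "formal_hom K C A \<upsilon>"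
  shows "(\<forall>r\<in>carrier C. comult G (\<upsilon> r) = point_add K C W (i1 \<circ> \<upsilon>) (i2 \<circ> \<upsilon>) r) \<longleftrightarrow>
    (\<forall>b\<in>carrier M. \<forall>c\<in>carrier M. \<forall>r\<in>carrier C.
      \<upsilon> r (b \<otimes>\<^bsub>M\<^esub> c) = point_add K C B (\<lambda>r. \<upsilon> r b) (\<lambda>r. \<upsilon> r c) r)" (is "?L \<longleftrightarrow> ?R")
proof -
  interpret C: formal_grp K C by (rule C)
  note v1 = formal_hom_comp[OF \<upsilon> i1_hom] and v2 = formal_hom_comp[OF \<upsilon> i2_hom]
  have pc: "point_add K C W (i1 \<circ> \<upsilon>) (i2 \<circ> \<upsilon>) r \<in> carrier W" if "r \<in> carrier C" for r
    using formal_hom_closed[OF C.padd_hom[OF formal_W v1 v2] that] .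
  have vc: "\<upsilon> r \<in> carrier A" if "r \<in> carrier C" for r using formal_hom_closed[OF \<upsilon> that] .
  have e: "ev b (point_add K C W (i1 \<circ> \<upsilon>) (i2 \<circ> \<upsilon>) r) c = point_add K C B (\<lambda>r. \<upsilon> r b) (\<lambda>r. \<upsilon> r c) r"
    if b: "b \<in> carrier M" "c \<in> carrier M" and r: "r \<in> carrier C" for b c r
  proof -
    have "ev b (point_add K C W (i1 \<circ> \<upsilon>) (i2 \<circ> \<upsilon>) r) c
        = point_add K C B ((\<lambda>w. ev b w c) \<circ> (i1 \<circ> \<upsilon>)) ((\<lambda>w. ev b w c) \<circ> (i2 \<circ> \<upsilon>)) r"
      by (rule C.padd_natural[OF formal_W base_formal(1)[OF K] v1 v2 eval_ev_hom[OF b] r])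
    also have "point_add K C B ((\<lambda>w. ev b w c) \<circ> (i1 \<circ> \<upsilon>)) ((\<lambda>w. ev b w c) \<circ> (i2 \<circ> \<upsilon>))
        = point_add K C B (\<lambda>r. \<upsilon> r b) (\<lambda>r. \<upsilon> r c)"
      by (rule C.padd_cong) (use b vc in \<open>simp_all add: ev_i1 ev_i2 del: fun_algebra_simps(1)\<close>)
    finally show ?thesis .
  qed
  show ?thesis
  proof
    assume ?L
    then show ?R using e eval_comult vc by metis
  next
    assume R: ?R
    show ?L
    proof
      fix r assume r: "r \<in> carrier C"
      show "comult G (\<upsilon> r) = point_add K C W (i1 \<circ> \<upsilon>) (i2 \<circ> \<upsilon>) r"
        by (rule eval_inject[OF comult_closed[OF vc[OF r]] pc[OF r]])
          (use R r in \<open>simp add: e eval_comult[OF vc[OF r]]\<close>)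
    qed
  qed
qed

end

section \<open>Sections and Taylor expansions\<close>

lemma (in cring) PIdl_iff: "a \<in> carrier R \<Longrightarrow> r \<in> PIdl a \<longleftrightarrow> (\<exists>t\<in>carrier R. r = a \<otimes> t)"
  unfolding cgenideal_def using m_comm by blast

text \<open>
  If \<open>d\<close> generates the ideal of the diagonal, its restriction to \<open>{u} \<times> C\<close> generates the ideal of \<open>u\<close>,
  because \<open>1 \<otimes> r - r \<otimes> 1\<close> is a multiple of \<open>d\<close>.
\<close>

lemma section_ideal_principal:
  assumes R: "formal_algebra K R" and diag: "regular_hypersurface_ideal (ctensor K R R) (diagonal_ideal K R)"
    and u: "formal_hom K R (base_algebra K) u"
  shows "\<exists>x\<in>carrier R. \<forall>r\<in>carrier R. u r = \<zero>\<^bsub>K\<^esub> \<longleftrightarrow> (\<exists>t\<in>carrier R. r = x \<otimes>\<^bsub>R\<^esub> t)"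
proof -
  interpret tensor K R R by (rule tensorI[OF R R])
  have B: "formal_algebra K (base_algebra K)" by (rule base_formal(1)[OF U.K.cring_axioms])
  interpret u: formal_map K R "base_algebra K" u by (rule formal_mapI[OF R B u])
  let ?\<mu> = "copair K R R R (\<lambda>r. r) (\<lambda>r. r)"
  note \<mu> = copair_hom[OF R formal_hom_id formal_hom_id] copair_i1[OF R formal_hom_id formal_hom_id]
    copair_i2[OF R formal_hom_id formal_hom_id]
  interpret \<mu>: formal_map K W R ?\<mu> by (rule formal_mapI[OF formal_W R \<mu>(1)])
  obtain d where d: "d \<in> carrier W" "a_kernel W R ?\<mu> = PIdl\<^bsub>W\<^esub> d"
    using diag by (auto simp: regular_hypersurface_ideal_def regular_element_def diagonal_ideal_def)
  \<comment> \<open>The constant point \<open>u\<close> over \<open>C\<close> itself, so that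
    \<open>?h\<close> below restricts functions on the product to
    \<open>{u} \<times> C\<close>.\<close>
  define s where "s r = struct_map R (u r)" for r
  have s: "formal_hom K R R s"
    using formal_hom_comp[OF u U.struct_hom] by (simp add: s_def[abs_def] comp_def)
  let ?h = "copair K R R R s (\<lambda>r. r)"
  note h = copair_hom[OF R s formal_hom_id] copair_i1[OF R s formal_hom_id] copair_i2[OF R s formal_hom_id]
  interpret h: formal_map K W R ?h by (rule formal_mapI[OF formal_W R h(1)])
  have us: "u (s r) = u r" if "r \<in> carrier R" for r
    using that u.hom_closed[OF that] by (simp add: s_def u.hom_struct)
  \<comment> \<open>Both sides evaluate at the point \<open>(u, u)\<close>, which lies on the
    diagonal; hence the restricted generator vanishes at \<open>u\<close>.\<close>
  have uh: "u (?h w) = u (?\<mu> w)" if "w \<in> carrier W" for w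
  proof -
    have "(u \<circ> ?h) w = (u \<circ> ?\<mu>) w"
      by (rule hom_ext[OF B formal_hom_comp[OF h(1) u] formal_hom_comp[OF \<mu>(1) u] _ _ that])
        (simp_all add: h \<mu> us)
    then show ?thesis by simp
  qed
  have ker: "?\<mu> w = \<zero>\<^bsub>R\<^esub> \<longleftrightarrow> (\<exists>e\<in>carrier W. w = d \<otimes>\<^bsub>W\<^esub> e)" if "w \<in> carrier W" for w
  proof -
    have "?\<mu> w = \<zero>\<^bsub>R\<^esub> \<longleftrightarrow> w \<in> a_kernel W R ?\<mu>" unfolding a_kernel_def' using that by blast
    also have "\<dots> \<longleftrightarrow> (\<exists>e\<in>carrier W. w = d \<otimes>\<^bsub>W\<^esub> e)" unfolding d(2) by (rule W.PIdl_iff[OF d(1)])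
    finally show ?thesis .
  qed
  have "?\<mu> d = \<zero>\<^bsub>R\<^esub>" using d(1) ker[OF d(1)] by (metis W.one_closed W.r_one)
  then have ud: "u (?h d) = \<zero>\<^bsub>K\<^esub>" using uh d(1) by simp
  have hd: "?h d \<in> carrier R" using d by simp
  have "\<exists>t\<in>carrier R. r = ?h d \<otimes>\<^bsub>R\<^esub> t" if r: "r \<in> carrier R" and ur: "u r = \<zero>\<^bsub>K\<^esub>" for r
  proof -
    have sr: "s r = \<zero>\<^bsub>R\<^esub>" using ur by (simp add: s_def)
    have cl: "i2 r \<ominus>\<^bsub>W\<^esub> i1 r \<in> carrier W" using r by simp
    have "?\<mu> (i2 r \<ominus>\<^bsub>W\<^esub> i1 r) = \<zero>\<^bsub>R\<^esub>"
      using r by (simp add: \<mu>.hom_sub \<mu> U.sub_self)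
    then obtain e where e: "e \<in> carrier W" "i2 r \<ominus>\<^bsub>W\<^esub> i1 r = d \<otimes>\<^bsub>W\<^esub> e"
      unfolding ker[OF cl] by blast
    have "r = ?h (i2 r \<ominus>\<^bsub>W\<^esub> i1 r)" using r sr by (simp add: h.hom_sub h U.minus_eq)
    then have "r = ?h d \<otimes>\<^bsub>R\<^esub> ?h e" using e d by simp
    then show ?thesis using e(1) h.hom_closed by blast
  qed
  moreover have "u r = \<zero>\<^bsub>K\<^esub>" if "t \<in> carrier R" "r = ?h d \<otimes>\<^bsub>R\<^esub> t" for r t
    unfolding that(2) using u.hom_mult[OF hd that(1)] ud u.hom_closed[OF that(1)] by simp
  ultimately show ?thesis by (intro bexI[OF _ hd]) blast
qed

text \<open>The algebraic part of \<open>sections\<close>: distinct sections with regular equations.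
  It suffices for the divisibility statements from which \<open>sectionsI\<close> derives the
  topological part.\<close>

locale pre_sections = formal_alg K R
  for K :: "('k, 'c) ring_scheme" and R :: "('k, 'r, 'm) formal_algebra_scheme" (structure) +
  fixes E :: "'e set" and u :: "'e \<Rightarrow> 'r \<Rightarrow> 'k" and x :: "'e \<Rightarrow> 'r"
  assumes K_field: "field K" and fin_E: "finite E"
    and u_hom: "b \<in> E \<Longrightarrow> formal_hom K R (base_algebra K) (u b)"
    and x_closed: "b \<in> E \<Longrightarrow> x b \<in> carrier R"
    and u_ker: "b \<in> E \<Longrightarrow> r \<in> carrier R \<Longrightarrow> u b r = \<zero>\<^bsub>K\<^esub> \<longleftrightarrow> (\<exists>t\<in>carrier R. r = x b \<otimes> t)"
    and x_regular: "b \<in> E \<Longrightarrow> t \<in> carrier R \<Longrightarrow> x b \<otimes> t = \<zero> \<Longrightarrow> t = \<zero>"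
    and u_distinct: "b \<in> E \<Longrightarrow> c \<in> E \<Longrightarrow> b \<noteq> c \<Longrightarrow> \<exists>r\<in>carrier R. u b r \<noteq> u c r"
begin

sublocale Kf: field K by (rule K_field)

lemma B_formal: "formal_algebra K (base_algebra K)"
  by (rule base_formal(1)[OF K.cring_axioms])

abbreviation "xid b m \<equiv> PIdl (x b [^] (m::nat))"

lemma mem_xid: "b \<in> E \<Longrightarrow> r \<in> xid b m \<longleftrightarrow> (\<exists>t\<in>carrier R. r = x b [^] m \<otimes> t)"
  using PIdl_iff[of "x b [^] m"] x_closed by simp

lemma xid_ideal: "b \<in> E \<Longrightarrow> ideal (xid b m) R"
  using x_closed by (intro cgenideal_ideal) simp

lemma xid_antimono:
  assumes "b \<in> E" "m \<le> n"
  shows "xid b n \<subseteq> xid b m"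
proof
  fix r assume "r \<in> xid b n"
  then obtain t where t: "t \<in> carrier R" "r = x b [^] n \<otimes> t" using mem_xid assms by blast
  then have "r = x b [^] m \<otimes> (x b [^] (n - m) \<otimes> t)"
    using assms x_closed by (simp add: m_assoc[symmetric] nat_pow_mult)
  then show "r \<in> xid b m" using t assms x_closed mem_xid by auto
qed

context
  fixes b assumes b: "b \<in> E"
begin

interpretation u: formal_map K R "base_algebra K" "u b"
  by (rule formal_mapI[OF formal B_formal u_hom[OF b]])

lemma u_simps:
  "r \<in> carrier R \<Longrightarrow> u b r \<in> carrier K" "c \<in> carrier K \<Longrightarrow> u b (struct_map R c) = c"
  "r \<in> carrier R \<Longrightarrow> r' \<in> carrier R \<Longrightarrow> u b (r \<oplus> r') = u b r \<oplus>\<^bsub>K\<^esub> u b r'"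
  "r \<in> carrier R \<Longrightarrow> r' \<in> carrier R \<Longrightarrow> u b (r \<otimes> r') = u b r \<otimes>\<^bsub>K\<^esub> u b r'"
  "u b \<one> = \<one>\<^bsub>K\<^esub>" "u b \<zero> = \<zero>\<^bsub>K\<^esub>" "u b (x b) = \<zero>\<^bsub>K\<^esub>"
  using u.hom_closed u.hom_struct u.hom_add u.hom_mult u.hom_one u.hom_zero u_ker[OF b x_closed[OF b]]
    x_closed[OF b] r_one[OF x_closed[OF b]] by (auto intro: bexI[of _ \<one>])

lemma u_minus: "r \<in> carrier R \<Longrightarrow> r' \<in> carrier R \<Longrightarrow> u b (r \<ominus> r') = \<zero>\<^bsub>K\<^esub> \<longleftrightarrow> u b r = u b r'"
  using u.hom_sub[of r r'] u.hom_closed[of r] u.hom_closed[of r'] u.T.r_right_minus_eq[of "u b r" "u b r'"] by simp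

lemma x_cancel:
  assumes "t \<in> carrier R" "t' \<in> carrier R" "x b \<otimes> t = x b \<otimes> t'"
  shows "t = t'"
proof -
  have "x b \<otimes> (t \<ominus> t') = \<zero>" using assms x_closed[OF b] by (simp add: minus_eq r_distr r_minus r_neg)
  then show ?thesis using x_regular[OF b, of "t \<ominus> t'"] assms by simp
qed

lemma xid_Suc_iff:
  assumes t: "t \<in> carrier R"
  shows "x b \<otimes> t \<in> xid b (Suc m) \<longleftrightarrow> t \<in> xid b m"
proof
  assume "x b \<otimes> t \<in> xid b (Suc m)"
  then obtain s where s: "s \<in> carrier R" "x b \<otimes> t = x b [^] Suc m \<otimes> s" using mem_xid[OF b] by blast
  then have "x b \<otimes> t = x b \<otimes> (x b [^] m \<otimes> s)" using x_closed[OF b] by (simp add: m_ac)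
  then have "t = x b [^] m \<otimes> s" using x_cancel t s x_closed[OF b] by simp
  then show "t \<in> xid b m" using s mem_xid[OF b] by blast
next
  assume "t \<in> xid b m"
  then obtain s where s: "s \<in> carrier R" "t = x b [^] m \<otimes> s" using mem_xid[OF b] by blast
  then have "x b \<otimes> t = x b [^] Suc m \<otimes> s" using x_closed[OF b] by (simp add: m_ac)
  then show "x b \<otimes> t \<in> xid b (Suc m)" using s mem_xid[OF b] by blast
qed

text \<open>If the product of \<open>a\<close> and \<open>t\<close> vanishes at \<open>u b\<close>,
  so does \<open>t\<close>, because \<open>K\<close> has no zero divisors. Hence factors
  \<open>x b\<close> can be cancelled from \<open>t\<close> one at a time.\<close>

lemma xid_mult_cancel:
  assumes a: "a \<in> carrier R" "u b a \<noteq> \<zero>\<^bsub>K\<^esub>"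
  shows "t \<in> carrier R \<Longrightarrow> a \<otimes> t \<in> xid b m \<Longrightarrow> t \<in> xid b m"
proof (induction m arbitrary: t)
  case 0
  then show ?case using mem_xid[OF b, of t 0] by simp
next
  case (Suc m)
  then obtain s where s: "s \<in> carrier R" "a \<otimes> t = x b [^] Suc m \<otimes> s" using mem_xid[OF b] by blast
  have "a \<otimes> t = x b \<otimes> (x b [^] m \<otimes> s)" using s x_closed[OF b] by (simp add: m_ac)
  moreover have "x b [^] m \<otimes> s \<in> carrier R" using s x_closed[OF b] by simp
  ultimately have "u b (a \<otimes> t) = \<zero>\<^bsub>K\<^esub>"
    using u_simps(4)[OF x_closed[OF b], of "x b [^] m \<otimes> s"] u_simps(1)[of "x b [^] m \<otimes> s"] u_simps(7) by simp
  then have "u b t = \<zero>\<^bsub>K\<^esub>" using a Suc.prems u_simps(1) Kf.integral by (metis u_simps(4))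
  then obtain t' where t': "t' \<in> carrier R" "t = x b \<otimes> t'" using u_ker[OF b Suc.prems(1)] by blast
  have "x b \<otimes> (a \<otimes> t') \<in> xid b (Suc m)" using Suc.prems(2) t' a x_closed[OF b] by (simp add: m_ac)
  then have "t' \<in> xid b m" using Suc.IH[OF t'(1)] xid_Suc_iff[of "a \<otimes> t'"] a t' by simp
  then show ?case using xid_Suc_iff t' by simp
qed

end

text \<open>Otherwise \<open>u b\<close> would vanish on the whole kernel of \<open>u c\<close>, in
  particular on \<open>r - u c r\<close> for every \<open>r\<close>, and the two sections would
  coincide.\<close>

lemma u_x_nonzero:
  assumes b: "b \<in> E" "c \<in> E" "b \<noteq> c"
  shows "u b (x c) \<noteq> \<zero>\<^bsub>K\<^esub>"
proof
  assume 0: "u b (x c) = \<zero>\<^bsub>K\<^esub>"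
  obtain r where r: "r \<in> carrier R" "u b r \<noteq> u c r" using u_distinct b by metis
  note ur = u_simps(1)[OF b(2) r(1)]
  let ?s = "r \<ominus> struct_map R (u c r)"
  have "u c ?s = \<zero>\<^bsub>K\<^esub>" using r b ur by (simp add: u_minus u_simps)
  then obtain t where t: "t \<in> carrier R" "?s = x c \<otimes> t" using u_ker[OF b(2), of ?s] r ur by auto
  then have "u b ?s = \<zero>\<^bsub>K\<^esub>" using 0 b x_closed by (simp add: u_simps)
  then show False using r b ur by (simp add: u_minus u_simps)
qed

text \<open>Dividing by one \<open>x\<^sub>c\<close> after the other; \<open>x\<^sub>c\<close> is invertible modulo powers of \<open>x\<^sub>b\<close> for \<open>b \<noteq> c\<close>.\<close>

lemma finprod_divides:
  assumes "finite S" "\<rho> \<in> S \<rightarrow> E" "r \<in> carrier R" "\<And>b. b \<in> E \<Longrightarrow> r \<in> xid b (card S + k)"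
  shows "\<exists>t\<in>carrier R. r = (\<Otimes>a\<in>S. x (\<rho> a)) \<otimes> t \<and> (\<forall>b\<in>E. t \<in> xid b k)"
  using assms
proof (induction S arbitrary: k rule: finite_induct)
  case empty
  then show ?case by (intro bexI[of _ r]) simp_all
next
  case (insert a S)
  have \<rho>: "\<rho> \<in> S \<rightarrow> E" and c: "\<rho> a \<in> E" using insert.prems by auto
  \<comment> \<open>Each division lowers the order at a section by at most one. The allowance
    \<open>card S\<close> covers the worst case, in which \<open>\<rho>\<close> takes only one
    value.\<close>
  have "\<exists>t\<in>carrier R. r = (\<Otimes>a\<in>S. x (\<rho> a)) \<otimes> t \<and> (\<forall>b\<in>E. t \<in> xid b (Suc k))"
    using insert by (intro insert.IH \<rho>) auto
  then obtain t where t: "t \<in> carrier R" "r = (\<Otimes>a\<in>S. x (\<rho> a)) \<otimes> t" "\<And>b. b \<in> E \<Longrightarrow> t \<in> xid b (Suc k)"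
    by blast
  obtain s where "s \<in> carrier R" "t = x (\<rho> a) [^] Suc k \<otimes> s" using t(3)[OF c] mem_xid[OF c] by blast
  then have "\<exists>t'\<in>carrier R. t = x (\<rho> a) \<otimes> t'"
    using x_closed[OF c] by (intro bexI[of _ "x (\<rho> a) [^] k \<otimes> s"]) (simp_all add: m_ac)
  then obtain t' where t': "t' \<in> carrier R" "t = x (\<rho> a) \<otimes> t'" by blast
  have "t' \<in> xid b k" if b: "b \<in> E" for b
  proof (cases "b = \<rho> a")
    case True
    then show ?thesis using t(3)[OF b] t' xid_Suc_iff[OF b] by simp
  next
    case False
    then have "t' \<in> xid b (Suc k)"
      using xid_mult_cancel[OF b x_closed[OF c] u_x_nonzero[OF b c False] t'(1)] t(3)[OF b] t'(2) by blast
    then show ?thesis using xid_antimono[OF b, of k "Suc k"] by auto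
  qed
  moreover have "(\<Otimes>a\<in>insert a S. x (\<rho> a)) = x (\<rho> a) \<otimes> (\<Otimes>a\<in>S. x (\<rho> a))"
    using insert.hyps \<rho> c x_closed by (intro finprod_insert) auto
  moreover have "(\<Otimes>a\<in>S. x (\<rho> a)) \<in> carrier R" using \<rho> x_closed by (intro finprod_closed) auto
  ultimately show ?case
    using t t' x_closed[OF c] by (intro bexI[of _ t']) (auto simp: m_ac)
qed

text \<open>Together with \<open>finprod_PIdl_subset'\<close> this compares two topologies, that of
  the powers of a product of equations, with multiplicities, and that of the intersections of powers
  of the single equations.\<close>

lemma finprod_pow_divides:
  assumes S: "finite S" "\<rho> \<in> S \<rightarrow> E"
  shows "r \<in> carrier R \<Longrightarrow> (\<And>b. b \<in> E \<Longrightarrow> r \<in> xid b (card S * m)) \<Longrightarrow> r \<in> PIdl ((\<Otimes>a\<in>S. x (\<rho> a)) [^] m)"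
proof (induction m arbitrary: r)
  case 0
  then show ?case using PIdl_iff[of \<one> r] by auto
next
  case (Suc m)
  let ?z = "\<Otimes>a\<in>S. x (\<rho> a)"
  have z: "?z \<in> carrier R" using S x_closed by (intro finprod_closed) auto
  obtain t where t: "t \<in> carrier R" "r = ?z \<otimes> t" "\<And>b. b \<in> E \<Longrightarrow> t \<in> xid b (card S * m)"
    using finprod_divides[OF S Suc.prems(1), of "card S * m"] Suc.prems(2) by auto
  then obtain s where "s \<in> carrier R" "t = ?z [^] m \<otimes> s" using Suc.IH[of t] z PIdl_iff[of "?z [^] m" t] by auto
  then show ?case using t z PIdl_iff[of "?z [^] Suc m" r] by (auto simp: m_ac intro!: bexI[of _ s])
qed

end

text \<open>The topology is described by intersections of the ideals \<open>xid b m\<close> over all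
  \<open>b\<close>, not by powers of the product divisor. Multiplicities disappear, and conditions
  can be imposed at each section separately, as the Chinese remainder theorem requires.\<close>

locale sections = pre_sections K R E u x
  for K :: "('k, 'c) ring_scheme" and R :: "('k, 'r, 'm) formal_algebra_scheme" (structure)
    and E :: "'e set" and u :: "'e \<Rightarrow> 'r \<Rightarrow> 'k" and x :: "'e \<Rightarrow> 'r" +
  assumes x_open: "b \<in> E \<Longrightarrow> openin (topol R) (PIdl (x b [^] (m::nat)))"
    and x_small: "J \<in> open_ideals R \<Longrightarrow> \<exists>m. \<forall>r\<in>carrier R. (\<forall>b\<in>E. r \<in> PIdl (x b [^] (m::nat))) \<longrightarrow> r \<in> J"
    and x_complete: "(\<And>m. s m \<in> carrier R) \<Longrightarrow>
      (\<And>(m::nat) b. b \<in> E \<Longrightarrow> s (Suc m) \<ominus> s m \<in> PIdl (x b [^] m)) \<Longrightarrow>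
      \<exists>z\<in>carrier R. \<forall>m. \<forall>b\<in>E. z \<ominus> s m \<in> PIdl (x b [^] m)"

lemma (in pre_sections) finprod_PIdl_subset:
  assumes S: "finite S" "\<rho> \<in> S \<rightarrow> E" and a: "a \<in> S"
  shows "PIdl ((\<Otimes>a\<in>S. x (\<rho> a)) [^] m) \<subseteq> xid (\<rho> a) m"
proof
  let ?z = "\<Otimes>a\<in>S. x (\<rho> a)" and ?q = "\<Otimes>c\<in>S - {a}. x (\<rho> c)"
  have b: "\<rho> a \<in> E" using S a by auto
  have z: "?z \<in> carrier R" and q: "?q \<in> carrier R" using S x_closed by (auto intro!: finprod_closed)
  have "?z = (\<Otimes>c\<in>insert a (S - {a}). x (\<rho> c))" using a by (simp add: insert_absorb)
  also have "\<dots> = x (\<rho> a) \<otimes> ?q" using a S x_closed by (subst finprod_insert) auto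
  finally have zq: "?z [^] m = x (\<rho> a) [^] m \<otimes> ?q [^] m" using q x_closed[OF b] by (simp add: nat_pow_distrib)
  fix r assume "r \<in> PIdl (?z [^] m)"
  then obtain t where t: "t \<in> carrier R" "r = ?z [^] m \<otimes> t" using PIdl_iff z by auto
  then have "r = x (\<rho> a) [^] m \<otimes> (?q [^] m \<otimes> t)" unfolding zq using q x_closed[OF b] by (simp add: m_assoc)
  then show "r \<in> xid (\<rho> a) m" using t q mem_xid[OF b] by auto
qed

lemma (in pre_sections) finprod_PIdl_subset':
  assumes "finite S" "\<rho> ` S = E" "b \<in> E"
  shows "PIdl ((\<Otimes>a\<in>S. x (\<rho> a)) [^] (m::nat)) \<subseteq> xid b m"
proof -
  obtain a where "a \<in> S" "b = \<rho> a" using assms(2,3) by blast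
  moreover have "\<rho> \<in> S \<rightarrow> E" using assms(2) by auto
  ultimately show ?thesis using finprod_PIdl_subset[OF assms(1), of \<rho> a m] by simp
qed

text \<open>With \<open>z\<close> the product of the equations and \<open>N\<close> the number of
  factors, the power \<open>m\<close> of \<open>z\<close> lies in every \<open>xid b m\<close>, and
  an element of all \<open>xid b (N * m)\<close> is a multiple of that power. The two systems of
  ideals are cofinal in each other, so openness, smallness and completeness pass from one to the
  other.\<close>

lemma (in pre_sections) sectionsI:
  assumes S: "finite S" "S \<noteq> {}" "\<rho> ` S = E"
    and lim: "is_limit_of_quotients R (\<lambda>m. PIdl ((\<Otimes>a\<in>S. x (\<rho> a)) [^] (m::nat)))"
  shows "sections K R E u x"
proof
  let ?z = "\<Otimes>a\<in>S. x (\<rho> a)"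
  let ?N = "card S"
  have \<rho>: "\<rho> \<in> S \<rightarrow> E" using S by auto
  have z: "?z \<in> carrier R" using \<rho> x_closed by (intro finprod_closed) auto
  have N: "?N > 0" using S by (simp add: card_gt_0_iff)
  have sub: "PIdl (?z [^] m) \<subseteq> xid b m" if "b \<in> E" for b and m :: nat
    by (rule finprod_PIdl_subset'[OF S(1,3) that])
  have z_open: "PIdl (?z [^] m) \<in> open_ideals R" for m :: nat
    using lim z cgenideal_ideal by (simp add: is_limit_of_quotients_def open_ideals_def)
  show "openin (topol R) (xid b m)" if "b \<in> E" for b and m :: nat
    using open_ideal_mono[OF z_open xid_ideal[OF that] sub[OF that]] by (simp add: open_ideals_def)
  fix J assume J: "J \<in> open_ideals R"
  then have "openin (topol R) J" "\<zero> \<in> J"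
    using additive_subgroup.zero_closed[OF ideal.axioms(1)] by (auto simp: open_ideals_def)
  moreover have "\<forall>U. openin (topol R) U \<and> \<zero> \<in> U \<longrightarrow> (\<exists>m::nat. PIdl (?z [^] m) \<subseteq> U)"
    using lim by (simp add: is_limit_of_quotients_def)
  ultimately obtain m :: nat where m: "PIdl (?z [^] m) \<subseteq> J" by metis
  then show "\<exists>m. \<forall>r\<in>carrier R. (\<forall>b\<in>E. r \<in> xid b m) \<longrightarrow> r \<in> J"
  proof (intro exI[of _ "?N * m"] ballI impI)
    fix r assume "r \<in> carrier R" "\<forall>b\<in>E. r \<in> xid b (?N * m)"
    then have "r \<in> PIdl (?z [^] m)" by (intro finprod_pow_divides[OF S(1) \<rho>]) auto
    then show "r \<in> J" using m by blast
  qed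
next
  let ?z = "\<Otimes>a\<in>S. x (\<rho> a)"
  let ?N = "card S"
  have \<rho>: "\<rho> \<in> S \<rightarrow> E" using S by auto
  have z: "?z \<in> carrier R" using \<rho> x_closed by (intro finprod_closed) auto
  have N: "?N > 0" using S by (simp add: card_gt_0_iff)
  fix s assume s: "\<And>m. s m \<in> carrier R" "\<And>m b. b \<in> E \<Longrightarrow> s (Suc m) \<ominus> s m \<in> xid b m"
  have tele: "s n \<ominus> s m \<in> xid b m" if b: "b \<in> E" and "m \<le> n" for b m n
    using that(2)
  proof (induction n rule: dec_induct)
    case base
    then show ?case using additive_subgroup.zero_closed[OF ideal.axioms(1)[OF xid_ideal[OF b]]] s by (simp add: sub_self)
  next
    case (step n)
    interpret I: ideal "xid b m" R by (rule xid_ideal[OF b])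
    have "(s (Suc n) \<ominus> s n) \<oplus> (s n \<ominus> s m) \<in> xid b m"
      using s(2)[OF b, of n] xid_antimono[OF b step(1)] step by (intro I.a_closed) auto
    moreover have "(s (Suc n) \<ominus> s n) \<oplus> (s n \<ominus> s m) = s (Suc n) \<ominus> s m"
      using s(1)[of n] s(1)[of m] s(1)[of "Suc n"] by algebra
    ultimately show ?case by simp
  qed
  \<comment> \<open>The sequence is thinned out so that consecutive differences are multiples of
    powers of \<open>?z\<close>. As \<open>?N\<close> is positive, \<open>m \<le> ?N * m\<close>, so
    \<open>s' m\<close> still approximates \<open>s m\<close> to order \<open>m\<close>.\<close>
  define s' where "s' m = s (?N * m)" for m
  have "s' (Suc m) \<ominus> s' m \<in> PIdl (?z [^] m)" for m
    unfolding s'_def by (rule finprod_pow_divides[OF S(1) \<rho>]) (use s tele in auto)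
  moreover have "s' m \<in> carrier R" for m using s by (simp add: s'_def)
  ultimately obtain w where w: "w \<in> carrier R" "\<And>m. w \<ominus> s' m \<in> PIdl (?z [^] m)"
    using lim unfolding is_limit_of_quotients_def by metis
  have "w \<ominus> s m \<in> xid b m" if b: "b \<in> E" for b m
  proof -
    interpret I: ideal "xid b m" R by (rule xid_ideal[OF b])
    have "PIdl (?z [^] m) \<subseteq> xid b m" by (rule finprod_PIdl_subset'[OF S(1,3) b])
    then have "(w \<ominus> s' m) \<oplus> (s' m \<ominus> s m) \<in> xid b m"
      using w(2)[of m] tele[OF b, of m "?N * m"] N unfolding s'_def by (intro I.a_closed) auto
    moreover have "(w \<ominus> s' m) \<oplus> (s' m \<ominus> s m) = w \<ominus> s m"
      using w(1) s(1)[of m] s(1)[of "?N * m"] unfolding s'_def by algebra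
    ultimately show ?thesis by simp
  qed
  then show "\<exists>z\<in>carrier R. \<forall>m. \<forall>b\<in>E. z \<ominus> s m \<in> xid b m" using w(1) by blast
qed

section \<open>Taylor expansion at a section\<close>

context sections
begin

lemma xid_open: "b \<in> E \<Longrightarrow> xid b m \<in> open_ideals R"
  using x_open xid_ideal by (simp add: open_ideals_def)

lemma xid_separated:
  assumes "r \<in> carrier R" "\<And>b m. b \<in> E \<Longrightarrow> r \<in> xid b m"
  shows "r = \<zero>"
  using assms x_small by (intro Inter_open_ideals) blast+

context
  fixes b assumes b: "b \<in> E"
begin

interpretation u: formal_map K R "base_algebra K" "u b"
  by (rule formal_mapI[OF formal B_formal u_hom[OF b]])

lemmas u_simps = u_simps[OF b] and u_minus = u_minus[OF b] and x_cancel = x_cancel[OF b]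

text \<open>The quotient of \<open>r - u b r\<close> by the equation \<open>x b\<close>, which is
  unique since \<open>x b\<close> is regular. Iterating it produces the Taylor coefficients.\<close>

definition remainder :: "'r \<Rightarrow> 'r" where
  "remainder r = (THE t. t \<in> carrier R \<and> r = struct_map R (u b r) \<oplus> x b \<otimes> t)"

lemma remainder:
  assumes r: "r \<in> carrier R"
  shows "remainder r \<in> carrier R \<and> r = struct_map R (u b r) \<oplus> x b \<otimes> remainder r"
  unfolding remainder_def
proof (rule theI')
  have c: "struct_map R (u b r) \<in> carrier R" using r u_simps(1) by simp
  have "u b (r \<ominus> struct_map R (u b r)) = \<zero>\<^bsub>K\<^esub>" using u_minus[OF r c] u_simps(2)[OF u_simps(1)[OF r]] by simp
  then obtain t where t: "t \<in> carrier R" "r \<ominus> struct_map R (u b r) = x b \<otimes> t"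
    using u_ker[OF b, of "r \<ominus> struct_map R (u b r)"] r c by auto
  have "r = struct_map R (u b r) \<oplus> (r \<ominus> struct_map R (u b r))" using r c by algebra
  then have 1: "r = struct_map R (u b r) \<oplus> x b \<otimes> t" using t by simp
  show "\<exists>!t. t \<in> carrier R \<and> r = struct_map R (u b r) \<oplus> x b \<otimes> t"
  proof (rule ex1I)
    show "t \<in> carrier R \<and> r = struct_map R (u b r) \<oplus> x b \<otimes> t" using t 1 by blast
    fix t' assume t': "t' \<in> carrier R \<and> r = struct_map R (u b r) \<oplus> x b \<otimes> t'"
    then have "struct_map R (u b r) \<oplus> x b \<otimes> t' = struct_map R (u b r) \<oplus> x b \<otimes> t" using 1 by simp
    moreover have "t' \<in> carrier R" using t' by blast
    ultimately have "x b \<otimes> t' = x b \<otimes> t" using t(1) c x_closed[OF b] by simp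
    then show "t' = t" using x_cancel t(1) t' by blast
  qed
qed

lemma remainder_closed: "r \<in> carrier R \<Longrightarrow> remainder r \<in> carrier R"
  using remainder by blast

lemma remainder_eqI:
  assumes c: "c \<in> carrier K" and t: "t \<in> carrier R" and r: "r = struct_map R c \<oplus> x b \<otimes> t"
  shows "u b r = c" and "remainder r = t"
proof -
  have rc: "r \<in> carrier R" using c t x_closed[OF b] unfolding r by simp
  show ub: "u b r = c" unfolding r using c t x_closed[OF b] by (simp add: u_simps)
  have "struct_map R c \<oplus> x b \<otimes> remainder r = struct_map R c \<oplus> x b \<otimes> t"
    using remainder[OF rc] r ub by simp
  then have "x b \<otimes> remainder r = x b \<otimes> t" using remainder_closed[OF rc] c t x_closed[OF b] by simp
  then show "remainder r = t" using x_cancel remainder_closed[OF rc] t by blast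
qed

lemma remainder_add:
  assumes r: "r \<in> carrier R" "s \<in> carrier R"
  shows "remainder (r \<oplus> s) = remainder r \<oplus> remainder s"
proof (rule remainder_eqI(2))
  note c = u_simps(1)[OF r(1)] u_simps(1)[OF r(2)]
  show "u b r \<oplus>\<^bsub>K\<^esub> u b s \<in> carrier K" "remainder r \<oplus> remainder s \<in> carrier R"
    using c r remainder_closed by simp_all
  have cl: "struct_map R (u b r) \<in> carrier R" "struct_map R (u b s) \<in> carrier R" "x b \<in> carrier R"
    "remainder r \<in> carrier R" "remainder s \<in> carrier R" using c x_closed[OF b] r remainder_closed by simp_all
  have "r \<oplus> s = (struct_map R (u b r) \<oplus> x b \<otimes> remainder r) \<oplus> (struct_map R (u b s) \<oplus> x b \<otimes> remainder s)"
    using remainder r by simp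
  also have "\<dots> = struct_map R (u b r) \<oplus> struct_map R (u b s) \<oplus> x b \<otimes> (remainder r \<oplus> remainder s)"
    using cl by algebra
  finally show "r \<oplus> s = struct_map R (u b r \<oplus>\<^bsub>K\<^esub> u b s) \<oplus> x b \<otimes> (remainder r \<oplus> remainder s)"
    using c by simp
qed

text \<open>A twisted Leibniz rule: expand one factor at the section and then the other. It is the
  recursion behind the Cauchy product in \<open>tcoeff_mult\<close>.\<close>

lemma remainder_mult:
  assumes r: "r \<in> carrier R" "s \<in> carrier R"
  shows "remainder (r \<otimes> s) = struct_map R (u b r) \<otimes> remainder s \<oplus> remainder r \<otimes> s"
proof (rule remainder_eqI(2))
  note c = u_simps(1)[OF r(1)] u_simps(1)[OF r(2)]
  have cl: "struct_map R (u b r) \<in> carrier R" "struct_map R (u b s) \<in> carrier R" "x b \<in> carrier R"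
    "remainder r \<in> carrier R" "remainder s \<in> carrier R" using c x_closed[OF b] r remainder_closed by simp_all
  show "u b r \<otimes>\<^bsub>K\<^esub> u b s \<in> carrier K" "struct_map R (u b r) \<otimes> remainder s \<oplus> remainder r \<otimes> s \<in> carrier R"
    using c r cl by simp_all
  have "r \<otimes> s = (struct_map R (u b r) \<oplus> x b \<otimes> remainder r) \<otimes> s"
    using remainder r by simp
  also have "\<dots> = struct_map R (u b r) \<otimes> s \<oplus> x b \<otimes> (remainder r \<otimes> s)" using cl r by algebra
  also have "struct_map R (u b r) \<otimes> s = struct_map R (u b r) \<otimes> (struct_map R (u b s) \<oplus> x b \<otimes> remainder s)"
    using remainder r by simp
  finally have "r \<otimes> s = struct_map R (u b r) \<otimes> (struct_map R (u b s) \<oplus> x b \<otimes> remainder s) \<oplus> x b \<otimes> (remainder r \<otimes> s)" .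
  also have "\<dots> = struct_map R (u b r) \<otimes> struct_map R (u b s) \<oplus> x b \<otimes> (struct_map R (u b r) \<otimes> remainder s \<oplus> remainder r \<otimes> s)"
    using cl r by algebra
  finally show "r \<otimes> s = struct_map R (u b r \<otimes>\<^bsub>K\<^esub> u b s) \<oplus> x b \<otimes> (struct_map R (u b r) \<otimes> remainder s \<oplus> remainder r \<otimes> s)"
    using c by simp
qed

lemma remainder_struct: "c \<in> carrier K \<Longrightarrow> remainder (struct_map R c) = \<zero>"
  by (rule remainder_eqI(2)) (use x_closed[OF b] in auto)

primrec tcoeff :: "nat \<Rightarrow> 'r \<Rightarrow> 'k" where
  "tcoeff 0 r = u b r"
| "tcoeff (Suc n) r = tcoeff n (remainder r)"

definition taylor :: "'r \<Rightarrow> nat \<Rightarrow> 'k" where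
  "taylor r = (\<lambda>n. tcoeff n r)"

lemma tcoeff_closed: "r \<in> carrier R \<Longrightarrow> tcoeff n r \<in> carrier K"
  by (induction n arbitrary: r) (simp_all add: u_simps remainder_closed)

lemma tcoeff_add: "r \<in> carrier R \<Longrightarrow> s \<in> carrier R \<Longrightarrow> tcoeff n (r \<oplus> s) = tcoeff n r \<oplus>\<^bsub>K\<^esub> tcoeff n s"
  by (induction n arbitrary: r s) (simp_all add: u_simps remainder_closed remainder_add)

lemma tcoeff_zero: "tcoeff n \<zero> = \<zero>\<^bsub>K\<^esub>"
  using remainder_struct[of "\<zero>\<^bsub>K\<^esub>"] by (induction n) (simp_all add: u_simps)

lemma tcoeff_struct_mult:
  assumes c: "c \<in> carrier K"
  shows "r \<in> carrier R \<Longrightarrow> tcoeff n (struct_map R c \<otimes> r) = c \<otimes>\<^bsub>K\<^esub> tcoeff n r"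
proof (induction n arbitrary: r)
  case (Suc n)
  then have "remainder (struct_map R c \<otimes> r) = struct_map R c \<otimes> remainder r"
    using c by (simp add: remainder_mult u_simps remainder_struct remainder_closed)
  then show ?case using Suc by (simp add: remainder_closed)
qed (use c in \<open>simp add: u_simps\<close>)

lemma tcoeff_mult:
  "r \<in> carrier R \<Longrightarrow> s \<in> carrier R \<Longrightarrow>
    tcoeff n (r \<otimes> s) = (\<Oplus>\<^bsub>K\<^esub>i\<in>{..n}. tcoeff i r \<otimes>\<^bsub>K\<^esub> tcoeff (n - i) s)"
proof (induction n arbitrary: r s)
  case 0
  then show ?case by (simp add: u_simps)
next
  case (Suc n)
  note cl = remainder_closed[OF Suc.prems(1)] remainder_closed[OF Suc.prems(2)]
  have ur: "u b r \<in> carrier K" using Suc.prems u_simps by simp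
  have "tcoeff (Suc n) (r \<otimes> s) = tcoeff n (struct_map R (u b r) \<otimes> remainder s) \<oplus>\<^bsub>K\<^esub> tcoeff n (remainder r \<otimes> s)"
    using Suc.prems cl ur by (simp add: remainder_mult tcoeff_add)
  also have "\<dots> = u b r \<otimes>\<^bsub>K\<^esub> tcoeff n (remainder s) \<oplus>\<^bsub>K\<^esub> (\<Oplus>\<^bsub>K\<^esub>i\<in>{..n}. tcoeff i (remainder r) \<otimes>\<^bsub>K\<^esub> tcoeff (n - i) s)"
    using Suc cl ur by (simp add: tcoeff_struct_mult)
  also have "\<dots> = (\<Oplus>\<^bsub>K\<^esub>i\<in>{..Suc n}. tcoeff i r \<otimes>\<^bsub>K\<^esub> tcoeff (Suc n - i) s)"
  proof -
    have f: "(\<lambda>i. tcoeff i r \<otimes>\<^bsub>K\<^esub> tcoeff (Suc n - i) s) \<in> {..Suc n} \<rightarrow> carrier K"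
      using Suc.prems tcoeff_closed by blast
    show ?thesis
      unfolding K.finsum_Suc2[OF f]
      using Suc.prems ur tcoeff_closed cl by (subst K.a_comm) (auto intro!: K.finsum_closed)
  qed
  finally show ?case .
qed

lemma tcoeff_struct: "c \<in> carrier K \<Longrightarrow> tcoeff n (struct_map R c) = (if n = 0 then c else \<zero>\<^bsub>K\<^esub>)"
  by (cases n) (simp_all add: u_simps remainder_struct tcoeff_zero)

lemma taylor_ring_hom: "taylor \<in> ring_hom R (powser_algebra K)"
proof (rule ring_hom_memI)
  show "taylor \<one> = \<one>\<^bsub>powser_algebra K\<^esub>"
    using tcoeff_struct[of "\<one>\<^bsub>K\<^esub>"] by (auto simp: taylor_def fun_eq_iff)
qed (auto simp: taylor_def tcoeff_closed tcoeff_add tcoeff_mult fun_eq_iff)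

text \<open>Passing to the remainder divides by \<open>x b\<close> and shifts the series by one
  place, so orders of vanishing correspond. Continuity of the Taylor map and control of its kernel
  both come from this.\<close>

lemma taylor_mem_iff: "r \<in> carrier R \<Longrightarrow> taylor r \<in> K.xpow_ideal m \<longleftrightarrow> r \<in> xid b m"
proof (induction m arbitrary: r)
  case 0
  then show ?case using mem_xid[OF b, of r 0] by (simp add: K.mem_xpow taylor_def tcoeff_closed)
next
  case (Suc m)
  note cl = remainder_closed[OF Suc.prems]
  have "taylor r \<in> K.xpow_ideal (Suc m) \<longleftrightarrow> u b r = \<zero>\<^bsub>K\<^esub> \<and> taylor (remainder r) \<in> K.xpow_ideal m"
    using Suc.prems cl by (simp add: K.mem_xpow taylor_def tcoeff_closed All_less_Suc2)
  also have "\<dots> \<longleftrightarrow> u b r = \<zero>\<^bsub>K\<^esub> \<and> remainder r \<in> xid b m" using Suc.IH[OF cl] by simp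
  also have "\<dots> \<longleftrightarrow> r \<in> xid b (Suc m)"
  proof
    assume L: "u b r = \<zero>\<^bsub>K\<^esub> \<and> remainder r \<in> xid b m"
    then obtain t where t: "t \<in> carrier R" "remainder r = x b [^] m \<otimes> t" using mem_xid[OF b] by blast
    have "struct_map R (u b r) \<oplus> x b \<otimes> remainder r = x b \<otimes> remainder r" using L cl x_closed[OF b] by simp
    then have "r = x b \<otimes> remainder r" using remainder[OF Suc.prems] by simp
    also have "\<dots> = x b [^] Suc m \<otimes> t" using t x_closed[OF b] by (simp add: m_ac)
    finally show "r \<in> xid b (Suc m)" using t mem_xid[OF b] by blast
  next
    assume "r \<in> xid b (Suc m)"
    then obtain t where t: "t \<in> carrier R" "r = x b [^] Suc m \<otimes> t" using mem_xid[OF b] by blast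
    then have "r = struct_map R \<zero>\<^bsub>K\<^esub> \<oplus> x b \<otimes> (x b [^] m \<otimes> t)" using x_closed[OF b] by (simp add: m_ac)
    from remainder_eqI[OF _ _ this] show "u b r = \<zero>\<^bsub>K\<^esub> \<and> remainder r \<in> xid b m"
      using t x_closed[OF b] mem_xid[OF b] by auto
  qed
  finally show ?case .
qed

lemma taylor_hom: "formal_hom K R (powser_algebra K) taylor"
proof (rule formal_homI[OF formal K.powser_formal taylor_ring_hom])
  show "taylor (struct_map R c) = struct_map (powser_algebra K) c" if "c \<in> carrier K" for c
    using that by (auto simp: taylor_def tcoeff_struct)
  fix J assume "J \<in> open_ideals (powser_algebra K)"
  then obtain m where m: "K.xpow_ideal m \<subseteq> J" using K.xpow_within by blast
  show "\<exists>I\<in>open_ideals R. \<forall>r\<in>I. taylor r \<in> J"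
    using m taylor_mem_iff ideal.Icarr[OF xid_ideal[OF b]] xid_open[OF b, of m] by blast
qed

text \<open>Horner's scheme. Passing from finitely many coefficients to all of them takes
  completeness and is done for all sections at once in \<open>expansion_surj\<close>.\<close>

lemma taylor_approx: "p \<in> UNIV \<rightarrow> carrier K \<Longrightarrow> \<exists>r\<in>carrier R. \<forall>i<m. taylor r i = p i"
proof (induction m arbitrary: p)
  case (Suc m)
  then have "(\<lambda>n. p (Suc n)) \<in> UNIV \<rightarrow> carrier K" by auto
  then obtain t where t: "t \<in> carrier R" "\<forall>i<m. taylor t i = p (Suc i)" using Suc.IH[of "\<lambda>n. p (Suc n)"] by blast
  let ?r = "struct_map R (p 0) \<oplus> x b \<otimes> t"
  have p0: "p 0 \<in> carrier K" using Suc.prems by auto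
  have "\<forall>i<Suc m. taylor ?r i = p i"
    using t remainder_eqI[OF p0 t(1) refl] by (auto simp: taylor_def less_Suc_eq_0_disj)
  moreover have "?r \<in> carrier R" using t p0 x_closed[OF b] by simp
  ultimately show ?case by blast
qed (auto intro: bexI[of _ \<zero>])

end

text \<open>The Chinese remainder theorem: if \<open>u\<^sub>b(a) = 1\<close> and \<open>u\<^sub>c(a) = 0\<close> for \<open>c \<noteq> b\<close>, take \<open>1 - (1 - a\<^sup>m)\<^sup>m\<close>.\<close>

lemma separating_element:
  assumes b: "b \<in> E"
  shows "\<exists>a\<in>carrier R. u b a = \<one>\<^bsub>K\<^esub> \<and> (\<forall>c\<in>E. c \<noteq> b \<longrightarrow> u c a = \<zero>\<^bsub>K\<^esub>)"
proof -
  have "\<exists>a\<in>carrier R. u b a = \<one>\<^bsub>K\<^esub> \<and> (\<forall>c\<in>S. u c a = \<zero>\<^bsub>K\<^esub>)" if "finite S" "S \<subseteq> E - {b}" for S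
    using that
  proof (induction S rule: finite_induct)
    case empty
    then show ?case using b by (auto simp: u_simps intro!: bexI[of _ \<one>])
  next
    case (insert c S)
    then have c: "c \<in> E" "c \<noteq> b" by auto
    obtain a where a: "a \<in> carrier R" "u b a = \<one>\<^bsub>K\<^esub>" "\<forall>c\<in>S. u c a = \<zero>\<^bsub>K\<^esub>" using insert by auto
    obtain r where r: "r \<in> carrier R" "u b r \<noteq> u c r" using u_distinct b c by metis
    let ?s = "r \<ominus> struct_map R (u c r)"
    note ur = u_simps(1)[OF c(1) r(1)]
    have s: "?s \<in> carrier R" using r ur by simp
    have uc: "u c ?s = \<zero>\<^bsub>K\<^esub>" using r c ur by (simp add: u_minus u_simps)
    have "u b ?s \<noteq> \<zero>\<^bsub>K\<^esub>" using r b ur by (simp add: u_minus u_simps)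
    then have k: "inv\<^bsub>K\<^esub> u b ?s \<in> carrier K" "inv\<^bsub>K\<^esub> u b ?s \<otimes>\<^bsub>K\<^esub> u b ?s = \<one>\<^bsub>K\<^esub>"
      using Kf.field_Units u_simps(1)[OF b s] by auto
    \<comment> \<open>A Lagrange interpolation factor: the rescaled \<open>?s\<close> is one at
      \<open>b\<close> and zero at \<open>c\<close>, and multiplication by it preserves the earlier
      zeros.\<close>
    let ?a = "a \<otimes> (struct_map R (inv\<^bsub>K\<^esub> u b ?s) \<otimes> ?s)"
    have "?a \<in> carrier R" using a s k by simp
    moreover have "u b ?a = \<one>\<^bsub>K\<^esub>" using a s k b by (simp add: u_simps)
    moreover have "u c' ?a = \<zero>\<^bsub>K\<^esub>" if "c' \<in> insert c S" for c'
      using that a s k uc c insert.prems by (auto simp: u_simps)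
    ultimately show ?case by blast
  qed
  from this[of "E - {b}"] fin_E show ?thesis by auto
qed

lemma xid_pow: "b \<in> E \<Longrightarrow> a \<in> carrier R \<Longrightarrow> u b a = \<zero>\<^bsub>K\<^esub> \<Longrightarrow> a [^] m \<in> xid b m"
  using u_ker[of b a] x_closed[of b] mem_xid[of b "a [^] m" m]
  by (auto simp: nat_pow_distrib)

text \<open>Applied to the power \<open>m\<close> of a separating element, it shows that the
  approximate idempotent vanishes to order \<open>m\<close> at the other sections.\<close>

lemma one_minus_pow:
  assumes a: "a \<in> carrier R"
  shows "\<exists>t\<in>carrier R. \<one> \<ominus> (\<one> \<ominus> a) [^] (m::nat) = a \<otimes> t"
proof (induction m)
  case 0
  then show ?case using a by (auto simp: sub_self intro!: bexI[of _ \<zero>])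
next
  case (Suc m)
  then obtain t where t: "t \<in> carrier R" "\<one> \<ominus> (\<one> \<ominus> a) [^] m = a \<otimes> t" by blast
  have "\<one> \<ominus> (\<one> \<ominus> a) [^] Suc m = (\<one> \<ominus> (\<one> \<ominus> a) [^] m) \<oplus> a \<otimes> (\<one> \<ominus> a) [^] m"
  proof -
    define p where "p = (\<one> \<ominus> a) [^] m"
    have "p \<in> carrier R" using a by (simp add: p_def)
    then have "\<one> \<ominus> p \<otimes> (\<one> \<ominus> a) = (\<one> \<ominus> p) \<oplus> a \<otimes> p" using a by algebra
    then show ?thesis by (simp add: p_def)
  qed
  also have "\<dots> = a \<otimes> (t \<oplus> (\<one> \<ominus> a) [^] m)" using t a by (simp add: r_distr)
  finally show ?case using t a by (intro bexI[of _ "t \<oplus> (\<one> \<ominus> a) [^] m"]) simp_all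
qed

lemma crt_idempotent:
  assumes b: "b \<in> E"
  shows "\<exists>e\<in>carrier R. \<one> \<ominus> e \<in> xid b m \<and> (\<forall>c\<in>E. c \<noteq> b \<longrightarrow> e \<in> xid c m)"
proof -
  obtain a where a: "a \<in> carrier R" "u b a = \<one>\<^bsub>K\<^esub>" "\<And>c. c \<in> E \<Longrightarrow> c \<noteq> b \<Longrightarrow> u c a = \<zero>\<^bsub>K\<^esub>"
    using separating_element[OF b] by blast
  let ?f = "(\<one> \<ominus> a [^] m) [^] m"
  have u_pow: "u b (a [^] n) = \<one>\<^bsub>K\<^esub>" for n :: nat
    by (induction n) (use a b in \<open>simp_all add: u_simps\<close>)
  have "u b (\<one> \<ominus> a [^] m) = \<zero>\<^bsub>K\<^esub>" using a b by (simp add: u_minus u_pow u_simps)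
  then have 1: "?f \<in> xid b m" using a by (intro xid_pow[OF b]) simp_all
  obtain t where t: "t \<in> carrier R" "\<one> \<ominus> ?f = a [^] m \<otimes> t" using one_minus_pow[of "a [^] m" m] a by auto
  have f: "?f \<in> carrier R" using a by simp
  have "\<one> \<ominus> (\<one> \<ominus> ?f) = ?f" using f by algebra
  moreover have "\<one> \<ominus> ?f \<in> xid c m" if "c \<in> E" "c \<noteq> b" for c
    unfolding t(2) by (rule ideal.I_r_closed[OF xid_ideal[OF that(1)] xid_pow[OF that(1) a(1) a(3)[OF that]] t(1)])
  ultimately show ?thesis using 1 f by (intro bexI[of _ "\<one> \<ominus> ?f"]) auto
qed

lemma crt_rearrange:
  assumes "e \<in> carrier R" "s \<in> carrier R" "q \<in> carrier R"
  shows "(e \<otimes> s \<oplus> q) \<ominus> s = q \<ominus> (\<one> \<ominus> e) \<otimes> s"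
  using assms by algebra

lemma crt:
  assumes s: "\<And>b. b \<in> E \<Longrightarrow> s b \<in> carrier R"
  shows "\<exists>r\<in>carrier R. \<forall>b\<in>E. r \<ominus> s b \<in> xid b m"
proof -
  obtain e where e: "\<And>b. b \<in> E \<Longrightarrow> e b \<in> carrier R" "\<And>b. b \<in> E \<Longrightarrow> \<one> \<ominus> e b \<in> xid b m"
    "\<And>b c. b \<in> E \<Longrightarrow> c \<in> E \<Longrightarrow> c \<noteq> b \<Longrightarrow> e b \<in> xid c m"
    using crt_idempotent[of _ m] by metis
  let ?r = "\<Oplus>b\<in>E. e b \<otimes> s b"
  have "?r \<ominus> s c \<in> xid c m" if c: "c \<in> E" for c
  proof -
    interpret I: ideal "xid c m" R by (rule xid_ideal[OF c])
    let ?q = "\<Oplus>b\<in>E - {c}. e b \<otimes> s b"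
    have q: "?q \<in> xid c m"
      by (rule I.finsum_mem) (use e s c in \<open>auto intro!: I.I_r_closed\<close>)
    have "?r = (\<Oplus>b\<in>insert c (E - {c}). e b \<otimes> s b)" using c by (simp add: insert_absorb)
    also have "\<dots> = e c \<otimes> s c \<oplus> ?q"
      using c e s fin_E by (subst finsum_insert) auto
    finally have "?r \<ominus> s c = ?q \<ominus> (\<one> \<ominus> e c) \<otimes> s c"
      using crt_rearrange[OF e(1)[OF c] s[OF c] I.Icarr[OF q]] by simp
    moreover have "(\<one> \<ominus> e c) \<otimes> s c \<in> xid c m" using e(2)[OF c] s[OF c] by (rule I.I_r_closed)
    ultimately show ?thesis using q I.sub_closed by simp
  qed
  moreover have "?r \<in> carrier R" using e s by (intro finsum_closed) auto
  ultimately show ?thesis by blast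
qed

text \<open>The family \<open>g\<close> is left open because two are needed: \<open>taylor\<close>,
  whose coordinate is \<open>x b\<close> at each section, and the translates of the Taylor map at
  the origin. Injectivity is separatedness. For surjectivity, \<open>crt\<close> realises the first
  \<open>m\<close> coefficients at all sections simultaneously, and completeness provides the
  limit.\<close>

lemma expansion_bijective:
  fixes g :: "'e \<Rightarrow> 'r \<Rightarrow> nat \<Rightarrow> 'k"
  assumes g: "\<And>b. b \<in> E \<Longrightarrow> g b \<in> ring_hom R (powser_algebra K)"
    and mem: "\<And>b r m. b \<in> E \<Longrightarrow> r \<in> carrier R \<Longrightarrow> g b r \<in> K.xpow_ideal m \<longleftrightarrow> r \<in> xid b m"
    and approx: "\<And>b p m. b \<in> E \<Longrightarrow> p \<in> UNIV \<rightarrow> carrier K \<Longrightarrow> \<exists>r\<in>carrier R. \<forall>i<m. g b r i = p i"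
  shows expansion_inject:
      "\<And>r r'. r \<in> carrier R \<Longrightarrow> r' \<in> carrier R \<Longrightarrow> (\<And>b. b \<in> E \<Longrightarrow> g b r = g b r') \<Longrightarrow> r = r'"
    and expansion_surj:
      "\<And>p. (\<And>b. b \<in> E \<Longrightarrow> p b \<in> UNIV \<rightarrow> carrier K) \<Longrightarrow> \<exists>r\<in>carrier R. \<forall>b\<in>E. g b r = p b"
proof -
  interpret PS: cring "powser_algebra K" by (rule K.PS_cring)
  have gc: "g b r \<in> carrier (powser_algebra K)" if "b \<in> E" "r \<in> carrier R" for b r
    using ring_hom_closed[OF g[OF that(1)] that(2)] .
  have g_sub: "g b (r \<ominus> s) = g b r \<ominus>\<^bsub>powser_algebra K\<^esub> g b s" if "b \<in> E" "r \<in> carrier R" "s \<in> carrier R" for b r s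
  proof -
    interpret gb: ring_hom_cring R "powser_algebra K" "g b" by unfold_locales (rule g[OF that(1)])
    show ?thesis using that(2,3) by (simp add: minus_eq PS.minus_eq del: powser_simps)
  qed
  have g_sub_mem: "r \<ominus> s \<in> xid b m \<longleftrightarrow> (\<forall>i<m. g b r i = g b s i)"
    if "b \<in> E" "r \<in> carrier R" "s \<in> carrier R" for b r s m
  proof -
    have "r \<ominus> s \<in> xid b m \<longleftrightarrow> g b r \<ominus>\<^bsub>powser_algebra K\<^esub> g b s \<in> K.xpow_ideal m"
      using mem[OF that(1), of "r \<ominus> s" m] that by (simp add: g_sub)
    also have "\<dots> \<longleftrightarrow> g b r \<in> K.xpow_ideal m +>\<^bsub>powser_algebra K\<^esub> g b s"
      using ideal.mem_coset_iff[OF K.xpow_ideal gc[OF that(1,3)]] gc[OF that(1,2)] by blast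
    also have "\<dots> \<longleftrightarrow> (\<forall>i<m. g b r i = g b s i)"
      unfolding K.xpow_coset[OF gc[OF that(1,3)]] using gc[OF that(1,2)] by blast
    finally show ?thesis .
  qed
  show "r = r'" if r: "r \<in> carrier R" "r' \<in> carrier R" and eq: "\<And>b. b \<in> E \<Longrightarrow> g b r = g b r'" for r r'
  proof -
    have "r \<ominus> r' = \<zero>" by (rule xid_separated) (use r eq in \<open>auto simp: g_sub_mem\<close>)
    then show ?thesis using r by simp
  qed
  fix p :: "'e \<Rightarrow> nat \<Rightarrow> 'k" assume p: "\<And>b. b \<in> E \<Longrightarrow> p b \<in> UNIV \<rightarrow> carrier K"
  have "\<exists>r\<in>carrier R. \<forall>b\<in>E. \<forall>i<m. g b r i = p b i" for m
  proof -
    have "\<exists>r\<in>carrier R. \<forall>i<m. g b r i = p b i" if "b \<in> E" for b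
      by (rule approx[OF that p[OF that]])
    then obtain s where s: "\<And>b. b \<in> E \<Longrightarrow> s b \<in> carrier R" "\<And>b. b \<in> E \<Longrightarrow> \<forall>i<m. g b (s b) i = p b i"
      by metis
    obtain r where "r \<in> carrier R" "\<forall>b\<in>E. r \<ominus> s b \<in> xid b m" using crt[of s m] s(1) by blast
    then show ?thesis using s g_sub_mem by (metis (no_types, lifting))
  qed
  then obtain s where s: "\<And>m. s m \<in> carrier R" "\<And>m b i. b \<in> E \<Longrightarrow> i < m \<Longrightarrow> g b (s m) i = p b i" by metis
  obtain z where z: "z \<in> carrier R" "\<And>m b. b \<in> E \<Longrightarrow> z \<ominus> s m \<in> xid b m"
    using x_complete[of s] s by (auto simp: g_sub_mem)
  have "g b z = p b" if b: "b \<in> E" for b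
  proof
    fix n
    have "g b z n = g b (s (Suc n)) n" using iffD1[OF g_sub_mem[OF b z(1) s(1)] z(2)[OF b, of "Suc n"]] by blast
    then show "g b z n = p b n" using s b by simp
  qed
  then show "\<exists>r\<in>carrier R. \<forall>b\<in>E. g b r = p b" using z(1) by blast
qed

lemma taylor_surj:
  assumes b: "b \<in> E" and p: "p \<in> UNIV \<rightarrow> carrier K"
  shows "\<exists>r\<in>carrier R. taylor b r = p"
  using expansion_surj[of taylor "\<lambda>_. p"] taylor_ring_hom taylor_mem_iff taylor_approx b p by blast

text \<open>The condition that a point of \<open>spf(R)\<close> over \<open>T\<close> lies in the
  component of \<open>u b\<close>. If the image of \<open>x b\<close> is topologically nilpotent,
  then modulo each open ideal \<open>c\<close> kills some \<open>xid b m\<close>. So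
  \<open>c\<close> is constant on the fibres of the surjective Taylor map, and the induced map is
  continuous.\<close>

lemma taylor_factor:
  assumes b: "b \<in> E" and T: "formal_algebra K T" and c: "formal_hom K R T c"
    and nil: "\<And>J. J \<in> open_ideals T \<Longrightarrow> \<exists>m::nat. c (x b) [^]\<^bsub>T\<^esub> m \<in> J"
  shows "\<exists>c'. formal_hom K (powser_algebra K) T c' \<and> (\<forall>r\<in>carrier R. c' (taylor b r) = c r)"
proof -
  let ?PS = "powser_algebra K"
  interpret PS: cring ?PS by (rule K.PS_cring)
  interpret T: formal_alg K T by unfold_locales (rule T)
  interpret c: formal_map K R T c by (rule formal_mapI[OF formal T c])
  interpret t: formal_map K R ?PS "taylor b" by (rule formal_mapI[OF formal K.powser_formal taylor_hom[OF b]])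
  have small: "\<exists>m. \<forall>r\<in>xid b m. c r \<in> J" if J: "J \<in> open_ideals T" for J
  proof -
    interpret J: ideal J T by (rule T.open_idealD[OF J])
    obtain m :: nat where m: "c (x b) [^]\<^bsub>T\<^esub> m \<in> J" using nil J by blast
    have "c r \<in> J" if r: "r \<in> xid b m" for r
    proof -
      obtain t where t: "t \<in> carrier R" "r = x b [^] m \<otimes> t" using r mem_xid[OF b] by blast
      have "c (x b [^] m) = c (x b) [^]\<^bsub>T\<^esub> m" by (rule c.hom_pow[OF x_closed[OF b]])
      then have "c r = c (x b) [^]\<^bsub>T\<^esub> m \<otimes>\<^bsub>T\<^esub> c t" unfolding t(2) using t(1) x_closed[OF b] by simp
      then show ?thesis using m t J.I_r_closed by simp
    qed
    then show ?thesis by blast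
  qed
  have ker: "c r = c r'" if r: "r \<in> carrier R" "r' \<in> carrier R" and eq: "taylor b r = taylor b r'" for r r'
  proof (rule T.separated)
    fix J assume J: "J \<in> open_ideals T"
    obtain m where m: "\<forall>r\<in>xid b m. c r \<in> J" using small J by blast
    have "taylor b (r \<ominus> r') = \<zero>\<^bsub>?PS\<^esub>" using r eq t.hom_sub[OF r] by (simp add: PS.sub_self del: powser_simps)
    then have "taylor b (r \<ominus> r') \<in> K.xpow_ideal m"
      using additive_subgroup.zero_closed[OF ideal.axioms(1)[OF K.xpow_ideal]] by simp
    then have "r \<ominus> r' \<in> xid b m" using iffD1[OF taylor_mem_iff[OF b]] r by simp
    then have "c (r \<ominus> r') \<in> J" using m by blast
    then show "c r \<ominus>\<^bsub>T\<^esub> c r' \<in> J" using c.hom_sub[OF r] by simp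
  qed (use r in simp_all)
  \<comment> \<open>The value of \<open>c\<close> at some preimage under the Taylor map;
    \<open>ker\<close> makes the choice irrelevant.\<close>
  define c' where "c' p = c (SOME r. r \<in> carrier R \<and> taylor b r = p)" for p
  have c': "c' (taylor b r) = c r" if r: "r \<in> carrier R" for r
  proof -
    have "\<exists>r'. r' \<in> carrier R \<and> taylor b r' = taylor b r" using r by blast
    from someI_ex[OF this] show ?thesis unfolding c'_def using ker r by blast
  qed
  have surj: "\<exists>r\<in>carrier R. p = taylor b r" if "p \<in> carrier ?PS" for p
    using taylor_surj[OF b, of p] that by auto
  have "formal_hom K ?PS T c'"
  proof (rule formal_homI[OF K.powser_formal T])
    show "c' \<in> ring_hom ?PS T"
    proof (rule ring_hom_memI)
      fix p q assume "p \<in> carrier ?PS" "q \<in> carrier ?PS"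
      then obtain r s where r: "r \<in> carrier R" "p = taylor b r" "s \<in> carrier R" "q = taylor b s"
        using surj by metis
      show "c' p \<in> carrier T" using r by (simp add: c')
      have eq: "p \<otimes>\<^bsub>?PS\<^esub> q = taylor b (r \<otimes> s)" "p \<oplus>\<^bsub>?PS\<^esub> q = taylor b (r \<oplus> s)"
        unfolding r(2,4) using t.hom_mult[OF r(1,3)] t.hom_add[OF r(1,3)] by simp_all
      show "c' (p \<otimes>\<^bsub>?PS\<^esub> q) = c' p \<otimes>\<^bsub>T\<^esub> c' q" "c' (p \<oplus>\<^bsub>?PS\<^esub> q) = c' p \<oplus>\<^bsub>T\<^esub> c' q"
        unfolding eq c'[OF m_closed[OF r(1,3)]] c'[OF a_closed[OF r(1,3)]]
        using r by (simp_all add: c')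
    next
      show "c' \<one>\<^bsub>?PS\<^esub> = \<one>\<^bsub>T\<^esub>" using c'[OF one_closed] t.hom_one by (simp del: powser_simps)
    qed
    show "c' (struct_map ?PS k) = struct_map T k" if k: "k \<in> carrier K" for k
      using c'[of "struct_map R k"] k t.hom_struct[OF k] c.hom_struct[OF k] by (simp del: powser_simps)
    fix J assume J: "J \<in> open_ideals T"
    obtain m where m: "\<forall>r\<in>xid b m. c r \<in> J" using small J by blast
    have "c' p \<in> J" if p: "p \<in> K.xpow_ideal m" for p
    proof -
      obtain r where r: "r \<in> carrier R" "p = taylor b r" using surj p K.mem_xpow by blast
      then have "r \<in> xid b m" using taylor_mem_iff[OF b] p by blast
      then show ?thesis using r m by (simp add: c')
    qed
    then show "\<exists>I\<in>open_ideals ?PS. \<forall>r\<in>I. c' r \<in> J" using K.xpow_open[of m] by blast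
  qed
  then show ?thesis using c' by blast
qed

end

section \<open>Transfer of group structures\<close>

text \<open>Compatibility with comultiplications is additivity for the tautological points;
  naturality extends it to all points. It is applied to maps from \<open>C\<close> to the power
  series, to the constant group and to the product group.\<close>

lemma (in formal_grp) hom_padd:
  assumes H: "formal_algebra K H" and \<pi>: "formal_hom K G H \<pi>"
    and comult: "\<And>r. r \<in> carrier G \<Longrightarrow>
      comult H (\<pi> r) = padd (ctensor K H H) (incl1 K H H \<circ> \<pi>) (incl2 K H H \<circ> \<pi>) r"
    and T: "formal_algebra K T" and f: "formal_hom K H T f" and g: "formal_hom K H T g" and r: "r \<in> carrier G"
  shows "point_add K H T f g (\<pi> r) = padd T (f \<circ> \<pi>) (g \<circ> \<pi>) r"
proof -
  note v1 = formal_hom_comp[OF \<pi> incl1_hom[OF H H]] and v2 = formal_hom_comp[OF \<pi> incl2_hom[OF H H]]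
  let ?t = "copair K H H T f g"
  have "point_add K H T f g (\<pi> r) = ?t (padd (ctensor K H H) (incl1 K H H \<circ> \<pi>) (incl2 K H H \<circ> \<pi>) r)"
    by (simp add: point_add_def comult[OF r])
  also have "\<dots> = padd T (?t \<circ> (incl1 K H H \<circ> \<pi>)) (?t \<circ> (incl2 K H H \<circ> \<pi>)) r"
    by (rule padd_natural[OF ctensor_formal[OF H H] T v1 v2 copair_formal_hom[OF H H T f g] r])
  also have "padd T (?t \<circ> (incl1 K H H \<circ> \<pi>)) (?t \<circ> (incl2 K H H \<circ> \<pi>)) = padd T (f \<circ> \<pi>) (g \<circ> \<pi>)"
    by (rule padd_cong)
      (use formal_hom_closed[OF \<pi>] in \<open>simp_all add: copair_incl1[OF H H T f g] copair_incl2[OF H H T f g]\<close>)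
  finally show ?thesis .
qed

text \<open>After composition with \<open>\<pi>\<close> every axiom of \<open>H\<close> becomes an
  identity between points of \<open>G\<close>, which is known. As \<open>\<pi>\<close> is onto,
  composition with it can be cancelled.\<close>

lemma (in formal_grp) quotient_group:
  fixes H :: "('k, 's, 'n) formal_group_scheme"
  assumes H: "formal_algebra K H" and \<pi>: "formal_hom K G H \<pi>" and surj: "\<And>p. p \<in> carrier H \<Longrightarrow> \<exists>r\<in>carrier G. p = \<pi> r"
    and comult: "\<And>r. r \<in> carrier G \<Longrightarrow>
      comult H (\<pi> r) = padd (ctensor K H H) (incl1 K H H \<circ> \<pi>) (incl2 K H H \<circ> \<pi>) r"
    and counit: "\<And>r. r \<in> carrier G \<Longrightarrow> counit H (\<pi> r) = counit G r"
    and antipode: "\<And>r. r \<in> carrier G \<Longrightarrow> antipode H (\<pi> r) = \<pi> (antipode G r)"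
    and comult_H: "formal_hom K H (ctensor K H H) (comult H)"
    and counit_H: "formal_hom K H (base_algebra K) (counit H)"
    and antipode_H: "formal_hom K H H (antipode H)"
  shows "comm_formal_group K H"
proof -
  interpret H: formal_alg K H by unfold_locales (rule H)
  note W2f = ctensor_formal[OF H H]
  note W3f = ctensor_formal[OF H W2f]
  have po: "formal_hom K H T (point_add K H T f g)"
    if "formal_algebra K T" "formal_hom K H T f" "formal_hom K H T g" for T :: "('k, 't, 'z) formal_algebra_scheme" and f g
    using formal_hom_comp[OF comult_H copair_formal_hom[OF H H that]] by (simp add: point_add_def comp_def)
  note hp = hom_padd[OF H \<pi> comult]
  let ?W2 = "ctensor K H H" and ?p1 = "incl1 K H H" and ?p2 = "incl2 K H H"
  let ?W3 = "ctensor K H ?W2"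
  define q1 q2 q3 where "q1 = incl1 K H ?W2" and "q2 = incl2 K H ?W2 \<circ> ?p1" and "q3 = incl2 K H ?W2 \<circ> ?p2"
  have q: "formal_hom K H ?W3 q1" "formal_hom K H ?W3 q2" "formal_hom K H ?W3 q3"
    unfolding q1_def q2_def q3_def
    by (auto intro: formal_hom_comp incl1_hom[OF H W2f] incl2_hom[OF H W2f] incl1_hom[OF H H] incl2_hom[OF H H])
  note q\<pi> = q[THEN formal_hom_comp[OF \<pi>]]
  have assoc: "point_add K H ?W3 (point_add K H ?W3 q1 q2) q3 p = point_add K H ?W3 q1 (point_add K H ?W3 q2 q3) p"
    if p: "p \<in> carrier H" for p
  proof -
    obtain r where r: "r \<in> carrier G" "p = \<pi> r" using surj p by blast
    have "point_add K H ?W3 (point_add K H ?W3 q1 q2) q3 p = padd ?W3 (point_add K H ?W3 q1 q2 \<circ> \<pi>) (q3 \<circ> \<pi>) r"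
      unfolding r(2) using q r(1) by (intro hp W3f po)
    also have "padd ?W3 (point_add K H ?W3 q1 q2 \<circ> \<pi>) (q3 \<circ> \<pi>) = padd ?W3 (padd ?W3 (q1 \<circ> \<pi>) (q2 \<circ> \<pi>)) (q3 \<circ> \<pi>)"
      by (rule padd_cong) (simp_all add: hp[OF _ W3f q(1,2)])
    also have "\<dots> r = padd ?W3 (q1 \<circ> \<pi>) (padd ?W3 (q2 \<circ> \<pi>) (q3 \<circ> \<pi>)) r"
      by (rule padd_assoc[OF W3f q\<pi> r(1)])
    also have "padd ?W3 (q1 \<circ> \<pi>) (padd ?W3 (q2 \<circ> \<pi>) (q3 \<circ> \<pi>)) = padd ?W3 (q1 \<circ> \<pi>) (point_add K H ?W3 q2 q3 \<circ> \<pi>)"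
      by (rule padd_cong) (simp_all add: hp[OF _ W3f q(2,3)])
    also have "\<dots> r = point_add K H ?W3 q1 (point_add K H ?W3 q2 q3) p"
      unfolding r(2) using q r(1) by (intro hp[symmetric] W3f po)
    finally show ?thesis .
  qed
  note p = incl1_hom[OF H H] incl2_hom[OF H H]
  have comm: "point_add K H ?W2 ?p1 ?p2 s = point_add K H ?W2 ?p2 ?p1 s" if "s \<in> carrier H" for s
    using surj[OF that] hp[OF _ W2f p] hp[OF _ W2f p(2,1)] padd_comm[OF W2f p[THEN formal_hom_comp[OF \<pi>]]] by auto
  have zero_hom: "formal_hom K H H (point_zero H H)"
    using formal_hom_comp[OF counit_H H.struct_hom] by (simp add: point_zero_def comp_def)
  have zero\<pi>: "point_zero H H (\<pi> r) = point_zero G H r" if "r \<in> carrier G" for r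
    using that by (simp add: point_zero_def counit)
  have zero: "point_add K H H (point_zero H H) (\<lambda>s. s) s = s" if s: "s \<in> carrier H" for s
  proof -
    obtain r where r: "r \<in> carrier G" "s = \<pi> r" using surj s by blast
    have "point_add K H H (point_zero H H) (\<lambda>s. s) s = padd H (point_zero H H \<circ> \<pi>) ((\<lambda>s. s) \<circ> \<pi>) r"
      unfolding r(2) by (rule hp[OF _ H zero_hom formal_hom_id r(1)])
    also have "padd H (point_zero H H \<circ> \<pi>) ((\<lambda>s. s) \<circ> \<pi>) = padd H (point_zero G H) \<pi>"
      by (rule padd_cong) (simp_all add: zero\<pi>)
    also have "\<dots> r = s" unfolding r(2) by (rule padd_zero[OF H \<pi> r(1)])
    finally show ?thesis .
  qed
  have inv: "point_add K H H (antipode H) (\<lambda>s. s) s = point_zero H H s" if s: "s \<in> carrier H" for s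
  proof -
    obtain r where r: "r \<in> carrier G" "s = \<pi> r" using surj s by blast
    have "point_add K H H (antipode H) (\<lambda>s. s) s = padd H (antipode H \<circ> \<pi>) ((\<lambda>s. s) \<circ> \<pi>) r"
      unfolding r(2) by (rule hp[OF _ H antipode_H formal_hom_id r(1)])
    also have "padd H (antipode H \<circ> \<pi>) ((\<lambda>s. s) \<circ> \<pi>) = padd H (\<pi> \<circ> antipode G) \<pi>"
      by (rule padd_cong) (simp_all add: antipode)
    also have "\<dots> r = point_zero H H s"
      unfolding r(2) zero\<pi>[OF r(1)] by (rule padd_antipode[OF H \<pi> r(1)])
    finally show ?thesis .
  qed
  show ?thesis
    unfolding comm_formal_group_def Let_def q1_def[symmetric] q2_def[symmetric] q3_def[symmetric]
    using H comult_H counit_H antipode_H assoc comm zero inv by blast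
qed

section \<open>Topological nilpotence\<close>

text \<open>The elements lying in \<open>rad R J\<close> for every open ideal \<open>J\<close> are
  the topologically nilpotent ones.\<close>

definition rad :: "('r, 'm) ring_scheme \<Rightarrow> 'r set \<Rightarrow> 'r set" where
  "rad R J = {y \<in> carrier R. \<exists>m::nat. y [^]\<^bsub>R\<^esub> m \<in> J}"

context cring
begin

lemma rad_mult:
  assumes "ideal J R" "y \<in> rad R J" "t \<in> carrier R"
  shows "y \<otimes> t \<in> rad R J"
proof -
  obtain m :: nat where "y \<in> carrier R" "y [^] m \<in> J" using assms by (auto simp: rad_def)
  then have "(y \<otimes> t) [^] m \<in> J" using assms ideal.I_r_closed by (fastforce simp: nat_pow_distrib)
  then show ?thesis using assms by (auto simp: rad_def)
qed

text \<open>The binomial theorem is replaced by an induction on \<open>k\<close>: the product of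
  \<open>y\<close> to the \<open>a\<close>, \<open>z\<close> to the \<open>b\<close> and
  \<open>y + z\<close> to the \<open>k\<close> lies in \<open>J\<close> whenever
  \<open>m + n \<le> a + b + k\<close>, since splitting off one factor \<open>y + z\<close> raises
  \<open>a\<close> or \<open>b\<close>.\<close>

lemma rad_add:
  assumes J: "ideal J R" and y: "y \<in> rad R J" and z: "z \<in> rad R J"
  shows "y \<oplus> z \<in> rad R J"
proof -
  interpret J: ideal J R by (rule J)
  obtain m n :: nat where c: "y \<in> carrier R" "z \<in> carrier R" and mn: "y [^] m \<in> J" "z [^] n \<in> J"
    using y z by (auto simp: rad_def)
  have pow: "w [^] k \<in> J" if "w [^] j \<in> J" "j \<le> k" "w \<in> carrier R" for w and j k :: nat
    using J.I_r_closed[OF that(1), of "w [^] (k - j)"] that by (simp add: nat_pow_mult)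
  have "y [^] a \<otimes> z [^] b \<otimes> (y \<oplus> z) [^] k \<in> J" if "m + n \<le> a + b + k" for a b k :: nat
    using that
  proof (induction k arbitrary: a b)
    case 0
    then have "m \<le> a \<or> n \<le> b" by auto
    then show ?case using pow[OF mn(1), of a] pow[OF mn(2), of b] c J.I_l_closed J.I_r_closed by auto
  next
    case (Suc k)
    have "y [^] a \<otimes> z [^] b \<otimes> (y \<oplus> z) [^] Suc k
        = y [^] Suc a \<otimes> z [^] b \<otimes> (y \<oplus> z) [^] k \<oplus> y [^] a \<otimes> z [^] Suc b \<otimes> (y \<oplus> z) [^] k"
    proof -
      define p q s where "p = y [^] a" and "q = z [^] b" and "s = (y \<oplus> z) [^] k"
      have "p \<in> carrier R" "q \<in> carrier R" "s \<in> carrier R" using c by (simp_all add: p_def q_def s_def)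
      then have "p \<otimes> q \<otimes> (s \<otimes> (y \<oplus> z)) = p \<otimes> y \<otimes> q \<otimes> s \<oplus> p \<otimes> (q \<otimes> z) \<otimes> s" using c by algebra
      then show ?thesis by (simp add: p_def q_def s_def)
    qed
    moreover have "y [^] Suc a \<otimes> z [^] b \<otimes> (y \<oplus> z) [^] k \<in> J" "y [^] a \<otimes> z [^] Suc b \<otimes> (y \<oplus> z) [^] k \<in> J"
      using Suc.prems by (intro Suc.IH; simp)+
    ultimately show ?case by (metis J.a_closed)
  qed
  from this[of 0 0 "m + n"] have "(y \<oplus> z) [^] (m + n) \<in> J" using c by simp
  then show ?thesis using c by (auto simp: rad_def)
qed

lemma rad_superset: "ideal J R \<Longrightarrow> y \<in> J \<Longrightarrow> y \<in> rad R J"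
  using ideal.Icarr[of J R y] by (auto simp: rad_def intro!: exI[of _ "1::nat"])

end

text \<open>Suppose that \<open>f\<close> and \<open>g\<close> are infinitesimally close to the
  rational points \<open>a\<close> and \<open>b\<close>. On tensors
  \<open>f(r) g(s) - a(r) b(s)\<close> equals \<open>f(r - a(r)) g(s) + a(r) g(s - b(s))\<close>,
  which is topologically nilpotent. Such elements are closed under sums, so by density the pair
  \<open>(f, g)\<close> differs from \<open>(a, b)\<close> by topologically nilpotent elements
  everywhere.\<close>

lemma copair_nilpotent:
  assumes U: "formal_algebra K U" and V: "formal_algebra K V" and T: "formal_algebra K T"
    and f: "formal_hom K U T f" and g: "formal_hom K V T g"
    and a: "formal_hom K U (base_algebra K) a" and b: "formal_hom K V (base_algebra K) b"
    and fn: "\<And>r J. r \<in> carrier U \<Longrightarrow> a r = \<zero>\<^bsub>K\<^esub> \<Longrightarrow> J \<in> open_ideals T \<Longrightarrow> f r \<in> rad T J"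
    and gn: "\<And>r J. r \<in> carrier V \<Longrightarrow> b r = \<zero>\<^bsub>K\<^esub> \<Longrightarrow> J \<in> open_ideals T \<Longrightarrow> g r \<in> rad T J"
    and w: "w \<in> carrier (ctensor K U V)" and 0: "copair K U V (base_algebra K) a b w = \<zero>\<^bsub>K\<^esub>"
    and J: "J \<in> open_ideals T"
  shows "copair K U V T f g w \<in> rad T J"
proof -
  interpret tensor K U V by (rule tensorI[OF U V])
  interpret T: formal_alg K T by unfold_locales (rule T)
  let ?B = "base_algebra K"
  have B: "formal_algebra K ?B" by (rule base_formal(1)[OF U.K.cring_axioms])
  interpret f: formal_map K U T f by (rule formal_mapI[OF U T f])
  interpret g: formal_map K V T g by (rule formal_mapI[OF V T g])
  interpret a: formal_map K U ?B a by (rule formal_mapI[OF U B a])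
  interpret b: formal_map K V ?B b by (rule formal_mapI[OF V B b])
  define h where "h = copair K U V T f g"
  define e where "e = copair K U V ?B a b"
  have hh: "formal_hom K W T h" and eh: "formal_hom K W ?B e"
    unfolding h_def e_def by (rule copair_hom[OF T f g] copair_hom[OF B a b])+
  interpret h: formal_map K W T h by (rule formal_mapI[OF formal_W T hh])
  interpret e: formal_map K W ?B e by (rule formal_mapI[OF formal_W B eh])
  have sh: "formal_hom K W T (\<lambda>w. struct_map T (e w))"
    using formal_hom_comp[OF eh T.struct_hom] by (simp add: comp_def)
  interpret s: formal_map K W T "\<lambda>w. struct_map T (e w)" by (rule formal_mapI[OF formal_W T sh])
  let ?D = "\<lambda>w. h w \<ominus>\<^bsub>T\<^esub> struct_map T (e w)"
  let ?Z = "{y. \<forall>J\<in>open_ideals T. y \<in> rad T J}"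
  have "\<exists>z\<in>?Z. z \<in> carrier T \<and> ?D w \<ominus>\<^bsub>T\<^esub> z \<in> J"
  proof (rule additive_dense[OF T _ _ _ _ _ w J])
    fix v w assume vw: "v \<in> carrier W" "w \<in> carrier W"
    then show "?D (v \<oplus>\<^bsub>W\<^esub> w) = ?D v \<oplus>\<^bsub>T\<^esub> ?D w"
      using s.hom_add[OF vw] s.hom_closed h.hom_add[OF vw] h.hom_closed by (simp add: T.add_diff_add)
  next
    fix J assume J: "J \<in> open_ideals T"
    let ?Q = "{w \<in> carrier W. h w \<in> J} \<inter> {w \<in> carrier W. struct_map T (e w) \<in> J}"
    have "?Q \<in> open_ideals W" using J by (intro W.Int_open_ideal h.vimage_open_ideal s.vimage_open_ideal)
    moreover have "\<forall>w\<in>?Q. ?D w \<in> J" using ideal.sub_closed[OF T.open_idealD[OF J]] by blast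
    ultimately show "\<exists>Q\<in>open_ideals W. \<forall>w\<in>Q. ?D w \<in> J" by blast
  next
    fix r s assume r: "r \<in> carrier U" and s: "s \<in> carrier V"
    have ar: "a r \<in> carrier K" and bs: "b s \<in> carrier K" using a.hom_closed[OF r] b.hom_closed[OF s] by simp_all
    let ?r = "r \<ominus>\<^bsub>U\<^esub> struct_map U (a r)" and ?s = "s \<ominus>\<^bsub>V\<^esub> struct_map V (b s)"
    have rs: "?r \<in> carrier U" "?s \<in> carrier V" using r s ar bs by simp_all
    have "a ?r = \<zero>\<^bsub>K\<^esub>" "b ?s = \<zero>\<^bsub>K\<^esub>"
      using a.hom_sub[of r "struct_map U (a r)"] b.hom_sub[of s "struct_map V (b s)"] r s ar bs
        a.T.sub_self[of "a r"] a.T.sub_self[of "b s"] by (simp_all add: a.hom_struct b.hom_struct)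
    then have n: "f ?r \<in> rad T J" "g ?s \<in> rad T J" if "J \<in> open_ideals T" for J using fn gn rs that by blast+
    have "?D (i1 r \<otimes>\<^bsub>W\<^esub> i2 s) = f r \<otimes>\<^bsub>T\<^esub> g s \<ominus>\<^bsub>T\<^esub> struct_map T (a r) \<otimes>\<^bsub>T\<^esub> struct_map T (b s)"
    proof -
      have "h (i1 r \<otimes>\<^bsub>W\<^esub> i2 s) = f r \<otimes>\<^bsub>T\<^esub> g s"
        using r s by (simp add: h_def[symmetric] copair_i1[OF T f g, folded h_def] copair_i2[OF T f g, folded h_def])
      moreover have "e (i1 r \<otimes>\<^bsub>W\<^esub> i2 s) = a r \<otimes>\<^bsub>K\<^esub> b s"
        using r s e.hom_mult[of "i1 r" "i2 s"] by (simp add: copair_i1[OF B a b, folded e_def] copair_i2[OF B a b, folded e_def])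
      ultimately show ?thesis using ar bs by simp
    qed
    also have "\<dots> = f ?r \<otimes>\<^bsub>T\<^esub> g s \<oplus>\<^bsub>T\<^esub> g ?s \<otimes>\<^bsub>T\<^esub> struct_map T (a r)"
    proof -
      have eq: "f ?r = f r \<ominus>\<^bsub>T\<^esub> struct_map T (a r)" "g ?s = g s \<ominus>\<^bsub>T\<^esub> struct_map T (b s)"
        using r s ar bs by (simp_all add: f.hom_sub g.hom_sub f.hom_struct g.hom_struct)
      have "f r \<in> carrier T" "g s \<in> carrier T" "struct_map T (a r) \<in> carrier T" "struct_map T (b s) \<in> carrier T"
        using r s ar bs by simp_all
      then show ?thesis unfolding eq by algebra
    qed
    finally show "?D (i1 r \<otimes>\<^bsub>W\<^esub> i2 s) \<in> ?Z"
      using n s ar T.rad_mult[OF T.open_idealD] T.rad_add[OF T.open_idealD] by simp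
  next
    show "y \<oplus>\<^bsub>T\<^esub> z \<in> ?Z" if "y \<in> ?Z" "z \<in> ?Z" for y z
      using that T.rad_add[OF T.open_idealD] by blast
  qed (use h.hom_closed s.hom_closed in simp)
  then obtain z where z: "z \<in> rad T J" "z \<in> carrier T" "?D w \<ominus>\<^bsub>T\<^esub> z \<in> J" using J by blast
  have "?D w = h w" using 0 h.hom_closed[OF w] by (simp add: e_def T.minus_eq)
  then have "(h w \<ominus>\<^bsub>T\<^esub> z) \<oplus>\<^bsub>T\<^esub> z \<in> rad T J"
    using z T.rad_add[OF T.open_idealD[OF J] T.rad_superset[OF T.open_idealD[OF J]]] by simp
  then show ?thesis using z h.hom_closed[OF w] by (simp add: T.minus_eq T.a_assoc T.l_neg h_def)
qed

section \<open>The product decomposition\<close>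

lemma (in formal_grp) padd_cancel':
  assumes T: "formal_algebra K T" and f: "formal_hom K G T f" and g: "formal_hom K G T g" and r: "r \<in> carrier G"
  shows "padd T f (padd T (f \<circ> antipode G) g) r = g r"
proof -
  note fS = formal_hom_comp[OF antipode_hom f]
  have "padd T (padd T f (f \<circ> antipode G)) g = padd T (point_zero G T) g"
    by (rule padd_cong) (simp_all add: padd_comm[OF T f fS] padd_antipode[OF T f])
  then show ?thesis using padd_assoc[OF T f fS g r] padd_zero[OF T g r] by simp
qed

locale split_group = formal_grp K C + S: sections K C "carrier M" u x + D: const_grp K M
  for K :: "('k, 'c) ring_scheme" and C :: "('k, 'r, 'm) formal_group_scheme"
    and M :: "('e, 'd) monoid_scheme" and u x +
  assumes u_one: "r \<in> carrier C \<Longrightarrow> u \<one>\<^bsub>M\<^esub> r = counit C r"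
    and u_mult: "\<lbrakk>b \<in> carrier M; c \<in> carrier M; r \<in> carrier C\<rbrakk> \<Longrightarrow>
      u (b \<otimes>\<^bsub>M\<^esub> c) r = point_add K C (base_algebra K) (u b) (u c) r"
begin

abbreviation "\<pi> \<equiv> S.taylor \<one>\<^bsub>M\<^esub>"
abbreviation "KX \<equiv> powser_algebra K"
abbreviation "B \<equiv> base_algebra K"

lemma one_M [simp]: "\<one>\<^bsub>M\<^esub> \<in> carrier M"
  by (rule D.M.one_closed)

lemma \<pi>_hom: "formal_hom K C KX \<pi>"
  by (rule S.taylor_hom[OF one_M])

lemma zero_point: "point_zero C B = counit C"
  by (simp add: point_zero_def)

text \<open>The equation \<open>x c\<close> generates the ideal of \<open>u c\<close>. So if its
  image under \<open>t\<close> vanishes at \<open>u d\<close>, that is, if \<open>t\<close> as a map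
  of curves takes \<open>u d\<close> to \<open>u c\<close>, orders of vanishing are respected. This
  is applied to translations.\<close>

lemma hom_xid:
  assumes t: "formal_hom K C C t" and c: "c \<in> carrier M" and d: "d \<in> carrier M"
    and 0: "u d (t (x c)) = \<zero>\<^bsub>K\<^esub>" and r: "r \<in> S.xid c m"
  shows "t r \<in> S.xid d m"
proof -
  interpret t: formal_map K C C t by (rule formal_mapI[OF formal formal t])
  note xc = S.x_closed[OF c] and xd = S.x_closed[OF d]
  obtain s where s: "s \<in> carrier C" "t (x c) = x d \<otimes>\<^bsub>C\<^esub> s"
    using S.u_ker[OF d, of "t (x c)"] 0 t.hom_closed[OF xc] by blast
  obtain q where q: "q \<in> carrier C" "r = x c [^]\<^bsub>C\<^esub> m \<otimes>\<^bsub>C\<^esub> q" using r S.mem_xid[OF c] by blast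
  have "t r = (x d \<otimes>\<^bsub>C\<^esub> s) [^]\<^bsub>C\<^esub> m \<otimes>\<^bsub>C\<^esub> t q"
    unfolding q(2) using q(1) xc t.hom_pow[OF xc, of m] by (simp add: s(2))
  also have "\<dots> = x d [^]\<^bsub>C\<^esub> m \<otimes>\<^bsub>C\<^esub> (s [^]\<^bsub>C\<^esub> m \<otimes>\<^bsub>C\<^esub> t q)"
    using xd s(1) q(1) by (simp add: nat_pow_distrib m_assoc)
  finally show ?thesis using S.mem_xid[OF d] s(1) q(1) by auto
qed

text \<open>Translation by \<open>u\<^sub>b\<close> carries the Taylor expansion at the origin to one at \<open>u\<^sub>b\<close>.\<close>

context
  fixes b assumes b: "b \<in> carrier M"
begin

definition const_pt :: "'r \<Rightarrow> 'r" where
  "const_pt r = struct_map C (u b r)"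

definition transl :: "'r \<Rightarrow> 'r" where
  "transl = padd C const_pt (\<lambda>r. r)"

definition transl_inv :: "'r \<Rightarrow> 'r" where
  "transl_inv = padd C (const_pt \<circ> antipode C) (\<lambda>r. r)"

lemma const_pt_hom: "formal_hom K C C const_pt"
  using formal_hom_comp[OF S.u_hom[OF b] struct_hom] by (simp add: const_pt_def[abs_def] comp_def)

lemma transl_hom: "formal_hom K C C transl"
  unfolding transl_def by (rule padd_hom[OF formal const_pt_hom formal_hom_id])

lemma transl_inv_hom: "formal_hom K C C transl_inv"
  unfolding transl_inv_def
  by (rule padd_hom[OF formal formal_hom_comp[OF antipode_hom const_pt_hom] formal_hom_id])

lemma comp_const_pt: "formal_hom K C C t \<Longrightarrow> r \<in> carrier C \<Longrightarrow> t (const_pt r) = const_pt r"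
  using S.u_simps(1)[OF b] by (simp add: const_pt_def formal_hom_def)

lemma transl_inv_transl: "r \<in> carrier C \<Longrightarrow> transl_inv (transl r) = r"
proof -
  assume r: "r \<in> carrier C"
  have "transl_inv (transl r) = padd C (transl_inv \<circ> const_pt) (transl_inv \<circ> (\<lambda>r. r)) r"
    unfolding transl_def by (rule padd_natural[OF formal formal const_pt_hom formal_hom_id transl_inv_hom r])
  also have "padd C (transl_inv \<circ> const_pt) (transl_inv \<circ> (\<lambda>r. r))
      = padd C const_pt (padd C (const_pt \<circ> antipode C) (\<lambda>r. r))"
    by (rule padd_cong) (simp_all add: comp_const_pt[OF transl_inv_hom], simp add: transl_inv_def)
  also have "\<dots> r = r" by (rule padd_cancel'[OF formal const_pt_hom formal_hom_id r])
  finally show ?thesis .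
qed

lemma transl_transl_inv: "r \<in> carrier C \<Longrightarrow> transl (transl_inv r) = r"
proof -
  assume r: "r \<in> carrier C"
  note h = formal_hom_comp[OF antipode_hom const_pt_hom]
  have "transl (transl_inv r) = padd C (transl \<circ> (const_pt \<circ> antipode C)) (transl \<circ> (\<lambda>r. r)) r"
    unfolding transl_inv_def by (rule padd_natural[OF formal formal h formal_hom_id transl_hom r])
  also have "padd C (transl \<circ> (const_pt \<circ> antipode C)) (transl \<circ> (\<lambda>r. r))
      = padd C (const_pt \<circ> antipode C) (padd C const_pt (\<lambda>r. r))"
    by (rule padd_cong)
      (simp_all add: comp_const_pt[OF transl_hom] formal_hom_closed[OF antipode_hom], simp add: transl_def)
  also have "\<dots> r = r" by (rule padd_cancel[OF formal const_pt_hom formal_hom_id r])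
  finally show ?thesis .
qed

lemma u_transl: "r \<in> carrier C \<Longrightarrow> u \<one>\<^bsub>M\<^esub> (transl r) = u b r"
proof -
  assume r: "r \<in> carrier C"
  note B = S.B_formal
  have "u \<one>\<^bsub>M\<^esub> (transl r) = padd B (u \<one>\<^bsub>M\<^esub> \<circ> const_pt) (u \<one>\<^bsub>M\<^esub> \<circ> (\<lambda>r. r)) r"
    unfolding transl_def by (rule padd_natural[OF formal B const_pt_hom formal_hom_id S.u_hom[OF one_M] r])
  also have "padd B (u \<one>\<^bsub>M\<^esub> \<circ> const_pt) (u \<one>\<^bsub>M\<^esub> \<circ> (\<lambda>r. r)) = padd B (u b) (point_zero C B)"
    by (rule padd_cong) (use S.u_simps(1)[OF b] S.u_simps(2)[OF one_M] in \<open>simp_all add: const_pt_def zero_point u_one\<close>)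
  also have "\<dots> r = u b r"
    using padd_comm[OF B S.u_hom[OF b] pzero_hom[OF B] r] padd_zero[OF B S.u_hom[OF b] r] by simp
  finally show ?thesis .
qed

lemma transl_mem_iff:
  assumes r: "r \<in> carrier C"
  shows "transl r \<in> S.xid \<one>\<^bsub>M\<^esub> m \<longleftrightarrow> r \<in> S.xid b m"
proof
  assume "transl r \<in> S.xid \<one>\<^bsub>M\<^esub> m"
  moreover have "u b (transl_inv (x \<one>\<^bsub>M\<^esub>)) = \<zero>\<^bsub>K\<^esub>"
    using S.x_closed[OF one_M] formal_hom_closed[OF transl_inv_hom] S.u_simps(7)[OF one_M]
    by (simp add: u_transl[symmetric] transl_transl_inv)
  ultimately have "transl_inv (transl r) \<in> S.xid b m" by (intro hom_xid[OF transl_inv_hom one_M b])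
  then show "r \<in> S.xid b m" using r by (simp add: transl_inv_transl)
next
  assume "r \<in> S.xid b m"
  then show "transl r \<in> S.xid \<one>\<^bsub>M\<^esub> m"
    using S.x_closed[OF b] S.u_simps(7)[OF b] by (intro hom_xid[OF transl_hom b one_M]) (simp_all add: u_transl)
qed

text \<open>The translated coordinate is used at \<open>u b\<close> in place of \<open>x b\<close>,
  because the latter bears no relation to the group structure.\<close>

definition expansion :: "'r \<Rightarrow> nat \<Rightarrow> 'k" where
  "expansion r = \<pi> (transl r)"

lemma expansion_ring_hom: "expansion \<in> ring_hom C KX"
  using formal_hom_comp[OF transl_hom \<pi>_hom] by (simp add: formal_hom_def comp_def expansion_def[abs_def])

lemma expansion_mem_iff: "r \<in> carrier C \<Longrightarrow> expansion r \<in> K.xpow_ideal m \<longleftrightarrow> r \<in> S.xid b m"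
  using formal_hom_closed[OF transl_hom] by (simp add: expansion_def S.taylor_mem_iff transl_mem_iff)

lemma expansion_approx: "p \<in> UNIV \<rightarrow> carrier K \<Longrightarrow> \<exists>r\<in>carrier C. \<forall>i<m. expansion r i = p i"
proof -
  assume "p \<in> UNIV \<rightarrow> carrier K"
  then obtain r where "r \<in> carrier C" "\<forall>i<m. \<pi> r i = p i" using S.taylor_approx[OF one_M] by blast
  then show ?thesis
    using formal_hom_closed[OF transl_inv_hom] by (intro bexI[of _ "transl_inv r"]) (simp_all add: expansion_def transl_transl_inv)
qed

text \<open>As a point of \<open>C\<close> over \<open>K[[x]]\<close>, the expansion is the constant
  point \<open>u b\<close> plus the tautological point of the component of the origin. In this form
  it is compared with the components of the product map.\<close>

lemma expansion_eq:
  assumes r: "r \<in> carrier C"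
  shows "expansion r = padd KX (\<lambda>r. struct_map KX (u b r)) \<pi> r"
proof -
  have "expansion r = padd KX (\<pi> \<circ> const_pt) (\<pi> \<circ> (\<lambda>r. r)) r"
    unfolding expansion_def transl_def
    by (rule padd_natural[OF formal K.powser_formal const_pt_hom formal_hom_id \<pi>_hom r])
  also have "padd KX (\<pi> \<circ> const_pt) (\<pi> \<circ> (\<lambda>r. r)) = padd KX (\<lambda>r. struct_map KX (u b r)) \<pi>"
    by (rule padd_cong) (use \<pi>_hom S.u_simps(1)[OF b] in \<open>simp_all add: const_pt_def formal_hom_def\<close>)
  finally show ?thesis .
qed

end

text \<open>A converse to \<open>taylor_factor\<close>: on a point that factors through the
  component of the origin, a function vanishing at the origin is topologically nilpotent, because
  its power \<open>m\<close> vanishes there to order \<open>m\<close>.\<close>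

lemma nilpotent:
  assumes T: "formal_algebra K T" and h: "formal_hom K KX T h" and r: "r \<in> carrier C" "counit C r = \<zero>\<^bsub>K\<^esub>"
    and J: "J \<in> open_ideals T"
  shows "h (\<pi> r) \<in> rad T J"
proof -
  interpret h: formal_map K KX T h by (rule formal_mapI[OF K.powser_formal T h])
  note h\<pi> = formal_hom_comp[OF \<pi>_hom h]
  interpret h\<pi>: formal_map K C T "h \<circ> \<pi>" by (rule formal_mapI[OF formal T h\<pi>])
  obtain m where m: "K.xpow_ideal m \<subseteq> {p \<in> carrier KX. h p \<in> J}"
    using K.xpow_within[OF h.vimage_open_ideal[OF J]] by blast
  have "r [^]\<^bsub>C\<^esub> m \<in> S.xid \<one>\<^bsub>M\<^esub> m" using r by (intro S.xid_pow) (simp_all add: u_one)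
  then have "\<pi> (r [^]\<^bsub>C\<^esub> m) \<in> K.xpow_ideal m" using r S.taylor_mem_iff[OF one_M] by simp
  then have "(h \<circ> \<pi>) (r [^]\<^bsub>C\<^esub> m) \<in> J" using m by auto
  then have "(h \<circ> \<pi>) r [^]\<^bsub>T\<^esub> m \<in> J" using h\<pi>.hom_pow[OF r(1)] by simp
  then show ?thesis using h\<pi>.hom_closed[OF r(1)] by (auto simp: rad_def)
qed

text \<open>Sum, zero and inverse of points in the component of the origin satisfy the condition of
  \<open>taylor_factor\<close>, so the three structure maps of \<open>C\<close> descend along
  \<open>\<pi>\<close>. For the sum this is \<open>copair_nilpotent\<close> with both rational
  points equal to the origin; for the inverse it is \<open>counit_antipode\<close>.\<close>

lemma connected_component:
  "\<exists>H. ordinary_formal_group K H \<and>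
    (\<forall>r\<in>carrier C. comult H (\<pi> r) = padd (ctensor K H H) (incl1 K H H \<circ> \<pi>) (incl2 K H H \<circ> \<pi>) r) \<and>
    (\<forall>r\<in>carrier C. counit H (\<pi> r) = counit C r)"
proof -
  let ?W = "ctensor K KX KX"
  note PSf = K.powser_formal and B = S.B_formal
  note Wf = ctensor_formal[OF PSf PSf] and j = incl1_hom[OF PSf PSf] incl2_hom[OF PSf PSf]
  note j\<pi> = j[THEN formal_hom_comp[OF \<pi>_hom]]
  let ?c = "padd ?W (incl1 K KX KX \<circ> \<pi>) (incl2 K KX KX \<circ> \<pi>)"
  let ?x = "x \<one>\<^bsub>M\<^esub>"
  have x: "?x \<in> carrier C" "counit C ?x = \<zero>\<^bsub>K\<^esub>"
    using S.x_closed[OF one_M] S.u_simps(7)[OF one_M] u_one by auto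
  \<comment> \<open>Since \<open>0 + 0 = 0\<close>, the coordinate of a sum vanishes at the pair of
    origins.\<close>
  have "copair K C C B (counit C) (counit C) (comult C ?x) = \<zero>\<^bsub>K\<^esub>"
    using padd_zero[OF B counit_hom x(1)] x(2) by (simp add: zero_point point_add_def)
  then have "?c ?x \<in> rad ?W J" if "J \<in> open_ideals ?W" for J
    unfolding point_add_def
    by (intro copair_nilpotent[OF formal formal Wf j\<pi> counit_hom counit_hom _ _ comult_closed[OF x(1)] _ that])
      (use nilpotent[OF Wf] j in auto)
  then have "\<exists>\<Delta>. formal_hom K KX ?W \<Delta> \<and> (\<forall>r\<in>carrier C. \<Delta> (\<pi> r) = ?c r)"
    by (intro S.taylor_factor[OF one_M Wf padd_hom[OF Wf j\<pi>]]) (auto simp: rad_def)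
  then obtain \<Delta> where \<Delta>: "formal_hom K KX ?W \<Delta>" "\<And>r. r \<in> carrier C \<Longrightarrow> \<Delta> (\<pi> r) = ?c r" by blast
  have "\<exists>m::nat. counit C ?x [^]\<^bsub>B\<^esub> m \<in> J" if J: "J \<in> open_ideals B" for J
  proof -
    interpret B: formal_alg K B by unfold_locales (rule B)
    have "counit C ?x [^]\<^bsub>B\<^esub> (1::nat) = \<zero>\<^bsub>B\<^esub>" using x by simp
    then show ?thesis using additive_subgroup.zero_closed[OF ideal.axioms(1)[OF B.open_idealD[OF J]]] by metis
  qed
  from S.taylor_factor[OF one_M B counit_hom this]
  obtain \<epsilon> where \<epsilon>: "formal_hom K KX B \<epsilon>" "\<And>r. r \<in> carrier C \<Longrightarrow> \<epsilon> (\<pi> r) = counit C r" by blast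
  have "(\<pi> \<circ> antipode C) ?x \<in> rad KX J" if "J \<in> open_ideals KX" for J
    using nilpotent[OF PSf formal_hom_id _ _ that, of "antipode C ?x"] x formal_hom_closed[OF antipode_hom x(1)]
    by (simp add: counit_antipode)
  then have "\<exists>\<iota>. formal_hom K KX KX \<iota> \<and> (\<forall>r\<in>carrier C. \<iota> (\<pi> r) = (\<pi> \<circ> antipode C) r)"
    by (intro S.taylor_factor[OF one_M PSf formal_hom_comp[OF antipode_hom \<pi>_hom]]) (auto simp: rad_def)
  then obtain \<iota> where \<iota>: "formal_hom K KX KX \<iota>" "\<And>r. r \<in> carrier C \<Longrightarrow> \<iota> (\<pi> r) = \<pi> (antipode C r)" by auto
  define H where "H = formal_algebra.extend KX (formal_group.fields \<Delta> \<epsilon> \<iota>)"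
  have tr: "formal_algebra.truncate H = formal_algebra.truncate KX" and tr': "formal_algebra.truncate H = KX"
    by (simp_all add: H_def truncate_extend truncate_trivial)
  have fields: "comult H = \<Delta>" "counit H = \<epsilon>" "antipode H = \<iota>" by (simp_all add: H_def group_fields_simps)
  note cong = ctensor_cong[OF tr tr, of K]
  have Hf: "formal_algebra K H" using formal_algebra_cong[OF tr, of K] PSf by blast
  have car: "carrier H = carrier KX" using truncate_simps(1)[of H] unfolding tr' by simp
  have "comm_formal_group K H"
  proof (rule quotient_group[OF Hf, of \<pi>])
    show "formal_hom K C H \<pi>" using \<pi>_hom by (simp add: formal_hom_cong_target[OF tr])
    show "\<exists>r\<in>carrier C. p = \<pi> r" if "p \<in> carrier H" for p
      using S.taylor_surj[OF one_M, of p] that unfolding car by auto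
    show "formal_hom K H (ctensor K H H) (comult H)" "formal_hom K H (base_algebra K) (counit H)"
      "formal_hom K H H (antipode H)"
      using \<Delta> \<epsilon> \<iota> by (simp_all add: fields cong formal_hom_cong_source[OF tr] formal_hom_cong_target[OF tr])
  qed (simp_all add: fields cong \<Delta> \<epsilon> \<iota>)
  then have "ordinary_formal_group K H" using tr' by (simp add: ordinary_formal_group_def)
  then show ?thesis using \<Delta>(2) \<epsilon>(2) by (intro exI[of _ H]) (simp add: fields cong)
qed

text \<open>The map \<open>g\<close> is the map of coordinate rings of
  \<open>(b, h) \<mapsto> u_b + h\<close>. Its component at \<open>b\<close> is
  \<open>expansion b\<close>, so it is bijective by \<open>expansion_bijective\<close>. It respects
  comultiplications because of the interchange law in the commutative group
  \<open>C\<close>.\<close>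

lemma product_iso:
  assumes H: "ordinary_formal_group K H"
    and comult_\<pi>: "\<And>r. r \<in> carrier C \<Longrightarrow> comult H (\<pi> r) = padd (ctensor K H H) (incl1 K H H \<circ> \<pi>) (incl2 K H H \<circ> \<pi>) r"
    and counit_\<pi>: "\<And>r. r \<in> carrier C \<Longrightarrow> counit H (\<pi> r) = counit C r"
  shows "\<exists>f. formal_group_iso K C (prod_group K (const_group K M) H) f \<and>
    (\<forall>w\<in>carrier (prod_group K (const_group K M) H). f w \<in> carrier C \<and>
      first_factor K (const_group K M) H w = (\<lambda>b\<in>carrier M. u b (f w)))"
proof -
  have H_grp: "formal_grp K H" and trH: "formal_algebra.truncate H = KX"
    using H by (auto simp: ordinary_formal_group_def formal_grp_def)
  interpret H: formal_grp K H by (rule H_grp)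
  have trH': "formal_algebra.truncate H = formal_algebra.truncate KX" by (simp add: trH truncate_trivial)
  have carH: "carrier H = carrier KX" using truncate_simps(1)[of H] unfolding trH by simp
  interpret FT: fun_tensor K "carrier M" H by unfold_locales (use H.formal D.fin_M in auto)
  let ?A = "fun_algebra K (carrier M)" and ?D = "const_group K M"
  let ?W = "ctensor K ?A H" and ?i1 = "incl1 K ?A H" and ?i2 = "incl2 K ?A H"
  let ?WW = "ctensor K ?W ?W" and ?j1 = "incl1 K ?W ?W" and ?j2 = "incl2 K ?W ?W"
  let ?P = "prod_group K ?D H"
  note Wf = FT.formal_W
  note WWf = ctensor_formal[OF Wf Wf]
  note j = incl1_hom[OF Wf Wf] incl2_hom[OF Wf Wf]
  note DH = ctensor_cong[OF D.trunc refl, of K H]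
  have trP: "formal_algebra.truncate ?P = ?W"
    by (simp add: prod_group_def Let_def truncate_extend DH)
  have trP': "formal_algebra.truncate ?P = formal_algebra.truncate ?W" by (simp add: trP truncate_trivial)
  note PP = ctensor_cong[OF trP' trP', of K]
  have carP: "carrier ?P = carrier ?W" using truncate_simps(1)[of ?P] unfolding trP by simp
  have topP: "topol ?P = topol ?W" using truncate_simps(7)[of ?P] unfolding trP by simp
  have Pf: "formal_algebra K ?P" using Wf formal_algebra_cong[OF trP', of K] by blast
  have comult_P: "comult ?P = copair K ?A H ?WW
      (point_add K ?D ?WW (?j1 \<circ> ?i1) (?j2 \<circ> ?i1)) (point_add K H ?WW (?j1 \<circ> ?i2) (?j2 \<circ> ?i2))"
    by (simp add: prod_group_def Let_def group_fields_simps DH)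
  have \<pi>H: "formal_hom K C H \<pi>" using \<pi>_hom by (simp add: formal_hom_cong_target[OF trH'])
  define \<upsilon> where "\<upsilon> r = (\<lambda>b\<in>carrier M. u b r)" for r
  have \<upsilon>: "formal_hom K C ?A \<upsilon>"
  proof (rule formal_homI[OF formal D.V_formal])
    show "\<upsilon> \<in> ring_hom C ?A"
      by (rule ring_hom_memI) (auto simp: \<upsilon>_def S.u_simps fun_eq_iff)
    show "\<upsilon> (struct_map C c) = struct_map ?A c" if "c \<in> carrier K" for c
      using that by (auto simp: \<upsilon>_def S.u_simps fun_eq_iff)
    fix J assume J: "J \<in> open_ideals ?A"
    have "\<exists>I\<in>open_ideals C. \<forall>r\<in>I. \<forall>b\<in>S. u b r = \<zero>\<^bsub>K\<^esub>" if "finite S" "S \<subseteq> carrier M" for S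
      using that
    proof (induction S rule: finite_induct)
      case empty
      then show ?case using carrier_open_ideal by blast
    next
      case (insert b S)
      then obtain I where I: "I \<in> open_ideals C" "\<forall>r\<in>I. \<forall>b\<in>S. u b r = \<zero>\<^bsub>K\<^esub>" by auto
      have b: "b \<in> carrier M" using insert by simp
      have "u b r = \<zero>\<^bsub>K\<^esub>" if "r \<in> S.xid b 1" for r
      proof -
        have "\<exists>t\<in>carrier C. r = x b \<otimes>\<^bsub>C\<^esub> t" using that S.mem_xid[OF b, of r 1] S.x_closed[OF b] by simp
        moreover from this have "r \<in> carrier C" using S.x_closed[OF b] by auto
        ultimately show ?thesis using S.u_ker[OF b] by blast
      qed
      then show ?case using I Int_open_ideal[OF I(1) S.xid_open[OF b, of 1]] by (intro bexI[of _ "I \<inter> S.xid b 1"]) auto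
    qed
    from this[OF D.fin_M] obtain I where I: "I \<in> open_ideals C" "\<forall>r\<in>I. \<forall>b\<in>carrier M. u b r = \<zero>\<^bsub>K\<^esub>" by auto
    have "\<upsilon> r \<in> J" if "r \<in> I" for r
    proof -
      have "\<upsilon> r = \<zero>\<^bsub>?A\<^esub>" using I that by (auto simp: \<upsilon>_def fun_eq_iff)
      then show ?thesis using additive_subgroup.zero_closed[OF ideal.axioms(1)[OF D.V.open_idealD[OF J]]] by simp
    qed
    then show "\<exists>I\<in>open_ideals C. \<forall>r\<in>I. \<upsilon> r \<in> J" using I by blast
  qed
  have \<upsilon>D: "formal_hom K C ?D \<upsilon>" using \<upsilon> by (simp add: formal_hom_cong_target[OF D.trunc])
  have \<upsilon>_grp: "comult ?D (\<upsilon> r) = padd (ctensor K ?D ?D) (incl1 K ?D ?D \<circ> \<upsilon>) (incl2 K ?D ?D \<circ> \<upsilon>) r"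
    if r: "r \<in> carrier C" for r
  proof -
    have "\<forall>b\<in>carrier M. \<forall>c\<in>carrier M. \<forall>r\<in>carrier C.
      \<upsilon> r (b \<otimes>\<^bsub>M\<^esub> c) = point_add K C B (\<lambda>r. \<upsilon> r b) (\<lambda>r. \<upsilon> r c) r"
      using u_mult by (simp add: \<upsilon>_def)
    then have "\<forall>r\<in>carrier C. comult ?D (\<upsilon> r) = padd D.W (D.i1 \<circ> \<upsilon>) (D.i2 \<circ> \<upsilon>) r"
      using D.const_group_hom_iff[OF formal_grp_axioms \<upsilon>] by blast
    then show ?thesis using r by (simp add: D.G_ctensor)
  qed
  note \<upsilon>_padd = hom_padd[OF D.G_formal \<upsilon>D \<upsilon>_grp]
  note \<pi>_padd = hom_padd[OF H.formal \<pi>H comult_\<pi>]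
  note v = formal_hom_comp[OF \<upsilon> FT.i1_hom] formal_hom_comp[OF \<pi>H FT.i2_hom]
  define g where "g = padd ?W (?i1 \<circ> \<upsilon>) (?i2 \<circ> \<pi>)"
  have g: "formal_hom K C ?W g" unfolding g_def by (rule padd_hom[OF Wf v])
  interpret g: formal_map K C ?W g by (rule formal_mapI[OF formal Wf g])
  have \<upsilon>c: "\<upsilon> r \<in> carrier ?A" and \<pi>c: "\<pi> r \<in> carrier H" if "r \<in> carrier C" for r
    using formal_hom_closed[OF \<upsilon> that] formal_hom_closed[OF \<pi>H that] by auto
  have ev_g: "FT.ev b (g r) = expansion b r" if b: "b \<in> carrier M" and r: "r \<in> carrier C" for b r
  proof -
    have "FT.ev b (g r) = padd H (FT.ev b \<circ> (?i1 \<circ> \<upsilon>)) (FT.ev b \<circ> (?i2 \<circ> \<pi>)) r"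
      unfolding g_def by (rule padd_natural[OF Wf H.formal v FT.ev_hom[OF b] r])
    also have "padd H (FT.ev b \<circ> (?i1 \<circ> \<upsilon>)) (FT.ev b \<circ> (?i2 \<circ> \<pi>)) = padd H (\<lambda>r. struct_map KX (u b r)) \<pi>"
    proof (rule padd_cong)
      have st: "struct_map H = struct_map KX" using truncate_simps(6)[of H] unfolding trH by simp
      fix r assume r: "r \<in> carrier C"
      show "(FT.ev b \<circ> (?i1 \<circ> \<upsilon>)) r = struct_map KX (u b r)"
        using FT.ev_i1[OF b \<upsilon>c[OF r]] b by (simp add: \<upsilon>_def st)
      show "(FT.ev b \<circ> (?i2 \<circ> \<pi>)) r = \<pi> r" using FT.ev_i2[OF b \<pi>c[OF r]] by simp
    qed
    also have "\<dots> = padd KX (\<lambda>r. struct_map KX (u b r)) \<pi>"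
    proof -
      have "copair K C C H = copair K C C KX"
        by (simp add: copair_def fun_eq_iff formal_hom_cong_target[OF trH'])
      then show ?thesis by (simp add: point_add_def fun_eq_iff)
    qed
    also have "\<dots> r = expansion b r" by (rule expansion_eq[OF b r, symmetric])
    finally show ?thesis .
  qed
  note bij = S.expansion_inject[OF expansion_ring_hom expansion_mem_iff expansion_approx]
    S.expansion_surj[OF expansion_ring_hom expansion_mem_iff expansion_approx]
  have g_inj: "r = r'" if "r \<in> carrier C" "r' \<in> carrier C" "g r = g r'" for r r'
    using bij(1)[of r r'] ev_g that by metis
  have g_surj: "\<exists>r\<in>carrier C. g r = w" if w: "w \<in> carrier ?W" for w
  proof -
    have "FT.ev b w \<in> UNIV \<rightarrow> carrier K" if "b \<in> carrier M" for b
      using formal_hom_closed[OF FT.ev_hom[OF that] w] by (simp add: carH)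
    then obtain r where r: "r \<in> carrier C" "\<forall>b\<in>carrier M. expansion b r = FT.ev b w"
      using bij(2)[of "\<lambda>b. FT.ev b w"] by blast
    have "g r = w" by (rule FT.ev_inject) (use r w ev_g in auto)
    then show ?thesis using r by blast
  qed
  \<comment> \<open>\<open>formal_group_iso\<close> asks for the map from the coordinate ring of the
    product to that of \<open>C\<close>, which is the inverse of \<open>g\<close>.\<close>
  define f where "f w = (THE r. r \<in> carrier C \<and> g r = w)" for w
  have fg: "f (g r) = r" if "r \<in> carrier C" for r
    unfolding f_def using that g_inj by (intro the_equality) auto
  have gf: "g (f w) = w" and fc: "f w \<in> carrier C" if "w \<in> carrier ?W" for w
    using g_surj[OF that] fg by auto
  have f_hom: "formal_hom K ?W C f"
  proof (rule formal_homI[OF Wf formal])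
    show "f \<in> ring_hom ?W C"
    proof (rule ring_hom_memI)
      fix v w assume vw: "v \<in> carrier ?W" "w \<in> carrier ?W"
      show "f (v \<otimes>\<^bsub>?W\<^esub> w) = f v \<otimes>\<^bsub>C\<^esub> f w"
        using fg[of "f v \<otimes>\<^bsub>C\<^esub> f w"] g.hom_mult[of "f v" "f w"] vw gf fc by simp
      show "f (v \<oplus>\<^bsub>?W\<^esub> w) = f v \<oplus>\<^bsub>C\<^esub> f w"
        using fg[of "f v \<oplus>\<^bsub>C\<^esub> f w"] g.hom_add[of "f v" "f w"] vw gf fc by simp
    qed (use fc fg[of "\<one>\<^bsub>C\<^esub>"] g.hom_one in auto)
    show "f (struct_map ?W c) = struct_map C c" if "c \<in> carrier K" for c
      using fg[of "struct_map C c"] g.hom_struct that by simp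
    fix J assume J: "J \<in> open_ideals C"
    \<comment> \<open>So \<open>f w\<close> lies in \<open>J\<close> as soon as all components of
      \<open>w\<close> vanish to order \<open>m\<close>, which is an open condition because
      \<open>M\<close> is finite.\<close>
    obtain m where m: "\<forall>r\<in>carrier C. (\<forall>b\<in>carrier M. r \<in> S.xid b m) \<longrightarrow> r \<in> J" using S.x_small[OF J] by blast
    have xo: "K.xpow_ideal m \<in> open_ideals H"
      using K.xpow_open[of m] open_ideals_truncate[of H] unfolding trH by simp
    have "\<exists>I\<in>open_ideals ?W. \<forall>w\<in>I. \<forall>b\<in>S. FT.ev b w \<in> K.xpow_ideal m" if "finite S" "S \<subseteq> carrier M" for S
      using that
    proof (induction S rule: finite_induct)
      case empty
      then show ?case using FT.W.carrier_open_ideal by blast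
    next
      case (insert b S)
      then obtain I where I: "I \<in> open_ideals ?W" "\<forall>w\<in>I. \<forall>b\<in>S. FT.ev b w \<in> K.xpow_ideal m" by auto
      have b: "b \<in> carrier M" using insert by simp
      interpret e: formal_map K ?W H "FT.ev b" by (rule formal_mapI[OF Wf H.formal FT.ev_hom[OF b]])
      show ?case using I FT.W.Int_open_ideal[OF I(1) e.vimage_open_ideal[OF xo]]
        by (intro bexI[of _ "I \<inter> {w \<in> carrier ?W. FT.ev b w \<in> K.xpow_ideal m}"]) auto
    qed
    from this[OF D.fin_M subset_refl] obtain I where
      I: "I \<in> open_ideals ?W" "\<forall>w\<in>I. \<forall>b\<in>carrier M. FT.ev b w \<in> K.xpow_ideal m" by blast
    have "f w \<in> J" if w: "w \<in> I" for w
    proof -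
      have wc: "w \<in> carrier ?W" using w ideal.Icarr[OF FT.W.open_idealD[OF I(1)]] by blast
      have "f w \<in> S.xid b m" if b: "b \<in> carrier M" for b
      proof -
        have "FT.ev b w \<in> K.xpow_ideal m" using I(2) w b by blast
        then have "expansion b (f w) \<in> K.xpow_ideal m" using ev_g[OF b fc[OF wc]] gf[OF wc] by simp
        then show ?thesis by (rule iffD1[OF expansion_mem_iff[OF b fc[OF wc]]])
      qed
      then show ?thesis using m fc[OF wc] by blast
    qed
    then show "\<exists>I\<in>open_ideals ?W. \<forall>w\<in>I. f w \<in> J" using I(1) by blast
  qed
  have gP: "formal_hom K C ?P g" using g by (simp add: formal_hom_cong_target[OF trP'])
  have comult_g: "comult ?P (g r) = padd (ctensor K ?P ?P) (incl1 K ?P ?P \<circ> g) (incl2 K ?P ?P \<circ> g) r"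
    if r: "r \<in> carrier C" for r
  proof -
    let ?a = "?j1 \<circ> ?i1" and ?b = "?j2 \<circ> ?i1" and ?c = "?j1 \<circ> ?i2" and ?d = "?j2 \<circ> ?i2"
    have h: "formal_hom K ?A ?WW ?a" "formal_hom K ?A ?WW ?b" "formal_hom K H ?WW ?c" "formal_hom K H ?WW ?d"
      by (rule formal_hom_comp[OF FT.i1_hom] formal_hom_comp[OF FT.i2_hom]; rule j)+
    have hD: "formal_hom K ?D ?WW ?a" "formal_hom K ?D ?WW ?b"
      using h(1,2) by (simp_all add: formal_hom_cong_source[OF D.trunc])
    let ?p = "point_add K ?D ?WW ?a ?b" and ?q = "point_add K H ?WW ?c ?d"
    have p: "formal_hom K ?A ?WW ?p" by (rule D.const_padd_hom[OF WWf h(1,2)])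
    have q: "formal_hom K H ?WW ?q" by (rule H.padd_hom[OF WWf h(3,4)])
    have "comult ?P (g r) = padd ?WW (copair K ?A H ?WW ?p ?q \<circ> (?i1 \<circ> \<upsilon>)) (copair K ?A H ?WW ?p ?q \<circ> (?i2 \<circ> \<pi>)) r"
      unfolding comult_P g_def by (rule padd_natural[OF Wf WWf v FT.copair_hom[OF WWf p q] r])
    also have "padd ?WW (copair K ?A H ?WW ?p ?q \<circ> (?i1 \<circ> \<upsilon>)) (copair K ?A H ?WW ?p ?q \<circ> (?i2 \<circ> \<pi>))
        = padd ?WW (padd ?WW (?a \<circ> \<upsilon>) (?b \<circ> \<upsilon>)) (padd ?WW (?c \<circ> \<pi>) (?d \<circ> \<pi>))"
    proof (rule padd_cong)
      fix r assume r: "r \<in> carrier C"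
      show "(copair K ?A H ?WW ?p ?q \<circ> (?i1 \<circ> \<upsilon>)) r = padd ?WW (?a \<circ> \<upsilon>) (?b \<circ> \<upsilon>) r"
        using FT.copair_i1[OF WWf p q \<upsilon>c[OF r]] \<upsilon>_padd[OF _ WWf hD r] by simp
      show "(copair K ?A H ?WW ?p ?q \<circ> (?i2 \<circ> \<pi>)) r = padd ?WW (?c \<circ> \<pi>) (?d \<circ> \<pi>) r"
        using FT.copair_i2[OF WWf p q \<pi>c[OF r]] \<pi>_padd[OF _ WWf h(3,4) r] by simp
    qed
    \<comment> \<open>The identity \<open>(u + u') + (h + h') = (u + h) + (u' + h')\<close>, where
      \<open>u, u'\<close> come from the constant factor and \<open>h, h'\<close> from the component
      of the origin.\<close>
    also have "\<dots> r = padd ?WW (padd ?WW (?a \<circ> \<upsilon>) (?c \<circ> \<pi>)) (padd ?WW (?b \<circ> \<upsilon>) (?d \<circ> \<pi>)) r"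
      by (rule padd_interchange[OF WWf h(1,2)[THEN formal_hom_comp[OF \<upsilon>]] h(3,4)[THEN formal_hom_comp[OF \<pi>H]] r])
    also have "padd ?WW (padd ?WW (?a \<circ> \<upsilon>) (?c \<circ> \<pi>)) (padd ?WW (?b \<circ> \<upsilon>) (?d \<circ> \<pi>)) = padd ?WW (?j1 \<circ> g) (?j2 \<circ> g)"
    proof (rule padd_cong)
      fix r assume r: "r \<in> carrier C"
      show "padd ?WW (?a \<circ> \<upsilon>) (?c \<circ> \<pi>) r = (?j1 \<circ> g) r"
        using padd_natural[OF Wf WWf v j(1) r] by (simp add: g_def comp_assoc)
      show "padd ?WW (?b \<circ> \<upsilon>) (?d \<circ> \<pi>) r = (?j2 \<circ> g) r"
        using padd_natural[OF Wf WWf v j(2) r] by (simp add: g_def comp_assoc)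
    qed
    finally show ?thesis by (simp add: PP)
  qed
  have "formal_group_hom K C ?P f"
    unfolding formal_group_hom_def
  proof (intro conjI ballI)
    show fP: "formal_hom K ?P C f" using f_hom by (simp add: formal_hom_cong_source[OF trP'])
    fix s assume "s \<in> carrier ?P"
    \<comment> \<open>At \<open>g r\<close> the maps \<open>f\<close> and \<open>g\<close> cancel,
      and what remains is the sum of the tautological points of \<open>C\<close>, that is,
      \<open>comult C r\<close>.\<close>
    then obtain r where r: "r \<in> carrier C" "s = g r" using g_surj carP by metis
    note pf = p_hom[THEN formal_hom_comp[OF fP]]
    have "point_add K ?P W2 (incl1 K C C \<circ> f) (incl2 K C C \<circ> f) s
        = padd W2 ((incl1 K C C \<circ> f) \<circ> g) ((incl2 K C C \<circ> f) \<circ> g) r"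
      unfolding r(2) by (rule hom_padd[OF Pf gP comult_g W2_formal pf r(1)])
    also have "padd W2 ((incl1 K C C \<circ> f) \<circ> g) ((incl2 K C C \<circ> f) \<circ> g) = padd W2 (incl1 K C C) (incl2 K C C)"
      by (rule padd_cong) (simp_all add: fg)
    also have "\<dots> r = comult C r"
      unfolding point_add_def by (rule copair_incl1_incl2[OF formal formal comult_closed[OF r(1)]])
    finally have eq: "point_add K ?P W2 (incl1 K C C \<circ> f) (incl2 K C C \<circ> f) s = comult C r" .
    have "f s = r" using r fg by simp
    then show "comult C (f s) = point_add K ?P W2 (incl1 K C C \<circ> f) (incl2 K C C \<circ> f) s"
      by (simp only: eq)
  qed
  moreover have "homeomorphic_map (topol ?P) (topol C) f"
    unfolding homeomorphic_map_maps homeomorphic_maps_def topP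
  proof (intro exI[of _ g] conjI ballI)
    show "continuous_map (topol ?W) (topol C) f" "continuous_map (topol C) (topol ?W) g"
      using f_hom g by (simp_all add: formal_hom_def)
  qed (auto simp: topspace FT.W_topspace fg gf)
  moreover have "first_factor K ?D H w = (\<lambda>b\<in>carrier M. u b (f w))" if w: "w \<in> carrier ?P" for w
  proof -
    obtain r where r: "r \<in> carrier C" "w = g r" using g_surj w carP by metis
    note Df = D.G_formal
    interpret Dfa: formal_alg K ?D by unfold_locales (rule Df)
    have id: "formal_hom K ?A ?D (\<lambda>r. r)"
      using formal_hom_id[of K ?A] by (simp add: formal_hom_cong_target[OF D.trunc])
    have zH: "formal_hom K H ?D (point_zero H ?D)" by (rule H.pzero_hom[OF Df])
    have z\<pi>: "point_zero H ?D (\<pi> r) = point_zero C ?D r" if "r \<in> carrier C" for r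
      by (simp add: point_zero_def counit_\<pi>[OF that])
    \<comment> \<open>Restriction to the zero of the second factor, where the product map becomes
      \<open>u_b + 0 = u_b\<close>.\<close>
    let ?t = "copair K ?A H ?D (\<lambda>r. r) (point_zero H ?D)"
    have "first_factor K ?D H w = ?t (g r)" unfolding first_factor_def r(2) by (simp add: DH)
    also have "\<dots> = padd ?D (?t \<circ> (?i1 \<circ> \<upsilon>)) (?t \<circ> (?i2 \<circ> \<pi>)) r"
      unfolding g_def by (rule padd_natural[OF Wf Df v FT.copair_hom[OF Df id zH] r(1)])
    also have "padd ?D (?t \<circ> (?i1 \<circ> \<upsilon>)) (?t \<circ> (?i2 \<circ> \<pi>)) = padd ?D \<upsilon> (point_zero C ?D)"
      by (rule padd_cong)
        (simp_all add: FT.copair_i1[OF Df id zH \<upsilon>c] FT.copair_i2[OF Df id zH \<pi>c] z\<pi>)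
    also have "\<dots> r = \<upsilon> r"
      using padd_comm[OF Df \<upsilon>D pzero_hom[OF Df] r(1)] padd_zero[OF Df \<upsilon>D r(1)] by simp
    finally show ?thesis using r fg by (simp add: \<upsilon>_def)
  qed
  ultimately show ?thesis using fc carP by (intro exI[of _ f]) (simp add: formal_group_iso_def)
qed

end

section \<open>Equivariant formal groups over a field\<close>

context cring
begin

lemma ideal_prod_PIdl:
  assumes a: "a \<in> carrier R" and b: "b \<in> carrier R"
  shows "ideal_prod R (PIdl a) (PIdl b) = PIdl (a \<otimes> b)"
proof
  show "ideal_prod R (PIdl a) (PIdl b) \<subseteq> PIdl (a \<otimes> b)"
  proof
    fix s assume "s \<in> ideal_prod R (PIdl a) (PIdl b)"
    then show "s \<in> PIdl (a \<otimes> b)"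
    proof induction
      case (prod i j)
      obtain s where s: "s \<in> carrier R" "i = a \<otimes> s" using prod(1) unfolding PIdl_iff[OF a] by (rule bexE)
      obtain t where t: "t \<in> carrier R" "j = b \<otimes> t" using prod(2) unfolding PIdl_iff[OF b] by (rule bexE)
      have "i \<otimes> j = a \<otimes> b \<otimes> (s \<otimes> t)" using a b s t by (simp add: m_ac)
      then show ?case unfolding PIdl_iff[OF m_closed[OF a b]] using s(1) t(1) m_closed[of s t] by (rule_tac bexI[of _ "s \<otimes> t"])
    next
      case (sum s t)
      then show ?case
        using additive_subgroup.a_closed[OF ideal.axioms(1)[OF cgenideal_ideal[of "a \<otimes> b"]]] a b by simp
    qed
  qed
  show "PIdl (a \<otimes> b) \<subseteq> ideal_prod R (PIdl a) (PIdl b)"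
    using a b ideal_prod.prod[OF cgenideal_self[OF a] cgenideal_self[OF b], of R]
    by (intro cgenideal_minimal ideal_prod_is_ideal cgenideal_ideal)
qed

lemma PIdl_one: "PIdl \<one> = carrier R"
  by (auto simp: cgenideal_def intro: r_one[symmetric])

lemma finprod_PIdl:
  assumes "finite S" "\<And>a. a \<in> S \<Longrightarrow> z a \<in> carrier R"
  shows "(\<Otimes>\<^bsub>ideals_set R\<^esub>a\<in>S. PIdl (z a)) = PIdl (\<Otimes>a\<in>S. z a)"
  using assms
proof (induction S rule: finite_induct)
  interpret I: Group.comm_monoid "ideals_set R" by (rule ideals_set_is_comm_monoid)
  {
    case empty
    show ?case unfolding I.finprod_empty finprod_empty PIdl_one by (simp add: ideals_set_def)
  next
    case (insert a S)
    have "(\<lambda>a. PIdl (z a)) \<in> insert a S \<rightarrow> carrier (ideals_set R)"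
      using insert.prems cgenideal_ideal by (auto simp: ideals_set_def)
    then have "(\<Otimes>\<^bsub>ideals_set R\<^esub>a\<in>insert a S. PIdl (z a))
        = PIdl (z a) \<otimes>\<^bsub>ideals_set R\<^esub> (\<Otimes>\<^bsub>ideals_set R\<^esub>a\<in>S. PIdl (z a))"
      using insert.hyps by (intro I.finprod_insert) auto
    also have "\<dots> = ideal_prod R (PIdl (z a)) (PIdl (\<Otimes>a\<in>S. z a))"
      using insert.IH insert.prems by (simp add: ideals_set_def)
    also have "\<dots> = PIdl (\<Otimes>a\<in>insert a S. z a)"
    proof -
      have "z a \<in> carrier R" "(\<Otimes>a\<in>S. z a) \<in> carrier R" using insert.prems by (auto intro!: finprod_closed)
      moreover have "(\<Otimes>a\<in>insert a S. z a) = z a \<otimes> (\<Otimes>a\<in>S. z a)"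
        using insert.hyps insert.prems by (intro finprod_insert) auto
      ultimately show ?thesis by (simp only: ideal_prod_PIdl)
    qed
    finally show ?case .
  }
qed

lemma pow_PIdl:
  assumes "z \<in> carrier R"
  shows "PIdl z [^]\<^bsub>ideals_set R\<^esub> (m::nat) = PIdl (z [^] m)"
proof (induction m)
  case 0
  show ?case using PIdl_one by (simp add: ideals_set_def nat_pow_def)
next
  case (Suc m)
  have "PIdl z [^]\<^bsub>ideals_set R\<^esub> Suc m = PIdl z [^]\<^bsub>ideals_set R\<^esub> m \<otimes>\<^bsub>ideals_set R\<^esub> PIdl z"
    by (simp add: nat_pow_def)
  also have "\<dots> = ideal_prod R (PIdl (z [^] m)) (PIdl z)" unfolding Suc by (simp add: ideals_set_def)
  also have "\<dots> = PIdl (z [^] Suc m)" using assms by (simp add: ideal_prod_PIdl)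
  finally show ?case .
qed

text \<open>From \<open>z t = 0\<close> one gets \<open>y^k t = 0\<close>, and the factors
  \<open>y\<close> are cancelled one by one. A multicurve provides a regular \<open>y\<close> only;
  this passes regularity on to the equations of the sections.\<close>

lemma regular_dvd_pow:
  assumes y: "regular_element R y" and yk: "y [^] (k::nat) = z \<otimes> b" and c: "b \<in> carrier R" "z \<in> carrier R"
    and t: "t \<in> carrier R" "z \<otimes> t = \<zero>"
  shows "t = \<zero>"
proof -
  have yc: "y \<in> carrier R" and reg: "\<And>b. b \<in> carrier R \<Longrightarrow> y \<otimes> b = \<zero> \<Longrightarrow> b = \<zero>"
    using y unfolding regular_element_def by blast+
  have "y [^] n \<otimes> t = \<zero> \<Longrightarrow> t = \<zero>" for n :: nat
  proof (induction n)
    case (Suc n)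
    have "y \<otimes> (y [^] n \<otimes> t) = y [^] Suc n \<otimes> t"
      using yc t(1) nat_pow_Suc[of y n] m_comm[of y "y [^] n"] by (simp add: m_assoc[symmetric])
    then have "y \<otimes> (y [^] n \<otimes> t) = \<zero>" using Suc.prems by (rule trans)
    moreover have "y [^] n \<otimes> t \<in> carrier R" using yc t(1) by simp
    ultimately show ?case using reg Suc.IH by blast
  qed (use t in simp)
  moreover have "y [^] k \<otimes> t = b \<otimes> (z \<otimes> t)" unfolding yk using c t by (simp add: m_ac)
  then have "y [^] k \<otimes> t = \<zero>" using t c by simp
  ultimately show ?thesis by blast
qed

end

theorem corollary8p3:
  fixes A :: "('a, 'd) monoid_scheme"
    and K :: "('k, 'c) ring_scheme"
    and C :: "('k, 'r, 'm) formal_group_scheme"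
    and \<phi> :: "'r \<Rightarrow> ('a \<Rightarrow> rat set) \<Rightarrow> 'k"
  assumes "comm_group A" and "finite (carrier A)"
    and "field K"
    and "equivariant_formal_group K A C \<phi>"
  shows "product_type K A C \<phi>"
proof -
  interpret A: comm_group A by fact
  interpret K: field K by fact
  let ?\<Gamma> = "dual_group A" and ?B = "base_algebra K"
  have \<Gamma>: "comm_group ?\<Gamma>" by (rule dual_comm_group[OF A.group_axioms])
  interpret \<Gamma>: comm_group ?\<Gamma> by (rule \<Gamma>)
  have fin\<Gamma>: "finite (carrier ?\<Gamma>)" using finite_characters[OF A.group_axioms assms(2)] by (simp add: dual_simps)
  have curve: "formal_multicurve K C" and grp: "comm_formal_group K C"
    and \<phi>: "formal_group_hom K (const_group K ?\<Gamma>) C \<phi>"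
    and lim: "is_limit_of_quotients C (\<lambda>m. euler_ideal K A C \<phi> [^]\<^bsub>ideals_set C\<^esub> (m::nat))"
    using assms(4) by (auto simp: equivariant_formal_group_def formal_multicurve_group_def)
  interpret C: formal_grp K C by (rule formal_grp.intro) (rule grp)
  note Bf = base_formal(1)[OF K.cring_axioms]
  let ?add = "point_add K C ?B"
  have G\<Gamma>: "const_grp K ?\<Gamma>" using K.cring_axioms \<Gamma> fin\<Gamma> by unfold_locales
  let ?A = "fun_algebra K (carrier ?\<Gamma>)"
  have \<phi>A: "formal_hom K C ?A \<phi>"
    using \<phi> iffD1[OF formal_hom_cong_target[OF const_grp.trunc[OF G\<Gamma>]], of K C \<phi>]
    unfolding formal_group_hom_def by blast
  have \<phi>_mult: "\<phi> r (\<alpha> \<otimes>\<^bsub>?\<Gamma>\<^esub> \<beta>) = ?add (\<lambda>r. \<phi> r \<alpha>) (\<lambda>r. \<phi> r \<beta>) r"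
    if "\<alpha> \<in> carrier ?\<Gamma>" "\<beta> \<in> carrier ?\<Gamma>" "r \<in> carrier C" for \<alpha> \<beta> r
    using const_grp.const_group_hom_iff[OF G\<Gamma> C.formal_grp_axioms \<phi>A] \<phi> that
    by (simp add: formal_group_hom_def const_grp.G_ctensor[OF G\<Gamma>])
  have \<phi>_hom: "formal_hom K C ?B (\<lambda>r. \<phi> r \<alpha>)" if "\<alpha> \<in> carrier ?\<Gamma>" for \<alpha>
    using formal_hom_comp[OF \<phi>A K.eval_hom[OF that]] by (simp add: comp_def)
  have zero: "point_zero C ?B = counit C" by (simp add: point_zero_def)
  have \<phi>_one: "\<phi> r \<one>\<^bsub>?\<Gamma>\<^esub> = counit C r" if "r \<in> carrier C" for r
    using C.idempotent_point[OF Bf \<phi>_hom[OF \<Gamma>.one_closed] _ that] \<phi>_mult[OF \<Gamma>.one_closed \<Gamma>.one_closed]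
    by (simp add: zero)
  have add_zero: "?add (counit C) f r = f r" if "formal_hom K C ?B f" "r \<in> carrier C" for f r
    using C.padd_zero[OF Bf that] by (simp add: zero)
  have add_zero': "?add f (counit C) r = f r" if "formal_hom K C ?B f" "r \<in> carrier C" for f r
    using C.padd_comm[OF Bf that(1) C.counit_hom that(2)] add_zero[OF that] by simp
  define N where "N = {\<alpha> \<in> carrier ?\<Gamma>. \<forall>r\<in>carrier C. \<phi> r \<alpha> = counit C r}"
  have N_mult: "\<phi> r (\<alpha> \<otimes>\<^bsub>?\<Gamma>\<^esub> \<beta>) = \<phi> r \<beta>" if "\<alpha> \<in> N" "\<beta> \<in> carrier ?\<Gamma>" "r \<in> carrier C" for \<alpha> \<beta> r
  proof -
    have "?add (\<lambda>r. \<phi> r \<alpha>) (\<lambda>r. \<phi> r \<beta>) = ?add (counit C) (\<lambda>r. \<phi> r \<beta>)"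
      using that by (intro C.padd_cong) (auto simp: N_def)
    then show ?thesis using that \<phi>_mult[of \<alpha> \<beta> r] add_zero[OF \<phi>_hom[OF that(2)] that(3)] by (simp add: N_def)
  qed
  have N: "subgroup N ?\<Gamma>"
  proof (rule \<Gamma>.subgroupI)
    show "N \<noteq> {}" using \<phi>_one by (auto simp: N_def)
    fix \<alpha> assume \<alpha>: "\<alpha> \<in> N"
    then have \<alpha>c: "\<alpha> \<in> carrier ?\<Gamma>" by (simp add: N_def)
    have "\<phi> r (inv\<^bsub>?\<Gamma>\<^esub> \<alpha>) = counit C r" if "r \<in> carrier C" for r
      using N_mult[OF \<alpha> \<Gamma>.inv_closed[OF \<alpha>c] that] \<phi>_one[OF that] \<alpha>c by simp
    then show "inv\<^bsub>?\<Gamma>\<^esub> \<alpha> \<in> N" using \<alpha>c by (simp add: N_def)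
    fix \<beta> assume "\<beta> \<in> N"
    then show "\<alpha> \<otimes>\<^bsub>?\<Gamma>\<^esub> \<beta> \<in> N" using N_mult[OF \<alpha>] \<alpha>c by (simp add: N_def)
  qed (auto simp: N_def)
  define H where "H = {a \<in> carrier A. \<forall>\<alpha>\<in>N. \<alpha> a = \<one>\<^bsub>rat_mod_int\<^esub>}"
  have HA: "subgroup H A" and dual: "{\<alpha> \<in> carrier ?\<Gamma>. \<forall>b\<in>H. \<alpha> b = \<one>\<^bsub>rat_mod_int\<^esub>} = N"
    unfolding H_def using annihilator_duality[OF assms(1,2) N] by auto
  let ?AH = "A\<lparr>carrier := H\<rparr>"
  let ?M = "dual_group ?AH"
  interpret AH: group ?AH by (rule A.subgroup_imp_group[OF HA])
  have HA': "H \<subseteq> carrier A" by (rule subgroup.subset[OF HA])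
  have AH_carrier: "carrier ?AH = H" by simp
  have M: "comm_group ?M" by (rule dual_comm_group[OF AH.group_axioms])
  have finM: "finite (carrier ?M)"
    using finite_characters[OF AH.group_axioms] finite_subset[OF HA' assms(2)] by (simp add: dual_simps)
  interpret M: comm_group ?M by (rule M)
  define \<rho> where "\<rho> \<alpha> = restrict \<alpha> H" for \<alpha> :: "'a \<Rightarrow> rat set"
  have \<rho>_closed: "\<rho> \<alpha> \<in> carrier ?M" if "\<alpha> \<in> carrier ?\<Gamma>" for \<alpha>
    using that HA' subgroup.m_closed[OF HA] by (auto simp: dual_simps \<rho>_def hom_def subset_eq)
  have \<rho>_mult: "\<rho> (\<alpha> \<otimes>\<^bsub>?\<Gamma>\<^esub> \<beta>) = \<rho> \<alpha> \<otimes>\<^bsub>?M\<^esub> \<rho> \<beta>" for \<alpha> \<beta>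
    using HA' by (auto simp: dual_simps \<rho>_def fun_eq_iff)
  have \<rho>_surj: "\<exists>\<alpha>\<in>carrier ?\<Gamma>. \<rho> \<alpha> = \<beta>" if \<beta>: "\<beta> \<in> carrier ?M" for \<beta>
  proof -
    obtain \<alpha> where \<alpha>: "\<alpha> \<in> hom A rat_mod_int" "\<forall>h\<in>H. \<alpha> h = \<beta> h"
      using extend_character[OF assms(1,2) HA, of \<beta>] \<beta> by (auto simp: dual_simps)
    have "restrict \<alpha> (carrier A) \<in> carrier ?\<Gamma>" using \<alpha> by (auto simp: dual_simps hom_def)
    moreover have "\<rho> (restrict \<alpha> (carrier A)) = \<beta>"
      using \<alpha> \<beta> HA' by (auto simp: \<rho>_def dual_simps fun_eq_iff extensional_def)
    ultimately show ?thesis by blast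
  qed
  \<comment> \<open>By duality the kernel of restriction to \<open>H\<close> is exactly
    \<open>N\<close>. Hence sections can be indexed by characters of \<open>H\<close>, and distinct
    characters give distinct sections.\<close>
  have \<rho>_one: "\<rho> \<alpha> = \<one>\<^bsub>?M\<^esub> \<longleftrightarrow> \<alpha> \<in> N" if "\<alpha> \<in> carrier ?\<Gamma>" for \<alpha>
  proof -
    have "\<rho> \<alpha> = \<one>\<^bsub>?M\<^esub> \<longleftrightarrow> (\<forall>b\<in>H. \<alpha> b = \<one>\<^bsub>rat_mod_int\<^esub>)"
    proof
      assume "\<rho> \<alpha> = \<one>\<^bsub>?M\<^esub>"
      then have "restrict \<alpha> H b = (\<lambda>a\<in>H. \<one>\<^bsub>rat_mod_int\<^esub>) b" for b by (simp only: \<rho>_def dual_simps AH_carrier)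
      then show "\<forall>b\<in>H. \<alpha> b = \<one>\<^bsub>rat_mod_int\<^esub>" by (metis restrict_apply')
    next
      assume "\<forall>b\<in>H. \<alpha> b = \<one>\<^bsub>rat_mod_int\<^esub>"
      then have "restrict \<alpha> H = (\<lambda>a\<in>H. \<one>\<^bsub>rat_mod_int\<^esub>)" by (intro restrict_ext) blast
      then show "\<rho> \<alpha> = \<one>\<^bsub>?M\<^esub>" by (simp only: \<rho>_def dual_simps AH_carrier)
    qed
    then show ?thesis using dual that by blast
  qed
  have \<rho>_hom: "group_hom ?\<Gamma> ?M \<rho>"
    using \<rho>_closed \<rho>_mult by unfold_locales (auto simp: hom_def)
  have \<rho>_eq: "\<rho> \<alpha> = \<rho> \<beta> \<longleftrightarrow> (\<forall>r\<in>carrier C. \<phi> r \<alpha> = \<phi> r \<beta>)"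
    if \<alpha>: "\<alpha> \<in> carrier ?\<Gamma>" and \<beta>: "\<beta> \<in> carrier ?\<Gamma>" for \<alpha> \<beta>
  proof -
    interpret \<rho>: group_hom ?\<Gamma> ?M \<rho> by (rule \<rho>_hom)
    let ?q = "\<alpha> \<otimes>\<^bsub>?\<Gamma>\<^esub> inv\<^bsub>?\<Gamma>\<^esub> \<beta>"
    have q: "?q \<in> carrier ?\<Gamma>" "?q \<otimes>\<^bsub>?\<Gamma>\<^esub> \<beta> = \<alpha>" using \<alpha> \<beta> by (simp_all add: \<Gamma>.m_assoc)
    have "\<rho> \<alpha> = \<rho> \<beta> \<longleftrightarrow> \<rho> ?q = \<one>\<^bsub>?M\<^esub>"
    proof -
      note c = \<rho>_closed[OF \<alpha>] \<rho>_closed[OF \<beta>]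
      have "\<rho> ?q = \<rho> \<alpha> \<otimes>\<^bsub>?M\<^esub> inv\<^bsub>?M\<^esub> \<rho> \<beta>" unfolding \<rho>_mult \<rho>.hom_inv[OF \<beta>] ..
      then show ?thesis
        using M.inv_solve_right[OF M.one_closed c] M.l_one[OF c(2)] by metis
    qed
    also have "\<dots> \<longleftrightarrow> ?q \<in> N" by (rule \<rho>_one[OF q(1)])
    also have "\<dots> \<longleftrightarrow> (\<forall>r\<in>carrier C. \<phi> r \<alpha> = \<phi> r \<beta>)"
    proof
      assume "?q \<in> N"
      then show "\<forall>r\<in>carrier C. \<phi> r \<alpha> = \<phi> r \<beta>" using N_mult[OF _ \<beta>] q(2) by metis
    next
      assume eq: "\<forall>r\<in>carrier C. \<phi> r \<alpha> = \<phi> r \<beta>"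
      have "\<phi> r ?q = counit C r" if r: "r \<in> carrier C" for r
      proof -
        have "\<phi> r ?q = ?add (\<lambda>r. \<phi> r \<alpha>) (\<lambda>r. \<phi> r (inv\<^bsub>?\<Gamma>\<^esub> \<beta>)) r"
          by (rule \<phi>_mult[OF \<alpha> \<Gamma>.inv_closed[OF \<beta>] r])
        also have "?add (\<lambda>r. \<phi> r \<alpha>) (\<lambda>r. \<phi> r (inv\<^bsub>?\<Gamma>\<^esub> \<beta>)) = ?add (\<lambda>r. \<phi> r \<beta>) (\<lambda>r. \<phi> r (inv\<^bsub>?\<Gamma>\<^esub> \<beta>))"
          by (rule C.padd_cong) (use eq in auto)
        also have "\<dots> r = \<phi> r (\<beta> \<otimes>\<^bsub>?\<Gamma>\<^esub> inv\<^bsub>?\<Gamma>\<^esub> \<beta>)" by (rule \<phi>_mult[OF \<beta> \<Gamma>.inv_closed[OF \<beta>] r, symmetric])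
        finally show ?thesis using \<phi>_one[OF r] \<beta> by simp
      qed
      then show "?q \<in> N" using q(1) by (simp add: N_def)
    qed
    finally show ?thesis .
  qed
  \<comment> \<open>An arbitrary extension of \<open>\<beta>\<close> to \<open>A\<close>; by
    \<open>\<rho>_eq\<close> the section \<open>u \<beta>\<close> does not depend on it.\<close>
  define lift where "lift \<beta> = (SOME \<alpha>. \<alpha> \<in> carrier ?\<Gamma> \<and> \<rho> \<alpha> = \<beta>)" for \<beta>
  have lift: "lift \<beta> \<in> carrier ?\<Gamma>" "\<rho> (lift \<beta>) = \<beta>" if "\<beta> \<in> carrier ?M" for \<beta>
    unfolding lift_def using someI_ex[of "\<lambda>\<alpha>. \<alpha> \<in> carrier ?\<Gamma> \<and> \<rho> \<alpha> = \<beta>"] \<rho>_surj[OF that] by blast+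
  define u where "u \<beta> r = \<phi> r (lift \<beta>)" for \<beta> r
  have u_\<rho>: "u (\<rho> \<alpha>) r = \<phi> r \<alpha>" if "\<alpha> \<in> carrier ?\<Gamma>" "r \<in> carrier C" for \<alpha> r
    using \<rho>_eq[OF lift(1)[OF \<rho>_closed[OF that(1)]] that(1)] lift(2)[OF \<rho>_closed[OF that(1)]] that(2)
    by (simp add: u_def)
  have u_hom: "formal_hom K C ?B (u \<beta>)" if "\<beta> \<in> carrier ?M" for \<beta>
    using \<phi>_hom[OF lift(1)[OF that]] by (simp add: u_def[abs_def])
  have u_one: "u \<one>\<^bsub>?M\<^esub> r = counit C r" if "r \<in> carrier C" for r
    using u_\<rho>[OF \<Gamma>.one_closed that] \<phi>_one[OF that] group_hom.hom_one[OF \<rho>_hom] by simp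
  have u_mult: "u (\<beta> \<otimes>\<^bsub>?M\<^esub> \<gamma>) r = ?add (u \<beta>) (u \<gamma>) r"
    if \<beta>: "\<beta> \<in> carrier ?M" and \<gamma>: "\<gamma> \<in> carrier ?M" and r: "r \<in> carrier C" for \<beta> \<gamma> r
  proof -
    have "\<beta> \<otimes>\<^bsub>?M\<^esub> \<gamma> = \<rho> (lift \<beta> \<otimes>\<^bsub>?\<Gamma>\<^esub> lift \<gamma>)" using lift[OF \<beta>] lift[OF \<gamma>] by (simp add: \<rho>_mult)
    then have "u (\<beta> \<otimes>\<^bsub>?M\<^esub> \<gamma>) r = \<phi> r (lift \<beta> \<otimes>\<^bsub>?\<Gamma>\<^esub> lift \<gamma>)"
      using u_\<rho>[OF \<Gamma>.m_closed[OF lift(1)[OF \<beta>] lift(1)[OF \<gamma>]] r] by simp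
    also have "\<dots> = ?add (u \<beta>) (u \<gamma>) r"
      unfolding u_def[abs_def] by (rule \<phi>_mult[OF lift(1)[OF \<beta>] lift(1)[OF \<gamma>] r])
    finally show ?thesis .
  qed
  have u_distinct: "\<exists>r\<in>carrier C. u \<beta> r \<noteq> u \<gamma> r"
    if "\<beta> \<in> carrier ?M" "\<gamma> \<in> carrier ?M" "\<beta> \<noteq> \<gamma>" for \<beta> \<gamma>
    using \<rho>_eq[OF lift(1)[OF that(1)] lift(1)[OF that(2)]] lift(2)[OF that(1)] lift(2)[OF that(2)] that(3)
    by (auto simp: u_def)
  have "\<forall>\<beta>\<in>carrier ?M. \<exists>x\<in>carrier C. \<forall>r\<in>carrier C. u \<beta> r = \<zero>\<^bsub>K\<^esub> \<longleftrightarrow> (\<exists>t\<in>carrier C. r = x \<otimes>\<^bsub>C\<^esub> t)"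
    using curve section_ideal_principal[OF C.formal _ u_hom] by (simp add: formal_multicurve_def)
  then obtain x where x: "\<And>\<beta>. \<beta> \<in> carrier ?M \<Longrightarrow> x \<beta> \<in> carrier C"
    "\<And>\<beta> r. \<beta> \<in> carrier ?M \<Longrightarrow> r \<in> carrier C \<Longrightarrow> u \<beta> r = \<zero>\<^bsub>K\<^esub> \<longleftrightarrow> (\<exists>t\<in>carrier C. r = x \<beta> \<otimes>\<^bsub>C\<^esub> t)"
    by metis
  \<comment> \<open>The product runs over the characters of \<open>A\<close>, not of
    \<open>H\<close>, because the given divisor counts each section once for every
    \<open>\<alpha>\<close> restricting to it.\<close>
  define z where "z = (\<Otimes>\<^bsub>C\<^esub>\<alpha>\<in>carrier ?\<Gamma>. x (\<rho> \<alpha>))"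
  have z: "z \<in> carrier C" unfolding z_def using x(1) \<rho>_closed by (intro C.finprod_closed) auto
  have "section_ideal K C (\<lambda>r. \<phi> r \<alpha>) = PIdl\<^bsub>C\<^esub> (x (\<rho> \<alpha>))" if \<alpha>: "\<alpha> \<in> carrier ?\<Gamma>" for \<alpha>
  proof (intro equalityI subsetI)
    note xc = x(1)[OF \<rho>_closed[OF \<alpha>]]
    fix r assume "r \<in> section_ideal K C (\<lambda>r. \<phi> r \<alpha>)"
    then have "r \<in> carrier C" "\<phi> r \<alpha> = \<zero>\<^bsub>K\<^esub>" by (simp_all add: section_ideal_def a_kernel_def')
    then show "r \<in> PIdl\<^bsub>C\<^esub> (x (\<rho> \<alpha>))"
      unfolding C.PIdl_iff[OF xc] x(2)[OF \<rho>_closed[OF \<alpha>] \<open>r \<in> carrier C\<close>, symmetric] by (simp add: u_\<rho>[OF \<alpha>])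
  next
    note xc = x(1)[OF \<rho>_closed[OF \<alpha>]]
    fix r assume r: "r \<in> PIdl\<^bsub>C\<^esub> (x (\<rho> \<alpha>))"
    then have rc: "r \<in> carrier C" unfolding C.PIdl_iff[OF xc] using C.m_closed[OF xc] by blast
    have "u (\<rho> \<alpha>) r = \<zero>\<^bsub>K\<^esub>"
      using r unfolding C.PIdl_iff[OF xc] x(2)[OF \<rho>_closed[OF \<alpha>] rc] .
    then show "r \<in> section_ideal K C (\<lambda>r. \<phi> r \<alpha>)"
      using rc by (simp add: section_ideal_def a_kernel_def' u_\<rho>[OF \<alpha>])
  qed
  then have "euler_ideal K A C \<phi> = (\<Otimes>\<^bsub>ideals_set C\<^esub>\<alpha>\<in>carrier ?\<Gamma>. PIdl\<^bsub>C\<^esub> (x (\<rho> \<alpha>)))"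
    unfolding euler_ideal_def
    by (intro comm_monoid.finprod_cong'[OF C.ideals_set_is_comm_monoid])
      (use C.cgenideal_ideal x(1) \<rho>_closed in \<open>auto simp: ideals_set_def\<close>)
  also have "\<dots> = PIdl\<^bsub>C\<^esub> z" unfolding z_def using x(1) \<rho>_closed by (intro C.finprod_PIdl[OF fin\<Gamma>]) auto
  finally have lim_z: "is_limit_of_quotients C (\<lambda>m. PIdl\<^bsub>C\<^esub> (z [^]\<^bsub>C\<^esub> (m::nat)))"
    using lim by (simp add: C.pow_PIdl[OF z])
  obtain y where y: "regular_element C y" "is_limit_of_quotients C (\<lambda>m. PIdl\<^bsub>C\<^esub> (y [^]\<^bsub>C\<^esub> (m::nat)))"
    using curve by (auto simp: formal_multicurve_def)
  have yc: "y \<in> carrier C" using y(1) by (simp add: regular_element_def)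
  have "openin (topol C) (PIdl\<^bsub>C\<^esub> (z [^]\<^bsub>C\<^esub> (1::nat)))"
    using lim_z unfolding is_limit_of_quotients_def by (elim conjE allE)
  then have "openin (topol C) (PIdl\<^bsub>C\<^esub> z)" "\<zero>\<^bsub>C\<^esub> \<in> PIdl\<^bsub>C\<^esub> z"
    using z additive_subgroup.zero_closed[OF ideal.axioms(1)[OF C.cgenideal_ideal[OF z]]] by simp_all
  \<comment> \<open>The ideal of \<open>z\<close> is open and the powers of \<open>y\<close>
    generate arbitrarily small ideals, so \<open>z\<close> divides a power of
    \<open>y\<close>.\<close>
  then have "\<exists>k::nat. PIdl\<^bsub>C\<^esub> (y [^]\<^bsub>C\<^esub> k) \<subseteq> PIdl\<^bsub>C\<^esub> z"
  proof -
    assume o: "openin (topol C) (PIdl\<^bsub>C\<^esub> z)" "\<zero>\<^bsub>C\<^esub> \<in> PIdl\<^bsub>C\<^esub> z"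
    have "\<forall>U. openin (topol C) U \<and> \<zero>\<^bsub>C\<^esub> \<in> U \<longrightarrow> (\<exists>m::nat. PIdl\<^bsub>C\<^esub> (y [^]\<^bsub>C\<^esub> m) \<subseteq> U)"
      using y(2) unfolding is_limit_of_quotients_def by (elim conjE)
    then show ?thesis using o by (elim allE[of _ "PIdl\<^bsub>C\<^esub> z"]) simp
  qed
  then obtain k :: nat where "PIdl\<^bsub>C\<^esub> (y [^]\<^bsub>C\<^esub> k) \<subseteq> PIdl\<^bsub>C\<^esub> z" by (rule exE)
  then have "y [^]\<^bsub>C\<^esub> k \<in> PIdl\<^bsub>C\<^esub> z" using C.cgenideal_self[of "y [^]\<^bsub>C\<^esub> k"] yc by auto
  then obtain s where s: "s \<in> carrier C" "y [^]\<^bsub>C\<^esub> k = z \<otimes>\<^bsub>C\<^esub> s" using C.PIdl_iff[OF z] by blast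
  have x_regular: "t = \<zero>\<^bsub>C\<^esub>" if \<beta>: "\<beta> \<in> carrier ?M" and t: "t \<in> carrier C" "x \<beta> \<otimes>\<^bsub>C\<^esub> t = \<zero>\<^bsub>C\<^esub>" for \<beta> t
  proof -
    \<comment> \<open>The factor of \<open>z\<close> with index \<open>lift \<beta>\<close> is
      \<open>x \<beta>\<close>, so an element killed by \<open>x \<beta>\<close> is killed by
      \<open>z\<close>.\<close>
    let ?q = "\<Otimes>\<^bsub>C\<^esub>\<alpha>\<in>carrier ?\<Gamma> - {lift \<beta>}. x (\<rho> \<alpha>)"
    have q: "?q \<in> carrier C" using x(1) \<rho>_closed by (intro C.finprod_closed) auto
    have "z = (\<Otimes>\<^bsub>C\<^esub>\<alpha>\<in>insert (lift \<beta>) (carrier ?\<Gamma> - {lift \<beta>}). x (\<rho> \<alpha>))"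
      unfolding z_def using lift(1)[OF \<beta>] by (simp add: insert_absorb)
    also have "\<dots> = x \<beta> \<otimes>\<^bsub>C\<^esub> ?q"
      using x(1) \<rho>_closed lift(2)[OF \<beta>] x(1)[OF \<beta>] fin\<Gamma> by (subst C.finprod_insert) auto
    finally have "z \<otimes>\<^bsub>C\<^esub> t = ?q \<otimes>\<^bsub>C\<^esub> (x \<beta> \<otimes>\<^bsub>C\<^esub> t)" using q x(1)[OF \<beta>] t(1) by (simp add: C.m_ac)
    then have "z \<otimes>\<^bsub>C\<^esub> t = \<zero>\<^bsub>C\<^esub>" using t(2) q by simp
    then show ?thesis by (rule C.regular_dvd_pow[OF y(1) s(2,1) z t(1)])
  qed
  have pre: "pre_sections K C (carrier ?M) u x"
    using assms(3) finM u_hom x x_regular u_distinct by unfold_locales auto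
  have \<rho>_image: "\<rho> ` carrier ?\<Gamma> = carrier ?M" using \<rho>_closed \<rho>_surj by blast
  have "sections K C (carrier ?M) u x"
    by (rule pre_sections.sectionsI[OF pre fin\<Gamma> _ \<rho>_image])
      (use lim_z \<Gamma>.one_closed in \<open>auto simp: z_def\<close>)
  moreover have GM: "const_grp K ?M" using K.cring_axioms M finM by unfold_locales
  ultimately have split: "split_group K C ?M u x"
    using grp u_one u_mult by (simp add: split_group_def split_group_axioms_def formal_grp_def)
  obtain G where G: "ordinary_formal_group K G"
    "\<And>r. r \<in> carrier C \<Longrightarrow> comult G (sections.taylor C u x \<one>\<^bsub>?M\<^esub> r) = point_add K C (ctensor K G G)
      (incl1 K G G \<circ> sections.taylor C u x \<one>\<^bsub>?M\<^esub>) (incl2 K G G \<circ> sections.taylor C u x \<one>\<^bsub>?M\<^esub>) r"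
    "\<And>r. r \<in> carrier C \<Longrightarrow> counit G (sections.taylor C u x \<one>\<^bsub>?M\<^esub> r) = counit C r"
    using split_group.connected_component[OF split] by blast
  let ?D = "const_group K ?M"
  obtain f where f: "formal_group_iso K C (prod_group K ?D G) f"
    "\<And>w. w \<in> carrier (prod_group K ?D G) \<Longrightarrow> f w \<in> carrier C"
    "\<And>w. w \<in> carrier (prod_group K ?D G) \<Longrightarrow> first_factor K ?D G w = (\<lambda>b\<in>carrier ?M. u b (f w))"
    using split_group.product_iso[OF split G] by blast
  have "\<phi> (f w) = dual_restriction A H (first_factor K ?D G w)" if w: "w \<in> carrier (prod_group K ?D G)" for w
  proof
    fix \<alpha>
    \<comment> \<open>Both sides are compared as total functions; outside the dual group they agree
      because this membership makes the left side extensional.\<close>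
    have "\<phi> (f w) \<in> carrier ?A" by (rule formal_hom_closed[OF \<phi>A f(2)[OF w]])
    then show "\<phi> (f w) \<alpha> = dual_restriction A H (first_factor K ?D G w) \<alpha>"
      using u_\<rho>[OF _ f(2)[OF w], of \<alpha>] \<rho>_closed[of \<alpha>]
      by (auto simp: dual_restriction_def f(3)[OF w] \<rho>_def PiE_iff extensional_def)
  qed
  then show ?thesis
    unfolding product_type_def Let_def using HA G(1) f(1) by blast
qed

end
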